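(* Let $$g_0^b(t)=\sum_{n=-\infty}^\infty a_ne^{in\omega t},\qquad t>0,$$ be a smooth periodic function of period $\tau=\frac{2\pi}{\omega}>0$ with Fourier coefficients $a_n\in\mathbb C$, $n\in\mathbb Z$, and mean value zero, i.e. $a_0=0$. Then there exists a unique periodic function $g_1^b(t)$ such that $\{g_0^b(t),g_1^b(t)\}$ is an asymptotically admissible pair for the free Schrödinger equation. This function $g_1^b(t)$ also has period $\tau$ and its Fourier series is given by $$g_1^b(t)=\sum_{n=-\infty}^\infty c_ne^{in\omega t},\qquad t>0,$$ where $$c_n=\begin{cases}-\sqrt{n\omega}\,a_n,&n>0,\\0,&n=0,\\ i\sqrt{-n\omega}\,a_n,&n<0.\end{cases}$$
   Context: $\mathcal S([0,\infty))=\{v\in C^\infty([0,\infty))\mid x^nv^{(m)}(x)\in L^\infty([0,\infty))\text{ for all }n,m\ge0\}$. A solution of the free Schrödinger equation in the quarter plane is a smooth function $u:[0,\infty)\times[0,\infty)\to\mathbb C$ such that $u(\cdot,t)\in\mathcal S([0,\infty))$ for each $t\ge0$ and $iu_t+u_{xx}=0$ for $x>0$ and $t>0$. A pair of smooth functions $\{g_0^b(t),g_1^b(t)\}$, $t\ge0$, is asymptotically admissible for the free Schrödinger equation if there exists a solution $u(x,t)$ of the free Schrödinger equation in the quarter plane such that $$u(0,\cdot)-g_0^b\in\mathcal S([0,\infty)),\qquad u_x(0,t)-g_1^b(t)=O(t^{-3/2}),\quad t\to\infty.$$ In the uniqueness claim, $g_1^b$ ranges over periodic functions of arbitrary period (not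 assumed a priori to be $\tau$). *)

theory Defs
  imports
    "HOL-Analysis.Analysis"
    "HOL-Library.Landau_Symbols"
begin

text \<open>
  Functions on \<open>[0,\<infinity>)\<close> and on \<open>[0,\<infinity>) \<times> [0,\<infinity>)\<close> are represented by total functions on the reals.
  All notions below depend only on the values at nonnegative arguments; derivatives are one-sided
  at the boundary.
\<close>

definition hderiv :: "(real \<Rightarrow> complex) \<Rightarrow> real \<Rightarrow> complex" where
  "hderiv f x = vector_derivative f (at x within {0..})"

definition smooth_halfline :: "(real \<Rightarrow> complex) \<Rightarrow> bool" where
  "smooth_halfline f \<longleftrightarrow> (\<forall>m. \<forall>x\<ge>0. ((hderiv ^^ m) f) differentiable (at x within {0..}))"

text \<open>
  Since the functions \<open>x\<^sup>n v\<^sup>(\<^sup>m\<^sup>)(x)\<close> are continuous, membership in \<open>L\<^sup>\<infinity>([0,\<infinity>))\<close> is boundedness.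
\<close>

definition schwartz_halfline :: "(real \<Rightarrow> complex) set" where
  "schwartz_halfline = {v. smooth_halfline v \<and>
     (\<forall>n m. bounded ((\<lambda>x. of_real (x ^ n) * (hderiv ^^ m) v x) ` {0..}))}"

definition partial_x :: "(real \<Rightarrow> real \<Rightarrow> complex) \<Rightarrow> real \<Rightarrow> real \<Rightarrow> complex" where
  "partial_x u = (\<lambda>x t. hderiv (\<lambda>y. u y t) x)"

definition partial_t :: "(real \<Rightarrow> real \<Rightarrow> complex) \<Rightarrow> real \<Rightarrow> real \<Rightarrow> complex" where
  "partial_t u = (\<lambda>x t. hderiv (\<lambda>s. u x s) t)"

inductive_set iterated_partials :: "(real \<Rightarrow> real \<Rightarrow> complex) \<Rightarrow> (real \<Rightarrow> real \<Rightarrow> complex) set"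
  for u where
  self: "u \<in> iterated_partials u"
| x: "v \<in> iterated_partials u \<Longrightarrow> partial_x v \<in> iterated_partials u"
| t: "v \<in> iterated_partials u \<Longrightarrow> partial_t v \<in> iterated_partials u"

text \<open>
  Smoothness on the closed quarter plane: all iterated partial derivatives, in any order, exist
  and are jointly continuous up to the boundary.
\<close>

definition smooth_quarter_plane :: "(real \<Rightarrow> real \<Rightarrow> complex) \<Rightarrow> bool" where
  "smooth_quarter_plane u \<longleftrightarrow> (\<forall>v \<in> iterated_partials u.
     continuous_on ({0..} \<times> {0..}) (\<lambda>(x, t). v x t) \<and>
     (\<forall>x\<ge>0. \<forall>t\<ge>0. (\<lambda>y. v y t) differentiable (at x within {0..}) \<and>
                   (\<lambda>s. v x s) differentiable (at t within {0..})))"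

definition schroedinger_solution :: "(real \<Rightarrow> real \<Rightarrow> complex) \<Rightarrow> bool" where
  "schroedinger_solution u \<longleftrightarrow>
     smooth_quarter_plane u \<and>
     (\<forall>t\<ge>0. (\<lambda>x. u x t) \<in> schwartz_halfline) \<and>
     (\<forall>x>0. \<forall>t>0. \<i> * partial_t u x t + partial_x (partial_x u) x t = 0)"

definition asymptotically_admissible :: "(real \<Rightarrow> complex) \<Rightarrow> (real \<Rightarrow> complex) \<Rightarrow> bool" where
  "asymptotically_admissible g0 g1 \<longleftrightarrow>
     smooth_halfline g0 \<and> smooth_halfline g1 \<and>
     (\<exists>u. schroedinger_solution u \<and>
          (\<lambda>t. u 0 t - g0 t) \<in> schwartz_halfline \<and>
          (\<lambda>t. partial_x u 0 t - g1 t) \<in> O[at_top](\<lambda>t. of_real (t powr (-3/2))))"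

text \<open>\<open>T\<close> is a period, not necessarily the minimal one.\<close>

definition has_period :: "(real \<Rightarrow> complex) \<Rightarrow> real \<Rightarrow> bool" where
  "has_period f T \<longleftrightarrow> T > 0 \<and> (\<forall>t\<ge>0. f (t + T) = f t)"

definition fourier_coeff :: "real \<Rightarrow> (real \<Rightarrow> complex) \<Rightarrow> int \<Rightarrow> complex" where
  "fourier_coeff T f n =
     (1 / of_real T) * integral {0..T} (\<lambda>t. f t * exp (- \<i> * of_real (of_int n * (2 * pi / T) * t)))"

definition neumann_coeff :: "real \<Rightarrow> (int \<Rightarrow> complex) \<Rightarrow> int \<Rightarrow> complex" where
  "neumann_coeff \<omega> a n =
     (if n > 0 then - of_real (sqrt (of_int n * \<omega>)) * a n
      else if n = 0 then 0
      else \<i> * of_real (sqrt (- of_int n * \<omega>)) * a n)"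

end

theory Submission
  imports Defs "HOL-Probability.Sinc_Integral"
begin

text \<open>
  Existence: each Fourier mode is extended separately. For \<open>\<lambda> > 0\<close> the mode \<open>exp (i \<lambda>\<^sup>2 t)\<close> extends to the
  evanescent wave \<open>exp (i \<lambda>\<^sup>2 t - \<lambda> x)\<close>, whose Neumann value is \<open>- \<lambda>\<close> times the Dirichlet value. The
  plane wave extending \<open>exp (- i \<lambda>\<^sup>2 t)\<close> does not decay in \<open>x\<close> and is replaced by an outgoing solution \<open>v\<close> that is
  a Schwartz function of \<open>x\<close>: a superposition of plane waves is rapidly decaying in time at \<open>x = 0\<close> if its weight
  vanishes to infinite order at wave number \<open>0\<close>, and \<open>v\<close> is obtained from one by inverting \<open>\<partial>\<^sub>x - i\<close>.
  Then \<open>v(0, t) = C exp (- i t)\<close> and \<open>v\<^sub>x(0, t) = i v(0, t)\<close> up to rapidly decaying errors, and \<open>C \<noteq> 0\<close> by Abel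
  summation. The other frequencies follow by scaling, and the sums over the modes converge because the
  Fourier coefficients decay rapidly.

  Uniqueness: let \<open>z\<close> be the difference of two solutions. Its decay in \<open>x\<close> is not assumed to be uniform in \<open>t\<close>, so
  the balance law for \<open>\<integral> |z|\<^sup>2 dx\<close> has to be justified: it holds on intervals where this mass is bounded, a Baire
  category argument shows that the mass is locally bounded, and then the rapid decay of \<open>z(0, t)\<close> bounds it
  globally. The momentum identity for time averages of \<open>z\<close>, whose derivatives have bounded mass as well,
  shows that the averages of \<open>z\<^sub>x(0, t)\<close> are square integrable in time. Up to \<open>O(t powr (- 3 / 2))\<close> they are differences of
  two periodic functions, and such a difference vanishes if it is square integrable.
\<close>

section \<open>Averages in time\<close>

text \<open>The Schwartz property in \<open>x\<close> holds at each time separately, so a priori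
  mass might arrive from spatial infinity; a plain energy estimate therefore does not give
  uniqueness. The balance law truncated at \<open>R\<close> has an error of size
  \<open>1 / R\<close> times norms of \<open>z\<close> and of one space derivative, and the latter
  has no bound at all. Averages repair this: their time derivative is a difference quotient of
  \<open>z\<close>, the equation turns it into a second space derivative, and interpolation gives
  the first. The balance law is reversible, and the argument uses both directions of time. In the
  momentum identity the boundary flux is the square of the Neumann value, up to a product containing
  the Dirichlet value; this is the only place where the Neumann value is controlled by quantities of
  the interior. The two nonzero cases of \<open>neumann_coeff\<close> are the two kinds of roots of
  the dispersion relation, frequency equal to minus the square of the wave number: an imaginary
  root, which decays in \<open>x\<close>, for positive frequencies and the real outgoing root for
  negative ones.\<close>

abbreviation qcont :: "(real \<Rightarrow> real \<Rightarrow> 'a::topological_space) \<Rightarrow> bool" where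
  "qcont f \<equiv> continuous_on ({0..} \<times> {0..}) (\<lambda>(x, t). f x t)"

lemma qcontD:
  assumes "qcont f" "continuous_on S g" "continuous_on S h" "\<And>p. p \<in> S \<Longrightarrow> g p \<ge> 0" "\<And>p. p \<in> S \<Longrightarrow> h p \<ge> 0"
  shows "continuous_on S (\<lambda>p. f (g p) (h p))"
proof -
  have "(\<lambda>p. (g p, h p)) ` S \<subseteq> {0..} \<times> {0..}" using assms(4,5) by auto
  from continuous_on_compose2[OF assms(1) continuous_on_Pair[OF assms(2,3)] this] show ?thesis by simp
qed

text \<open>Jensen's inequality on the unit interval: the variance about the mean \<open>m\<close>
  is nonnegative.\<close>

lemma square_integral_le:
  fixes f :: "real \<Rightarrow> real"
  assumes "continuous_on {0..1} f"
  shows "(integral {0..1} f)\<^sup>2 \<le> integral {0..1} (\<lambda>s. (f s)\<^sup>2)"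
proof -
  define m where "m = integral {0..1} f"
  have f: "f integrable_on {0..1}" "(\<lambda>s. (f s)\<^sup>2) integrable_on {0..1}"
    using assms by (auto intro!: integrable_continuous_real continuous_intros)
  have "0 \<le> integral {0..1} (\<lambda>s. (f s - m)\<^sup>2)"
    using assms by (intro integral_nonneg integrable_continuous_real continuous_intros) auto
  also have "(\<lambda>s. (f s - m)\<^sup>2) = (\<lambda>s. ((f s)\<^sup>2 + m\<^sup>2) - (2 * m) * f s)"
    by (simp add: power2_eq_square algebra_simps)
  also have "integral {0..1} \<dots> = integral {0..1} (\<lambda>s. (f s)\<^sup>2 + m\<^sup>2) - integral {0..1} (\<lambda>s. (2 * m) * f s)"
    using assms by (intro integral_diff integrable_continuous_real continuous_intros)
  also have "integral {0..1} (\<lambda>s. (f s)\<^sup>2 + m\<^sup>2) = integral {0..1} (\<lambda>s. (f s)\<^sup>2) + m\<^sup>2"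
    using f by (subst integral_add) auto
  also have "integral {0..1} (\<lambda>s. (2 * m) * f s) = 2 * m * m"
    using f by (subst integral_mult_right) (simp add: m_def)
  finally show ?thesis by (simp add: m_def power2_eq_square)
qed

text \<open>Rescaled to the unit interval, the average depends on \<open>\<epsilon>\<close> only
  through the integrand, so it makes sense at \<open>\<epsilon> = 0\<close>, and derivatives in
  \<open>x\<close> and \<open>t\<close> fall on \<open>f\<close>. It looks forward in time and
  therefore never leaves the quarter plane.\<close>

definition avg :: "real \<Rightarrow> (real \<Rightarrow> real \<Rightarrow> complex) \<Rightarrow> real \<Rightarrow> real \<Rightarrow> complex" where
  "avg \<epsilon> f x t = integral {0..1} (\<lambda>s. f x (t + \<epsilon> * s))"

lemma avg_integrand_continuous:
  assumes "qcont f" "\<epsilon> \<ge> 0" "x \<ge> 0" "t \<ge> 0"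
  shows "continuous_on {0..1} (\<lambda>s. f x (t + \<epsilon> * s))"
  by (intro qcontD[OF assms(1)] continuous_intros) (use assms in auto)

lemma avg_qcont:
  assumes "qcont f" "\<epsilon> \<ge> 0"
  shows "qcont (avg \<epsilon> f)"
proof -
  have "continuous_on ({0..} \<times> {0..}) (\<lambda>p. integral (cbox 0 1) (\<lambda>s. f (fst p) (snd p + \<epsilon> * s)))"
    by (rule integral_continuous_on_param)
      (use assms in \<open>auto simp: case_prod_unfold intro!: qcontD[OF assms(1)] continuous_intros\<close>)
  then show ?thesis by (simp add: avg_def case_prod_unfold)
qed

lemma avg_has_vector_derivative_x:
  assumes "qcont f" "qcont g" "\<epsilon> \<ge> 0" "x \<ge> 0" "t \<ge> 0"
    and "\<And>x t. x \<ge> 0 \<Longrightarrow> t \<ge> 0 \<Longrightarrow> ((\<lambda>y. f y t) has_vector_derivative g x t) (at x within {0..})"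
  shows "((\<lambda>y. avg \<epsilon> f y t) has_vector_derivative avg \<epsilon> g x t) (at x within {0..})"
proof -
  have "((\<lambda>y. integral (cbox 0 1) (\<lambda>s. f y (t + \<epsilon> * s))) has_vector_derivative integral (cbox 0 1) (\<lambda>s. g x (t + \<epsilon> * s))) (at x within {0..})"
  proof (rule leibniz_rule_vector_derivative)
    show "((\<lambda>x. f x (t + \<epsilon> * s)) has_vector_derivative g y (t + \<epsilon> * s)) (at y within {0..})" if "y \<in> {0..}" "s \<in> cbox 0 1" for y s
      using that assms by auto
    show "(\<lambda>s. f y (t + \<epsilon> * s)) integrable_on cbox 0 1" if "y \<in> {0..}" for y
      using avg_integrand_continuous[OF assms(1,3) _ assms(5), of y] that by (auto intro: integrable_continuous_real)
    show "continuous_on ({0..} \<times> cbox 0 1) (\<lambda>(y, s). g y (t + \<epsilon> * s))"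
      unfolding case_prod_unfold using assms by (intro qcontD[OF assms(2)] continuous_intros) auto
  qed (use assms(4) in auto)
  then show ?thesis by (simp add: avg_def)
qed

lemma avg_has_vector_derivative_t:
  assumes "qcont f" "qcont g" "\<epsilon> \<ge> 0" "x \<ge> 0" "t \<ge> 0"
    and "\<And>x t. x \<ge> 0 \<Longrightarrow> t \<ge> 0 \<Longrightarrow> ((\<lambda>s. f x s) has_vector_derivative g x t) (at t within {0..})"
  shows "((\<lambda>s. avg \<epsilon> f x s) has_vector_derivative avg \<epsilon> g x t) (at t within {0..})"
proof -
  have "((\<lambda>r. integral (cbox 0 1) (\<lambda>s. f x (r + \<epsilon> * s))) has_vector_derivative integral (cbox 0 1) (\<lambda>s. g x (t + \<epsilon> * s))) (at t within {0..})"
  proof (rule leibniz_rule_vector_derivative)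
    show "((\<lambda>r. f x (r + \<epsilon> * s)) has_vector_derivative g x (r + \<epsilon> * s)) (at r within {0..})" if "r \<in> {0..}" "s \<in> cbox 0 1" for r s
    proof -
      have "((\<lambda>s. f x s) has_vector_derivative g x (r + \<epsilon> * s)) (at (r + \<epsilon> * s) within {0..})"
        using that assms by auto
      then have "((\<lambda>s. f x s) has_vector_derivative g x (r + \<epsilon> * s)) (at (r + \<epsilon> * s) within (\<lambda>r. r + \<epsilon> * s) ` {0..})"
        by (rule has_vector_derivative_within_subset) (use that assms in auto)
      moreover have "((\<lambda>r. r + \<epsilon> * s) has_vector_derivative 1) (at r within {0..})"
        by (auto intro!: derivative_eq_intros)
      ultimately show ?thesis
        using vector_diff_chain_within[of "\<lambda>r. r + \<epsilon> * s" 1 r "{0..}" "\<lambda>s. f x s"] by (simp add: o_def)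
    qed
    show "(\<lambda>s. f x (r + \<epsilon> * s)) integrable_on cbox 0 1" if "r \<in> {0..}" for r
      using avg_integrand_continuous[OF assms(1,3,4), of r] that by (auto intro: integrable_continuous_real)
    show "continuous_on ({0..} \<times> cbox 0 1) (\<lambda>(r, s). g x (r + \<epsilon> * s))"
      unfolding case_prod_unfold using assms by (intro qcontD[OF assms(2)] continuous_intros) auto
  qed (use assms(5) in auto)
  then show ?thesis by (simp add: avg_def)
qed

text \<open>The fundamental theorem of calculus along the averaging window. The average of a time
  derivative is thus controlled by values of \<open>f\<close> alone, at the price of a factor
  \<open>1 / \<epsilon>\<close>; this is the regularity gained by averaging.\<close>

lemma avg_derivative_eq:
  assumes "qcont f" "qcont g" "\<epsilon> > 0" "x \<ge> 0" "t \<ge> 0"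
    and "\<And>x t. x \<ge> 0 \<Longrightarrow> t \<ge> 0 \<Longrightarrow> ((\<lambda>s. f x s) has_vector_derivative g x t) (at t within {0..})"
  shows "\<epsilon> *\<^sub>R avg \<epsilon> g x t = f x (t + \<epsilon>) - f x t"
proof -
  have "((\<lambda>s. \<epsilon> *\<^sub>R g x (t + \<epsilon> * s)) has_integral (f x (t + \<epsilon> * 1) - f x (t + \<epsilon> * 0))) {0..1}"
  proof (rule fundamental_theorem_of_calculus)
    fix s :: real assume s: "s \<in> {0..1}"
    have "((\<lambda>s. f x s) has_vector_derivative g x (t + \<epsilon> * s)) (at (t + \<epsilon> * s) within {0..})"
      using s assms by auto
    then have "((\<lambda>s. f x s) has_vector_derivative g x (t + \<epsilon> * s)) (at (t + \<epsilon> * s) within (\<lambda>s. t + \<epsilon> * s) ` {0..1})"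
      by (rule has_vector_derivative_within_subset) (use assms in auto)
    moreover have "((\<lambda>s. t + \<epsilon> * s) has_vector_derivative \<epsilon>) (at s within {0..1})"
      by (auto intro!: derivative_eq_intros)
    ultimately show "((\<lambda>s. f x (t + \<epsilon> * s)) has_vector_derivative \<epsilon> *\<^sub>R g x (t + \<epsilon> * s)) (at s within {0..1})"
      using vector_diff_chain_within[of "\<lambda>s. t + \<epsilon> * s" \<epsilon> s "{0..1}" "\<lambda>s. f x s"] by (simp add: o_def)
  qed simp
  then have "integral {0..1} (\<lambda>s. \<epsilon> *\<^sub>R g x (t + \<epsilon> * s)) = f x (t + \<epsilon>) - f x t"
    by (auto dest: integral_unique)
  then show ?thesis by (simp add: avg_def)
qed

lemma avg_norm_square_le:
  assumes "qcont f" "\<epsilon> \<ge> 0" "x \<ge> 0" "t \<ge> 0"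
  shows "(norm (avg \<epsilon> f x t))\<^sup>2 \<le> integral {0..1} (\<lambda>s. (norm (f x (t + \<epsilon> * s)))\<^sup>2)"
proof -
  note c = avg_integrand_continuous[OF assms]
  have "norm (avg \<epsilon> f x t) \<le> integral {0..1} (\<lambda>s. norm (f x (t + \<epsilon> * s)))"
    unfolding avg_def using c by (intro integral_norm_bound_integral integrable_continuous_real continuous_intros) auto
  then have "(norm (avg \<epsilon> f x t))\<^sup>2 \<le> (integral {0..1} (\<lambda>s. norm (f x (t + \<epsilon> * s))))\<^sup>2"
    by (intro power_mono) auto
  also have "\<dots> \<le> integral {0..1} (\<lambda>s. (norm (f x (t + \<epsilon> * s)))\<^sup>2)"
    using c by (intro square_integral_le continuous_intros)
  finally show ?thesis .
qed

text \<open>A bound for the squared L2 norm on the half line, window by window: no integrability at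
  infinity has to be stated, and each window depends continuously on \<open>t\<close>, which makes
  the set of times with a given bound closed.\<close>

definition mass_le :: "(real \<Rightarrow> real \<Rightarrow> complex) \<Rightarrow> real \<Rightarrow> real \<Rightarrow> bool" where
  "mass_le f K t \<longleftrightarrow> (\<forall>R\<ge>0. integral {0..R} (\<lambda>x. (norm (f x t))\<^sup>2) \<le> K)"

lemma mass_leD: "mass_le f K t \<Longrightarrow> R \<ge> 0 \<Longrightarrow> integral {0..R} (\<lambda>x. (norm (f x t))\<^sup>2) \<le> K"
  by (simp add: mass_le_def)

lemma mass_le_mono: "mass_le f K t \<Longrightarrow> K \<le> L \<Longrightarrow> mass_le f L t"
  unfolding mass_le_def by (auto intro: order_trans)

lemma mass_le_nonneg: "mass_le f K t \<Longrightarrow> K \<ge> 0"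
  using mass_leD[of f K t 0] by simp

lemma qcont_x: "qcont f \<Longrightarrow> t \<ge> 0 \<Longrightarrow> S \<subseteq> {0..} \<Longrightarrow> continuous_on S (\<lambda>x. f x t)"
  by (rule qcontD[OF _ continuous_on_id continuous_on_const, unfolded id_def]) auto

lemma qcont_t: "qcont f \<Longrightarrow> x \<ge> 0 \<Longrightarrow> S \<subseteq> {0..} \<Longrightarrow> continuous_on S (\<lambda>t. f x t)"
  by (rule qcontD[OF _ continuous_on_const continuous_on_id, unfolded id_def]) auto

text \<open>Jensen's inequality in time and an exchange of integrals on each window: the mass of an
  average is at most the average of the masses.\<close>

lemma mass_le_avg:
  assumes "qcont f" "\<epsilon> \<ge> 0" "t \<ge> 0" "\<And>s. s \<in> {t..t + \<epsilon>} \<Longrightarrow> mass_le f K s"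
  shows "mass_le (avg \<epsilon> f) K t"
  unfolding mass_le_def
proof (intro allI impI)
  fix R :: real assume R: "R \<ge> 0"
  let ?g = "\<lambda>x s. (norm (f x (t + \<epsilon> * s)))\<^sup>2"
  have cg: "continuous_on ({0..R} \<times> {0..1}) (\<lambda>(x, s). ?g x s)"
    unfolding case_prod_unfold using assms by (intro continuous_intros qcontD[OF assms(1)]) auto
  have "integral {0..R} (\<lambda>x. (norm (avg \<epsilon> f x t))\<^sup>2) \<le> integral {0..R} (\<lambda>x. integral {0..1} (?g x))"
  proof (rule integral_le)
    show "(\<lambda>x. (norm (avg \<epsilon> f x t))\<^sup>2) integrable_on {0..R}"
      using assms by (intro integrable_continuous_real continuous_intros qcont_x[OF avg_qcont]) auto
    show "(\<lambda>x. integral {0..1} (?g x)) integrable_on {0..R}"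
      using integral_continuous_on_param[of "{0..R}" 0 1 ?g] cg by (auto intro: integrable_continuous_real)
  qed (use avg_norm_square_le[OF assms(1,2) _ assms(3)] in auto)
  also have "\<dots> = integral {0..1} (\<lambda>s. integral {0..R} (\<lambda>x. ?g x s))"
    using integral_swap_continuous[of 0 0 R 1 ?g] cg by (simp add: cbox_Pair_eq)
  also have "\<dots> \<le> integral {0..1} (\<lambda>s::real. K)"
  proof (rule integral_le)
    have "continuous_on ({0..1} \<times> {0..R}) (\<lambda>(s, x). ?g x s)"
      unfolding case_prod_unfold using assms by (intro continuous_intros qcontD[OF assms(1)]) auto
    then show "(\<lambda>s. integral {0..R} (\<lambda>x. ?g x s)) integrable_on {0..1}"
      using integral_continuous_on_param[of "{0..1}" 0 R "\<lambda>s x. ?g x s"] by (auto intro: integrable_continuous_real)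
    show "integral {0..R} (\<lambda>x. ?g x s) \<le> K" if "s \<in> {0..1}" for s
    proof -
      have "t + \<epsilon> * s \<in> {t..t + \<epsilon>}" using that assms(2) by (auto intro: mult_left_le)
      from mass_leD[OF assms(4)[OF this] R] show ?thesis .
    qed
  qed (rule integrable_const_ivl)
  finally show "integral {0..R} (\<lambda>x. (norm (avg \<epsilon> f x t))\<^sup>2) \<le> K" by simp
qed

lemma norm_diff_square_le: "(norm (a - b :: complex))\<^sup>2 \<le> 2 * (norm a)\<^sup>2 + 2 * (norm b)\<^sup>2"
proof -
  have "(norm (a - b))\<^sup>2 \<le> (norm a + norm b)\<^sup>2"
    by (intro power_mono norm_triangle_ineq4) auto
  also have "\<dots> = 2 * (norm a)\<^sup>2 + 2 * (norm b)\<^sup>2 - (norm a - norm b)\<^sup>2"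
    by (simp add: power2_eq_square algebra_simps)
  finally show ?thesis by (smt (verit) zero_le_power2)
qed

text \<open>Meant for \<open>g\<close> the average of a time derivative, as in
  \<open>avg_derivative_eq\<close>. The constant is \<open>2 * K + 2 * K\<close> from
  \<open>norm_diff_square_le\<close>, divided by \<open>\<epsilon>\<^sup>2\<close>.\<close>

lemma mass_le_difference_quotient:
  assumes "qcont f" "\<epsilon> > 0" "t \<ge> 0" "mass_le f K t" "mass_le f K (t + \<epsilon>)"
    and g: "\<And>x. x \<ge> 0 \<Longrightarrow> \<epsilon> *\<^sub>R g x t = f x (t + \<epsilon>) - f x t"
    and cg: "continuous_on {0..} (\<lambda>x. g x t)"
  shows "mass_le g (4 * K / \<epsilon>\<^sup>2) t"
  unfolding mass_le_def
proof (intro allI impI)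
  fix R :: real assume R: "R \<ge> 0"
  let ?h = "\<lambda>x. (2 / \<epsilon>\<^sup>2) * (norm (f x (t + \<epsilon>)))\<^sup>2 + (2 / \<epsilon>\<^sup>2) * (norm (f x t))\<^sup>2"
  have i: "(\<lambda>x. (2 / \<epsilon>\<^sup>2) * (norm (f x (t + \<epsilon>)))\<^sup>2) integrable_on {0..R}" "(\<lambda>x. (2 / \<epsilon>\<^sup>2) * (norm (f x t))\<^sup>2) integrable_on {0..R}"
    using assms by (auto intro!: integrable_continuous_real continuous_intros qcont_x[OF assms(1)])
  have "integral {0..R} (\<lambda>x. (norm (g x t))\<^sup>2) \<le> integral {0..R} ?h"
  proof (rule integral_le)
    show "(\<lambda>x. (norm (g x t))\<^sup>2) integrable_on {0..R}"
      by (intro integrable_continuous_real continuous_intros continuous_on_subset[OF cg]) auto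
    show "?h integrable_on {0..R}" using i by (rule integrable_add)
    fix x assume "x \<in> {0..R}"
    then have "norm (\<epsilon> *\<^sub>R g x t) = norm (f x (t + \<epsilon>) - f x t)"
      using g[of x] by simp
    then have "\<epsilon>\<^sup>2 * (norm (g x t))\<^sup>2 = (norm (f x (t + \<epsilon>) - f x t))\<^sup>2"
      using assms(2) by (simp flip: power_mult_distrib)
    also have "\<dots> \<le> 2 * (norm (f x (t + \<epsilon>)))\<^sup>2 + 2 * (norm (f x t))\<^sup>2"
      by (rule norm_diff_square_le)
    finally have "(norm (g x t))\<^sup>2 \<le> (2 * (norm (f x (t + \<epsilon>)))\<^sup>2 + 2 * (norm (f x t))\<^sup>2) / \<epsilon>\<^sup>2"
      using assms(2) by (subst pos_le_divide_eq) (simp_all add: mult.commute)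
    then show "(norm (g x t))\<^sup>2 \<le> ?h x" by (simp add: add_divide_distrib)
  qed
  also have "\<dots> = (2 / \<epsilon>\<^sup>2) * integral {0..R} (\<lambda>x. (norm (f x (t + \<epsilon>)))\<^sup>2) + (2 / \<epsilon>\<^sup>2) * integral {0..R} (\<lambda>x. (norm (f x t))\<^sup>2)"
    unfolding integral_add[OF i] by (simp only: integral_mult_right)
  also have "\<dots> \<le> (2 / \<epsilon>\<^sup>2) * K + (2 / \<epsilon>\<^sup>2) * K"
    by (intro add_mono mult_left_mono mass_leD assms R) auto
  finally show "integral {0..R} (\<lambda>x. (norm (g x t))\<^sup>2) \<le> 4 * K / \<epsilon>\<^sup>2" by simp
qed

lemma avg_uniform_approx:
  assumes "qcont f" "e > 0"
  shows "\<exists>\<epsilon>0>0. \<forall>\<epsilon>. 0 \<le> \<epsilon> \<and> \<epsilon> \<le> \<epsilon>0 \<longrightarrow> (\<forall>x\<in>{0..X}. \<forall>t\<in>{0..T}. norm (avg \<epsilon> f x t - f x t) \<le> e)"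
proof -
  \<comment> \<open>The box is longer by \<open>1\<close> in time because the average at
    \<open>t\<close> reaches up to \<open>t + \<epsilon>\<close>; this is why
    \<open>\<epsilon>0\<close> is at most \<open>1\<close>.\<close>
  have "uniformly_continuous_on ({0..X} \<times> {0..T + 1}) (\<lambda>(x, t). f x t)"
    by (intro compact_uniformly_continuous compact_Times continuous_on_subset[OF assms(1)]) auto
  then obtain d where d: "d > 0" "\<And>p q. p \<in> {0..X} \<times> {0..T + 1} \<Longrightarrow> q \<in> {0..X} \<times> {0..T + 1} \<Longrightarrow> dist q p < d \<Longrightarrow>
      dist (case q of (x, t) \<Rightarrow> f x t) (case p of (x, t) \<Rightarrow> f x t) < e"
    unfolding uniformly_continuous_on_def using assms(2) by metis
  define \<epsilon>0 where "\<epsilon>0 = min 1 (d / 2)"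
  have "norm (avg \<epsilon> f x t - f x t) \<le> e" if \<epsilon>: "0 \<le> \<epsilon>" "\<epsilon> \<le> \<epsilon>0" and xt: "x \<in> {0..X}" "t \<in> {0..T}" for \<epsilon> x t
  proof -
    have c: "continuous_on {0..1} (\<lambda>s. f x (t + \<epsilon> * s))"
      using avg_integrand_continuous[OF assms(1) \<epsilon>(1)] xt by auto
    have "avg \<epsilon> f x t - f x t = integral {0..1} (\<lambda>s. f x (t + \<epsilon> * s) - f x t)"
      unfolding avg_def using c by (subst integral_diff) (auto intro: integrable_continuous_real)
    also have "norm \<dots> \<le> integral {0..1} (\<lambda>s::real. e)"
    proof (rule integral_norm_bound_integral)
      show "(\<lambda>s. f x (t + \<epsilon> * s) - f x t) integrable_on {0..1}"
        using c by (intro integrable_continuous_real continuous_intros)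
      fix s :: real assume s: "s \<in> {0..1}"
      have "\<epsilon> * s \<le> \<epsilon>" using s \<epsilon> by (auto intro: mult_left_le)
      then have "\<epsilon> * s < d" "\<epsilon> * s \<le> 1" "0 \<le> \<epsilon> * s" using \<epsilon> s d(1) by (auto simp: \<epsilon>0_def)
      then show "norm (f x (t + \<epsilon> * s) - f x t) \<le> e"
        using d(2)[of "(x, t)" "(x, t + \<epsilon> * s)"] xt by (simp add: dist_norm dist_Pair_Pair)
    qed (rule integrable_const_ivl)
    finally show ?thesis by simp
  qed
  moreover have "\<epsilon>0 > 0" using d by (simp add: \<epsilon>0_def)
  ultimately show ?thesis by blast
qed

section \<open>Pairing two solutions\<close>

text \<open>The derivatives are parameters of their own rather than iterated partial derivatives, so
  that averages and differences of solutions are again instances. The equation is imposed up to the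
  boundary, where the fluxes are evaluated.\<close>

locale schr =
  fixes z zx zxx zt :: "real \<Rightarrow> real \<Rightarrow> complex"
  assumes cz: "qcont z" and czx: "qcont zx" and czxx: "qcont zxx" and czt: "qcont zt"
    and dx: "\<And>x t. x \<ge> 0 \<Longrightarrow> t \<ge> 0 \<Longrightarrow> ((\<lambda>y. z y t) has_vector_derivative zx x t) (at x within {0..})"
    and dxx: "\<And>x t. x \<ge> 0 \<Longrightarrow> t \<ge> 0 \<Longrightarrow> ((\<lambda>y. zx y t) has_vector_derivative zxx x t) (at x within {0..})"
    and dt: "\<And>x t. x \<ge> 0 \<Longrightarrow> t \<ge> 0 \<Longrightarrow> ((\<lambda>s. z x s) has_vector_derivative zt x t) (at t within {0..})"
    and pde: "\<And>x t. x \<ge> 0 \<Longrightarrow> t \<ge> 0 \<Longrightarrow> zt x t = \<i> * zxx x t"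
begin

text \<open>Averaging commutes with differentiation, and the coefficients of the equation do not
  depend on time.\<close>

lemma schr_avg:
  assumes "\<epsilon> \<ge> 0"
  shows "schr (avg \<epsilon> z) (avg \<epsilon> zx) (avg \<epsilon> zxx) (avg \<epsilon> zt)"
proof
  fix x t :: real assume xt: "x \<ge> 0" "t \<ge> 0"
  show "((\<lambda>y. avg \<epsilon> z y t) has_vector_derivative avg \<epsilon> zx x t) (at x within {0..})"
    by (rule avg_has_vector_derivative_x[OF cz czx assms xt dx])
  show "((\<lambda>y. avg \<epsilon> zx y t) has_vector_derivative avg \<epsilon> zxx x t) (at x within {0..})"
    by (rule avg_has_vector_derivative_x[OF czx czxx assms xt dxx])
  show "((\<lambda>s. avg \<epsilon> z x s) has_vector_derivative avg \<epsilon> zt x t) (at t within {0..})"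
    by (rule avg_has_vector_derivative_t[OF cz czt assms xt dt])
  have "integral {0..1} (\<lambda>s. zt x (t + \<epsilon> * s)) = integral {0..1} (\<lambda>s. \<i> * zxx x (t + \<epsilon> * s))"
    using pde xt assms by (intro integral_cong) auto
  then show "avg \<epsilon> zt x t = \<i> * avg \<epsilon> zxx x t"
    by (simp add: avg_def)
qed (intro avg_qcont cz czx czxx czt assms)+

end

section \<open>Interpolation: the mass of a first space derivative\<close>

lemma has_vector_derivative_cnj:
  "(f has_vector_derivative D) F \<Longrightarrow> ((\<lambda>x. cnj (f x)) has_vector_derivative cnj D) F"
  by (rule bounded_linear.has_vector_derivative[OF bounded_linear_cnj])

lemma mult_le_half_squares: "(a::real) * b \<le> (a\<^sup>2 + b\<^sup>2) / 2"
  using zero_le_power2[of "a - b"] by (simp add: power2_eq_square algebra_simps)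

text \<open>Integrate the derivative of \<open>q\<^sup>2 cnj f f1\<close> with
  \<open>q = 1 - x / R\<close>. The weight removes the boundary term at \<open>R\<close>; its
  derivative keeps one factor \<open>q\<close>, so the resulting term is absorbed by half of the
  left side. The constant \<open>5\<close> is \<open>1\<close> from the product of \<open>f\<close>
  and \<open>f2\<close> plus \<open>4\<close> from this absorption.\<close>

lemma weighted_derivative_bound:
  fixes f f1 f2 :: "real \<Rightarrow> complex"
  assumes R: "R \<ge> 1"
    and df: "\<And>x. x \<in> {0..R} \<Longrightarrow> (f has_vector_derivative f1 x) (at x within {0..R})"
    and df1: "\<And>x. x \<in> {0..R} \<Longrightarrow> (f1 has_vector_derivative f2 x) (at x within {0..R})"
    and cont: "continuous_on {0..R} f" "continuous_on {0..R} f1" "continuous_on {0..R} f2"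
  shows "integral {0..R} (\<lambda>x. (1 - x / R)\<^sup>2 * (norm (f1 x))\<^sup>2)
    \<le> 2 * (norm (f 0) * norm (f1 0)) + integral {0..R} (\<lambda>x. 5 * (norm (f x))\<^sup>2 + (norm (f2 x))\<^sup>2)"
proof -
  let ?q = "\<lambda>x. 1 - x / R"
  let ?F = "\<lambda>x. (?q x)\<^sup>2 *\<^sub>R (cnj (f x) * f1 x)"
  let ?g = "\<lambda>x. (?q x)\<^sup>2 *\<^sub>R (cnj (f x) * f2 x + cnj (f1 x) * f1 x) + (2 * ?q x * (- 1 / R)) *\<^sub>R (cnj (f x) * f1 x)"
  have "(?g has_integral (?F R - ?F 0)) {0..R}"
  proof (rule fundamental_theorem_of_calculus)
    fix x assume x: "x \<in> {0..R}"
    have "((\<lambda>x. (?q x)\<^sup>2) has_real_derivative (2 * ?q x * (- 1 / R))) (at x within {0..R})"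
      using R by (auto intro!: derivative_eq_intros)
    from has_vector_derivative_scaleR[OF this has_vector_derivative_mult[OF has_vector_derivative_cnj[OF df[OF x]] df1[OF x]]]
    show "(?F has_vector_derivative ?g x) (at x within {0..R})" .
  qed (use R in simp)
  then have "((\<lambda>x. Re (?g x)) has_integral Re (?F R - ?F 0)) {0..R}"
    by (rule has_integral_Re)
  then have ig: "(\<lambda>x. Re (?g x)) integrable_on {0..R}" "integral {0..R} (\<lambda>x. Re (?g x)) = - Re (cnj (f 0) * f1 0)"
    using R by (auto simp: has_integral_integrable integral_unique)
  let ?h = "\<lambda>x. (5 * (norm (f x))\<^sup>2 + (norm (f2 x))\<^sup>2) / 2"
  let ?k = "\<lambda>x. (?q x)\<^sup>2 * (norm (f1 x))\<^sup>2 / 2"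
  have ih: "?h integrable_on {0..R}" by (intro integrable_continuous_real continuous_intros cont) auto
  have "integral {0..R} ?k \<le> integral {0..R} (\<lambda>x. Re (?g x) + ?h x)"
  proof (rule integral_le)
    show "?k integrable_on {0..R}"
      using R by (intro integrable_continuous_real continuous_intros cont) auto
    show "(\<lambda>x. Re (?g x) + ?h x) integrable_on {0..R}" by (rule integrable_add[OF ig(1) ih])
    fix x assume x: "x \<in> {0..R}"
    then have q: "0 \<le> ?q x" "?q x \<le> 1" using R by auto
    have "- ((?q x)\<^sup>2 * Re (cnj (f x) * f2 x)) \<le> norm (f x) * norm (f2 x)"
    proof -
      have "- ((?q x)\<^sup>2 * Re (cnj (f x) * f2 x)) \<le> \<bar>(?q x)\<^sup>2 * Re (cnj (f x) * f2 x)\<bar>" by linarith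
      also have "\<dots> = (?q x)\<^sup>2 * \<bar>Re (cnj (f x) * f2 x)\<bar>" by (simp add: abs_mult)
      also have "\<dots> \<le> 1 * norm (cnj (f x) * f2 x)"
        using q by (intro mult_mono abs_Re_le_cmod power_le_one) auto
      finally show ?thesis by (simp add: norm_mult)
    qed
    also have "\<dots> \<le> ((norm (f x))\<^sup>2 + (norm (f2 x))\<^sup>2) / 2" by (rule mult_le_half_squares)
    finally have 1: "- ((?q x)\<^sup>2 * Re (cnj (f x) * f2 x)) \<le> ((norm (f x))\<^sup>2 + (norm (f2 x))\<^sup>2) / 2" .
    have "0 \<le> 2 * ?q x / R" using q R by (intro divide_nonneg_nonneg mult_nonneg_nonneg) auto
    then have "(2 * ?q x / R) * Re (cnj (f x) * f1 x) \<le> (2 * ?q x / R) * norm (cnj (f x) * f1 x)"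
      by (rule mult_left_mono[OF complex_Re_le_cmod])
    also have "\<dots> = (?q x * norm (f1 x)) * (2 * norm (f x) / R)" by (simp add: norm_mult)
    also have "\<dots> \<le> (?q x * norm (f1 x)) * (2 * norm (f x))"
    proof (intro mult_left_mono mult_nonneg_nonneg q norm_ge_zero)
      have "2 * norm (f x) / R \<le> 2 * norm (f x) / 1" using R by (intro divide_left_mono) auto
      then show "2 * norm (f x) / R \<le> 2 * norm (f x)" by simp
    qed
    also have "\<dots> \<le> ((?q x * norm (f1 x))\<^sup>2 + (2 * norm (f x))\<^sup>2) / 2" by (rule mult_le_half_squares)
    finally have 2: "(2 * ?q x / R) * Re (cnj (f x) * f1 x) \<le> ((?q x)\<^sup>2 * (norm (f1 x))\<^sup>2 + 4 * (norm (f x))\<^sup>2) / 2"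
      by (simp add: power_mult_distrib)
    have "Re (?g x) = (?q x)\<^sup>2 * Re (cnj (f x) * f2 x) + (?q x)\<^sup>2 * (norm (f1 x))\<^sup>2 - (2 * ?q x / R) * Re (cnj (f x) * f1 x)"
    proof -
      have "Re (cnj (f1 x) * f1 x) = (norm (f1 x))\<^sup>2"
        by (metis Re_complex_of_real complex_norm_square mult.commute)
      then show ?thesis by (simp only: plus_complex.sel scaleR_complex.sel) (simp add: distrib_left)
    qed
    with 1 2 show "?k x \<le> Re (?g x) + ?h x" by (simp add: field_simps)
  qed
  also have "\<dots> = - Re (cnj (f 0) * f1 0) + integral {0..R} ?h"
    by (subst integral_add[OF ig(1) ih]) (simp only: ig(2))
  also have "- Re (cnj (f 0) * f1 0) \<le> norm (f 0) * norm (f1 0)"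
    using abs_Re_le_cmod[of "cnj (f 0) * f1 0"] by (simp add: norm_mult)
  finally show ?thesis by simp
qed

text \<open>Supplies the bound that is missing for first space derivatives: for an averaged solution
  the mass of the second derivative is known from the equation.\<close>

lemma mass_le_derivative:
  assumes "qcont f" "qcont f1" "qcont f2" "t \<ge> 0"
    and "\<And>x. x \<ge> 0 \<Longrightarrow> ((\<lambda>y. f y t) has_vector_derivative f1 x t) (at x within {0..})"
    and "\<And>x. x \<ge> 0 \<Longrightarrow> ((\<lambda>y. f1 y t) has_vector_derivative f2 x t) (at x within {0..})"
    and "mass_le f K t" "mass_le f2 L t"
  shows "mass_le f1 (4 * (2 * (norm (f 0 t) * norm (f1 0 t)) + 5 * K + L)) t"
  unfolding mass_le_def
proof (intro allI impI)
  fix R :: real assume R: "R \<ge> 0"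
  \<comment> \<open>On the first half of the doubled window the weight is at least
    \<open>1 / 4\<close>, which is where the factor \<open>4\<close> comes from; the maximum with
    \<open>1\<close> meets the hypothesis on \<open>R\<close> in the weighted bound.\<close>
  define S where "S = 2 * max R 1"
  have S: "S \<ge> 1" "R \<le> S" "2 * R \<le> S" using R by (auto simp: S_def)
  let ?w = "\<lambda>x. (1 - x / S)\<^sup>2 * (norm (f1 x t))\<^sup>2"
  have cw: "continuous_on {0..S} ?w"
    using S by (intro continuous_intros qcont_x[OF assms(2,4)]) auto
  have "integral {0..R} (\<lambda>x. (norm (f1 x t))\<^sup>2) \<le> integral {0..R} (\<lambda>x. 4 * ?w x)"
  proof (rule integral_le)
    show "(\<lambda>x. (norm (f1 x t))\<^sup>2) integrable_on {0..R}"
      by (intro integrable_continuous_real continuous_intros qcont_x[OF assms(2,4)]) auto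
    show "(\<lambda>x. 4 * ?w x) integrable_on {0..R}"
      using S by (intro integrable_continuous_real continuous_intros continuous_on_subset[OF cw]) auto
    fix x assume x: "x \<in> {0..R}"
    have "1 / 2 \<le> 1 - x / S" using S x by (simp add: field_simps)
    then have "(1 / 2)\<^sup>2 \<le> (1 - x / S)\<^sup>2" by (intro power_mono) auto
    then have "1 \<le> 4 * (1 - x / S)\<^sup>2" by (simp add: power2_eq_square mult.commute)
    from mult_right_mono[OF this, of "(norm (f1 x t))\<^sup>2"]
    show "(norm (f1 x t))\<^sup>2 \<le> 4 * ?w x" by simp
  qed
  also have "\<dots> \<le> integral {0..S} (\<lambda>x. 4 * ?w x)"
    using S by (intro integral_subset_le integrable_continuous_real continuous_intros continuous_on_subset[OF cw]) auto
  also have "\<dots> = 4 * integral {0..S} ?w" by (rule integral_mult_right)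
  also have "integral {0..S} ?w \<le> 2 * (norm (f 0 t) * norm (f1 0 t)) + integral {0..S} (\<lambda>x. 5 * (norm (f x t))\<^sup>2 + (norm (f2 x t))\<^sup>2)"
    by (rule weighted_derivative_bound[OF S(1)])
      (auto intro!: qcont_x[OF assms(1,4)] qcont_x[OF assms(2,4)] qcont_x[OF assms(3,4)]
        has_vector_derivative_within_subset[OF assms(5)] has_vector_derivative_within_subset[OF assms(6)])
  also have "integral {0..S} (\<lambda>x. 5 * (norm (f x t))\<^sup>2 + (norm (f2 x t))\<^sup>2)
      = 5 * integral {0..S} (\<lambda>x. (norm (f x t))\<^sup>2) + integral {0..S} (\<lambda>x. (norm (f2 x t))\<^sup>2)"
    by (subst integral_add) (auto intro!: integrable_continuous_real continuous_intros qcont_x[OF assms(1,4)] qcont_x[OF assms(3,4)])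
  also have "5 * integral {0..S} (\<lambda>x. (norm (f x t))\<^sup>2) + integral {0..S} (\<lambda>x. (norm (f2 x t))\<^sup>2) \<le> 5 * K + L"
    using S by (intro add_mono mult_left_mono mass_leD assms) auto
  finally show "integral {0..R} (\<lambda>x. (norm (f1 x t))\<^sup>2) \<le> 4 * (2 * (norm (f 0 t) * norm (f1 0 t)) + 5 * K + L)"
    by simp
qed

text \<open>The weight vanishes to second order at \<open>R\<close>, so that no value of
  \<open>z\<close>, \<open>v\<close> or their derivatives at \<open>R\<close> enters the balance
  law.\<close>

definition pairing :: "real \<Rightarrow> (real \<Rightarrow> real \<Rightarrow> complex) \<Rightarrow> (real \<Rightarrow> real \<Rightarrow> complex) \<Rightarrow> real \<Rightarrow> complex" where
  "pairing R z v t = integral {0..R} (\<lambda>x. (1 - x / R)\<^sup>2 *\<^sub>R (cnj (z x t) * v x t))"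

lemma pairing_has_vector_derivative:
  assumes "schr z zx zxx zt" "schr v vx vxx vt" "R > 0" "t \<ge> 0"
  shows "(pairing R z v has_vector_derivative
    integral {0..R} (\<lambda>x. (1 - x / R)\<^sup>2 *\<^sub>R (cnj (z x t) * vt x t + cnj (zt x t) * v x t))) (at t within {0..})"
proof -
  interpret z: schr z zx zxx zt by fact
  interpret v: schr v vx vxx vt by fact
  have "((\<lambda>t. integral (cbox 0 R) (\<lambda>x. (1 - x / R)\<^sup>2 *\<^sub>R (cnj (z x t) * v x t))) has_vector_derivative
    integral (cbox 0 R) (\<lambda>x. (1 - x / R)\<^sup>2 *\<^sub>R (cnj (z x t) * vt x t + cnj (zt x t) * v x t))) (at t within {0..})"
  proof (rule leibniz_rule_vector_derivative)
    show "((\<lambda>t. (1 - x / R)\<^sup>2 *\<^sub>R (cnj (z x t) * v x t)) has_vector_derivative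
        (1 - x / R)\<^sup>2 *\<^sub>R (cnj (z x t) * vt x t + cnj (zt x t) * v x t)) (at t within {0..})"
      if "t \<in> {0..}" "x \<in> cbox 0 R" for t x
      using that
      by (intro bounded_linear.has_vector_derivative[OF bounded_linear_scaleR_right] has_vector_derivative_mult
          has_vector_derivative_cnj z.dt v.dt) auto
    show "(\<lambda>x. (1 - x / R)\<^sup>2 *\<^sub>R (cnj (z x t) * v x t)) integrable_on cbox 0 R" if "t \<in> {0..}" for t
      unfolding cbox_interval using that assms(3)
      by (intro integrable_continuous_real continuous_intros qcont_x[OF z.cz] qcont_x[OF v.cz]) auto
    show "continuous_on ({0..} \<times> cbox 0 R) (\<lambda>(t, x). (1 - x / R)\<^sup>2 *\<^sub>R (cnj (z x t) * vt x t + cnj (zt x t) * v x t))"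
      unfolding case_prod_unfold using assms(3)
      by (intro continuous_intros qcontD[OF z.cz] qcontD[OF v.cz] qcontD[OF z.czt] qcontD[OF v.czt]) auto
  qed (use assms(4) in auto)
  then show ?thesis by (simp add: pairing_def[abs_def])
qed

text \<open>The error contains \<open>vx\<close> but not \<open>zx\<close>, which is decisive:
  \<open>v\<close> will be an average, whose derivative has bounded mass, while nothing is known
  about \<open>zx\<close>. By the equation the integrand is \<open>\<i>\<close> times a weighted
  derivative of \<open>cnj z vx - cnj zx v\<close>, and the error consists of the terms in which the
  weight is differentiated.\<close>

lemma pairing_flux:
  assumes "schr z zx zxx zt" "schr v vx vxx vt" "R \<ge> 1" "t \<ge> 0"
  shows "norm (integral {0..R} (\<lambda>x. (1 - x / R)\<^sup>2 *\<^sub>R (cnj (z x t) * vt x t + cnj (zt x t) * v x t))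
      - \<i> * (cnj (zx 0 t) * v 0 t - cnj (z 0 t) * vx 0 t))
    \<le> (2 * (norm (z 0 t) * norm (v 0 t)) + integral {0..R} (\<lambda>x. 3 * (norm (z x t))\<^sup>2 + 2 * (norm (vx x t))\<^sup>2 + (norm (v x t))\<^sup>2)) / R"
proof -
  interpret z: schr z zx zxx zt by fact
  interpret v: schr v vx vxx vt by fact
  let ?q = "\<lambda>x. 1 - x / R"
  \<comment> \<open>The second summand is chosen so that the terms with
    \<open>cnj (zx x t) * v x t\<close> and a differentiated weight cancel; what remains is
    \<open>?E\<close>, of size \<open>1 / R\<close>.\<close>
  let ?A = "\<lambda>x. (?q x)\<^sup>2 *\<^sub>R (cnj (z x t) * vx x t - cnj (zx x t) * v x t) - (2 * ?q x / R) *\<^sub>R (cnj (z x t) * v x t)"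
  let ?D = "\<lambda>x. (?q x)\<^sup>2 *\<^sub>R (cnj (z x t) * vt x t + cnj (zt x t) * v x t)"
  let ?E = "\<lambda>x. (4 * ?q x / R) *\<^sub>R (cnj (z x t) * vx x t) - (2 / R\<^sup>2) *\<^sub>R (cnj (z x t) * v x t)"
  note conts = qcont_x[OF z.cz assms(4)] qcont_x[OF z.czx assms(4)] qcont_x[OF z.czt assms(4)]
    qcont_x[OF v.cz assms(4)] qcont_x[OF v.czx assms(4)] qcont_x[OF v.czt assms(4)]
  have iD: "?D integrable_on {0..R}"
    using assms(3) by (intro integrable_continuous_real continuous_intros conts) auto
  have iE: "?E integrable_on {0..R}"
    using assms(3) by (intro integrable_continuous_real continuous_intros conts) auto
  have B: "norm (integral {0..R} ?E) \<le> integral {0..R} (\<lambda>x. (1 / R) * (3 * (norm (z x t))\<^sup>2 + 2 * (norm (vx x t))\<^sup>2 + (norm (v x t))\<^sup>2))"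
  proof (rule integral_norm_bound_integral[OF iE])
    have "continuous_on {0..R} (\<lambda>x. 3 * (norm (z x t))\<^sup>2 + 2 * (norm (vx x t))\<^sup>2 + (norm (v x t))\<^sup>2)"
      by (intro continuous_on_add continuous_on_mult continuous_on_const continuous_on_power continuous_on_norm conts) auto
    then show "(\<lambda>x. (1 / R) * (3 * (norm (z x t))\<^sup>2 + 2 * (norm (vx x t))\<^sup>2 + (norm (v x t))\<^sup>2)) integrable_on {0..R}"
      by (intro integrable_on_mult_right integrable_continuous_real)
    fix x assume x: "x \<in> {0..R}"
    then have q: "0 \<le> ?q x" "?q x \<le> 1" using assms(3) by auto
    have "norm (?E x) \<le> norm ((4 * ?q x / R) *\<^sub>R (cnj (z x t) * vx x t)) + norm ((2 / R\<^sup>2) *\<^sub>R (cnj (z x t) * v x t))"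
      by (rule norm_triangle_ineq4)
    also have "\<dots> = (4 * ?q x / R) * (norm (z x t) * norm (vx x t)) + (2 / R\<^sup>2) * (norm (z x t) * norm (v x t))"
      unfolding norm_scaleR norm_mult complex_mod_cnj using q assms(3) by (simp only: abs_of_nonneg divide_nonneg_nonneg mult_nonneg_nonneg zero_le_numeral zero_le_power2)
    also have "\<dots> \<le> (4 / R) * (norm (z x t) * norm (vx x t)) + (2 / R) * (norm (z x t) * norm (v x t))"
    proof (intro add_mono mult_right_mono)
      show "4 * ?q x / R \<le> 4 / R" using q assms(3) by (intro divide_right_mono) auto
      show "2 / R\<^sup>2 \<le> 2 / R" using assms(3) by (intro divide_left_mono) (auto simp: power2_eq_square)
    qed auto
    also have "\<dots> \<le> (4 / R) * (((norm (z x t))\<^sup>2 + (norm (vx x t))\<^sup>2) / 2) + (2 / R) * (((norm (z x t))\<^sup>2 + (norm (v x t))\<^sup>2) / 2)"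
      using assms(3) by (intro add_mono mult_left_mono mult_le_half_squares) auto
    also have "\<dots> = (1 / R) * (3 * (norm (z x t))\<^sup>2 + 2 * (norm (vx x t))\<^sup>2 + (norm (v x t))\<^sup>2)"
      unfolding divide_inverse by (simp add: algebra_simps)
    finally show "norm (?E x) \<le> (1 / R) * (3 * (norm (z x t))\<^sup>2 + 2 * (norm (vx x t))\<^sup>2 + (norm (v x t))\<^sup>2)" .
  qed
  have "((\<lambda>x. ?D x - \<i> * ?E x) has_integral (\<i> * ?A R - \<i> * ?A 0)) {0..R}"
  proof (rule fundamental_theorem_of_calculus)
    fix x assume x: "x \<in> {0..R}"
    have d: "((\<lambda>y. z y t) has_vector_derivative zx x t) (at x within {0..R})"
      "((\<lambda>y. zx y t) has_vector_derivative zxx x t) (at x within {0..R})"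
      "((\<lambda>y. v y t) has_vector_derivative vx x t) (at x within {0..R})"
      "((\<lambda>y. vx y t) has_vector_derivative vxx x t) (at x within {0..R})"
      using x assms(4) by (auto intro: has_vector_derivative_within_subset[OF z.dx] has_vector_derivative_within_subset[OF z.dxx]
        has_vector_derivative_within_subset[OF v.dx] has_vector_derivative_within_subset[OF v.dxx])
    have w: "((\<lambda>x. (?q x)\<^sup>2) has_real_derivative (2 * ?q x * (- 1 / R))) (at x within {0..R})"
      "((\<lambda>x. 2 * ?q x / R) has_real_derivative (2 * (- 1 / R) / R)) (at x within {0..R})"
      using assms(3) by (auto intro!: derivative_eq_intros)
    have "(?A has_vector_derivative
        ((?q x)\<^sup>2 *\<^sub>R ((cnj (z x t) * vxx x t + cnj (zx x t) * vx x t) - (cnj (zx x t) * vx x t + cnj (zxx x t) * v x t))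
          + (2 * ?q x * (- 1 / R)) *\<^sub>R (cnj (z x t) * vx x t - cnj (zx x t) * v x t))
        - ((2 * ?q x / R) *\<^sub>R (cnj (z x t) * vx x t + cnj (zx x t) * v x t) + (2 * (- 1 / R) / R) *\<^sub>R (cnj (z x t) * v x t)))
        (at x within {0..R})" (is "(_ has_vector_derivative ?A') _")
      by (intro has_vector_derivative_diff has_vector_derivative_scaleR w has_vector_derivative_mult has_vector_derivative_cnj d)
    then have "((\<lambda>x. \<i> * ?A x) has_vector_derivative \<i> * ?A') (at x within {0..R})"
      by (rule has_vector_derivative_mult_right)
    moreover have "\<i> * ?A' = ?D x - \<i> * ?E x"
    proof -
      have p: "vt x t = \<i> * vxx x t" "zt x t = \<i> * zxx x t"
        using z.pde v.pde x assms(4) by auto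
      define a b c where "a = complex_of_real (2 * ?q x / R)" and "b = complex_of_real (2 / R\<^sup>2)"
        and "c = complex_of_real ((?q x)\<^sup>2)"
      have "(2 * ?q x * (- 1 / R)) *\<^sub>R y = - a * y" "(2 * ?q x / R) *\<^sub>R y = a * y"
        "(4 * ?q x / R) *\<^sub>R y = 2 * a * y" "(2 * (- 1 / R) / R) *\<^sub>R y = - b * y"
        "(2 / R\<^sup>2) *\<^sub>R y = b * y" "(?q x)\<^sup>2 *\<^sub>R y = c * y" for y :: complex
        using assms(3) by (auto simp: a_def b_def c_def scaleR_conv_of_real power2_eq_square field_simps)
      then show ?thesis unfolding p by (simp only:) (simp add: algebra_simps)
    qed
    ultimately show "((\<lambda>x. \<i> * ?A x) has_vector_derivative ?D x - \<i> * ?E x) (at x within {0..R})" by simp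
  qed (use assms(3) in simp)
  then have 1: "integral {0..R} (\<lambda>x. ?D x - \<i> * ?E x) = \<i> * ?A R - \<i> * ?A 0"
    by (rule integral_unique)
  have 2: "integral {0..R} (\<lambda>x. ?D x - \<i> * ?E x) = integral {0..R} ?D - \<i> * integral {0..R} ?E"
    by (subst integral_diff[OF iD integrable_on_mult_right[OF iE]]) simp
  have AR: "?A R = 0" using assms(3) by simp
  have A0: "?A 0 = cnj (z 0 t) * vx 0 t - cnj (zx 0 t) * v 0 t - (2 / R) *\<^sub>R (cnj (z 0 t) * v 0 t)" by simp
  define X Y where "X = integral {0..R} ?D" and "Y = integral {0..R} ?E"
  have "X - \<i> * Y = - (\<i> * ?A 0)"
    unfolding X_def Y_def 2[symmetric] 1 AR by (simp only: mult_zero_right diff_0)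
  then have "X - \<i> * (cnj (zx 0 t) * v 0 t - cnj (z 0 t) * vx 0 t) = \<i> * Y + \<i> * ((2 / R) *\<^sub>R (cnj (z 0 t) * v 0 t))"
    unfolding A0 by (simp add: algebra_simps)
  then have eq: "integral {0..R} ?D - \<i> * (cnj (zx 0 t) * v 0 t - cnj (z 0 t) * vx 0 t)
      = \<i> * integral {0..R} ?E + \<i> * ((2 / R) *\<^sub>R (cnj (z 0 t) * v 0 t))"
    by (simp only: X_def Y_def)
  have "norm (\<i> * y + \<i> * ((2 / R) *\<^sub>R w)) \<le> norm y + (2 / R) * norm w" for y w :: complex
    using norm_triangle_ineq[of "\<i> * y" "\<i> * ((2 / R) *\<^sub>R w)"] assms(3)
    by (simp add: norm_mult)
  from this[of "integral {0..R} ?E" "cnj (z 0 t) * v 0 t"]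
  have N: "norm (integral {0..R} ?D - \<i> * (cnj (zx 0 t) * v 0 t - cnj (z 0 t) * vx 0 t))
      \<le> norm (integral {0..R} ?E) + (2 / R) * (norm (z 0 t) * norm (v 0 t))"
    unfolding eq norm_mult[of "cnj (z 0 t)"] complex_mod_cnj .
  note order_trans[OF N add_right_mono[OF B[unfolded integral_mult_right]]]
  moreover have "(1 / R) * i + (2 / R) * a = (2 * a + i) / R" for i a
    by (simp add: add_divide_distrib)
  ultimately show ?thesis by (simp only:)
qed

text \<open>The constant may depend on \<open>t\<close> in an arbitrary way. This rate already gives
  finite mass with tails of order \<open>1 / a\<close> at each time, but nothing uniform in
  time.\<close>

locale decaying_schr = schr +
  assumes decay: "\<And>t. t \<ge> 0 \<Longrightarrow> \<exists>C. \<forall>x\<ge>0. (1 + x) * norm (z x t) \<le> C"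
begin

lemma decay_bound:
  assumes "t \<ge> 0"
  obtains C where "C \<ge> 0" "\<forall>x\<ge>0. norm (z x t) \<le> C / (1 + x)"
proof -
  obtain C where C: "\<forall>x\<ge>0. (1 + x) * norm (z x t) \<le> C" using decay[OF assms] by blast
  have "0 \<le> (1 + 0) * norm (z 0 t)" by simp
  also have "\<dots> \<le> C" using C by blast
  finally have "C \<ge> 0" .
  moreover have "\<forall>x\<ge>0. norm (z x t) \<le> C / (1 + x)"
    using C by (simp add: pos_le_divide_eq mult.commute)
  ultimately show ?thesis using that by blast
qed

lemma tail_bound:
  assumes "t \<ge> 0" "0 \<le> a" "a \<le> b" and C: "\<forall>x\<ge>0. norm (z x t) \<le> C / (1 + x)"
  shows "integral {a..b} (\<lambda>x. (norm (z x t))\<^sup>2) \<le> C\<^sup>2 / (1 + a)"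
proof -
  have "((\<lambda>x. C\<^sup>2 / (1 + x)\<^sup>2) has_integral (- C\<^sup>2 / (1 + b) - (- C\<^sup>2 / (1 + a)))) {a..b}"
  proof (rule fundamental_theorem_of_calculus)
    fix x assume "x \<in> {a..b}"
    then have "((\<lambda>x. - C\<^sup>2 / (1 + x)) has_real_derivative C\<^sup>2 / (1 + x)\<^sup>2) (at x within {a..b})"
      using assms by (auto intro!: derivative_eq_intros simp: power2_eq_square)
    then show "((\<lambda>x. - C\<^sup>2 / (1 + x)) has_vector_derivative C\<^sup>2 / (1 + x)\<^sup>2) (at x within {a..b})"
      by (simp add: has_real_derivative_iff_has_vector_derivative)
  qed (use assms in simp)
  then have i: "(\<lambda>x. C\<^sup>2 / (1 + x)\<^sup>2) integrable_on {a..b}" "integral {a..b} (\<lambda>x. C\<^sup>2 / (1 + x)\<^sup>2) \<le> C\<^sup>2 / (1 + a)"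
    using assms by (auto simp: has_integral_integrable integral_unique)
  have "integral {a..b} (\<lambda>x. (norm (z x t))\<^sup>2) \<le> integral {a..b} (\<lambda>x. C\<^sup>2 / (1 + x)\<^sup>2)"
  proof (rule integral_le[OF _ i(1)])
    show "(\<lambda>x. (norm (z x t))\<^sup>2) integrable_on {a..b}"
      using assms by (intro integrable_continuous_real continuous_intros qcont_x[OF cz]) auto
    fix x assume "x \<in> {a..b}"
    then have "(norm (z x t))\<^sup>2 \<le> (C / (1 + x))\<^sup>2" using C assms by (intro power_mono) auto
    then show "(norm (z x t))\<^sup>2 \<le> C\<^sup>2 / (1 + x)\<^sup>2" by (simp add: power_divide)
  qed
  with i(2) show ?thesis by linarith
qed

lemma ex_mass_le:
  assumes "t \<ge> 0"
  shows "\<exists>K. mass_le z K t"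
proof -
  obtain C where "C \<ge> 0" "\<forall>x\<ge>0. norm (z x t) \<le> C / (1 + x)" using decay_bound[OF assms] .
  then have "mass_le z (C\<^sup>2) t"
    unfolding mass_le_def using tail_bound[OF assms, of 0 _ C] by simp
  then show ?thesis by blast
qed

text \<open>The point is uniformity in \<open>R\<close>. On \<open>{0..R1}\<close> the averages
  converge uniformly; beyond \<open>R1\<close>, Young's inequality with parameter
  \<open>\<mu>\<close> sets the small tail of \<open>z\<close> at the fixed time
  \<open>\<tau>\<close> against the mass bound \<open>K\<close>, which the averages share.\<close>

lemma pairing_approx:
  assumes "\<tau> \<ge> 0" "\<eta> > 0" "\<And>s. s \<in> {\<tau>..\<tau> + \<eta>} \<Longrightarrow> mass_le z K s" "e > 0"
  shows "\<exists>\<epsilon>1>0. \<exists>R1\<ge>1. \<forall>\<epsilon> R. 0 \<le> \<epsilon> \<and> \<epsilon> \<le> \<epsilon>1 \<and> R \<ge> R1 \<longrightarrow>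
    norm (pairing R z (avg \<epsilon> z) \<tau> - pairing R z z \<tau>) \<le> e"
proof -
  have K: "K \<ge> 0" using assms(2) mass_le_nonneg[OF assms(3)[of \<tau>]] by auto
  obtain C where C: "C \<ge> 0" "\<forall>x\<ge>0. norm (z x \<tau>) \<le> C / (1 + x)" using decay_bound[OF assms(1)] .
  \<comment> \<open>\<open>\<mu>\<close> makes the tail of the difference, whose mass is at most
    \<open>4 * K\<close>, cost \<open>e / 2\<close>; then \<open>R1\<close> makes the tail of
    \<open>z\<close> cost \<open>e / 4\<close>, and \<open>\<delta>\<close> makes the compact part
    cost \<open>e / 4\<close>.\<close>
  define \<mu> where "\<mu> = e / (4 * K + 1)"
  have \<mu>: "\<mu> > 0" using K assms(4) by (simp add: \<mu>_def)
  define R1 where "R1 = 1 + 2 * C\<^sup>2 / (e * \<mu>)"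
  have R1: "R1 \<ge> 1" using \<mu> assms(4) by (simp add: R1_def)
  define \<delta> where "\<delta> = e / (4 * (R1 * C + 1))"
  have RC: "R1 * C \<ge> 0" using R1 C by simp
  have \<delta>: "\<delta> > 0" using RC assms(4) by (simp add: \<delta>_def)
  obtain \<epsilon>0 where \<epsilon>0: "\<epsilon>0 > 0"
    "\<forall>\<epsilon>. 0 \<le> \<epsilon> \<and> \<epsilon> \<le> \<epsilon>0 \<longrightarrow> (\<forall>x\<in>{0..R1}. \<forall>t\<in>{0..\<tau>}. norm (avg \<epsilon> z x t - z x t) \<le> \<delta>)"
    using avg_uniform_approx[OF cz \<delta>] by blast
  have "norm (pairing R z (avg \<epsilon> z) \<tau> - pairing R z z \<tau>) \<le> e"
    if h: "0 \<le> \<epsilon> \<and> \<epsilon> \<le> min \<epsilon>0 \<eta> \<and> R \<ge> R1" for \<epsilon> R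
  proof -
    from h have \<epsilon>: "\<epsilon> \<ge> 0" "\<epsilon> \<le> \<epsilon>0" "\<epsilon> \<le> \<eta>" and R: "R \<ge> R1" "R \<ge> 1" using R1 by auto
    let ?v = "\<lambda>x. avg \<epsilon> z x \<tau>" and ?z = "\<lambda>x. z x \<tau>"
    let ?q = "\<lambda>x. (1 - x / R)\<^sup>2"
    have cv: "qcont (avg \<epsilon> z)" by (rule avg_qcont[OF cz \<epsilon>(1)])
    have c: "continuous_on S ?v" "continuous_on S ?z" if "S \<subseteq> {0..}" for S
      using qcont_x[OF cv assms(1) that] qcont_x[OF cz assms(1) that] .
    have mv: "mass_le (avg \<epsilon> z) K \<tau>"
      using assms(3) \<epsilon> by (intro mass_le_avg[OF cz \<epsilon>(1) assms(1)]) auto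
    have mz: "mass_le z K \<tau>" using assms(2,3) by auto
    let ?h = "\<lambda>x. norm (?z x) * norm (?v x - ?z x)"
    have eq: "pairing R z (avg \<epsilon> z) \<tau> - pairing R z z \<tau>
        = integral {0..R} (\<lambda>x. ?q x *\<^sub>R (cnj (?z x) * ?v x) - ?q x *\<^sub>R (cnj (?z x) * ?z x))"
      unfolding pairing_def using R(2)
      by (intro integral_diff[symmetric] integrable_continuous_real continuous_intros c) auto
    have 1: "norm (pairing R z (avg \<epsilon> z) \<tau> - pairing R z z \<tau>) \<le> integral {0..R} ?h"
      unfolding eq
    proof (rule integral_norm_bound_integral)
      show "(\<lambda>x. ?q x *\<^sub>R (cnj (?z x) * ?v x) - ?q x *\<^sub>R (cnj (?z x) * ?z x)) integrable_on {0..R}"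
        using R(2) by (intro integrable_continuous_real continuous_intros c) auto
      show "?h integrable_on {0..R}" by (intro integrable_continuous_real continuous_intros c) auto
      fix x assume x: "x \<in> {0..R}"
      have "?q x *\<^sub>R (cnj (?z x) * ?v x) - ?q x *\<^sub>R (cnj (?z x) * ?z x) = ?q x *\<^sub>R (cnj (?z x) * (?v x - ?z x))"
        by (simp add: right_diff_distrib scaleR_diff_right)
      then have "norm (?q x *\<^sub>R (cnj (?z x) * ?v x) - ?q x *\<^sub>R (cnj (?z x) * ?z x)) = ?q x * ?h x"
        by (simp add: norm_mult)
      also have "\<dots> \<le> 1 * ?h x" using x R(2) by (intro mult_right_mono power_le_one) auto
      finally show "norm (?q x *\<^sub>R (cnj (?z x) * ?v x) - ?q x *\<^sub>R (cnj (?z x) * ?z x)) \<le> ?h x" by simp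
    qed
    have 2: "integral {0..R} ?h = integral {0..R1} ?h + integral {R1..R} ?h"
    proof -
      have "?h integrable_on {0..R}" by (intro integrable_continuous_real continuous_intros c) auto
      from Henstock_Kurzweil_Integration.integral_combine[OF _ _ this, of R1] show ?thesis using R R1 by simp
    qed
    have 3: "integral {0..R1} ?h \<le> integral {0..R1} (\<lambda>x. C * \<delta>)"
    proof (rule integral_le)
      show "?h integrable_on {0..R1}" by (intro integrable_continuous_real continuous_intros c) auto
      fix x assume x: "x \<in> {0..R1}"
      have "norm (?z x) \<le> C / (1 + x)" using C x by auto
      also have "\<dots> \<le> C / 1" using C x by (intro divide_left_mono) auto
      finally have "norm (?z x) \<le> C" by simp
      moreover have "norm (?v x - ?z x) \<le> \<delta>" using \<epsilon>0(2) \<epsilon> x assms(1) by auto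
      ultimately show "?h x \<le> C * \<delta>" using C by (intro mult_mono) auto
    qed (rule integrable_const_ivl)
    have 4: "integral {0..R1} (\<lambda>x. C * \<delta>) \<le> e / 4"
    proof -
      have "integral {0..R1} (\<lambda>x. C * \<delta>) = (R1 * C) * \<delta>" using R1 by simp
      also have "\<dots> \<le> (R1 * C + 1) * \<delta>" using \<delta> by (intro mult_right_mono) auto
      also have "\<dots> = e / 4" using RC unfolding \<delta>_def by (simp add: field_simps)
      finally show ?thesis .
    qed
    have 5: "integral {R1..R} ?h \<le> e / 4 + e / 2"
    proof -
      let ?a = "\<lambda>x. (1 / (2 * \<mu>)) * (norm (?z x))\<^sup>2" and ?b = "\<lambda>x. (\<mu> / 2) * (norm (?v x - ?z x))\<^sup>2"
      have i: "?a integrable_on {R1..R}" "?b integrable_on {R1..R}"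
        using R1 \<mu> by (auto intro!: integrable_continuous_real continuous_intros c)
      have "integral {R1..R} ?h \<le> integral {R1..R} (\<lambda>x. ?a x + ?b x)"
      proof (rule integral_le)
        show "?h integrable_on {R1..R}" using R1 by (intro integrable_continuous_real continuous_intros c) auto
        show "(\<lambda>x. ?a x + ?b x) integrable_on {R1..R}" by (rule integrable_add[OF i])
        fix x
        have "0 \<le> (norm (?z x) - \<mu> * norm (?v x - ?z x))\<^sup>2" by simp
        then have "2 * \<mu> * ?h x \<le> (norm (?z x))\<^sup>2 + \<mu>\<^sup>2 * (norm (?v x - ?z x))\<^sup>2"
          by (simp add: power2_eq_square algebra_simps)
        then have "?h x \<le> ((norm (?z x))\<^sup>2 + \<mu>\<^sup>2 * (norm (?v x - ?z x))\<^sup>2) / (2 * \<mu>)"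
          using \<mu> by (subst pos_le_divide_eq) (simp_all add: mult_ac)
        also have "\<dots> = ?a x + ?b x" using \<mu> by (simp add: field_simps power2_eq_square)
        finally show "?h x \<le> ?a x + ?b x" .
      qed
      also have "\<dots> = (1 / (2 * \<mu>)) * integral {R1..R} (\<lambda>x. (norm (?z x))\<^sup>2) + (\<mu> / 2) * integral {R1..R} (\<lambda>x. (norm (?v x - ?z x))\<^sup>2)"
        unfolding integral_add[OF i] by (simp only: integral_mult_right)
      also have "(1 / (2 * \<mu>)) * integral {R1..R} (\<lambda>x. (norm (?z x))\<^sup>2) \<le> e / 4"
      proof -
        have "integral {R1..R} (\<lambda>x. (norm (?z x))\<^sup>2) \<le> C\<^sup>2 / (1 + R1)"
          using R R1 by (intro tail_bound[OF assms(1) _ _ C(2)]) auto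
        also have "\<dots> \<le> e * \<mu> / 2"
        proof -
          have "C\<^sup>2 = (2 * C\<^sup>2 / (e * \<mu>)) * (e * \<mu> / 2)" using \<mu> assms(4) by simp
          also have "\<dots> \<le> (1 + R1) * (e * \<mu> / 2)"
            using \<mu> assms(4) by (intro mult_right_mono) (auto simp: R1_def)
          finally show ?thesis using R1 by (subst pos_divide_le_eq) (auto simp: mult_ac)
        qed
        finally have "(1 / (2 * \<mu>)) * integral {R1..R} (\<lambda>x. (norm (?z x))\<^sup>2) \<le> (1 / (2 * \<mu>)) * (e * \<mu> / 2)"
          using \<mu> by (intro mult_left_mono) auto
        also have "\<dots> = e / 4" using \<mu> by simp
        finally show ?thesis .
      qed
      also have "(\<mu> / 2) * integral {R1..R} (\<lambda>x. (norm (?v x - ?z x))\<^sup>2) \<le> e / 2"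
      proof -
        have "integral {R1..R} (\<lambda>x. (norm (?v x - ?z x))\<^sup>2) \<le> integral {0..R} (\<lambda>x. (norm (?v x - ?z x))\<^sup>2)"
          using R R1 by (intro integral_subset_le integrable_continuous_real continuous_intros c) auto
        also have "\<dots> \<le> integral {0..R} (\<lambda>x. 2 * (norm (?v x))\<^sup>2 + 2 * (norm (?z x))\<^sup>2)"
          by (intro integral_le integrable_continuous_real continuous_intros c norm_diff_square_le) auto
        also have "\<dots> = 2 * integral {0..R} (\<lambda>x. (norm (?v x))\<^sup>2) + 2 * integral {0..R} (\<lambda>x. (norm (?z x))\<^sup>2)"
          by (subst integral_add) (auto intro!: integrable_continuous_real continuous_intros c)
        also have "\<dots> \<le> 2 * K + 2 * K"
          using R(2) by (intro add_mono mult_left_mono mass_leD mv mz) auto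
        finally have "(\<mu> / 2) * integral {R1..R} (\<lambda>x. (norm (?v x - ?z x))\<^sup>2) \<le> (\<mu> / 2) * (4 * K)"
          using \<mu> by (intro mult_left_mono) auto
        also have "\<dots> \<le> (\<mu> / 2) * (4 * K + 1)" using \<mu> by (intro mult_left_mono) auto
        also have "\<dots> = \<mu> * (4 * K + 1) / 2" by (rule times_divide_eq_left)
        also have "\<mu> * (4 * K + 1) = e" using K by (simp add: \<mu>_def)
        finally show ?thesis .
      qed
      finally show ?thesis by simp
    qed
    from 1 2 3 4 5 show ?thesis by linarith
  qed
  moreover have "min \<epsilon>0 \<eta> > 0" using \<epsilon>0 assms by simp
  ultimately show ?thesis using R1 by blast
qed

end

text \<open>\<open>E\<close> collects the terms that the factor \<open>1 / R\<close> will make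
  negligible; \<open>d\<close> allows for the difference between the boundary values of
  \<open>v\<close> and those of \<open>z\<close>.\<close>

lemma pairing_increment:
  assumes sz: "schr z zx zxx zt" and sv: "schr v vx vxx vt" and R: "R \<ge> 1" and ab: "0 \<le> a" "a \<le> b"
    and E: "\<And>r. r \<in> {a..b} \<Longrightarrow> 2 * (norm (z 0 r) * norm (v 0 r))
      + integral {0..R} (\<lambda>x. 3 * (norm (z x r))\<^sup>2 + 2 * (norm (vx x r))\<^sup>2 + (norm (v x r))\<^sup>2) \<le> E"
    and F: "\<And>r. r \<in> {a..b} \<Longrightarrow> norm (cnj (zx 0 r) * v 0 r - cnj (z 0 r) * vx 0 r) \<le> 2 * (norm (z 0 r) * norm (zx 0 r)) + d"
  shows "norm (pairing R z v b - pairing R z v a)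
    \<le> integral {a..b} (\<lambda>r. 2 * (norm (z 0 r) * norm (zx 0 r))) + (d + E / R) * (b - a)"
proof -
  interpret z: schr z zx zxx zt by fact
  define D where "D t = integral {0..R} (\<lambda>x. (1 - x / R)\<^sup>2 *\<^sub>R (cnj (z x t) * vt x t + cnj (zt x t) * v x t))" for t
  have hi: "(D has_integral (pairing R z v b - pairing R z v a)) {a..b}"
  proof (rule fundamental_theorem_of_calculus)
    fix t assume "t \<in> {a..b}"
    then have "t \<ge> 0" using ab by simp
    have "(pairing R z v has_vector_derivative D t) (at t within {0..})"
      unfolding D_def using R \<open>t \<ge> 0\<close> by (intro pairing_has_vector_derivative[OF sz sv]) auto
    then show "(pairing R z v has_vector_derivative D t) (at t within {a..b})"
      by (rule has_vector_derivative_within_subset) (use ab in auto)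
  qed (use ab in simp)
  have c: "continuous_on {a..b} (\<lambda>r. 2 * (norm (z 0 r) * norm (zx 0 r)))"
    using ab by (intro continuous_intros qcont_t[OF z.cz] qcont_t[OF z.czx]) auto
  let ?G = "\<lambda>r. 2 * (norm (z 0 r) * norm (zx 0 r)) + (d + E / R)"
  have "norm (integral {a..b} D) \<le> integral {a..b} ?G"
  proof (rule integral_norm_bound_integral)
    show "D integrable_on {a..b}" using hi by (rule has_integral_integrable)
    show "?G integrable_on {a..b}" by (intro integrable_add integrable_continuous_real c integrable_const_ivl)
    fix t assume t: "t \<in> {a..b}"
    then have t0: "t \<ge> 0" using ab by simp
    let ?f = "cnj (zx 0 t) * v 0 t - cnj (z 0 t) * vx 0 t"
    have "norm (D t - \<i> * ?f) \<le> E / R"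
    proof -
      have "norm (D t - \<i> * ?f) \<le> (2 * (norm (z 0 t) * norm (v 0 t))
          + integral {0..R} (\<lambda>x. 3 * (norm (z x t))\<^sup>2 + 2 * (norm (vx x t))\<^sup>2 + (norm (v x t))\<^sup>2)) / R"
        unfolding D_def by (rule pairing_flux[OF sz sv R t0])
      also have "\<dots> \<le> E / R" using R by (intro divide_right_mono E t) auto
      finally show ?thesis .
    qed
    moreover have "norm (\<i> * ?f) \<le> 2 * (norm (z 0 t) * norm (zx 0 t)) + d"
      using F[OF t] by (simp only: norm_mult norm_ii mult_1_left)
    moreover have "norm (D t) \<le> norm (\<i> * ?f) + norm (D t - \<i> * ?f)" by (rule norm_triangle_sub)
    ultimately show "norm (D t) \<le> ?G t" by linarith
  qed
  also have "\<dots> = integral {a..b} (\<lambda>r. 2 * (norm (z 0 r) * norm (zx 0 r))) + (d + E / R) * (b - a)"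
    unfolding integral_add[OF integrable_continuous_real[OF c] integrable_const_ivl] using ab by simp
  finally show ?thesis using integral_unique[OF hi] by simp
qed

lemma Re_pairing_self:
  assumes "continuous_on {0..R} (\<lambda>x. z x t)" "R > 0"
  shows "Re (pairing R z z t) = integral {0..R} (\<lambda>x. (1 - x / R)\<^sup>2 * (norm (z x t))\<^sup>2)"
proof -
  have "(\<lambda>x. (1 - x / R)\<^sup>2 *\<^sub>R (cnj (z x t) * z x t)) integrable_on {0..R}"
    using assms by (intro integrable_continuous_real continuous_intros) auto
  from integral_linear[OF this bounded_linear_Re]
  have 1: "Re (pairing R z z t) = integral {0..R} (\<lambda>x. Re ((1 - x / R)\<^sup>2 *\<^sub>R (cnj (z x t) * z x t)))"
    by (simp add: pairing_def o_def)
  have 2: "Re ((1 - x / R)\<^sup>2 *\<^sub>R (cnj w * w)) = (1 - x / R)\<^sup>2 * (norm w)\<^sup>2" for x w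
  proof -
    have "Re (cnj w * w) = (norm w)\<^sup>2"
      by (metis Re_complex_of_real complex_norm_square mult.commute)
    then show ?thesis by (simp only: scaleR_complex.sel)
  qed
  show ?thesis using 1 unfolding 2 .
qed

section \<open>Boundedness of the mass\<close>

context decaying_schr
begin

text \<open>At \<open>x = 0\<close> and on bounded times the averages of \<open>z\<close> and
  \<open>zx\<close> are uniformly close to \<open>z\<close> and \<open>zx\<close>, so each of the
  two products is at most \<open>norm (z 0 r) * norm (zx 0 r)\<close> up to a small error.\<close>

lemma flux_approx:
  assumes "d > 0"
  shows "\<exists>\<epsilon>0>0. \<forall>\<epsilon>. 0 \<le> \<epsilon> \<and> \<epsilon> \<le> \<epsilon>0 \<longrightarrow> (\<forall>r\<in>{0..T}.
    norm (cnj (zx 0 r) * avg \<epsilon> z 0 r - cnj (z 0 r) * avg \<epsilon> zx 0 r) \<le> 2 * (norm (z 0 r) * norm (zx 0 r)) + d)"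
proof -
  have "bounded ((\<lambda>r. z 0 r) ` {0..T})" "bounded ((\<lambda>r. zx 0 r) ` {0..T})"
    by (auto intro!: compact_imp_bounded compact_continuous_image qcont_t[OF cz] qcont_t[OF czx])
  then obtain A B where AB: "\<forall>r\<in>{0..T}. norm (z 0 r) \<le> A" "\<forall>r\<in>{0..T}. norm (zx 0 r) \<le> B"
    unfolding bounded_iff by (auto simp: image_iff)
  define e where "e = d / (\<bar>A\<bar> + \<bar>B\<bar> + 1)"
  have e: "e > 0" using assms by (simp add: e_def add_nonneg_pos)
  have eAB: "B' * e + A' * e \<le> d" if "A' \<le> A" "B' \<le> B" for A' B'
  proof -
    have "B' * e + A' * e = (A' + B') * e" by (simp add: algebra_simps)
    also have "\<dots> \<le> (\<bar>A\<bar> + \<bar>B\<bar> + 1) * e" using that e by (intro mult_right_mono) auto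
    also have "\<dots> = d" unfolding e_def by simp
    finally show ?thesis .
  qed
  obtain e1 where e1: "e1 > 0" "\<forall>\<epsilon>. 0 \<le> \<epsilon> \<and> \<epsilon> \<le> e1 \<longrightarrow> (\<forall>x\<in>{0..0}. \<forall>t\<in>{0..T}. norm (avg \<epsilon> z x t - z x t) \<le> e)"
    using avg_uniform_approx[OF cz e, of 0 T] by blast
  obtain e2 where e2: "e2 > 0" "\<forall>\<epsilon>. 0 \<le> \<epsilon> \<and> \<epsilon> \<le> e2 \<longrightarrow> (\<forall>x\<in>{0..0}. \<forall>t\<in>{0..T}. norm (avg \<epsilon> zx x t - zx x t) \<le> e)"
    using avg_uniform_approx[OF czx e, of 0 T] by blast
  have "norm (cnj (zx 0 r) * avg \<epsilon> z 0 r - cnj (z 0 r) * avg \<epsilon> zx 0 r) \<le> 2 * (norm (z 0 r) * norm (zx 0 r)) + d"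
    if \<epsilon>: "0 \<le> \<epsilon>" "\<epsilon> \<le> min e1 e2" and r: "r \<in> {0..T}" for \<epsilon> r
  proof -
    let ?a = "avg \<epsilon> z 0 r - z 0 r" and ?b = "avg \<epsilon> zx 0 r - zx 0 r"
    have ab: "norm ?a \<le> e" "norm ?b \<le> e" using e1(2) e2(2) \<epsilon> r by auto
    have "norm (avg \<epsilon> z 0 r) \<le> norm (z 0 r) + e" using ab(1) norm_triangle_sub[of "avg \<epsilon> z 0 r" "z 0 r"] by linarith
    then have 1: "norm (cnj (zx 0 r) * avg \<epsilon> z 0 r) \<le> norm (zx 0 r) * (norm (z 0 r) + e)"
      unfolding norm_mult complex_mod_cnj by (rule mult_left_mono) simp
    have "norm (avg \<epsilon> zx 0 r) \<le> norm (zx 0 r) + e" using ab(2) norm_triangle_sub[of "avg \<epsilon> zx 0 r" "zx 0 r"] by linarith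
    then have 2: "norm (cnj (z 0 r) * avg \<epsilon> zx 0 r) \<le> norm (z 0 r) * (norm (zx 0 r) + e)"
      unfolding norm_mult complex_mod_cnj by (rule mult_left_mono) simp
    have 3: "norm (zx 0 r) * e + norm (z 0 r) * e \<le> d" using AB r by (intro eAB) auto
    have "norm (cnj (zx 0 r) * avg \<epsilon> z 0 r - cnj (z 0 r) * avg \<epsilon> zx 0 r)
        \<le> norm (cnj (zx 0 r) * avg \<epsilon> z 0 r) + norm (cnj (z 0 r) * avg \<epsilon> zx 0 r)"
      by (rule norm_triangle_ineq4)
    with 1 2 3 show ?thesis by (simp add: algebra_simps)
  qed
  moreover have "min e1 e2 > 0" using e1 e2 by simp
  ultimately show ?thesis by blast
qed

text \<open>The minimum and maximum make it symmetric in its arguments: the same quantity limits the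
  gain of mass forwards and backwards in time.\<close>

definition influx :: "real \<Rightarrow> real \<Rightarrow> real" where
  "influx a b = integral {min a b..max a b} (\<lambda>r. 2 * (norm (z 0 r) * norm (zx 0 r)))"

text \<open>Pairing \<open>z\<close> with its time average, rather than with itself, costs the error terms only one derivative,
  which is controlled by the mass because averaging in time is smoothing in space.\<close>

lemma mass_propagation:
  assumes st: "0 \<le> s" "s \<le> t" and \<eta>: "\<eta> > 0" and mass: "\<And>r. r \<in> {s..t + \<eta>} \<Longrightarrow> mass_le z K r"
    and \<sigma>\<tau>: "\<sigma> \<in> {s..t}" "\<tau> \<in> {s..t}" and L: "mass_le z L \<sigma>"
  shows "mass_le z (L + influx \<sigma> \<tau>) \<tau>"
  unfolding mass_le_def
proof (intro allI impI)
  fix R0 :: real assume R0: "R0 \<ge> 0"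
  show "integral {0..R0} (\<lambda>x. (norm (z x \<tau>))\<^sup>2) \<le> L + influx \<sigma> \<tau>"
  proof (rule field_le_epsilon)
    fix e0 :: real assume "e0 > 0"
    \<comment> \<open>Five errors of size \<open>e\<close>: the replacement of \<open>z\<close> by
      its average at each of the two times, two in the increment of the pairing, and one for
      removing the weight at \<open>\<tau>\<close>.\<close>
    define e where "e = e0 / 5"
    have e: "e > 0" using \<open>e0 > 0\<close> by (simp add: e_def)
    have K: "K \<ge> 0" using mass_le_nonneg[OF mass[of s]] st \<eta> by auto
    have nonneg: "\<sigma> \<ge> 0" "\<tau> \<ge> 0" using \<sigma>\<tau> st by auto
    obtain e1 R1 where 1: "e1 > 0" "R1 \<ge> 1" "\<forall>\<epsilon> R. 0 \<le> \<epsilon> \<and> \<epsilon> \<le> e1 \<and> R \<ge> R1 \<longrightarrow>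
        norm (pairing R z (avg \<epsilon> z) \<tau> - pairing R z z \<tau>) \<le> e"
      using pairing_approx[OF nonneg(2) \<eta> mass e] \<sigma>\<tau> by auto
    obtain e2 R2 where 2: "e2 > 0" "R2 \<ge> 1" "\<forall>\<epsilon> R. 0 \<le> \<epsilon> \<and> \<epsilon> \<le> e2 \<and> R \<ge> R2 \<longrightarrow>
        norm (pairing R z (avg \<epsilon> z) \<sigma> - pairing R z z \<sigma>) \<le> e"
      using pairing_approx[OF nonneg(1) \<eta> mass e] \<sigma>\<tau> by auto
    define d where "d = e / (t - s + 1)"
    have d: "d > 0" "d * (t - s) \<le> e" using e st by (auto simp: d_def field_simps)
    obtain e3 where 3: "e3 > 0" "\<forall>\<epsilon>. 0 \<le> \<epsilon> \<and> \<epsilon> \<le> e3 \<longrightarrow> (\<forall>r\<in>{0..t}.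
        norm (cnj (zx 0 r) * avg \<epsilon> z 0 r - cnj (z 0 r) * avg \<epsilon> zx 0 r) \<le> 2 * (norm (z 0 r) * norm (zx 0 r)) + d)"
      using flux_approx[OF d(1)] by blast
    define \<epsilon> where "\<epsilon> = min (min e1 e2) (min e3 \<eta>)"
    have \<epsilon>: "\<epsilon> > 0" "\<epsilon> \<le> e1" "\<epsilon> \<le> e2" "\<epsilon> \<le> e3" "\<epsilon> \<le> \<eta>" using 1 2 3 \<eta> by (auto simp: \<epsilon>_def)
    interpret v: schr "avg \<epsilon> z" "avg \<epsilon> zx" "avg \<epsilon> zxx" "avg \<epsilon> zt"
      using \<epsilon> by (intro schr_avg) auto
    have mv: "mass_le (avg \<epsilon> z) K r" if "r \<in> {s..t}" for r
      using that st \<epsilon> by (intro mass_le_avg[OF cz]) (auto intro!: mass)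
    \<comment> \<open>The equation turns the time derivative of the average, a difference quotient
      of \<open>z\<close>, into its second space derivative; together with \<open>mv\<close> this
      feeds the interpolation in \<open>mvx\<close>.\<close>
    have mvt: "mass_le (avg \<epsilon> zxx) (4 * K / \<epsilon>\<^sup>2) r" if r: "r \<in> {s..t}" for r
    proof -
      have r0: "r \<ge> 0" using r st by simp
      have "mass_le (avg \<epsilon> zt) (4 * K / \<epsilon>\<^sup>2) r"
      proof (rule mass_le_difference_quotient[OF cz \<epsilon>(1) r0])
        show "mass_le z K r" "mass_le z K (r + \<epsilon>)" using r st \<epsilon> by (auto intro!: mass)
        show "\<epsilon> *\<^sub>R avg \<epsilon> zt x r = z x (r + \<epsilon>) - z x r" if "x \<ge> 0" for x
          by (rule avg_derivative_eq[OF cz czt \<epsilon>(1) that r0 dt])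
        show "continuous_on {0..} (\<lambda>x. avg \<epsilon> zt x r)" by (rule qcont_x[OF v.czt r0]) simp
      qed
      moreover have "integral {0..R} (\<lambda>x. (norm (avg \<epsilon> zxx x r))\<^sup>2) = integral {0..R} (\<lambda>x. (norm (avg \<epsilon> zt x r))\<^sup>2)" for R
        by (intro integral_cong) (simp add: v.pde r0 norm_mult)
      ultimately show ?thesis unfolding mass_le_def by simp
    qed
    have "bounded ((\<lambda>r. norm (avg \<epsilon> z 0 r) * norm (avg \<epsilon> zx 0 r)) ` {s..t})"
      "bounded ((\<lambda>r. norm (z 0 r) * norm (avg \<epsilon> z 0 r)) ` {s..t})"
      using st by (auto intro!: compact_imp_bounded compact_continuous_image continuous_intros qcont_t[OF cz] qcont_t[OF v.cz] qcont_t[OF v.czx])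
    then obtain A B where AB: "\<forall>r\<in>{s..t}. norm (avg \<epsilon> z 0 r) * norm (avg \<epsilon> zx 0 r) \<le> A"
      "\<forall>r\<in>{s..t}. norm (z 0 r) * norm (avg \<epsilon> z 0 r) \<le> B"
      unfolding bounded_iff by (auto simp: image_iff abs_mult)
    define K1 where "K1 = 4 * (2 * A + 5 * K + 4 * K / \<epsilon>\<^sup>2)"
    have mvx: "mass_le (avg \<epsilon> zx) K1 r" if r: "r \<in> {s..t}" for r
    proof -
      have r0: "r \<ge> 0" using r st by simp
      have "mass_le (avg \<epsilon> zx) (4 * (2 * (norm (avg \<epsilon> z 0 r) * norm (avg \<epsilon> zx 0 r)) + 5 * K + 4 * K / \<epsilon>\<^sup>2)) r"
        by (rule mass_le_derivative[OF v.cz v.czx v.czxx r0 v.dx v.dxx mv[OF r] mvt[OF r]]) (use r0 in auto)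
      then show ?thesis using AB(1) r unfolding K1_def by (elim mass_le_mono) auto
    qed
    define E where "E = 2 * B + (3 * K + 2 * K1 + K)"
    \<comment> \<open>Chosen last, because \<open>E\<close> depends on \<open>\<epsilon>\<close>
      through \<open>K1\<close>. The entry with \<open>E\<close> makes the interior error at most
      \<open>e\<close>, the entry with \<open>R0\<close> makes the weight nearly \<open>1\<close> on
      \<open>{0..R0}\<close>.\<close>
    define R where "R = max (max R1 R2) (max (\<bar>E\<bar> * (t - s) / e) (2 * R0 * K / e + R0 + 1))"
    have R: "R \<ge> R1" "R \<ge> R2" "R \<ge> 1" "R \<ge> \<bar>E\<bar> * (t - s) / e" "R \<ge> 2 * R0 * K / e" "R \<ge> R0"
      using 1 2 R0 K e by (auto simp: R_def add_nonneg_nonneg le_max_iff_disj)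
    have "E / R * (t - s) \<le> e"
    proof -
      have "E * (t - s) \<le> \<bar>E\<bar> * (t - s)" using st by (intro mult_right_mono) auto
      also have "\<dots> \<le> R * e" using R(4) e by (simp add: pos_divide_le_eq)
      finally show ?thesis using R(3) by (simp add: pos_divide_le_eq mult.commute)
    qed
    have incr: "norm (pairing R z (avg \<epsilon> z) b - pairing R z (avg \<epsilon> z) a)
        \<le> integral {a..b} (\<lambda>r. 2 * (norm (z 0 r) * norm (zx 0 r))) + (d + E / R) * (b - a)"
      if ab: "a \<in> {s..t}" "b \<in> {s..t}" "a \<le> b" for a b
    proof (rule pairing_increment[OF schr_axioms v.schr_axioms R(3) _ ab(3)])
      show "0 \<le> a" using ab st by simp
      fix r assume "r \<in> {a..b}"
      then have r: "r \<in> {s..t}" and r0: "r \<ge> 0" "r \<in> {0..t}" using ab st by auto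
      show "norm (cnj (zx 0 r) * avg \<epsilon> z 0 r - cnj (z 0 r) * avg \<epsilon> zx 0 r) \<le> 2 * (norm (z 0 r) * norm (zx 0 r)) + d"
        using 3(2) \<epsilon> r0 by simp
      have i: "(\<lambda>x. (norm (z x r))\<^sup>2) integrable_on {0..R}" "(\<lambda>x. (norm (avg \<epsilon> zx x r))\<^sup>2) integrable_on {0..R}"
        "(\<lambda>x. (norm (avg \<epsilon> z x r))\<^sup>2) integrable_on {0..R}"
        by (auto intro!: integrable_continuous_real continuous_intros qcont_x[OF cz r0(1)] qcont_x[OF v.cz r0(1)] qcont_x[OF v.czx r0(1)])
      have "integral {0..R} (\<lambda>x. 3 * (norm (z x r))\<^sup>2 + 2 * (norm (avg \<epsilon> zx x r))\<^sup>2 + (norm (avg \<epsilon> z x r))\<^sup>2)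
          = 3 * integral {0..R} (\<lambda>x. (norm (z x r))\<^sup>2) + 2 * integral {0..R} (\<lambda>x. (norm (avg \<epsilon> zx x r))\<^sup>2)
            + integral {0..R} (\<lambda>x. (norm (avg \<epsilon> z x r))\<^sup>2)"
        using i by (simp add: integral_add integrable_add integrable_on_mult_right)
      also have "\<dots> \<le> 3 * K + 2 * K1 + K"
        using R(3) r st \<eta> by (intro add_mono mult_left_mono mass_leD mass mvx mv) auto
      finally show "2 * (norm (z 0 r) * norm (avg \<epsilon> z 0 r)) + integral {0..R} (\<lambda>x. 3 * (norm (z x r))\<^sup>2
          + 2 * (norm (avg \<epsilon> zx x r))\<^sup>2 + (norm (avg \<epsilon> z x r))\<^sup>2) \<le> E"
        using AB(2) r by (simp add: E_def add_mono)
    qed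
    have E0: "E \<ge> 0"
    proof -
      have "0 \<le> norm (z 0 s) * norm (avg \<epsilon> z 0 s)" by simp
      also have "\<dots> \<le> B" using AB(2) st by auto
      finally show ?thesis using K mass_le_nonneg[OF mvx[of s]] st by (simp add: E_def)
    qed
    have incr': "norm (pairing R z (avg \<epsilon> z) \<tau> - pairing R z (avg \<epsilon> z) \<sigma>) \<le> influx \<sigma> \<tau> + 2 * e"
    proof -
      have small: "(d + E / R) * (b - a) \<le> 2 * e" if "a \<in> {s..t}" "b \<in> {s..t}" "a \<le> b" for a b
      proof -
        have "(d + E / R) * (b - a) \<le> (d + E / R) * (t - s)"
          using that d(1) E0 R(3) by (intro mult_left_mono) auto
        also have "\<dots> = d * (t - s) + E / R * (t - s)" by (rule distrib_right)
        also have "\<dots> \<le> e + e" by (intro add_mono d(2)) fact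
        finally show ?thesis by simp
      qed
      show ?thesis
      proof (cases "\<sigma> \<le> \<tau>")
        case True
        then show ?thesis using incr[OF \<sigma>\<tau>] small[OF \<sigma>\<tau>] by (simp add: influx_def)
      next
        case False
        then show ?thesis using incr[OF \<sigma>\<tau>(2,1)] small[OF \<sigma>\<tau>(2,1)]
          by (simp add: influx_def norm_minus_commute)
      qed
    qed
    have cR: "continuous_on {0..R} (\<lambda>x. z x r)" if "r \<ge> 0" for r by (rule qcont_x[OF cz that]) simp
    let ?W = "\<lambda>r. integral {0..R} (\<lambda>x. (1 - x / R)\<^sup>2 * (norm (z x r))\<^sup>2)"
    have W: "Re (pairing R z z r) = ?W r" if "r \<ge> 0" for r
      using R(3) by (intro Re_pairing_self cR that) auto
    have "?W \<sigma> \<le> integral {0..R} (\<lambda>x. (norm (z x \<sigma>))\<^sup>2)"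
    proof (rule integral_le)
      fix x assume x: "x \<in> {0..R}"
      have "(1 - x / R)\<^sup>2 * (norm (z x \<sigma>))\<^sup>2 \<le> 1 * (norm (z x \<sigma>))\<^sup>2"
        using x R(3) by (intro mult_right_mono power_le_one) auto
      then show "(1 - x / R)\<^sup>2 * (norm (z x \<sigma>))\<^sup>2 \<le> (norm (z x \<sigma>))\<^sup>2" by simp
    qed (use R(3) nonneg in \<open>auto intro!: integrable_continuous_real continuous_intros cR\<close>)
    also have "\<dots> \<le> L" using R(3) by (intro mass_leD L) auto
    finally have W\<sigma>: "?W \<sigma> \<le> L" .
    \<comment> \<open>On \<open>{0..R0}\<close> the weight is at least
      \<open>(1 - R0 / R)\<^sup>2\<close>, hence at least \<open>1 - 2 * R0 / R\<close>, and
      \<open>R\<close> was chosen so that this loses at most \<open>e\<close>.\<close>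
    have W\<tau>: "integral {0..R0} (\<lambda>x. (norm (z x \<tau>))\<^sup>2) - e \<le> ?W \<tau>"
    proof -
      let ?I = "integral {0..R0} (\<lambda>x. (norm (z x \<tau>))\<^sup>2)"
      have I: "0 \<le> ?I" "?I \<le> K"
        using R0 \<sigma>\<tau> \<eta> nonneg
        by (auto intro!: integral_nonneg integrable_continuous_real continuous_intros qcont_x[OF cz] mass_leD mass)
      have "(2 * R0 / R) * ?I \<le> (2 * R0 / R) * K" using I R0 R(3) by (intro mult_left_mono) auto
      also have "\<dots> \<le> e" using R(3,5) e by (simp add: pos_divide_le_eq mult.commute)
      finally have "?I - e \<le> (1 - 2 * R0 / R) * ?I" by (simp add: left_diff_distrib)
      also have "\<dots> \<le> (1 - R0 / R)\<^sup>2 * ?I"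
      proof (intro mult_right_mono I)
        have "(1 - R0 / R)\<^sup>2 = 1 - 2 * R0 / R + (R0 / R)\<^sup>2" by (simp add: power2_eq_square algebra_simps)
        then show "1 - 2 * R0 / R \<le> (1 - R0 / R)\<^sup>2" by simp
      qed
      also have "\<dots> = integral {0..R0} (\<lambda>x. (1 - R0 / R)\<^sup>2 * (norm (z x \<tau>))\<^sup>2)"
        by (rule integral_mult_right[symmetric])
      also have "\<dots> \<le> integral {0..R0} (\<lambda>x. (1 - x / R)\<^sup>2 * (norm (z x \<tau>))\<^sup>2)"
      proof (rule integral_le)
        fix x assume x: "x \<in> {0..R0}"
        have "1 - R0 / R \<le> 1 - x / R" using x R(3) by (simp add: divide_right_mono)
        moreover have "0 \<le> 1 - R0 / R" using R(3,6) by simp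
        ultimately show "(1 - R0 / R)\<^sup>2 * (norm (z x \<tau>))\<^sup>2 \<le> (1 - x / R)\<^sup>2 * (norm (z x \<tau>))\<^sup>2"
          by (intro mult_right_mono power_mono) auto
      qed (use R(3) nonneg in \<open>auto intro!: integrable_continuous_real continuous_intros qcont_x[OF cz]\<close>)
      also have "\<dots> \<le> ?W \<tau>"
        using R(3,6) R0 nonneg
        by (intro integral_subset_le integrable_continuous_real continuous_intros qcont_x[OF cz]) auto
      finally show ?thesis .
    qed
    have p1: "norm (pairing R z (avg \<epsilon> z) \<tau> - pairing R z z \<tau>) \<le> e" using 1(3) \<epsilon> R by simp
    have p2: "norm (pairing R z (avg \<epsilon> z) \<sigma> - pairing R z z \<sigma>) \<le> e" using 2(3) \<epsilon> R by simp
    have re: "\<bar>Re a - Re b\<bar> \<le> c" if "norm (a - b) \<le> c" for a b :: complex and c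
      using abs_Re_le_cmod[of "a - b"] that by simp
    show "integral {0..R0} (\<lambda>x. (norm (z x \<tau>))\<^sup>2) \<le> L + influx \<sigma> \<tau> + e0"
      using re[OF p1] re[OF p2] re[OF incr'] W[OF nonneg(1)] W[OF nonneg(2)] W\<sigma> W\<tau> unfolding e_def by linarith
  qed
qed

end

section \<open>Local and global boundedness of the mass\<close>

context decaying_schr
begin

lemma window_mass_continuous:
  assumes "R \<ge> 0"
  shows "continuous_on {0..} (\<lambda>t. integral {0..R} (\<lambda>x. (norm (z x t))\<^sup>2))"
proof -
  have "continuous_on ({0..} \<times> cbox 0 R) (\<lambda>(t, x). (norm (z x t))\<^sup>2)"
    unfolding case_prod_unfold by (intro continuous_intros qcontD[OF cz]) auto
  from integral_continuous_on_param[OF this] show ?thesis by simp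
qed

text \<open>An intersection of conditions on single windows, each closed by continuity in time.
  Closedness is what Baire's theorem needs.\<close>

lemma closed_mass_le: "closed {t. t \<ge> 0 \<and> mass_le z K t}"
proof -
  have "{t. t \<ge> 0 \<and> mass_le z K t} = {0..} \<inter> (\<Inter>R\<in>{0..}. {0..} \<inter> (\<lambda>t. integral {0..R} (\<lambda>x. (norm (z x t))\<^sup>2)) -` {..K})"
    by (auto simp: mass_le_def)
  moreover have "\<forall>R\<in>{0..}. closed ({0..} \<inter> (\<lambda>t. integral {0..R} (\<lambda>x. (norm (z x t))\<^sup>2)) -` {..K})"
    by (intro ballI continuous_closed_preimage window_mass_continuous) auto
  ultimately show ?thesis by (simp only:) (rule closed_Int[OF closed_atLeast closed_INT])
qed

text \<open>The a priori bound under which \<open>mass_propagation\<close> applies. The value of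
  \<open>K\<close> is immaterial, since the conclusion of the propagation involves only the initial
  mass and the influx.\<close>

definition tame :: "real \<Rightarrow> bool" where
  "tame t \<longleftrightarrow> (\<exists>d>0. \<exists>K. \<forall>r\<ge>0. \<bar>r - t\<bar> < d \<longrightarrow> mass_le z K r)"

lemma tameI:
  assumes "d > 0" "\<And>r. r \<ge> 0 \<Longrightarrow> \<bar>r - t\<bar> < d \<Longrightarrow> mass_le z K r"
  shows "tame t"
  using assms unfolding tame_def by blast

lemma tame_interval:
  assumes "0 \<le> p" "\<And>r. r \<in> {p..q} \<Longrightarrow> tame r"
  shows "\<exists>K. \<forall>r\<in>{p..q}. mass_le z K r"
proof -
  have "\<forall>r\<in>{p..q}. \<exists>d K. d > 0 \<and> (\<forall>s\<ge>0. \<bar>s - r\<bar> < d \<longrightarrow> mass_le z K s)"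
    using assms(2) unfolding tame_def by blast
  then obtain d K where dK: "\<And>r. r \<in> {p..q} \<Longrightarrow> d r > 0"
    "\<And>r s. r \<in> {p..q} \<Longrightarrow> s \<ge> 0 \<Longrightarrow> \<bar>s - r\<bar> < d r \<Longrightarrow> mass_le z (K r) s"
    by metis
  have "{p..q} \<subseteq> (\<Union>r\<in>{p..q}. ball r (d r))" using dK(1) by auto
  then obtain C where C: "C \<subseteq> {p..q}" "finite C" "{p..q} \<subseteq> (\<Union>r\<in>C. ball r (d r))"
    using compactE_image[of "{p..q}" "{p..q}" "\<lambda>r. ball r (d r)"] by auto
  have "mass_le z (\<Sum>r\<in>C. \<bar>K r\<bar>) s" if s: "s \<in> {p..q}" for s
  proof -
    obtain r where r: "r \<in> C" "s \<in> ball r (d r)" using C(3) s by blast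
    have "mass_le z (K r) s" using dK(2)[of r s] r C(1) s assms(1) by (auto simp: dist_real_def abs_minus_commute)
    moreover have "K r \<le> (\<Sum>r\<in>C. \<bar>K r\<bar>)"
      using member_le_sum[OF r(1), of "\<lambda>r. \<bar>K r\<bar>"] C(2) by simp
    ultimately show ?thesis by (rule mass_le_mono)
  qed
  then show ?thesis by blast
qed

lemma influx_le:
  assumes "\<And>r. r \<in> {p..q} \<Longrightarrow> 2 * (norm (z 0 r) * norm (zx 0 r)) \<le> M" "0 \<le> p" "a \<in> {p..q}" "b \<in> {p..q}"
  shows "influx a b \<le> M * (q - p)"
proof -
  have M: "M \<ge> 0" using assms(1)[OF assms(3)] by (rule order_trans[rotated]) simp
  have "influx a b \<le> integral {min a b..max a b} (\<lambda>r. M)"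
    unfolding influx_def
  proof (rule integral_le)
    show "(\<lambda>r. 2 * (norm (z 0 r) * norm (zx 0 r))) integrable_on {min a b..max a b}"
      using assms by (intro integrable_continuous_real continuous_intros qcont_t[OF cz] qcont_t[OF czx]) auto
    show "2 * (norm (z 0 r) * norm (zx 0 r)) \<le> M" if "r \<in> {min a b..max a b}" for r
      using that assms(3,4) by (intro assms(1)) (auto simp: min_def max_def split: if_splits)
  qed (rule integrable_const_ivl)
  also have "\<dots> = M * (max a b - min a b)" by (simp add: max_def min_def)
  also have "\<dots> \<le> M * (q - p)" using assms M by (intro mult_left_mono) auto
  finally show ?thesis .
qed

text \<open>If every time in \<open>(a, t]\<close> is tame, then the mass is bounded on the whole of \<open>(a, t]\<close>, and
  propagation from \<open>a\<close> itself becomes available: no mass can enter from infinity right after \<open>a\<close>.\<close>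

lemma mass_le_across_gap:
  assumes a: "0 \<le> a" "a < t" "mass_le z L a" and tame: "\<And>r. a < r \<Longrightarrow> r \<le> t \<Longrightarrow> tame r"
  shows "mass_le z (L + influx a t) t"
proof -
  have "bounded ((\<lambda>r. 2 * (norm (z 0 r) * norm (zx 0 r))) ` {0..t})"
    by (intro compact_imp_bounded compact_continuous_image continuous_intros qcont_t[OF cz] qcont_t[OF czx]) auto
  then obtain M where "\<forall>r\<in>{0..t}. 2 * (norm (z 0 r) * norm (zx 0 r)) \<le> M"
    unfolding bounded_iff by (auto simp: abs_mult)
  then have M: "\<And>r. r \<in> {0..t} \<Longrightarrow> 2 * (norm (z 0 r) * norm (zx 0 r)) \<le> M" by blast
  obtain d K1 where d: "d > 0" "\<And>r. r \<ge> 0 \<Longrightarrow> \<bar>r - t\<bar> < d \<Longrightarrow> mass_le z K1 r"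
    using tame[of t] a unfolding tame_def by auto
  define \<eta> where "\<eta> = d / 2"
  have \<eta>: "\<eta> > 0" using d by (simp add: \<eta>_def)
  have near: "mass_le z K1 r" if "r \<in> {t..t + \<eta>}" for r
    using that d a by (intro d(2)) (auto simp: \<eta>_def)
  \<comment> \<open>Propagation backwards from \<open>t\<close>. The resulting bound does not depend
    on \<open>r\<close>, although the bound \<open>K2\<close> that justifies it does.\<close>
  have mid: "mass_le z (K1 + M * t) r" if r: "a < r" "r \<le> t" for r
  proof -
    obtain K2 where K2: "\<forall>s\<in>{r..t}. mass_le z K2 s"
      using tame_interval[of r t] r a tame by auto
    have "mass_le z (K1 + influx t r) r"
    proof (rule mass_propagation[where s = r and t = t and \<eta> = \<eta> and K = "max K1 K2"])
      fix s assume s: "s \<in> {r..t + \<eta>}"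
      show "mass_le z (max K1 K2) s"
      proof (cases "s \<le> t")
        case True
        then have "mass_le z K2 s" using K2 s by auto
        then show ?thesis by (rule mass_le_mono) simp
      next
        case False
        then have "mass_le z K1 s" using near s by auto
        then show ?thesis by (rule mass_le_mono) simp
      qed
    next
      show "mass_le z K1 t" using near \<eta> by simp
    qed (use r a \<eta> in auto)
    moreover have "influx t r \<le> M * (t - 0)" using r a by (intro influx_le M) auto
    ultimately show ?thesis by (elim mass_le_mono) simp
  qed
  \<comment> \<open>With \<open>mid\<close> and the bound at \<open>a\<close> the whole of
    \<open>{a..t}\<close> has one common bound, so the forward propagation may start at
    \<open>a\<close> with the constant \<open>L\<close>.\<close>
  show ?thesis
  proof (rule mass_propagation[where s = a and t = t and \<eta> = \<eta> and K = "max L (max K1 (K1 + M * t))"])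
    fix s assume s: "s \<in> {a..t + \<eta>}"
    consider "s = a" | "a < s" "s \<le> t" | "t < s" using s by force
    then show "mass_le z (max L (max K1 (K1 + M * t))) s"
    proof cases
      case 1
      then show ?thesis using a(3) by (auto intro: mass_le_mono)
    next
      case 2
      then show ?thesis by (intro mass_le_mono[OF mid]) auto
    next
      case 3
      then show ?thesis using s by (intro mass_le_mono[OF near]) auto
    qed
  qed (use a \<eta> in auto)
qed

text \<open>Some mass bound holds on a relatively open portion of the closed set of times that are not tame, by
  Baire; crossing the gaps of that set then makes a point of the portion tame.\<close>

lemma all_tame:
  assumes "t \<ge> 0"
  shows "tame t"
proof (rule ccontr)
  assume "\<not> tame t"
  define F where "F = {t. t \<ge> 0 \<and> \<not> tame t}"
  define A where "A n = {t. t \<ge> 0 \<and> mass_le z (real n) t}" for n :: nat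
  have "closed F"
    unfolding closed_def
  proof (subst open_subopen, intro ballI)
    fix t assume "t \<in> - F"
    then consider "t < 0" | "tame t" unfolding F_def by force
    then show "\<exists>T. open T \<and> t \<in> T \<and> T \<subseteq> - F"
    proof cases
      case 1
      then show ?thesis unfolding F_def by (intro exI[of _ "{..<0}"]) auto
    next
      case 2
      then obtain d K where d: "d > 0" "\<forall>r\<ge>0. \<bar>r - t\<bar> < d \<longrightarrow> mass_le z K r" unfolding tame_def by blast
      have "tame s" if "s \<in> ball t (d / 2)" for s
      proof (rule tameI[where d = "d / 2" and K = K])
        fix r :: real assume "r \<ge> 0" "\<bar>r - s\<bar> < d / 2"
        moreover have "\<bar>s - t\<bar> < d / 2" using that by (simp add: dist_real_def abs_minus_commute)
        ultimately have "\<bar>r - t\<bar> < d" by linarith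
        with \<open>r \<ge> 0\<close> show "mass_le z K r" using d(2) by blast
      next
        show "d / 2 > 0" using d by simp
      qed
      then show ?thesis using d unfolding F_def by (intro exI[of _ "ball t (d / 2)"]) auto
    qed
  qed
  \<comment> \<open>Otherwise every \<open>F - A n\<close> is dense in \<open>F\<close> and
    relatively open, so by Baire the intersection is dense in \<open>F\<close>; but it is empty
    because each single time has some finite mass bound.\<close>
  have "\<exists>n. \<not> F \<subseteq> closure (F - A n)"
  proof (rule ccontr)
    assume "\<not> (\<exists>n. \<not> F \<subseteq> closure (F - A n))"
    then have sub: "F \<subseteq> closure (\<Inter>(range (\<lambda>n. F - A n)))"
      using closed_mass_le unfolding A_def
      by (intro Baire \<open>closed F\<close>) (auto intro!: openin_diff closed_subset simp: closedin_closed_Int Diff_eq openin_open_Int open_Compl)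
    have empty: "\<Inter>(range (\<lambda>n. F - A n)) = {}"
    proof -
      have "\<exists>n. s \<in> A n" if s: "s \<in> F" for s
      proof -
        have "s \<ge> 0" using s by (simp add: F_def)
        then obtain K where "mass_le z K s" using ex_mass_le by blast
        moreover obtain n where "K \<le> real n" using real_arch_simple by blast
        ultimately show ?thesis using \<open>s \<ge> 0\<close> unfolding A_def by (auto intro: mass_le_mono)
      qed
      then show ?thesis by blast
    qed
    have "F = {}" using sub unfolding empty by simp
    then show False using assms \<open>\<not> tame t\<close> by (auto simp: F_def)
  qed
  then obtain n t0 where t0: "t0 \<in> F" "t0 \<notin> closure (F - A n)" by blast
  then obtain \<delta> where "\<delta> > 0" and far: "\<forall>r\<in>F - A n. \<not> dist r t0 < \<delta>"
    unfolding closure_approachable by blast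
  note \<delta>0 = \<open>\<delta> > 0\<close>
  have \<delta>1: "mass_le z (real n) r" if "r \<in> F" "\<bar>r - t0\<bar> < \<delta>" for r
    using far that by (auto simp: dist_real_def A_def)
  note \<delta> = \<delta>0 \<delta>1
  have "t0 \<ge> 0" using t0 by (simp add: F_def)
  \<comment> \<open>The left end of a neighbourhood of \<open>t0\<close>, cut off at
    \<open>0\<close>. A time in this neighbourhood may have no point of \<open>F\<close> between
    \<open>c\<close> and itself; the mass bound at \<open>c\<close> then starts the
    propagation.\<close>
  define c where "c = max 0 (t0 - \<delta> / 2)"
  define T where "T = t0 + \<delta> / 2"
  have c: "c \<ge> 0" "c \<le> t0" "t0 - \<delta> / 2 \<le> c" using \<open>t0 \<ge> 0\<close> \<delta> by (auto simp: c_def)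
  obtain Kc where Kc: "mass_le z Kc c" using ex_mass_le[OF c(1)] by blast
  have "bounded ((\<lambda>r. 2 * (norm (z 0 r) * norm (zx 0 r))) ` {0..T})"
    by (intro compact_imp_bounded compact_continuous_image continuous_intros qcont_t[OF cz] qcont_t[OF czx]) auto
  then obtain M where "\<forall>r\<in>{0..T}. 2 * (norm (z 0 r) * norm (zx 0 r)) \<le> M"
    unfolding bounded_iff by (auto simp: abs_mult)
  then have M: "\<And>r. r \<in> {0..T} \<Longrightarrow> 2 * (norm (z 0 r) * norm (zx 0 r)) \<le> M" by blast
  define L where "L = max (real n) Kc"
  have claim: "mass_le z (L + M * T) t" if t: "c \<le> t" "t < T" for t
  proof -
    \<comment> \<open>The largest element \<open>a\<close> is the last time up to \<open>t\<close>
      with a bound by \<open>L\<close>: it is either \<open>c\<close> or a point of \<open>F\<close>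
      close to \<open>t0\<close>. Every time after it up to \<open>t\<close> is tame.\<close>
    define S where "S = insert c (F \<inter> {c..t})"
    have S: "closed S" "S \<noteq> {}" "bdd_above S" "S \<subseteq> {c..t}"
      using \<open>closed F\<close> t unfolding S_def by (auto intro!: closed_insert closed_Int)
    define a where "a = Sup S"
    have "a \<in> S" unfolding a_def by (rule closed_contains_Sup[OF S(2,3,1)])
    then have a: "c \<le> a" "a \<le> t" using S(4) by auto
    have ma: "mass_le z L a"
    proof (cases "a = c")
      case True
      then show ?thesis using Kc by (auto simp: L_def intro: mass_le_mono)
    next
      case False
      then have "a \<in> F" using \<open>a \<in> S\<close> by (simp add: S_def)
      moreover have "\<bar>a - t0\<bar> < \<delta>" using a t c \<delta> unfolding T_def by linarith
      ultimately have "mass_le z (real n) a" by (rule \<delta>(2))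
      then show ?thesis by (rule mass_le_mono) (simp add: L_def)
    qed
    have M0: "M \<ge> 0" "T \<ge> 0" using M[of 0] \<open>t0 \<ge> 0\<close> \<delta> order_trans[of 0 "2 * (norm (z 0 0) * norm (zx 0 0))" M] by (auto simp: T_def)
    show ?thesis
    proof (cases "a = t")
      case True
      then show ?thesis using ma M0 by (auto intro: mass_le_mono)
    next
      case False
      have tr: "tame r" if r: "a < r" "r \<le> t" for r
      proof (rule ccontr)
        assume "\<not> tame r"
        then have "r \<in> S" using r a c unfolding S_def F_def by auto
        then have "r \<le> a" unfolding a_def using S(3) by (rule cSup_upper)
        then show False using r by simp
      qed
      have "mass_le z (L + influx a t) t"
        using False a c tr by (intro mass_le_across_gap ma) auto
      moreover have "influx a t \<le> M * (T - 0)"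
        using a c t by (intro influx_le M) auto
      ultimately show ?thesis by (elim mass_le_mono) simp
    qed
  qed
  have "tame t0"
  proof (rule tameI[where d = "\<delta> / 2" and K = "L + M * T"])
    fix r :: real assume "r \<ge> 0" "\<bar>r - t0\<bar> < \<delta> / 2"
    then have "t0 - \<delta> / 2 \<le> r" "r < t0 + \<delta> / 2" by linarith+
    then show "mass_le z (L + M * T) r" using \<open>r \<ge> 0\<close> by (intro claim) (auto simp: c_def T_def)
  next
    show "\<delta> / 2 > 0" using \<delta> by simp
  qed
  then show False using t0 by (simp add: F_def)
qed

text \<open>Local boundedness permits propagation from time \<open>0\<close> over any interval, and
  the resulting constant is the initial mass plus the total influx, whatever the local bounds
  were.\<close>

lemma global_mass:
  assumes "\<And>t. t \<ge> 0 \<Longrightarrow> integral {0..t} (\<lambda>r. 2 * (norm (z 0 r) * norm (zx 0 r))) \<le> M"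
  shows "\<exists>K. \<forall>t\<ge>0. mass_le z K t"
proof -
  obtain L where L: "mass_le z L 0" using ex_mass_le[of 0] by auto
  have "mass_le z (L + M) t" if t: "t \<ge> 0" for t
  proof -
    obtain K where K: "\<forall>r\<in>{0..t + 1}. mass_le z K r"
      using tame_interval[of 0 "t + 1"] all_tame by auto
    have "mass_le z (L + influx 0 t) t"
      using K t by (intro mass_propagation[where s = 0 and t = t and \<eta> = 1 and K = K] L) auto
    moreover have "influx 0 t \<le> M" using assms[OF t] t by (simp add: influx_def)
    ultimately show ?thesis by (elim mass_le_mono) simp
  qed
  then show ?thesis by blast
qed

end

section \<open>Square integrability of the Neumann data\<close>

text \<open>By the equation \<open>cnj y yxt + cnj yt yx\<close> is the \<open>x\<close>-derivative
  of \<open>cnj y yt - \<i> cnj yx yx\<close>. Hence the momentum, the integral of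
  \<open>cnj y yx\<close>, changes at the rate \<open>\<i> (norm yx)\<^sup>2\<close> up to
  \<open>cnj y yt\<close>, both at \<open>x = 0\<close>. It is at most \<open>K\<close> in modulus
  at both end times, which gives \<open>2 * K\<close>.\<close>

lemma momentum_bound:
  assumes "schr y yx yxx yt" and cyxt: "qcont yxt"
    and dxt: "\<And>x t. x \<ge> 0 \<Longrightarrow> t \<ge> 0 \<Longrightarrow> ((\<lambda>s. yx x s) has_vector_derivative yxt x t) (at t within {0..})"
    and dtx: "\<And>x t. x \<ge> 0 \<Longrightarrow> t \<ge> 0 \<Longrightarrow> ((\<lambda>x. yt x t) has_vector_derivative yxt x t) (at x within {0..})"
    and m: "\<And>t. t \<ge> 0 \<Longrightarrow> mass_le y K t" "\<And>t. t \<ge> 0 \<Longrightarrow> mass_le yx K t" "\<And>t. t \<ge> 0 \<Longrightarrow> mass_le yt K t"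
    and T: "T \<ge> 0" and N: "integral {0..T} (\<lambda>t. norm (y 0 t) * norm (yt 0 t)) \<le> N"
  shows "integral {0..T} (\<lambda>t. (norm (yx 0 t))\<^sup>2) \<le> 2 * K + N + 1"
proof -
  interpret y: schr y yx yxx yt by fact
  have K: "K \<ge> 0" using mass_le_nonneg[OF m(1)[of 0]] by simp
  \<comment> \<open>Makes the truncation error \<open>2 * K / R\<close> integrate to at most
    \<open>1\<close> over \<open>{0..T}\<close>, the last summand of the bound.\<close>
  define R where "R = 1 + 2 * K * T"
  have R: "R \<ge> 1" "R > 0" using K T by (auto simp: R_def add_pos_nonneg)
  let ?q = "\<lambda>x. 1 - x / R"
  define P where "P t = integral {0..R} (\<lambda>x. ?q x *\<^sub>R (cnj (y x t) * yx x t))" for t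
  define D where "D t = integral {0..R} (\<lambda>x. ?q x *\<^sub>R (cnj (y x t) * yxt x t + cnj (yt x t) * yx x t))" for t
  have dP: "(P has_vector_derivative D t) (at t within {0..})" if "t \<ge> 0" for t
  proof -
    have "((\<lambda>t. integral (cbox 0 R) (\<lambda>x. ?q x *\<^sub>R (cnj (y x t) * yx x t))) has_vector_derivative
      integral (cbox 0 R) (\<lambda>x. ?q x *\<^sub>R (cnj (y x t) * yxt x t + cnj (yt x t) * yx x t))) (at t within {0..})"
    proof (rule leibniz_rule_vector_derivative)
      show "((\<lambda>t. ?q x *\<^sub>R (cnj (y x t) * yx x t)) has_vector_derivative
          ?q x *\<^sub>R (cnj (y x t) * yxt x t + cnj (yt x t) * yx x t)) (at t within {0..})"
        if "t \<in> {0..}" "x \<in> cbox 0 R" for t x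
        using that
        by (intro bounded_linear.has_vector_derivative[OF bounded_linear_scaleR_right] has_vector_derivative_mult
            has_vector_derivative_cnj y.dt dxt) auto
      show "(\<lambda>x. ?q x *\<^sub>R (cnj (y x t) * yx x t)) integrable_on cbox 0 R" if "t \<in> {0..}" for t
        unfolding cbox_interval using that R
        by (intro integrable_continuous_real continuous_intros qcont_x[OF y.cz] qcont_x[OF y.czx]) auto
      show "continuous_on ({0..} \<times> cbox 0 R) (\<lambda>(t, x). ?q x *\<^sub>R (cnj (y x t) * yxt x t + cnj (yt x t) * yx x t))"
        unfolding case_prod_unfold using R
        by (intro continuous_intros qcontD[OF y.cz] qcontD[OF y.czx] qcontD[OF cyxt] qcontD[OF y.czt]) auto
    qed (use that in auto)
    then show ?thesis by (simp add: P_def[abs_def] D_def)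
  qed
  have hP: "(D has_integral (P T - P 0)) {0..T}"
    using T by (intro fundamental_theorem_of_calculus has_vector_derivative_within_subset[OF dP]) auto
  have Pb: "norm (P t) \<le> K" if t: "t \<ge> 0" for t
  proof -
    note c = qcont_x[OF y.cz t] qcont_x[OF y.czx t]
    have i: "(\<lambda>x. (norm (y x t))\<^sup>2) integrable_on {0..R}" "(\<lambda>x. (norm (yx x t))\<^sup>2) integrable_on {0..R}"
      by (auto intro!: integrable_continuous_real continuous_intros c)
    have "norm (P t) \<le> integral {0..R} (\<lambda>x. (1 / 2) * ((norm (y x t))\<^sup>2 + (norm (yx x t))\<^sup>2))"
      unfolding P_def
    proof (rule integral_norm_bound_integral)
      show "(\<lambda>x. ?q x *\<^sub>R (cnj (y x t) * yx x t)) integrable_on {0..R}"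
        using R by (intro integrable_continuous_real continuous_intros c) auto
      show "(\<lambda>x. (1 / 2) * ((norm (y x t))\<^sup>2 + (norm (yx x t))\<^sup>2)) integrable_on {0..R}"
        by (intro integrable_on_mult_right integrable_add i)
      fix x assume x: "x \<in> {0..R}"
      then have "0 \<le> ?q x" "?q x \<le> 1" using R by auto
      then have "norm (?q x *\<^sub>R (cnj (y x t) * yx x t)) \<le> 1 * (norm (y x t) * norm (yx x t))"
        unfolding norm_scaleR norm_mult complex_mod_cnj by (intro mult_right_mono) auto
      also have "\<dots> \<le> (1 / 2) * ((norm (y x t))\<^sup>2 + (norm (yx x t))\<^sup>2)"
        using mult_le_half_squares[of "norm (y x t)" "norm (yx x t)"] by simp
      finally show "norm (?q x *\<^sub>R (cnj (y x t) * yx x t)) \<le> (1 / 2) * ((norm (y x t))\<^sup>2 + (norm (yx x t))\<^sup>2)" .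
    qed
    also have "\<dots> = (1 / 2) * (integral {0..R} (\<lambda>x. (norm (y x t))\<^sup>2) + integral {0..R} (\<lambda>x. (norm (yx x t))\<^sup>2))"
      unfolding integral_mult_right integral_add[OF i] by (rule refl)
    also have "\<dots> \<le> (1 / 2) * (K + K)"
      using R by (intro mult_left_mono add_mono mass_leD m t) auto
    finally show ?thesis by simp
  qed
  have flux: "norm (D t - \<i> * of_real ((norm (yx 0 t))\<^sup>2)) \<le> norm (y 0 t) * norm (yt 0 t) + 2 * K / R" if t: "t \<ge> 0" for t
  proof -
    note c = qcont_x[OF y.cz t] qcont_x[OF y.czx t] qcont_x[OF y.czt t] qcont_x[OF cyxt t]
    let ?A = "\<lambda>x. ?q x *\<^sub>R (cnj (y x t) * yt x t - \<i> * (cnj (yx x t) * yx x t))"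
    let ?D = "\<lambda>x. ?q x *\<^sub>R (cnj (y x t) * yxt x t + cnj (yt x t) * yx x t)"
    let ?E = "\<lambda>x. (1 / R) *\<^sub>R (cnj (y x t) * yt x t - \<i> * (cnj (yx x t) * yx x t))"
    have iD: "?D integrable_on {0..R}" and iE: "?E integrable_on {0..R}"
      using R by (auto intro!: integrable_continuous_real continuous_intros c)
    have "((\<lambda>x. ?D x - ?E x) has_integral (?A R - ?A 0)) {0..R}"
    proof (rule fundamental_theorem_of_calculus)
      fix x assume x: "x \<in> {0..R}"
      have d: "((\<lambda>x. y x t) has_vector_derivative yx x t) (at x within {0..R})"
        "((\<lambda>x. yx x t) has_vector_derivative yxx x t) (at x within {0..R})"
        "((\<lambda>x. yt x t) has_vector_derivative yxt x t) (at x within {0..R})"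
        using x t by (auto intro: has_vector_derivative_within_subset[OF y.dx] has_vector_derivative_within_subset[OF y.dxx]
          has_vector_derivative_within_subset[OF dtx])
      have w: "(?q has_real_derivative (- 1 / R)) (at x within {0..R})"
        using R by (auto intro!: derivative_eq_intros)
      have "(?A has_vector_derivative
          (?q x *\<^sub>R ((cnj (y x t) * yxt x t + cnj (yx x t) * yt x t) - \<i> * (cnj (yx x t) * yxx x t + cnj (yxx x t) * yx x t))
           + (- 1 / R) *\<^sub>R (cnj (y x t) * yt x t - \<i> * (cnj (yx x t) * yx x t)))) (at x within {0..R})"
        (is "(_ has_vector_derivative ?A') _")
        by (intro has_vector_derivative_diff has_vector_derivative_scaleR w has_vector_derivative_mult has_vector_derivative_cnj
            has_vector_derivative_mult_right d)
      moreover have "?A' = ?D x - ?E x"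
      proof -
        have "yxx x t = - \<i> * yt x t" using y.pde[of x t] x t by simp
        then have br: "(cnj (y x t) * yxt x t + cnj (yx x t) * yt x t) - \<i> * (cnj (yx x t) * yxx x t + cnj (yxx x t) * yx x t)
            = cnj (y x t) * yxt x t + cnj (yt x t) * yx x t"
          by (simp add: algebra_simps)
        show ?thesis by (simp only: br divide_minus_left scaleR_minus_left add_uminus_conv_diff)
      qed
      ultimately show "(?A has_vector_derivative ?D x - ?E x) (at x within {0..R})" by (simp only:)
    qed (use R in simp)
    then have 1: "integral {0..R} (\<lambda>x. ?D x - ?E x) = ?A R - ?A 0" by (rule integral_unique)
    have 2: "integral {0..R} (\<lambda>x. ?D x - ?E x) = D t - integral {0..R} ?E"
      unfolding D_def by (rule integral_diff[OF iD iE])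
    have AR: "?A R = 0" using R by simp
    have A0: "?A 0 = cnj (y 0 t) * yt 0 t - \<i> * of_real ((norm (yx 0 t))\<^sup>2)"
      using complex_norm_square[of "yx 0 t"] by (simp add: mult.commute)
    define Y where "Y = integral {0..R} ?E"
    have "D t - Y = - ?A 0" unfolding Y_def 2[symmetric] 1 AR by simp
    then have eq: "D t - \<i> * of_real ((norm (yx 0 t))\<^sup>2) = Y - cnj (y 0 t) * yt 0 t"
      unfolding A0 by (simp add: algebra_simps)
    have i: "(\<lambda>x. (norm (y x t))\<^sup>2) integrable_on {0..R}" "(\<lambda>x. (norm (yt x t))\<^sup>2) integrable_on {0..R}"
      "(\<lambda>x. (norm (yx x t))\<^sup>2) integrable_on {0..R}"
      by (auto intro!: integrable_continuous_real continuous_intros c)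
    have 3: "norm Y \<le> integral {0..R} (\<lambda>x. (1 / R) * (((1 / 2) * (norm (y x t))\<^sup>2 + (1 / 2) * (norm (yt x t))\<^sup>2) + (norm (yx x t))\<^sup>2))"
      unfolding Y_def
    proof (rule integral_norm_bound_integral[OF iE])
      show "(\<lambda>x. (1 / R) * (((1 / 2) * (norm (y x t))\<^sup>2 + (1 / 2) * (norm (yt x t))\<^sup>2) + (norm (yx x t))\<^sup>2)) integrable_on {0..R}"
        by (intro integrable_on_mult_right integrable_add i)
      fix x
      have "norm (cnj (y x t) * yt x t - \<i> * (cnj (yx x t) * yx x t)) \<le> norm (cnj (y x t) * yt x t) + norm (\<i> * (cnj (yx x t) * yx x t))"
        by (rule norm_triangle_ineq4)
      also have "\<dots> = norm (y x t) * norm (yt x t) + (norm (yx x t))\<^sup>2"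
        by (simp add: norm_mult power2_eq_square)
      also have "\<dots> \<le> ((1 / 2) * (norm (y x t))\<^sup>2 + (1 / 2) * (norm (yt x t))\<^sup>2) + (norm (yx x t))\<^sup>2"
        using mult_le_half_squares[of "norm (y x t)" "norm (yt x t)"] by simp
      finally have "norm (cnj (y x t) * yt x t - \<i> * (cnj (yx x t) * yx x t)) \<le> ((1 / 2) * (norm (y x t))\<^sup>2 + (1 / 2) * (norm (yt x t))\<^sup>2) + (norm (yx x t))\<^sup>2" .
      moreover have "\<bar>1 / R\<bar> = 1 / R" using R by simp
      ultimately show "norm (?E x) \<le> (1 / R) * (((1 / 2) * (norm (y x t))\<^sup>2 + (1 / 2) * (norm (yt x t))\<^sup>2) + (norm (yx x t))\<^sup>2)"
        unfolding norm_scaleR using R by (simp only:) (intro mult_left_mono, auto)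
    qed
    have 4: "integral {0..R} (\<lambda>x. (1 / R) * (((1 / 2) * (norm (y x t))\<^sup>2 + (1 / 2) * (norm (yt x t))\<^sup>2) + (norm (yx x t))\<^sup>2))
        = (1 / R) * (((1 / 2) * integral {0..R} (\<lambda>x. (norm (y x t))\<^sup>2) + (1 / 2) * integral {0..R} (\<lambda>x. (norm (yt x t))\<^sup>2))
          + integral {0..R} (\<lambda>x. (norm (yx x t))\<^sup>2))"
      unfolding integral_mult_right integral_add[OF integrable_add[OF integrable_on_mult_right[OF i(1)] integrable_on_mult_right[OF i(2)]] i(3)]
        integral_add[OF integrable_on_mult_right[OF i(1)] integrable_on_mult_right[OF i(2)]] by (rule refl)
    have 5: "(1 / R) * (((1 / 2) * integral {0..R} (\<lambda>x. (norm (y x t))\<^sup>2) + (1 / 2) * integral {0..R} (\<lambda>x. (norm (yt x t))\<^sup>2))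
          + integral {0..R} (\<lambda>x. (norm (yx x t))\<^sup>2)) \<le> (1 / R) * (((1 / 2) * K + (1 / 2) * K) + K)"
      using R by (intro mult_left_mono add_mono mass_leD m t) auto
    have "norm Y \<le> (1 / R) * (((1 / 2) * K + (1 / 2) * K) + K)"
      using 3 5 unfolding 4 by (rule order_trans)
    then have "norm Y \<le> 2 * K / R" by simp
    moreover have "norm (Y - cnj (y 0 t) * yt 0 t) \<le> norm Y + norm (y 0 t) * norm (yt 0 t)"
      using norm_triangle_ineq4[of Y "cnj (y 0 t) * yt 0 t"] by (simp add: norm_mult)
    ultimately show ?thesis unfolding eq by linarith
  qed
  have cyx: "continuous_on {0..T} (\<lambda>t. (norm (yx 0 t))\<^sup>2)"
    by (intro continuous_intros qcont_t[OF y.czx]) auto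
  have cc: "continuous_on {0..T} (\<lambda>t. norm (y 0 t) * norm (yt 0 t))"
    by (intro continuous_intros qcont_t[OF y.cz] qcont_t[OF y.czt]) auto
  have ir: "((\<lambda>t. \<i> * complex_of_real ((norm (yx 0 t))\<^sup>2)) has_integral \<i> * of_real (integral {0..T} (\<lambda>t. (norm (yx 0 t))\<^sup>2))) {0..T}"
    using has_integral_linear[OF integrable_integral[OF integrable_continuous_real[OF cyx]], of "\<lambda>r. \<i> * of_real r"]
    by (simp add: o_def bounded_linear_const_mult bounded_linear_compose[OF bounded_linear_mult_right bounded_linear_of_real])
  define I where "I = integral {0..T} (\<lambda>t. (norm (yx 0 t))\<^sup>2)"
  have "norm (P T - P 0 - \<i> * of_real I) \<le> integral {0..T} (\<lambda>t. norm (y 0 t) * norm (yt 0 t) + 2 * K / R)"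
  proof -
    have h: "((\<lambda>t. D t - \<i> * of_real ((norm (yx 0 t))\<^sup>2)) has_integral (P T - P 0 - \<i> * of_real I)) {0..T}"
      unfolding I_def by (rule has_integral_diff[OF hP ir])
    have "norm (integral {0..T} (\<lambda>t. D t - \<i> * of_real ((norm (yx 0 t))\<^sup>2))) \<le> integral {0..T} (\<lambda>t. norm (y 0 t) * norm (yt 0 t) + 2 * K / R)"
      by (rule integral_norm_bound_integral[OF has_integral_integrable[OF h]
            integrable_add[OF integrable_continuous_real[OF cc] integrable_const_ivl]])
        (use flux in auto)
    then show ?thesis unfolding integral_unique[OF h] .
  qed
  also have "\<dots> = integral {0..T} (\<lambda>t. norm (y 0 t) * norm (yt 0 t)) + (2 * K / R) * T"
    unfolding integral_add[OF integrable_continuous_real[OF cc] integrable_const_ivl] using T by simp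
  finally have main: "norm (P T - P 0 - \<i> * of_real I) \<le> N + (2 * K / R) * T" using N by linarith
  have "(2 * K / R) * T \<le> 1" using R(2) by (simp add: pos_divide_le_eq R_def)
  moreover have "I \<le> norm (\<i> * of_real I)" by (simp add: norm_mult)
  moreover have "norm (\<i> * of_real I) \<le> norm (P T) + norm (P 0) + norm (P T - P 0 - \<i> * of_real I)"
  proof -
    have "\<i> * of_real I = P T - P 0 - (P T - P 0 - \<i> * of_real I)" by simp
    then have "norm (\<i> * of_real I) \<le> norm (P T - P 0) + norm (P T - P 0 - \<i> * of_real I)"
      by (metis norm_triangle_ineq4)
    with norm_triangle_ineq4[of "P T" "P 0"] show ?thesis by linarith
  qed
  ultimately show ?thesis using main Pb[of T] Pb[of 0] T unfolding I_def by linarith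
qed

section \<open>Periodic functions and square integrability\<close>

lemma has_period_nat:
  assumes "has_period f T" "t \<ge> 0"
  shows "f (t + real n * T) = f t"
proof (induction n)
  case (Suc n)
  have "t + real n * T \<ge> 0" using assms unfolding has_period_def by (intro add_nonneg_nonneg) auto
  then have "f (t + real n * T + T) = f (t + real n * T)" using assms unfolding has_period_def by blast
  then show ?case using Suc by (simp add: algebra_simps)
qed simp

lemma has_period_bounded:
  assumes "has_period f T" "continuous_on {0..} f"
  shows "bounded (f ` {0..})"
proof -
  have T: "T > 0" using assms unfolding has_period_def by simp
  have "f ` {0..} \<subseteq> f ` {0..T}"
  proof
    fix y assume "y \<in> f ` {0..}"
    then obtain t where t: "t \<ge> 0" "y = f t" by auto
    define n where "n = nat \<lfloor>t / T\<rfloor>"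
    have n: "real n = of_int \<lfloor>t / T\<rfloor>" using t T by (simp add: n_def)
    have "real n \<le> t / T" "t / T \<le> real n + 1" unfolding n by linarith+
    then have "0 \<le> t - real n * T" "t - real n * T \<le> T"
      using T by (auto simp: pos_le_divide_eq pos_divide_le_eq algebra_simps)
    moreover from this have "f (t - real n * T) = y" using has_period_nat[OF assms(1), of "t - real n * T" n] t by simp
    ultimately show "y \<in> f ` {0..T}" by force
  qed
  moreover have "bounded (f ` {0..T})"
    by (intro compact_imp_bounded compact_continuous_image continuous_on_subset[OF assms(2)]) auto
  ultimately show ?thesis by (rule bounded_subset[rotated])
qed

text \<open>Every period contributes the same amount \<open>I\<close> to a bounded integral, so
  \<open>I\<close> vanishes, and a continuous nonnegative function with integral zero is
  zero.\<close>

lemma periodic_square_integrable_zero: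
  fixes f :: "real \<Rightarrow> complex"
  assumes f: "has_period f T" "continuous_on {0..} f" and T0: "T0 \<ge> 0"
    and M: "\<And>X. X \<ge> T0 \<Longrightarrow> integral {T0..X} (\<lambda>t. (norm (f t))\<^sup>2) \<le> M" and t: "t \<ge> 0"
  shows "f t = 0"
proof (rule ccontr)
  assume ft: "f t \<noteq> 0"
  have T: "T > 0" using f unfolding has_period_def by simp
  obtain k where k: "T0 \<le> real k * T" using reals_Archimedean3[OF T] less_imp_le by blast
  define a where "a = t + real k * T"
  have a: "a \<ge> T0" "a \<ge> 0" "f a = f t" using k t T0 has_period_nat[OF f(1) t] by (auto simp: a_def)
  let ?g = "\<lambda>t. (norm (f t))\<^sup>2"
  have c: "continuous_on S ?g" if "S \<subseteq> {0..}" for S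
    by (intro continuous_intros continuous_on_subset[OF f(2) that])
  define I where "I = integral {a..a + T} ?g"
  have "I \<ge> 0" unfolding I_def using a by (intro integral_nonneg integrable_continuous_real c) auto
  moreover have "I \<noteq> 0"
  proof
    assume "I = 0"
    then have "\<forall>x\<in>{a..a + T}. ?g x = 0"
      unfolding I_def using a T by (subst (asm) integral_eq_0_iff) (auto intro!: c)
    then show False using a T ft by auto
  qed
  ultimately have I: "I > 0" by simp
  have shift: "integral {a + real n * T..a + real (Suc n) * T} ?g = I" for n
  proof -
    have "integral {a..a + T} (?g \<circ> (\<lambda>x. x + real n * T)) = integral {a + real n * T..a + T + real n * T} ?g"
      using a T by (intro integral_shift c) (auto intro: order_trans[OF _ le_add_same_cancel1[THEN iffD2]])
    moreover have "integral {a..a + T} (?g \<circ> (\<lambda>x. x + real n * T)) = I"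
      unfolding I_def using a by (intro integral_cong) (auto simp: has_period_nat[OF f(1)])
    ultimately show ?thesis by (simp add: algebra_simps)
  qed
  have "real n * I \<le> integral {T0..a + real n * T} ?g" for n
  proof (induction n)
    case 0
    show ?case using a T0 by (auto intro!: integral_nonneg integrable_continuous_real c)
  next
    case (Suc n)
    have "?g integrable_on {T0..a + real (Suc n) * T}"
      using T0 by (intro integrable_continuous_real c) auto
    moreover have "T0 \<le> a + real n * T" "a + real n * T \<le> a + real (Suc n) * T"
      using a T by (auto intro: add_increasing2 mult_right_mono)
    ultimately have "integral {T0..a + real (Suc n) * T} ?g = integral {T0..a + real n * T} ?g + integral {a + real n * T..a + real (Suc n) * T} ?g"
      using Henstock_Kurzweil_Integration.integral_combine[of T0 "a + real n * T" "a + real (Suc n) * T" ?g] by simp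
    then show ?case using Suc shift[of n] by (simp add: distrib_right)
  qed
  moreover have "T0 \<le> a + real n * T" for n using a T by (auto intro: add_increasing2)
  ultimately have "real n * I \<le> M" for n using M order_trans by blast
  moreover obtain n where "M < real n * I" using reals_Archimedean3[OF I] by blast
  ultimately show False by (simp add: not_le[symmetric])
qed

lemma integral_square_diff_le:
  fixes f g :: "real \<Rightarrow> complex"
  assumes "continuous_on {a..b} f" "continuous_on {a..b} g"
  shows "integral {a..b} (\<lambda>t. (norm (f t - g t))\<^sup>2)
    \<le> 2 * integral {a..b} (\<lambda>t. (norm (f t))\<^sup>2) + 2 * integral {a..b} (\<lambda>t. (norm (g t))\<^sup>2)"
proof -
  have i: "(\<lambda>t. 2 * (norm (f t))\<^sup>2) integrable_on {a..b}" "(\<lambda>t. 2 * (norm (g t))\<^sup>2) integrable_on {a..b}"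
    using assms by (auto intro!: integrable_continuous_real continuous_intros)
  have "integral {a..b} (\<lambda>t. (norm (f t - g t))\<^sup>2) \<le> integral {a..b} (\<lambda>t. 2 * (norm (f t))\<^sup>2 + 2 * (norm (g t))\<^sup>2)"
    using assms by (intro integral_le integrable_add i norm_diff_square_le) (auto intro!: integrable_continuous_real continuous_intros)
  then show ?thesis unfolding integral_add[OF i] by (simp only: integral_mult_right)
qed

text \<open>The periods need not be commensurable, so \<open>f - g\<close> need not be periodic. But
  \<open>f t - f (t + T)\<close> is \<open>S\<close>-periodic and equals the same difference formed
  with \<open>f - g\<close>, hence is square integrable and zero. Now \<open>f\<close> has period
  \<open>T\<close> as well, and so has \<open>f - g\<close>.\<close>

lemma periodic_difference_zero:
  fixes f g :: "real \<Rightarrow> complex"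
  assumes f: "has_period f S" "continuous_on {0..} f" and g: "has_period g T" "continuous_on {0..} g"
    and T0: "T0 \<ge> 0" and M: "\<And>X. X \<ge> T0 \<Longrightarrow> integral {T0..X} (\<lambda>t. (norm (f t - g t))\<^sup>2) \<le> M"
    and t: "t \<ge> 0"
  shows "f t = g t"
proof -
  have ST: "S > 0" "T > 0" using f g unfolding has_period_def by auto
  let ?h = "\<lambda>t. f t - g t" and ?d = "\<lambda>t. f t - f (t + T)"
  have ch: "continuous_on A ?h" if "A \<subseteq> {0..}" for A
    by (intro continuous_intros continuous_on_subset[OF f(2) that] continuous_on_subset[OF g(2) that])
  have cfT: "continuous_on {0..} (\<lambda>t. f (t + T))"
    by (rule continuous_on_compose2[OF f(2)]) (use ST in \<open>auto intro!: continuous_intros\<close>)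
  have d0: "?d r = 0" if r: "r \<ge> 0" for r
  proof (rule periodic_square_integrable_zero[where f = ?d and T = S and M = "4 * M" and ?T0.0 = T0])
    show "has_period ?d S"
      unfolding has_period_def
    proof (intro conjI allI impI)
      fix t :: real assume "t \<ge> 0"
      then have "f (t + S) = f t" "f (t + T + S) = f (t + T)"
        using f(1) ST unfolding has_period_def by auto
      then show "f (t + S) - f (t + S + T) = f t - f (t + T)" by (simp add: add_ac)
    qed (rule ST)
    show "continuous_on {0..} ?d" by (intro continuous_intros f(2) cfT)
    fix X assume X: "X \<ge> T0"
    have "integral {T0..X} (\<lambda>t. (norm (?d t))\<^sup>2) = integral {T0..X} (\<lambda>t. (norm (?h t - ?h (t + T)))\<^sup>2)"
      using g(1) T0 unfolding has_period_def by (intro integral_cong) auto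
    also have "\<dots> \<le> 2 * integral {T0..X} (\<lambda>t. (norm (?h t))\<^sup>2) + 2 * integral {T0..X} (\<lambda>t. (norm (?h (t + T)))\<^sup>2)"
    proof (rule integral_square_diff_le)
      show "continuous_on {T0..X} ?h" using T0 by (intro ch) auto
      show "continuous_on {T0..X} (\<lambda>t. ?h (t + T))"
        by (rule continuous_on_compose2[OF ch[of "{0..}"]]) (use ST T0 in \<open>auto intro!: continuous_intros\<close>)
    qed
    also have "integral {T0..X} (\<lambda>t. (norm (?h (t + T)))\<^sup>2) = integral {T0 + T..X + T} (\<lambda>t. (norm (?h t))\<^sup>2)"
    proof -
      have "continuous_on {T0 + T..X + T} (\<lambda>t. (norm (?h t))\<^sup>2)"
        using T0 ST by (intro continuous_on_power continuous_on_norm ch) auto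
      from integral_shift[OF this] show ?thesis by (simp add: o_def)
    qed
    also have "integral {T0 + T..X + T} (\<lambda>t. (norm (?h t))\<^sup>2) \<le> integral {T0..X + T} (\<lambda>t. (norm (?h t))\<^sup>2)"
      using T0 ST X by (intro integral_subset_le integrable_continuous_real continuous_on_power continuous_on_norm ch) auto
    finally show "integral {T0..X} (\<lambda>t. (norm (?d t))\<^sup>2) \<le> 4 * M"
      using M[OF X] M[of "X + T"] X ST by linarith
  qed (use T0 r in auto)
  have "?h t = 0"
  proof (rule periodic_square_integrable_zero[where f = ?h and T = T and M = M and ?T0.0 = T0])
    show "has_period ?h T"
      unfolding has_period_def
    proof (intro conjI allI impI)
      fix r :: real assume "r \<ge> 0"
      then have "f r = f (r + T)" "g (r + T) = g r" using d0[of r] g(1) by (auto simp: has_period_def)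
      then show "f (r + T) - g (r + T) = f r - g r" by simp
    qed (rule ST)
    show "continuous_on {0..} ?h" by (rule ch) simp
    show "integral {T0..X} (\<lambda>t. (norm (?h t))\<^sup>2) \<le> M" if "X \<ge> T0" for X by (rule M[OF that])
  qed (rule T0, rule t)
  then show ?thesis by simp
qed

lemma qcont_time_function:
  assumes "continuous_on {0..} f"
  shows "qcont (\<lambda>_. f)"
proof -
  have "continuous_on ({0..} \<times> {0..}) (\<lambda>p. f (snd p))"
    by (rule continuous_on_compose2[OF assms continuous_on_snd[OF continuous_on_id]]) auto
  then show ?thesis by (simp add: case_prod_unfold)
qed

text \<open>Supplies the mixed derivative for averages: in \<open>schr\<close> the function
  \<open>zx\<close> is only continuous in time, while its average is a difference of values of a
  primitive.\<close>

lemma avg_time_function_derivative: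
  assumes "continuous_on {0..} f" "\<epsilon> > 0" "t \<ge> 0"
  shows "((\<lambda>t. avg \<epsilon> (\<lambda>_. f) x t) has_vector_derivative (f (t + \<epsilon>) - f t) /\<^sub>R \<epsilon>) (at t within {0..})"
proof -
  define \<Phi> where "\<Phi> t = integral {0..t} f" for t
  have d\<Phi>: "(\<Phi> has_vector_derivative f t) (at t within {0..})" if t: "t \<ge> 0" for t
  proof -
    have "(\<Phi> has_vector_derivative f t) (at t within {0..t + 1})"
      unfolding \<Phi>_def[abs_def] using t by (intro integral_has_vector_derivative continuous_on_subset[OF assms(1)]) auto
    then have "(\<Phi> has_vector_derivative f t) (at t within {0..} \<inter> {..<t + 1})"
      by (rule has_vector_derivative_within_subset) auto
    moreover have "at t within {0..} \<inter> {..<t + 1} = at t within {0..}"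
      by (rule at_within_nhd[of _ "{..<t + 1}"]) auto
    ultimately show ?thesis by simp
  qed
  have q: "qcont (\<lambda>_. \<Phi>)" "qcont (\<lambda>_. f)"
  proof -
    have "continuous_on {0..} \<Phi>"
      unfolding continuous_on_eq_continuous_within
      using has_vector_derivative_continuous[OF d\<Phi>] by auto
    then show "qcont (\<lambda>_. \<Phi>)" "qcont (\<lambda>_. f)"
      using qcont_time_function[of \<Phi>] qcont_time_function[OF assms(1)] by auto
  qed
  have eq: "avg \<epsilon> (\<lambda>_. f) x t = (\<Phi> (t + \<epsilon>) - \<Phi> t) /\<^sub>R \<epsilon>" if t: "t \<ge> 0" for t
  proof -
    have "\<epsilon> *\<^sub>R avg \<epsilon> (\<lambda>_. f) 0 t = \<Phi> (t + \<epsilon>) - \<Phi> t"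
      using avg_derivative_eq[OF q assms(2) order_refl t] d\<Phi> by simp
    then have "(\<Phi> (t + \<epsilon>) - \<Phi> t) /\<^sub>R \<epsilon> = avg \<epsilon> (\<lambda>_. f) 0 t"
      using assms(2) by (simp flip: \<open>\<epsilon> *\<^sub>R avg \<epsilon> (\<lambda>_. f) 0 t = _\<close>)
    then show ?thesis by (simp add: avg_def)
  qed
  have "((\<lambda>t. \<Phi> (t + \<epsilon>)) has_vector_derivative f (t + \<epsilon>)) (at t within {0..})"
  proof -
    have "(\<Phi> has_vector_derivative f (t + \<epsilon>)) (at (t + \<epsilon>) within (\<lambda>t. t + \<epsilon>) ` {0..})"
      by (rule has_vector_derivative_within_subset[OF d\<Phi>]) (use assms in auto)
    moreover have "((\<lambda>t. t + \<epsilon>) has_vector_derivative 1) (at t within {0..})"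
      by (auto intro!: derivative_eq_intros)
    ultimately show ?thesis
      using vector_diff_chain_within[of "\<lambda>t. t + \<epsilon>" 1 t "{0..}" \<Phi>] by (simp add: o_def)
  qed
  then have "((\<lambda>t. (\<Phi> (t + \<epsilon>) - \<Phi> t) /\<^sub>R \<epsilon>) has_vector_derivative (f (t + \<epsilon>) - f t) /\<^sub>R \<epsilon>) (at t within {0..})"
    by (intro bounded_linear.has_vector_derivative[OF bounded_linear_scaleR_right] has_vector_derivative_diff d\<Phi> assms(3))
  then show ?thesis
    by (rule has_vector_derivative_transform[rotated 2]) (use assms eq in auto)
qed

lemma integral_inverse_square_le:
  assumes X: "X \<ge> (0::real)"
  shows "integral {0..X} (\<lambda>t. inverse (1 + t\<^sup>2)) \<le> 2"
proof -
  have "((\<lambda>t. inverse (1 + t\<^sup>2)) has_integral (arctan X - arctan 0)) {0..X}"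
    using X by (intro fundamental_theorem_of_calculus)
      (auto intro!: derivative_eq_intros simp flip: has_real_derivative_iff_has_vector_derivative)
  then have "integral {0..X} (\<lambda>t. inverse (1 + t\<^sup>2)) = arctan X" by (simp add: integral_unique)
  also have "\<dots> \<le> pi / 2" using arctan_ubound[of X] by simp
  also have "\<dots> \<le> 2" using pi_less_4 by simp
  finally show ?thesis .
qed

context decaying_schr
begin

text \<open>Global mass bounds pass from \<open>z\<close> to its averages, to their time derivatives
  as difference quotients and, by interpolation, to their space derivatives, so
  \<open>momentum_bound\<close> applies with constants independent of the time horizon. The decay of
  \<open>z 0\<close> makes both the influx and the Dirichlet term of the momentum identity
  integrable.\<close>

lemma neumann_square_integrable:
  assumes \<epsilon>: "\<epsilon> > 0" and z0: "\<And>t. t \<ge> 0 \<Longrightarrow> norm (z 0 t) \<le> A * inverse (1 + t\<^sup>2)"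
    and zx0: "\<And>t. t \<ge> 0 \<Longrightarrow> norm (zx 0 t) \<le> B"
  shows "\<exists>N. \<forall>X\<ge>0. integral {0..X} (\<lambda>t. (norm (avg \<epsilon> zx 0 t))\<^sup>2) \<le> N"
proof -
  have AB: "A \<ge> 0" "B \<ge> 0" using order_trans[OF norm_ge_zero z0[of 0]] order_trans[OF norm_ge_zero zx0[of 0]] by auto
  have inv_cont: "continuous_on S (\<lambda>t::real. inverse (1 + t\<^sup>2))" for S
    by (intro continuous_intros) (auto simp: add_nonneg_eq_0_iff)
  have inv1: "inverse (1 + t\<^sup>2) \<le> 1" for t :: real by (simp add: inverse_le_1_iff)
  have z0': "norm (z 0 t) \<le> A" if "t \<ge> 0" for t
    using order_trans[OF z0[OF that] mult_left_mono[OF inv1 AB(1)]] by simp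
  have flux: "integral {0..t} (\<lambda>r. 2 * (norm (z 0 r) * norm (zx 0 r))) \<le> (2 * A * B) * 2" if t: "t \<ge> 0" for t
  proof -
    have "integral {0..t} (\<lambda>r. 2 * (norm (z 0 r) * norm (zx 0 r))) \<le> integral {0..t} (\<lambda>r. (2 * A * B) * inverse (1 + r\<^sup>2))"
    proof (rule integral_le)
      show "(\<lambda>r. 2 * (norm (z 0 r) * norm (zx 0 r))) integrable_on {0..t}"
        by (intro integrable_continuous_real continuous_intros qcont_t[OF cz] qcont_t[OF czx]) auto
      show "(\<lambda>r. (2 * A * B) * inverse (1 + r\<^sup>2)) integrable_on {0..t}"
        by (intro integrable_on_mult_right integrable_continuous_real inv_cont)
      fix r assume "r \<in> {0..t}"
      then have "norm (z 0 r) * norm (zx 0 r) \<le> (A * inverse (1 + r\<^sup>2)) * B"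
        using AB by (intro mult_mono z0 zx0) (auto simp: add_nonneg_nonneg)
      then show "2 * (norm (z 0 r) * norm (zx 0 r)) \<le> (2 * A * B) * inverse (1 + r\<^sup>2)" by (simp add: mult_ac)
    qed
    also have "\<dots> = (2 * A * B) * integral {0..t} (\<lambda>r. inverse (1 + r\<^sup>2))" by (rule integral_mult_right)
    also have "\<dots> \<le> (2 * A * B) * 2" using AB t by (intro mult_left_mono integral_inverse_square_le) auto
    finally show ?thesis .
  qed
  obtain K where K: "\<And>t. t \<ge> 0 \<Longrightarrow> mass_le z K t" using global_mass[OF flux] by blast
  have K0: "K \<ge> 0" using mass_le_nonneg[OF K[of 0]] by simp
  interpret y: schr "avg \<epsilon> z" "avg \<epsilon> zx" "avg \<epsilon> zxx" "avg \<epsilon> zt"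
    using \<epsilon> by (intro schr_avg) auto
  \<comment> \<open>The common mixed derivative: differentiating the average of \<open>zx\<close> in
    \<open>t\<close>, or the difference quotient of \<open>z\<close> in \<open>x\<close>, gives the
    same function.\<close>
  define yxt where "yxt x t = (zx x (t + \<epsilon>) - zx x t) /\<^sub>R \<epsilon>" for x t
  have my: "mass_le (avg \<epsilon> z) K t" if "t \<ge> 0" for t
    using that \<epsilon> by (intro mass_le_avg[OF cz] K) auto
  have yt_eq: "\<epsilon> *\<^sub>R avg \<epsilon> zt x t = z x (t + \<epsilon>) - z x t" if "x \<ge> 0" "t \<ge> 0" for x t
    by (rule avg_derivative_eq[OF cz czt \<epsilon> that dt])
  then have yt_eq': "avg \<epsilon> zt x t = (z x (t + \<epsilon>) - z x t) /\<^sub>R \<epsilon>" if "x \<ge> 0" "t \<ge> 0" for x t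
    using \<epsilon> that by (simp flip: yt_eq)
  have myt: "mass_le (avg \<epsilon> zt) (4 * K / \<epsilon>\<^sup>2) t" if t: "t \<ge> 0" for t
  proof (rule mass_le_difference_quotient[OF cz \<epsilon> t])
    show "mass_le z K t" "mass_le z K (t + \<epsilon>)" using t \<epsilon> by (auto intro!: K)
    show "\<epsilon> *\<^sub>R avg \<epsilon> zt x t = z x (t + \<epsilon>) - z x t" if "x \<ge> 0" for x
      using yt_eq[OF that t] .
    show "continuous_on {0..} (\<lambda>x. avg \<epsilon> zt x t)" by (rule qcont_x[OF y.czt t]) simp
  qed
  have myxx: "mass_le (avg \<epsilon> zxx) (4 * K / \<epsilon>\<^sup>2) t" if t: "t \<ge> 0" for t
  proof -
    have "integral {0..R} (\<lambda>x. (norm (avg \<epsilon> zxx x t))\<^sup>2) = integral {0..R} (\<lambda>x. (norm (avg \<epsilon> zt x t))\<^sup>2)" for R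
      by (intro integral_cong) (simp add: y.pde t norm_mult)
    with myt[OF t] show ?thesis unfolding mass_le_def by simp
  qed
  have avg_le: "norm (avg \<epsilon> f 0 t) \<le> C" if "qcont f" "t \<ge> 0" "\<And>r. r \<ge> t \<Longrightarrow> norm (f 0 r) \<le> C" for f C t
  proof -
    have "norm (integral {0..1} (\<lambda>s. f 0 (t + \<epsilon> * s))) \<le> integral {0..1} (\<lambda>s::real. C)"
      using that \<epsilon> avg_integrand_continuous[OF that(1) less_imp_le[OF \<epsilon>] order_refl that(2)]
      by (intro integral_norm_bound_integral integrable_continuous_real integrable_const_ivl) auto
    then show ?thesis by (simp add: avg_def)
  qed
  have y0: "norm (avg \<epsilon> z 0 t) \<le> A * inverse (1 + t\<^sup>2)" if t: "t \<ge> 0" for t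
  proof (rule avg_le[OF cz t])
    fix r assume r: "r \<ge> t"
    have "norm (z 0 r) \<le> A * inverse (1 + r\<^sup>2)" using r t by (intro z0) auto
    also have "\<dots> \<le> A * inverse (1 + t\<^sup>2)"
      using r t AB by (intro mult_left_mono le_imp_inverse_le add_left_mono power_mono) (auto intro: add_pos_nonneg)
    finally show "norm (z 0 r) \<le> A * inverse (1 + t\<^sup>2)" .
  qed
  have y0': "norm (avg \<epsilon> z 0 t) \<le> A" if t: "t \<ge> 0" for t
    using t by (intro avg_le[OF cz t] z0') auto
  have yx0: "norm (avg \<epsilon> zx 0 t) \<le> B" if t: "t \<ge> 0" for t
    using t by (intro avg_le[OF czx t] zx0) auto
  have yt0: "norm (avg \<epsilon> zt 0 t) \<le> 2 * A / \<epsilon>" if t: "t \<ge> 0" for t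
  proof -
    have "norm (z 0 (t + \<epsilon>) - z 0 t) \<le> A + A"
      using z0'[of "t + \<epsilon>"] z0'[of t] t \<epsilon> norm_triangle_ineq4[of "z 0 (t + \<epsilon>)" "z 0 t"] by linarith
    then have "norm (z 0 (t + \<epsilon>) - z 0 t) / \<epsilon> \<le> (A + A) / \<epsilon>"
      using \<epsilon> by (intro divide_right_mono) auto
    moreover have "norm ((z 0 (t + \<epsilon>) - z 0 t) /\<^sub>R \<epsilon>) = norm (z 0 (t + \<epsilon>) - z 0 t) / \<epsilon>"
      using \<epsilon> by (simp add: divide_inverse_commute)
    ultimately show ?thesis unfolding yt_eq'[OF order_refl t] by simp
  qed
  define L where "L = 4 * (2 * (A * B) + 5 * K + 4 * K / \<epsilon>\<^sup>2)"
  have myx: "mass_le (avg \<epsilon> zx) L t" if t: "t \<ge> 0" for t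
  proof -
    have "mass_le (avg \<epsilon> zx) (4 * (2 * (norm (avg \<epsilon> z 0 t) * norm (avg \<epsilon> zx 0 t)) + 5 * K + 4 * K / \<epsilon>\<^sup>2)) t"
      by (rule mass_le_derivative[OF y.cz y.czx y.czxx t y.dx y.dxx my[OF t] myxx[OF t]]) (use t in auto)
    moreover have "norm (avg \<epsilon> z 0 t) * norm (avg \<epsilon> zx 0 t) \<le> A * B"
      using AB by (intro mult_mono y0' yx0 t) auto
    ultimately show ?thesis unfolding L_def by (elim mass_le_mono) simp
  qed
  define KK where "KK = max K (max L (4 * K / \<epsilon>\<^sup>2))"
  have main: "integral {0..X} (\<lambda>t. (norm (avg \<epsilon> zx 0 t))\<^sup>2) \<le> 2 * KK + (A * (2 * A / \<epsilon>)) * 2 + 1" if X: "X \<ge> 0" for X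
  proof (rule momentum_bound[OF y.schr_axioms, where yxt = yxt])
    show "qcont yxt"
      unfolding yxt_def case_prod_unfold using \<epsilon> by (intro continuous_intros qcontD[OF czx]) auto
    show "((\<lambda>s. avg \<epsilon> zx x s) has_vector_derivative yxt x t) (at t within {0..})" if "x \<ge> 0" "t \<ge> 0" for x t
      using avg_time_function_derivative[OF qcont_t[OF czx that(1) order_refl] \<epsilon> that(2), of x]
      by (simp add: avg_def[abs_def] yxt_def)
    show "((\<lambda>x. avg \<epsilon> zt x t) has_vector_derivative yxt x t) (at x within {0..})" if "x \<ge> 0" "t \<ge> 0" for x t
    proof -
      have "((\<lambda>x. (z x (t + \<epsilon>) - z x t) /\<^sub>R \<epsilon>) has_vector_derivative yxt x t) (at x within {0..})"
        unfolding yxt_def using that \<epsilon>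
        by (intro bounded_linear.has_vector_derivative[OF bounded_linear_scaleR_right] has_vector_derivative_diff dx) auto
      then show ?thesis
        by (rule has_vector_derivative_transform[rotated 2]) (use that yt_eq' in auto)
    qed
    show "mass_le (avg \<epsilon> z) KK t" "mass_le (avg \<epsilon> zx) KK t" "mass_le (avg \<epsilon> zt) KK t" if "t \<ge> 0" for t
      using my[OF that] myx[OF that] myt[OF that] by (auto simp: KK_def intro: mass_le_mono)
    have "integral {0..X} (\<lambda>t. norm (avg \<epsilon> z 0 t) * norm (avg \<epsilon> zt 0 t)) \<le> integral {0..X} (\<lambda>t. (A * (2 * A / \<epsilon>)) * inverse (1 + t\<^sup>2))"
    proof (rule integral_le)
      show "(\<lambda>t. norm (avg \<epsilon> z 0 t) * norm (avg \<epsilon> zt 0 t)) integrable_on {0..X}"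
        by (intro integrable_continuous_real continuous_intros qcont_t[OF y.cz] qcont_t[OF y.czt]) auto
      show "(\<lambda>t. (A * (2 * A / \<epsilon>)) * inverse (1 + t\<^sup>2)) integrable_on {0..X}"
        by (intro integrable_on_mult_right integrable_continuous_real inv_cont)
      fix t assume "t \<in> {0..X}"
      then have "norm (avg \<epsilon> z 0 t) * norm (avg \<epsilon> zt 0 t) \<le> (A * inverse (1 + t\<^sup>2)) * (2 * A / \<epsilon>)"
        using AB by (intro mult_mono y0 yt0) (auto simp: add_nonneg_nonneg)
      then show "norm (avg \<epsilon> z 0 t) * norm (avg \<epsilon> zt 0 t) \<le> (A * (2 * A / \<epsilon>)) * inverse (1 + t\<^sup>2)" by (simp only: mult_ac)
    qed
    also have "\<dots> = (A * (2 * A / \<epsilon>)) * integral {0..X} (\<lambda>t. inverse (1 + t\<^sup>2))" by (rule integral_mult_right)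
    also have "\<dots> \<le> (A * (2 * A / \<epsilon>)) * 2"
      using AB X \<epsilon> by (intro mult_left_mono integral_inverse_square_le) auto
    finally show "integral {0..X} (\<lambda>t. norm (avg \<epsilon> z 0 t) * norm (avg \<epsilon> zt 0 t)) \<le> (A * (2 * A / \<epsilon>)) * 2" .
  qed (rule X)
  then show ?thesis by blast
qed

end

section \<open>Uniqueness of the Neumann data\<close>

lemma hderiv_works:
  "f differentiable (at x within {0..}) \<Longrightarrow> (f has_vector_derivative hderiv f x) (at x within {0..})"
  unfolding hderiv_def by (simp add: vector_derivative_works)

text \<open>The equation is given for positive \<open>x\<close> and \<open>t\<close>; continuity of
  the partial derivatives carries it to the closed quarter plane.\<close>

lemma schroedinger_solution_schr:
  assumes "schroedinger_solution u"
  shows "schr u (partial_x u) (partial_x (partial_x u)) (partial_t u)"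
proof -
  have sm: "smooth_quarter_plane u" and pde: "\<And>x t. x > 0 \<Longrightarrow> t > 0 \<Longrightarrow> \<i> * partial_t u x t + partial_x (partial_x u) x t = 0"
    using assms unfolding schroedinger_solution_def by auto
  have c: "qcont v" if "v \<in> iterated_partials u" for v
    using sm that unfolding smooth_quarter_plane_def by blast
  have dx: "((\<lambda>y. v y t) has_vector_derivative partial_x v x t) (at x within {0..})"
    if "v \<in> iterated_partials u" "x \<ge> 0" "t \<ge> 0" for v x t
    using sm that unfolding smooth_quarter_plane_def partial_x_def by (intro hderiv_works) blast
  have dt: "((\<lambda>s. v x s) has_vector_derivative partial_t v x t) (at t within {0..})"
    if "v \<in> iterated_partials u" "x \<ge> 0" "t \<ge> 0" for v x t
    using sm that unfolding smooth_quarter_plane_def partial_t_def by (intro hderiv_works) blast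
  note ip = iterated_partials.self[of u] iterated_partials.x[OF iterated_partials.self[of u]]
    iterated_partials.x[OF iterated_partials.x[OF iterated_partials.self[of u]]]
    iterated_partials.t[OF iterated_partials.self[of u]]
  show ?thesis
  proof
    fix x t :: real assume xt: "x \<ge> 0" "t \<ge> 0"
    let ?F = "\<lambda>p. \<i> * partial_t u (fst p) (snd p) + partial_x (partial_x u) (fst p) (snd p)"
    have cl: "closure ({0<..} \<times> {0<..}) = {0::real..} \<times> {0::real..}" by (simp add: closure_Times)
    have "continuous_on ({0..} \<times> {0..}) ?F"
      using c[OF ip(3)] c[OF ip(4)] by (intro continuous_intros) (auto simp: case_prod_unfold)
    then have "?F (x, t) = 0"
      using continuous_constant_on_closure[of "{0<..} \<times> {0<..}" ?F 0 "(x, t)"] pde xt unfolding cl by auto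
    then have "\<i> * (\<i> * partial_t u x t + partial_x (partial_x u) x t) = 0" by simp
    then show "partial_t u x t = \<i> * partial_x (partial_x u) x t"
      by (simp add: algebra_simps)
  qed (use c ip dx dt in auto)
qed

lemma schr_diff:
  assumes "schr u ux uxx ut" "schr v vx vxx vt"
  shows "schr (\<lambda>x t. u x t - v x t) (\<lambda>x t. ux x t - vx x t) (\<lambda>x t. uxx x t - vxx x t) (\<lambda>x t. ut x t - vt x t)"
proof -
  interpret u: schr u ux uxx ut by fact
  interpret v: schr v vx vxx vt by fact
  have c: "qcont (\<lambda>x t. f x t - g x t)" if "qcont f" "qcont g" for f g :: "real \<Rightarrow> real \<Rightarrow> complex"
    using continuous_on_diff[OF that] by (simp add: case_prod_unfold)
  show ?thesis
  proof
    fix x t :: real assume xt: "x \<ge> 0" "t \<ge> 0"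
    show "((\<lambda>y. u y t - v y t) has_vector_derivative ux x t - vx x t) (at x within {0..})"
      by (rule has_vector_derivative_diff[OF u.dx[OF xt] v.dx[OF xt]])
    show "((\<lambda>y. ux y t - vx y t) has_vector_derivative uxx x t - vxx x t) (at x within {0..})"
      by (rule has_vector_derivative_diff[OF u.dxx[OF xt] v.dxx[OF xt]])
    show "((\<lambda>s. u x s - v x s) has_vector_derivative ut x t - vt x t) (at t within {0..})"
      by (rule has_vector_derivative_diff[OF u.dt[OF xt] v.dt[OF xt]])
    show "ut x t - vt x t = \<i> * (uxx x t - vxx x t)"
      using u.pde[OF xt] v.pde[OF xt] by (simp add: algebra_simps)
  qed (intro c u.cz v.cz u.czx v.czx u.czxx v.czxx u.czt v.czt)+
qed

lemma schwartz_halfline_bound: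
  assumes "v \<in> schwartz_halfline"
  shows "\<exists>C\<ge>0. \<forall>x\<ge>0. x ^ n * norm (v x) \<le> C"
proof -
  have "bounded ((\<lambda>x. of_real (x ^ n) * (hderiv ^^ 0) v x) ` {0..})"
    using assms unfolding schwartz_halfline_def by blast
  then obtain C where "\<forall>x\<ge>0. norm (of_real (x ^ n) * v x) \<le> C"
    unfolding bounded_iff by auto
  then have C: "\<forall>x\<ge>0. x ^ n * norm (v x) \<le> C" by (simp add: norm_mult norm_power)
  moreover have "C \<ge> 0" using C[rule_format, of 0] by (rule order_trans[rotated]) auto
  ultimately show ?thesis by blast
qed

lemma schwartz_halfline_diff_decay:
  assumes "v \<in> schwartz_halfline" "w \<in> schwartz_halfline"
  shows "\<exists>C. \<forall>x\<ge>0. (1 + x ^ n) * norm (v x - w x) \<le> C"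
proof -
  obtain A where A: "\<forall>x\<ge>0. x ^ 0 * norm (v x) \<le> A" using schwartz_halfline_bound[OF assms(1)] by blast
  obtain B where B: "\<forall>x\<ge>0. x ^ n * norm (v x) \<le> B" using schwartz_halfline_bound[OF assms(1)] by blast
  obtain A' where A': "\<forall>x\<ge>0. x ^ 0 * norm (w x) \<le> A'" using schwartz_halfline_bound[OF assms(2)] by blast
  obtain B' where B': "\<forall>x\<ge>0. x ^ n * norm (w x) \<le> B'" using schwartz_halfline_bound[OF assms(2)] by blast
  have "(1 + x ^ n) * norm (v x - w x) \<le> A + B + A' + B'" if x: "x \<ge> 0" for x
  proof -
    have "(1 + x ^ n) * norm (v x - w x) \<le> (1 + x ^ n) * (norm (v x) + norm (w x))"
      using x by (intro mult_left_mono norm_triangle_ineq4) auto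
    also have "\<dots> = x ^ 0 * norm (v x) + x ^ n * norm (v x) + x ^ 0 * norm (w x) + x ^ n * norm (w x)"
      by (simp add: algebra_simps)
    also have "\<dots> \<le> A + B + A' + B'" using A B A' B' x by (intro add_mono) auto
    finally show ?thesis .
  qed
  then show ?thesis by blast
qed

lemma smooth_halfline_continuous:
  assumes "smooth_halfline h"
  shows "continuous_on {0..} h"
  unfolding continuous_on_eq_continuous_within
proof
  fix x :: real assume "x \<in> {0..}"
  then have "((hderiv ^^ 0) h) differentiable (at x within {0..})"
    using assms unfolding smooth_halfline_def atLeast_iff by blast
  then show "continuous (at x within {0..}) h" by (simp add: differentiable_imp_continuous_within)
qed

lemma has_period_avg:
  assumes "has_period f T" "\<epsilon> > 0"
  shows "has_period (avg \<epsilon> (\<lambda>_. f) x) T"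
  unfolding has_period_def
proof (intro conjI allI impI)
  show "T > 0" using assms by (simp add: has_period_def)
  fix t :: real assume t: "t \<ge> 0"
  show "avg \<epsilon> (\<lambda>_. f) x (t + T) = avg \<epsilon> (\<lambda>_. f) x t"
    unfolding avg_def
  proof (rule integral_cong)
    fix s :: real assume "s \<in> {0..1}"
    then have "f (t + \<epsilon> * s + T) = f (t + \<epsilon> * s)" using assms t unfolding has_period_def by simp
    then show "f (t + T + \<epsilon> * s) = f (t + \<epsilon> * s)" by (simp add: add_ac)
  qed
qed

lemma avg_continuous_t:
  assumes "continuous_on {0..} f" "\<epsilon> > 0" "S \<subseteq> {0..}"
  shows "continuous_on S (avg \<epsilon> (\<lambda>_. f) 0)"
  using qcont_t[OF avg_qcont[OF qcont_time_function[OF assms(1)] less_imp_le[OF assms(2)]] order_refl assms(3)] by simp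

lemma avg_diff:
  assumes "continuous_on {0..} f" "continuous_on {0..} g" "\<epsilon> > 0" "t \<ge> 0"
  shows "avg \<epsilon> (\<lambda>_ t. f t - g t) x t = avg \<epsilon> (\<lambda>_. f) x t - avg \<epsilon> (\<lambda>_. g) x t"
proof -
  have i: "(\<lambda>s. h (t + \<epsilon> * s)) integrable_on {0..1}" if "continuous_on {0..} h" for h :: "real \<Rightarrow> complex"
    using avg_integrand_continuous[OF qcont_time_function[OF that] less_imp_le[OF assms(3)] order_refl assms(4)]
    by (rule integrable_continuous_real)
  show ?thesis unfolding avg_def by (rule integral_diff[OF i[OF assms(1)] i[OF assms(2)]])
qed

lemma neumann_data_unique:
  assumes a1: "asymptotically_admissible g h1" and p1: "has_period h1 S"
    and a2: "asymptotically_admissible g h2" and p2: "has_period h2 T" and t: "t \<ge> 0"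
  shows "h1 t = h2 t"
proof -
  obtain u1 where u1: "schroedinger_solution u1" "(\<lambda>t. u1 0 t - g t) \<in> schwartz_halfline"
    "(\<lambda>t. partial_x u1 0 t - h1 t) \<in> O[at_top](\<lambda>t. of_real (t powr (-3/2)))"
    using a1 unfolding asymptotically_admissible_def by blast
  obtain u2 where u2: "schroedinger_solution u2" "(\<lambda>t. u2 0 t - g t) \<in> schwartz_halfline"
    "(\<lambda>t. partial_x u2 0 t - h2 t) \<in> O[at_top](\<lambda>t. of_real (t powr (-3/2)))"
    using a2 unfolding asymptotically_admissible_def by blast
  have c: "continuous_on {0..} h1" "continuous_on {0..} h2"
    using a1 a2 smooth_halfline_continuous unfolding asymptotically_admissible_def by auto
  define z where "z x t = u1 x t - u2 x t" for x t
  define zx where "zx x t = partial_x u1 x t - partial_x u2 x t" for x t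
  define zxx where "zxx x t = partial_x (partial_x u1) x t - partial_x (partial_x u2) x t" for x t
  define zt where "zt x t = partial_t u1 x t - partial_t u2 x t" for x t
  have "schr z zx zxx zt"
    unfolding z_def[abs_def] zx_def[abs_def] zxx_def[abs_def] zt_def[abs_def]
    by (intro schr_diff schroedinger_solution_schr u1 u2)
  moreover have "\<exists>C. \<forall>x\<ge>0. (1 + x) * norm (z x t) \<le> C" if "t \<ge> 0" for t
  proof -
    have "(\<lambda>x. u1 x t) \<in> schwartz_halfline" "(\<lambda>x. u2 x t) \<in> schwartz_halfline"
      using u1(1) u2(1) that unfolding schroedinger_solution_def by auto
    from schwartz_halfline_diff_decay[OF this, of 1] show ?thesis by (simp add: z_def)
  qed
  ultimately interpret decaying_schr z zx zxx zt
    by (auto simp: decaying_schr_def decaying_schr_axioms_def)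
  obtain A where "\<forall>t\<ge>0. (1 + t ^ 2) * norm ((u1 0 t - g t) - (u2 0 t - g t)) \<le> A"
    using schwartz_halfline_diff_decay[OF u1(2) u2(2)] by blast
  then have z0: "norm (z 0 t) \<le> A * inverse (1 + t\<^sup>2)" if "t \<ge> 0" for t
    using that unfolding z_def divide_inverse[symmetric]
    by (subst pos_le_divide_eq) (auto simp: add_pos_nonneg mult.commute)
  obtain c1 where c1: "\<forall>\<^sub>F t in at_top. norm (partial_x u1 0 t - h1 t) \<le> c1 * norm (complex_of_real (t powr (-3/2)))"
    using u1(3) by (elim landau_o.bigE)
  obtain c2 where c2: "\<forall>\<^sub>F t in at_top. norm (partial_x u2 0 t - h2 t) \<le> c2 * norm (complex_of_real (t powr (-3/2)))"
    using u2(3) by (elim landau_o.bigE)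
  \<comment> \<open>The part of the Neumann value of \<open>z\<close> that the two periodic
    functions leave over.\<close>
  define r where "r t = zx 0 t - (h1 t - h2 t)" for t
  define C where "C = \<bar>c1\<bar> + \<bar>c2\<bar>"
  have C: "C \<ge> 0" by (simp add: C_def)
  have "\<forall>\<^sub>F t in at_top. t \<ge> 1 \<and> norm (r t) \<le> C / t"
    using c1 c2 eventually_ge_at_top[of 1]
  proof eventually_elim
    case (elim t)
    \<comment> \<open>Only the rate \<open>1 / t\<close> is kept, which is square integrable at
      infinity.\<close>
    have "t powr (-3/2) \<le> t powr (-1)" using elim by (intro powr_mono) auto
    also have "\<dots> = 1 / t" using elim by (simp add: powr_minus_divide)
    finally have p: "norm (complex_of_real (t powr (-3/2))) \<le> 1 / t" by simp
    have "r t = (partial_x u1 0 t - h1 t) - (partial_x u2 0 t - h2 t)" by (simp add: r_def zx_def)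
    then have "norm (r t) \<le> norm (partial_x u1 0 t - h1 t) + norm (partial_x u2 0 t - h2 t)"
      by (metis norm_triangle_ineq4)
    also have "\<dots> \<le> c1 * norm (complex_of_real (t powr (-3/2))) + c2 * norm (complex_of_real (t powr (-3/2)))"
      using elim by (intro add_mono) auto
    also have "\<dots> \<le> \<bar>c1\<bar> * (1 / t) + \<bar>c2\<bar> * (1 / t)"
      using p by (intro add_mono mult_mono) auto
    also have "\<dots> = C / t" by (simp add: C_def add_divide_distrib)
    finally show ?case using elim by simp
  qed
  then obtain T0 where T0': "\<And>t. t \<ge> T0 \<Longrightarrow> t \<ge> 1 \<and> norm (r t) \<le> C / t"
    unfolding eventually_at_top_linorder by blast
  have T0: "T0 \<ge> 1" using T0'[of T0] by simp
  have r: "norm (r t) \<le> C / s" if "s \<ge> T0" "t \<ge> s" for s t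
  proof -
    have "norm (r t) \<le> C / t" using T0'[of t] that by auto
    also have "\<dots> \<le> C / s" using that T0 C by (intro divide_left_mono) auto
    finally show ?thesis .
  qed
  have czx0: "continuous_on {0..} (zx 0)" using qcont_t[OF czx order_refl] by simp
  have cr: "continuous_on {0..} r" unfolding r_def by (intro continuous_intros czx0 c)
  obtain B where B: "\<And>t. t \<ge> 0 \<Longrightarrow> norm (zx 0 t) \<le> B"
  proof -
    obtain B1 where B1: "\<forall>t\<ge>0. norm (h1 t) \<le> B1" using has_period_bounded[OF p1 c(1)] unfolding bounded_iff by auto
    obtain B2 where B2: "\<forall>t\<ge>0. norm (h2 t) \<le> B2" using has_period_bounded[OF p2 c(2)] unfolding bounded_iff by auto
    have "bounded (r ` {0..T0})" by (intro compact_imp_bounded compact_continuous_image continuous_on_subset[OF cr]) auto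
    then obtain B3 where B3: "\<forall>t\<in>{0..T0}. norm (r t) \<le> B3" unfolding bounded_iff by auto
    have "norm (zx 0 t) \<le> (B1 + B2) + (\<bar>B3\<bar> + C / T0)" if t: "t \<ge> 0" for t
    proof -
      have "norm (r t) \<le> \<bar>B3\<bar> + C / T0"
      proof (cases "t \<le> T0")
        case True
        then have "norm (r t) \<le> B3" using B3 t by auto
        moreover have "C / T0 \<ge> 0" using C T0 by simp
        ultimately show ?thesis by linarith
      next
        case False
        then show ?thesis using r[of T0 t] by simp
      qed
      moreover have "norm (h1 t - h2 t) \<le> B1 + B2"
        using norm_triangle_ineq4[of "h1 t" "h2 t"] B1 B2 t by (smt (verit))
      moreover have "norm (zx 0 t) \<le> norm (h1 t - h2 t) + norm (r t)"
        using norm_triangle_ineq[of "h1 t - h2 t" "r t"] by (simp add: r_def)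
      ultimately show ?thesis by linarith
    qed
    then show ?thesis using that by blast
  qed
  \<comment> \<open>The Neumann value is known to be square integrable only after averaging, so the
    periodic functions are compared after averaging as well; averaging keeps their periods.\<close>
  have avg_eq: "avg \<epsilon> (\<lambda>_. h1) 0 s = avg \<epsilon> (\<lambda>_. h2) 0 s" if \<epsilon>: "\<epsilon> > 0" and s: "s \<ge> 0" for \<epsilon> s
  proof -
    obtain N where N: "\<And>X. X \<ge> 0 \<Longrightarrow> integral {0..X} (\<lambda>t. (norm (avg \<epsilon> zx 0 t))\<^sup>2) \<le> N"
      using neumann_square_integrable[OF \<epsilon> z0 B] by blast
    have avg_zx: "avg \<epsilon> zx 0 = avg \<epsilon> (\<lambda>_. zx 0) 0" by (simp add: avg_def[abs_def])
    note ca = avg_continuous_t[OF _ \<epsilon>]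
    show ?thesis
    proof (rule periodic_difference_zero[OF has_period_avg[OF p1 \<epsilon>] ca[OF c(1) order_refl] has_period_avg[OF p2 \<epsilon>] ca[OF c(2) order_refl] _ _ s])
      show "T0 \<ge> 0" using T0 by simp
      fix X assume X: "X \<ge> T0"
      have "integral {T0..X} (\<lambda>t. (norm (avg \<epsilon> (\<lambda>_. h1) 0 t - avg \<epsilon> (\<lambda>_. h2) 0 t))\<^sup>2)
          = integral {T0..X} (\<lambda>t. (norm (avg \<epsilon> (\<lambda>_. zx 0) 0 t - avg \<epsilon> (\<lambda>_. r) 0 t))\<^sup>2)"
      proof (rule integral_cong)
        fix t assume "t \<in> {T0..X}"
        then have t: "t \<ge> 0" using T0 by simp
        have "avg \<epsilon> (\<lambda>_. h1) 0 t - avg \<epsilon> (\<lambda>_. h2) 0 t = avg \<epsilon> (\<lambda>_ t. h1 t - h2 t) 0 t"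
          by (rule avg_diff[OF c \<epsilon> t, symmetric])
        also have "(\<lambda>_ t. h1 t - h2 t) = (\<lambda>_ t. zx 0 t - r t)" by (simp add: r_def)
        also have "avg \<epsilon> (\<lambda>_ t. zx 0 t - r t) 0 t = avg \<epsilon> (\<lambda>_. zx 0) 0 t - avg \<epsilon> (\<lambda>_. r) 0 t"
          by (rule avg_diff[OF czx0 cr \<epsilon> t])
        finally show "(norm (avg \<epsilon> (\<lambda>_. h1) 0 t - avg \<epsilon> (\<lambda>_. h2) 0 t))\<^sup>2
            = (norm (avg \<epsilon> (\<lambda>_. zx 0) 0 t - avg \<epsilon> (\<lambda>_. r) 0 t))\<^sup>2" by simp
      qed
      also have "\<dots> \<le> 2 * integral {T0..X} (\<lambda>t. (norm (avg \<epsilon> (\<lambda>_. zx 0) 0 t))\<^sup>2) + 2 * integral {T0..X} (\<lambda>t. (norm (avg \<epsilon> (\<lambda>_. r) 0 t))\<^sup>2)"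
        using T0 by (intro integral_square_diff_le ca czx0 cr) auto
      also have "integral {T0..X} (\<lambda>t. (norm (avg \<epsilon> (\<lambda>_. zx 0) 0 t))\<^sup>2) \<le> N"
      proof -
        have "integral {T0..X} (\<lambda>t. (norm (avg \<epsilon> (\<lambda>_. zx 0) 0 t))\<^sup>2) \<le> integral {0..X} (\<lambda>t. (norm (avg \<epsilon> (\<lambda>_. zx 0) 0 t))\<^sup>2)"
          using T0 X by (intro integral_subset_le integrable_continuous_real continuous_on_power continuous_on_norm ca czx0) auto
        also have "\<dots> \<le> N" using N[of X] X T0 by (simp add: avg_zx)
        finally show ?thesis .
      qed
      also have "integral {T0..X} (\<lambda>t. (norm (avg \<epsilon> (\<lambda>_. r) 0 t))\<^sup>2) \<le> integral {T0..X} (\<lambda>t. (2 * C\<^sup>2) * inverse (1 + t\<^sup>2))"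
      proof (rule integral_le)
        show "(\<lambda>t. (norm (avg \<epsilon> (\<lambda>_. r) 0 t))\<^sup>2) integrable_on {T0..X}"
          using T0 by (intro integrable_continuous_real continuous_on_power continuous_on_norm ca cr) auto
        show "(\<lambda>t. (2 * C\<^sup>2) * inverse (1 + t\<^sup>2)) integrable_on {T0..X}"
          by (intro integrable_on_mult_right integrable_continuous_real continuous_intros) (auto simp: add_nonneg_eq_0_iff)
        fix t assume t: "t \<in> {T0..X}"
        then have t0: "t \<ge> 1" using T0 by simp
        have "norm (avg \<epsilon> (\<lambda>_. r) 0 t) \<le> integral {0..1} (\<lambda>s::real. C / t)"
          unfolding avg_def
        proof (rule integral_norm_bound_integral)
          show "(\<lambda>s. r (t + \<epsilon> * s)) integrable_on {0..1}"
            using avg_integrand_continuous[OF qcont_time_function[OF cr] less_imp_le[OF \<epsilon>] order_refl, of t] t0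
            by (auto intro: integrable_continuous_real)
          fix s :: real assume "s \<in> {0..1}"
          then show "norm (r (t + \<epsilon> * s)) \<le> C / t" using t \<epsilon> by (intro r) auto
        qed (rule integrable_const_ivl)
        then have "(norm (avg \<epsilon> (\<lambda>_. r) 0 t))\<^sup>2 \<le> (C / t)\<^sup>2" by (intro power_mono) auto
        also have "\<dots> = C\<^sup>2 * (1 / t\<^sup>2)" by (simp add: power_divide)
        also have "\<dots> \<le> C\<^sup>2 * (2 * inverse (1 + t\<^sup>2))"
        proof (rule mult_left_mono)
          have "1 + t\<^sup>2 \<le> 2 * t\<^sup>2" using t0 by (simp add: one_le_power)
          moreover have "t\<^sup>2 > 0" "1 + t\<^sup>2 > 0" using t0 by (auto simp: add_pos_nonneg)
          ultimately show "1 / t\<^sup>2 \<le> 2 * inverse (1 + t\<^sup>2)" by (simp add: divide_simps)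
        qed simp
        finally show "(norm (avg \<epsilon> (\<lambda>_. r) 0 t))\<^sup>2 \<le> (2 * C\<^sup>2) * inverse (1 + t\<^sup>2)" by simp
      qed
      also have "integral {T0..X} (\<lambda>t. (2 * C\<^sup>2) * inverse (1 + t\<^sup>2)) \<le> (2 * C\<^sup>2) * 2"
      proof -
        have "integral {T0..X} (\<lambda>t. (2 * C\<^sup>2) * inverse (1 + t\<^sup>2)) \<le> integral {0..X} (\<lambda>t. (2 * C\<^sup>2) * inverse (1 + t\<^sup>2))"
          using T0 by (intro integral_subset_le integrable_on_mult_right integrable_continuous_real continuous_intros)
            (auto simp: add_nonneg_eq_0_iff)
        also have "\<dots> = (2 * C\<^sup>2) * integral {0..X} (\<lambda>t. inverse (1 + t\<^sup>2))" by (rule integral_mult_right)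
        also have "\<dots> \<le> (2 * C\<^sup>2) * 2" using X T0 by (intro mult_left_mono integral_inverse_square_le) auto
        finally show ?thesis .
      qed
      finally show "integral {T0..X} (\<lambda>t. (norm (avg \<epsilon> (\<lambda>_. h1) 0 t - avg \<epsilon> (\<lambda>_. h2) 0 t))\<^sup>2) \<le> 2 * N + 2 * ((2 * C\<^sup>2) * 2)"
        by simp
    qed
  qed
  \<comment> \<open>As the averaging window shrinks, the averages converge to the functions
    themselves.\<close>
  have "norm (h1 t - h2 t) \<le> 0 + e" if e: "e > 0" for e
  proof -
    have q: "qcont (\<lambda>_ t. h1 t - h2 t)" by (intro qcont_time_function continuous_intros c)
    obtain \<epsilon> where \<epsilon>: "\<epsilon> > 0" "\<forall>x\<in>{0..0}. \<forall>s\<in>{0..t}. norm (avg \<epsilon> (\<lambda>_ t. h1 t - h2 t) x s - (h1 s - h2 s)) \<le> e"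
      using avg_uniform_approx[OF q e, of 0 t] by (meson less_imp_le order_refl)
    have "avg \<epsilon> (\<lambda>_ t. h1 t - h2 t) 0 t = 0"
      unfolding avg_diff[OF c \<epsilon>(1) t] using avg_eq[OF \<epsilon>(1) t] by simp
    then show ?thesis using \<epsilon>(2)[rule_format, of 0 t] t by (simp add: norm_minus_commute)
  qed
  then have "norm (h1 t - h2 t) \<le> 0" by (rule field_le_epsilon)
  then show ?thesis by simp
qed

section \<open>Superpositions of plane waves\<close>

lemma tendsto_lebesgue_integral_at_within:
  fixes f :: "'p::metric_space \<Rightarrow> 'a \<Rightarrow> complex"
  assumes "r > 0" and "integrable M B" and "f p \<in> borel_measurable M"
    and meas: "\<And>q. q \<in> S - {p} \<Longrightarrow> f q \<in> borel_measurable M"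
    and lim: "\<And>s. s \<in> space M \<Longrightarrow> ((\<lambda>q. f q s) \<longlongrightarrow> f p s) (at p within S)"
    and bound: "\<And>q s. q \<in> S - {p} \<Longrightarrow> dist q p < r \<Longrightarrow> s \<in> space M \<Longrightarrow> norm (f q s) \<le> B s"
  shows "((\<lambda>q. \<integral>s. f q s \<partial>M) \<longlongrightarrow> (\<integral>s. f p s \<partial>M)) (at p within S)"
  unfolding tendsto_at_iff_sequentially
proof (intro allI impI)
  fix X :: "nat \<Rightarrow> 'p"
  assume X: "\<forall>i. X i \<in> S - {p}" "X \<longlonglongrightarrow> p"
  obtain N where N: "\<And>n. n \<ge> N \<Longrightarrow> dist (X n) p < r"
    using X(2) \<open>r > 0\<close> unfolding lim_sequentially by blast
  have "(\<lambda>n. \<integral>s. f (X (n + N)) s \<partial>M) \<longlonglongrightarrow> (\<integral>s. f p s \<partial>M)"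
  proof (rule integral_dominated_convergence[where w = B])
    show "AE s in M. (\<lambda>n. f (X (n + N)) s) \<longlonglongrightarrow> f p s"
    proof (rule AE_I2)
      fix s assume "s \<in> space M"
      from lim[OF this] X have "(\<lambda>n. f (X n) s) \<longlonglongrightarrow> f p s"
        unfolding tendsto_at_iff_sequentially by (auto simp: o_def)
      then show "(\<lambda>n. f (X (n + N)) s) \<longlonglongrightarrow> f p s"
        by (rule LIMSEQ_ignore_initial_segment)
    qed
    show "\<And>n. AE s in M. norm (f (X (n + N)) s) \<le> B s"
      using X N bound by (intro AE_I2) auto
  qed (use assms X in auto)
  then show "((\<lambda>q. \<integral>s. f q s \<partial>M) \<circ> X) \<longlonglongrightarrow> (\<integral>s. f p s \<partial>M)"
    unfolding o_def by (rule LIMSEQ_offset)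
qed

lemma has_vector_derivative_iff_tendsto:
  fixes f :: "real \<Rightarrow> 'a::real_normed_vector"
  shows "(f has_vector_derivative D) (at p within S) \<longleftrightarrow>
    ((\<lambda>q. (f q - f p) /\<^sub>R (q - p)) \<longlongrightarrow> D) (at p within S)"
proof -
  define G where "G q = (1 / norm (q - p)) *\<^sub>R (f q - (f p + (q - p) *\<^sub>R D))" for q
  have eq: "norm (G q) = norm ((f q - f p) /\<^sub>R (q - p) - D)" if "q \<noteq> p" for q
  proof -
    have "(f q - f p) /\<^sub>R (q - p) - D = (f q - (f p + (q - p) *\<^sub>R D)) /\<^sub>R (q - p)"
      using that by (simp add: scaleR_diff_right diff_diff_add[symmetric])
    then show ?thesis by (simp add: G_def divide_simps)
  qed
  have "(f has_vector_derivative D) (at p within S) \<longleftrightarrow> (G \<longlongrightarrow> 0) (at p within S)"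
    unfolding has_vector_derivative_def has_derivative_within G_def
    by (simp add: bounded_linear_scaleR_left)
  also have "\<dots> \<longleftrightarrow> ((\<lambda>q. norm (G q)) \<longlongrightarrow> 0) (at p within S)"
    by (simp add: tendsto_norm_zero_iff)
  also have "\<dots> \<longleftrightarrow> ((\<lambda>q. norm ((f q - f p) /\<^sub>R (q - p) - D)) \<longlongrightarrow> 0) (at p within S)"
    by (rule filterlim_cong) (auto simp: eventually_at_filter eq)
  also have "\<dots> \<longleftrightarrow> ((\<lambda>q. (f q - f p) /\<^sub>R (q - p)) \<longlongrightarrow> D) (at p within S)"
    by (simp only: tendsto_norm_zero_iff Lim_null[where l = D])
  finally show ?thesis .
qed

lemma norm_difference_quotient_le:
  fixes f :: "real \<Rightarrow> 'a::real_normed_vector"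
  assumes "convex S" "p \<in> S" "q \<in> S" "q \<noteq> p"
    and "\<And>x. x \<in> S \<Longrightarrow> (f has_vector_derivative f' x) (at x within S)"
    and "\<And>x. x \<in> S \<Longrightarrow> norm (f' x) \<le> C"
  shows "norm ((f q - f p) /\<^sub>R (q - p)) \<le> C"
proof -
  have "norm (f q - f p) \<le> C * norm (q - p)"
  proof (rule differentiable_bound[OF \<open>convex S\<close>])
    fix x assume "x \<in> S"
    then show "(f has_derivative (\<lambda>h. h *\<^sub>R f' x)) (at x within S)"
      using assms(5) by (simp add: has_vector_derivative_def)
    show "onorm (\<lambda>h. h *\<^sub>R f' x) \<le> C"
      using assms(6)[OF \<open>x \<in> S\<close>] by (intro onorm_le) (simp add: mult.commute[of C] mult_left_mono)
  qed (use assms in auto)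
  moreover have "norm ((f q - f p) /\<^sub>R (q - p)) = norm (f q - f p) / norm (q - p)"
    by (simp add: divide_inverse_commute)
  ultimately show ?thesis using \<open>q \<noteq> p\<close> by (simp add: pos_divide_le_eq)
qed

text \<open>The measure is arbitrary because the lemma serves Lebesgue integrals and, with the
  counting measure, sums over modes. By the mean value inequality the bound on the derivative near
  \<open>p\<close> is also a majorant of the difference quotients.\<close>

lemma has_vector_derivative_lebesgue_integral:
  fixes f :: "real \<Rightarrow> 'a \<Rightarrow> complex"
  assumes "convex S" "p \<in> S" "r > 0" and B: "integrable M B"
    and int: "\<And>q. q \<in> S \<Longrightarrow> integrable M (f q)"
    and meas: "f' p \<in> borel_measurable M"
    and der: "\<And>q s. q \<in> S \<Longrightarrow> s \<in> space M \<Longrightarrow>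
      ((\<lambda>q. f q s) has_vector_derivative f' q s) (at q within S)"
    and bound: "\<And>q s. q \<in> S \<Longrightarrow> dist q p < r \<Longrightarrow> s \<in> space M \<Longrightarrow> norm (f' q s) \<le> B s"
  shows "((\<lambda>q. \<integral>s. f q s \<partial>M) has_vector_derivative (\<integral>s. f' p s \<partial>M)) (at p within S)"
  unfolding has_vector_derivative_iff_tendsto
proof -
  \<comment> \<open>The difference quotient, continued by the derivative at \<open>p\<close>:
    differentiability of the integral becomes continuity of a dominated integral.\<close>
  define h where "h = (\<lambda>q s. if q = p then f' p s else (f q s - f p s) /\<^sub>R (q - p))"
  have "((\<lambda>q. \<integral>s. h q s \<partial>M) \<longlongrightarrow> (\<integral>s. h p s \<partial>M)) (at p within S)"
  proof (rule tendsto_lebesgue_integral_at_within[OF \<open>r > 0\<close> B])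
    show "h p \<in> borel_measurable M"
      using meas by (simp add: h_def)
    show "h q \<in> borel_measurable M" if "q \<in> S - {p}" for q
    proof -
      have [measurable]: "f q \<in> borel_measurable M" "f p \<in> borel_measurable M"
        using int that \<open>p \<in> S\<close> by auto
      show ?thesis using that by (auto simp: h_def)
    qed
    show "((\<lambda>q. h q s) \<longlongrightarrow> h p s) (at p within S)" if "s \<in> space M" for s
    proof -
      have "((\<lambda>q. (f q s - f p s) /\<^sub>R (q - p)) \<longlongrightarrow> f' p s) (at p within S)"
        using der[OF \<open>p \<in> S\<close> that] unfolding has_vector_derivative_iff_tendsto .
      then have "((\<lambda>q. h q s) \<longlongrightarrow> f' p s) (at p within S)"
        by (rule Lim_transform_eventually) (auto simp: eventually_at_filter h_def)
      then show ?thesis by (simp add: h_def)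
    qed
    show "norm (h q s) \<le> B s" if q: "q \<in> S - {p}" "dist q p < r" and s: "s \<in> space M" for q s
    proof -
      have "norm ((f q s - f p s) /\<^sub>R (q - p)) \<le> B s"
      proof (rule norm_difference_quotient_le[where S = "S \<inter> ball p r" and f = "\<lambda>q. f q s"])
        show "convex (S \<inter> ball p r)" using \<open>convex S\<close> by (intro convex_Int convex_ball)
        show "((\<lambda>q. f q s) has_vector_derivative f' x s) (at x within S \<inter> ball p r)"
          if "x \<in> S \<inter> ball p r" for x
          using der[of x s] that s by (auto intro: has_vector_derivative_within_subset)
      qed (use assms q s in \<open>auto simp: dist_commute\<close>)
      then show ?thesis using q by (simp add: h_def)
    qed
  qed
  then have "((\<lambda>q. \<integral>s. h q s \<partial>M) \<longlongrightarrow> (\<integral>s. f' p s \<partial>M)) (at p within S)"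
    by (simp add: h_def)
  then show "((\<lambda>q. ((\<integral>s. f q s \<partial>M) - (\<integral>s. f p s \<partial>M)) /\<^sub>R (q - p)) \<longlongrightarrow> (\<integral>s. f' p s \<partial>M)) (at p within S)"
  proof (rule Lim_transform_eventually)
    show "\<forall>\<^sub>F q in at p within S. (\<integral>s. h q s \<partial>M) = ((\<integral>s. f q s \<partial>M) - (\<integral>s. f p s \<partial>M)) /\<^sub>R (q - p)"
      using int \<open>p \<in> S\<close> by (auto simp: eventually_at_filter h_def intro!: always_eventually)
  qed
qed

section \<open>The weighted superpositions and their decay\<close>

definition weight :: "int \<Rightarrow> real \<Rightarrow> real" where
  "weight m s = exp (of_int m * s - exp s - exp (- s))"

lemma weight_pos: "weight m s > 0"
  by (simp add: weight_def)

text \<open>In \<open>k = exp s\<close> the weight is \<open>k ^ m exp (- k - 1 / k)\<close>, small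
  beyond all powers at both ends, so every integer \<open>m\<close> is admissible and multiplication
  by \<open>k\<close> or \<open>1 / k\<close> only shifts the index. This keeps all derivatives of
  \<open>wave\<close> within one family.\<close>

lemma weight_shift: "exp s * weight m s = weight (m + 1) s" "exp (- s) * weight m s = weight (m - 1) s"
  "exp (2 * s) * weight m s = weight (m + 2) s"
  by (simp_all add: weight_def exp_add[symmetric] algebra_simps)

lemma weight_measurable [measurable]: "weight m \<in> borel_measurable borel"
  unfolding weight_def[abs_def] by measurable

text \<open>From \<open>exp s + exp (- s) \<ge> s\<^sup>2 / 2\<close> and
  \<open>m s \<le> m\<^sup>2 + s\<^sup>2 / 4\<close> a Gaussian remains, which is weakened to a
  multiple of the integrable function that serves as majorant throughout.\<close>

lemma weight_le: "weight m s \<le> 4 * exp ((of_int m)\<^sup>2) * inverse (1 + s\<^sup>2)"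
proof -
  have "exp \<bar>s\<bar> \<ge> 1 + \<bar>s\<bar> + \<bar>s\<bar>\<^sup>2 / 2"
    by (rule exp_lower_Taylor_quadratic) simp
  moreover have "exp s + exp (- s) \<ge> exp \<bar>s\<bar>"
    by (cases "s \<ge> 0") auto
  ultimately have 1: "exp s + exp (- s) \<ge> s\<^sup>2 / 2" by simp
  have "0 \<le> (of_int m - s / 2)\<^sup>2" by simp
  then have "of_int m * s \<le> (of_int m)\<^sup>2 + s\<^sup>2 / 4"
    by (simp add: power2_eq_square field_simps)
  with 1 have "weight m s \<le> exp ((of_int m)\<^sup>2 - s\<^sup>2 / 4)"
    unfolding weight_def by (subst exp_le_cancel_iff) linarith
  also have "\<dots> = exp ((of_int m)\<^sup>2) * inverse (exp (s\<^sup>2 / 4))"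
    by (simp only: exp_diff divide_inverse)
  also have "\<dots> \<le> exp ((of_int m)\<^sup>2) * inverse (1 + s\<^sup>2 / 4)"
    by (intro mult_left_mono le_imp_inverse_le) (auto intro: add_pos_nonneg)
  also have "\<dots> \<le> exp ((of_int m)\<^sup>2) * (4 * inverse (1 + s\<^sup>2))"
    by (intro mult_left_mono) (auto simp: field_simps add_pos_nonneg)
  finally show ?thesis by simp
qed

lemma integrable_inverse_1_plus_square_lborel: "integrable lborel (\<lambda>x::real. inverse (1 + x\<^sup>2))"
  using integrable_inverse_1_plus_square by (simp add: set_integrable_def)

lemma weight_integrable: "integrable lborel (weight m)"
proof (rule Bochner_Integration.integrable_bound)
  show "integrable lborel (\<lambda>s. 4 * exp ((of_int m)\<^sup>2) * inverse (1 + s\<^sup>2) :: real)"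
    using integrable_inverse_1_plus_square_lborel by (rule integrable_mult_right)
  show "AE s in lborel. norm (weight m s) \<le> norm (4 * exp ((of_int m)\<^sup>2) * inverse (1 + s\<^sup>2) :: real)"
    using weight_le[of m] abs_of_pos[OF weight_pos[of m]] by (auto intro!: AE_I2 order_trans[OF _ abs_ge_self])
qed simp

lemma weight_deriv:
  "(weight m has_real_derivative (of_int m * weight m s - weight (m + 1) s + weight (m - 1) s)) (at s)"
proof -
  have "(weight m has_real_derivative weight m s * (of_int m - exp s + exp (- s))) (at s)"
    unfolding weight_def[abs_def] by (auto intro!: derivative_eq_intros)
  moreover have "weight m s * (of_int m - exp s + exp (- s))
      = of_int m * weight m s - exp s * weight m s + exp (- s) * weight m s"
    by (simp add: algebra_simps)
  ultimately show ?thesis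
    by (simp only: weight_shift)
qed

definition plane_wave :: "real \<Rightarrow> real \<Rightarrow> real \<Rightarrow> complex" where
  "plane_wave x t s = cis (exp s * x - exp (2 * s) * t)"

text \<open>With \<open>k = exp s\<close>, \<open>wave m x t\<close> is the integral of \<open>k ^ (m - 1) exp (- k - 1 / k) exp (i k x - i k\<^sup>2 t)\<close>
  over \<open>k > 0\<close>; the weight vanishes to infinite order at \<open>k = 0\<close>, the only stationary point of the
  phase at \<open>x = 0\<close>.\<close>

definition wave :: "int \<Rightarrow> real \<Rightarrow> real \<Rightarrow> complex" where
  "wave m x t = (\<integral>s. weight m s *\<^sub>R plane_wave x t s \<partial>lborel)"

lemma norm_plane_wave [simp]: "norm (plane_wave x t s) = 1"
  by (simp add: plane_wave_def)

lemma cis_measurable [measurable]: "cis \<in> borel_measurable borel"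
  by (intro borel_measurable_continuous_onI continuous_intros)

lemma plane_wave_measurable [measurable]: "plane_wave x t \<in> borel_measurable borel"
  unfolding plane_wave_def[abs_def] by measurable

lemma wave_integrable: "integrable lborel (\<lambda>s. weight m s *\<^sub>R plane_wave x t s)"
  by (rule Bochner_Integration.integrable_bound[OF weight_integrable[of m]]) auto

lemma norm_wave_le: "norm (wave m x t) \<le> (\<integral>s. weight m s \<partial>lborel)"
  unfolding wave_def using wave_integrable
  by (intro order_trans[OF integral_norm_bound]) (simp add: abs_of_pos[OF weight_pos])

lemma has_vector_derivative_cis:
  assumes "(g has_real_derivative g') (at s within S)"
  shows "((\<lambda>s. cis (g s)) has_vector_derivative \<i> * of_real g' * cis (g s)) (at s within S)"
  using has_derivative_cis[OF assms[unfolded has_field_derivative_def]]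
  unfolding has_vector_derivative_def by (simp add: scaleR_conv_of_real mult_ac)

lemma plane_wave_has_vector_derivative:
  "((\<lambda>x. plane_wave x t s) has_vector_derivative \<i> * exp s * plane_wave x t s) (at x within S)"
  "((\<lambda>t. plane_wave x t s) has_vector_derivative - \<i> * exp (2 * s) * plane_wave x t s) (at t within T)"
  "((\<lambda>s. plane_wave x t s) has_vector_derivative \<i> * (exp s * x - 2 * exp (2 * s) * t) * plane_wave x t s) (at s within U)"
proof -
  have "((\<lambda>x. exp s * x - exp (2 * s) * t) has_real_derivative exp s) (at x within S)"
    "((\<lambda>t. exp s * x - exp (2 * s) * t) has_real_derivative - exp (2 * s)) (at t within T)"
    "((\<lambda>s. exp s * x - exp (2 * s) * t) has_real_derivative exp s * x - 2 * exp (2 * s) * t) (at s within U)"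
    by (auto intro!: derivative_eq_intros)
  from this[THEN has_vector_derivative_cis] show
  "((\<lambda>x. plane_wave x t s) has_vector_derivative \<i> * exp s * plane_wave x t s) (at x within S)"
  "((\<lambda>t. plane_wave x t s) has_vector_derivative - \<i> * exp (2 * s) * plane_wave x t s) (at t within T)"
  "((\<lambda>s. plane_wave x t s) has_vector_derivative \<i> * (exp s * x - 2 * exp (2 * s) * t) * plane_wave x t s) (at s within U)"
    unfolding plane_wave_def by (simp_all add: mult_ac exp_of_real)
qed

lemma wave_has_vector_derivative_x:
  "((\<lambda>x. wave m x t) has_vector_derivative \<i> * wave (m + 1) x t) (at x within S)"
proof -
  have "((\<lambda>x. \<integral>s. weight m s *\<^sub>R plane_wave x t s \<partial>lborel) has_vector_derivative
      (\<integral>s. \<i> * (weight (m + 1) s *\<^sub>R plane_wave x t s) \<partial>lborel)) (at x within UNIV)"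
  proof (rule has_vector_derivative_lebesgue_integral[where r = 1 and B = "weight (m + 1)" and
        f' = "\<lambda>x s. \<i> * (weight (m + 1) s *\<^sub>R plane_wave x t s)"])
    fix q s
    have "((\<lambda>q. weight m s *\<^sub>R plane_wave q t s) has_vector_derivative weight m s *\<^sub>R (\<i> * exp s * plane_wave q t s)) (at q within UNIV)"
      by (rule bounded_linear.has_vector_derivative[OF bounded_linear_scaleR_right plane_wave_has_vector_derivative(1)])
    also have "weight m s *\<^sub>R (\<i> * exp s * plane_wave q t s) = \<i> * (weight (m + 1) s *\<^sub>R plane_wave q t s)"
      by (simp add: weight_shift[symmetric] scaleR_conv_of_real mult_ac)
    finally show "((\<lambda>q. weight m s *\<^sub>R plane_wave q t s) has_vector_derivative \<i> * (weight (m + 1) s *\<^sub>R plane_wave q t s)) (at q within UNIV)" .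
  qed (auto simp: weight_integrable wave_integrable norm_mult abs_of_pos[OF weight_pos])
  then have "((\<lambda>x. wave m x t) has_vector_derivative \<i> * wave (m + 1) x t) (at x)"
    by (simp only: wave_def integral_mult_right_zero)
  then show ?thesis by (rule has_vector_derivative_at_within)
qed

lemma wave_has_vector_derivative_t:
  "((\<lambda>t. wave m x t) has_vector_derivative - \<i> * wave (m + 2) x t) (at t within S)"
proof -
  have "((\<lambda>t. \<integral>s. weight m s *\<^sub>R plane_wave x t s \<partial>lborel) has_vector_derivative
      (\<integral>s. - \<i> * (weight (m + 2) s *\<^sub>R plane_wave x t s) \<partial>lborel)) (at t within UNIV)"
  proof (rule has_vector_derivative_lebesgue_integral[where r = 1 and B = "weight (m + 2)" and
        f' = "\<lambda>t s. - \<i> * (weight (m + 2) s *\<^sub>R plane_wave x t s)"])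
    fix q s
    have "((\<lambda>q. weight m s *\<^sub>R plane_wave x q s) has_vector_derivative weight m s *\<^sub>R (- \<i> * exp (2 * s) * plane_wave x q s)) (at q within UNIV)"
      by (rule bounded_linear.has_vector_derivative[OF bounded_linear_scaleR_right plane_wave_has_vector_derivative(2)])
    also have "weight m s *\<^sub>R (- \<i> * exp (2 * s) * plane_wave x q s) = - \<i> * (weight (m + 2) s *\<^sub>R plane_wave x q s)"
      by (simp add: weight_shift[symmetric] scaleR_conv_of_real mult_ac)
    finally show "((\<lambda>q. weight m s *\<^sub>R plane_wave x q s) has_vector_derivative - \<i> * (weight (m + 2) s *\<^sub>R plane_wave x q s)) (at q within UNIV)" .
  qed (auto simp: weight_integrable wave_integrable norm_mult abs_of_pos[OF weight_pos])
  then have "((\<lambda>t. wave m x t) has_vector_derivative - \<i> * wave (m + 2) x t) (at t)"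
    by (simp only: wave_def integral_mult_right_zero)
  then show ?thesis by (rule has_vector_derivative_at_within)
qed

lemma wave_continuous: "continuous_on S (\<lambda>(x, t). wave m x t)"
proof -
  have "continuous_on UNIV (\<lambda>p. \<integral>s. weight m s *\<^sub>R plane_wave (fst p) (snd p) s \<partial>lborel)"
    unfolding continuous_on_def
  proof
    fix p :: "real \<times> real"
    show "((\<lambda>p. \<integral>s. weight m s *\<^sub>R plane_wave (fst p) (snd p) s \<partial>lborel) \<longlongrightarrow>
        (\<integral>s. weight m s *\<^sub>R plane_wave (fst p) (snd p) s \<partial>lborel)) (at p within UNIV)"
    proof (rule tendsto_lebesgue_integral_at_within[where r = 1 and B = "weight m" and
          f = "\<lambda>p s. weight m s *\<^sub>R plane_wave (fst p) (snd p) s"])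
      show "((\<lambda>q. weight m s *\<^sub>R plane_wave (fst q) (snd q) s) \<longlongrightarrow> weight m s *\<^sub>R plane_wave (fst p) (snd p) s) (at p within UNIV)" for s
        unfolding plane_wave_def by (auto intro!: tendsto_intros tendsto_fst tendsto_snd tendsto_ident_at)
    qed (auto simp: weight_integrable abs_of_pos[OF weight_pos])
  qed
  then show ?thesis
    by (auto simp: wave_def case_prod_unfold intro: continuous_on_subset)
qed

text \<open>The derivative in \<open>s\<close> of the weight times the plane wave integrates to
  zero. Since the phase has derivative \<open>k x - 2 k\<^sup>2 t\<close>, this trades a factor
  \<open>x\<close> or \<open>t\<close> for a shift of the index; iterating it takes the place of
  repeated integration by parts.\<close>

lemma wave_recurrence:
  "of_int m * wave m x t - wave (m + 1) x t + wave (m - 1) x t + \<i> * x * wave (m + 1) x t - 2 * \<i> * t * wave (m + 2) x t = 0"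
proof -
  let ?F = "\<lambda>m s. weight m s *\<^sub>R plane_wave x t s"
  let ?f = "\<lambda>s. of_int m * ?F m s - ?F (m + 1) s + ?F (m - 1) s + \<i> * x * ?F (m + 1) s - 2 * \<i> * t * ?F (m + 2) s"
  have deriv: "(?F m has_vector_derivative ?f s) (at s)" for s
  proof -
    have "(?F m has_vector_derivative weight m s *\<^sub>R (\<i> * (exp s * x - 2 * exp (2 * s) * t) * plane_wave x t s)
        + (of_int m * weight m s - weight (m + 1) s + weight (m - 1) s) *\<^sub>R plane_wave x t s) (at s)"
      by (rule has_vector_derivative_scaleR[OF weight_deriv plane_wave_has_vector_derivative(3)])
    also have "weight m s *\<^sub>R (\<i> * (exp s * x - 2 * exp (2 * s) * t) * plane_wave x t s)
        + (of_int m * weight m s - weight (m + 1) s + weight (m - 1) s) *\<^sub>R plane_wave x t s = ?f s"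
      unfolding weight_shift[of s m, symmetric] by (simp add: scaleR_conv_of_real algebra_simps)
    finally show ?thesis .
  qed
  have cont: "isCont (?F k) s" for k s
    using has_vector_derivative_continuous[OF has_vector_derivative_scaleR[OF weight_deriv plane_wave_has_vector_derivative(3)]] .
  have lim0: "((\<lambda>s. 4 * exp ((real_of_int m)\<^sup>2) * inverse (1 + s\<^sup>2)) \<longlongrightarrow> 0) at_top"
    "((\<lambda>s. 4 * exp ((real_of_int m)\<^sup>2) * inverse (1 + s\<^sup>2)) \<longlongrightarrow> 0) at_bot"
  proof -
    have "filterlim (\<lambda>s::real. 1 + s\<^sup>2) at_top at_top" "filterlim (\<lambda>s::real. 1 + s\<^sup>2) at_top at_bot"
      by (intro filterlim_tendsto_add_at_top[OF tendsto_const] filterlim_pow_at_top filterlim_pow_at_bot_even filterlim_ident; simp)+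
    from this[THEN filterlim_compose[OF tendsto_inverse_0_at_top[OF filterlim_ident]]]
    show "((\<lambda>s. 4 * exp ((real_of_int m)\<^sup>2) * inverse (1 + s\<^sup>2)) \<longlongrightarrow> 0) at_top"
    "((\<lambda>s. 4 * exp ((real_of_int m)\<^sup>2) * inverse (1 + s\<^sup>2)) \<longlongrightarrow> 0) at_bot"
      by (auto intro!: tendsto_mult_right_zero)
  qed
  have lim: "(?F m \<longlongrightarrow> 0) at_top" "(?F m \<longlongrightarrow> 0) at_bot"
    using weight_le[of m] by (auto intro!: Lim_null_comparison[OF _ lim0(1)] Lim_null_comparison[OF _ lim0(2)] always_eventually
        simp: abs_of_pos[OF weight_pos])
  have int: "integrable lborel ?f"
    by (intro Bochner_Integration.integrable_add Bochner_Integration.integrable_diff integrable_mult_right wave_integrable)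
  have "(LBINT s=-\<infinity>..\<infinity>. ?f s) = 0 - 0"
  proof (rule interval_integral_FTC_integrable[where F = "?F m"])
    show "isCont ?f s" for s
      by (intro continuous_add continuous_diff continuous_mult continuous_const cont)
    show "set_integrable lborel (einterval (-\<infinity>) \<infinity>) ?f"
      using int by (simp add: set_integrable_def)
  qed (use deriv lim in \<open>auto simp: ereal_tendsto_simps\<close>)
  then have "integral\<^sup>L lborel ?f = 0"
    by (simp add: interval_lebesgue_integral_def set_lebesgue_integral_def)
  then show ?thesis
    by (simp only: wave_def Bochner_Integration.integral_add Bochner_Integration.integral_diff
      integral_mult_right_zero wave_integrable integrable_mult_right Bochner_Integration.integrable_add
      Bochner_Integration.integrable_diff)
qed

lemma norm_add_diff_le:
  fixes a b c :: "'a::real_normed_vector"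
  shows "norm (a - b + c) \<le> norm a + norm b + norm c"
  by (metis norm_triangle_le norm_triangle_ineq4 add_mono order_refl)

lemma norm_of_int_diff_mult:
  "norm ((of_int m - of_int k) * z :: complex) = \<bar>of_int m - of_int k\<bar> * norm z"
  by (simp only: norm_mult norm_of_int flip: of_int_diff)

text \<open>Solving the recurrence for \<open>x * wave m x t\<close> leaves a single term with a
  factor \<open>t\<close>, so each power of \<open>x\<close> costs at most one power of
  \<open>1 + \<bar>t\<bar>\<close>. The induction must allow all \<open>m\<close> because the
  indices move.\<close>

lemma wave_bound_x: "\<exists>C. \<forall>x t. \<bar>x\<bar> ^ j * norm (wave m x t) \<le> C * (1 + \<bar>t\<bar>) ^ j"
proof (induction j arbitrary: m)
  case 0
  show ?case using norm_wave_le[of m] by auto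
next
  case (Suc j)
  obtain C1 where C1: "\<And>x t. \<bar>x\<bar> ^ j * norm (wave (m - 1) x t) \<le> C1 * (1 + \<bar>t\<bar>) ^ j" using Suc by blast
  obtain C2 where C2: "\<And>x t. \<bar>x\<bar> ^ j * norm (wave m x t) \<le> C2 * (1 + \<bar>t\<bar>) ^ j" using Suc by blast
  obtain C3 where C3: "\<And>x t. \<bar>x\<bar> ^ j * norm (wave (m - 2) x t) \<le> C3 * (1 + \<bar>t\<bar>) ^ j" using Suc by blast
  obtain C4 where C4: "\<And>x t. \<bar>x\<bar> ^ j * norm (wave (m + 1) x t) \<le> C4 * (1 + \<bar>t\<bar>) ^ j" using Suc by blast
  let ?C = "\<bar>real_of_int m - 1\<bar> * C1 + C2 + C3 + 2 * C4"
  have "\<bar>x\<bar> ^ Suc j * norm (wave m x t) \<le> ?C * (1 + \<bar>t\<bar>) ^ Suc j" for x t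
  proof -
    have "\<i> * x * wave m x t = wave m x t - (of_int m - 1) * wave (m - 1) x t + (2 * \<i> * t * wave (m + 1) x t - wave (m - 2) x t)"
      using wave_recurrence[of "m - 1" x t] by (simp add: algebra_simps)
    then have "norm (\<i> * x * wave m x t) = norm (wave m x t - (of_int m - 1) * wave (m - 1) x t + (2 * \<i> * t * wave (m + 1) x t - wave (m - 2) x t))"
      by simp
    also have "\<dots> \<le> norm ((of_int m - 1) * wave (m - 1) x t) + norm (wave m x t) + norm (wave (m - 2) x t) + norm (2 * \<i> * t * wave (m + 1) x t)"
      by (rule order_trans[OF norm_add_diff_le]) (simp add: norm_triangle_le_diff)
    also have "norm ((of_int m - 1) * wave (m - 1) x t) = \<bar>real_of_int m - 1\<bar> * norm (wave (m - 1) x t)"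
      using norm_of_int_diff_mult[of m 1] by simp
    finally have "\<bar>x\<bar> * norm (wave m x t) \<le> \<bar>real_of_int m - 1\<bar> * norm (wave (m - 1) x t) + norm (wave m x t) + norm (wave (m - 2) x t)
        + 2 * \<bar>t\<bar> * norm (wave (m + 1) x t)"
      by (simp add: norm_mult)
    then have "\<bar>x\<bar> ^ j * (\<bar>x\<bar> * norm (wave m x t)) \<le> \<bar>x\<bar> ^ j * (\<bar>real_of_int m - 1\<bar> * norm (wave (m - 1) x t) + norm (wave m x t) + norm (wave (m - 2) x t)
        + 2 * \<bar>t\<bar> * norm (wave (m + 1) x t))"
      by (rule mult_left_mono) simp
    also have "\<dots> = \<bar>real_of_int m - 1\<bar> * (\<bar>x\<bar> ^ j * norm (wave (m - 1) x t)) + \<bar>x\<bar> ^ j * norm (wave m x t) + \<bar>x\<bar> ^ j * norm (wave (m - 2) x t)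
        + 2 * \<bar>t\<bar> * (\<bar>x\<bar> ^ j * norm (wave (m + 1) x t))"
      by (simp add: algebra_simps)
    also have "\<dots> \<le> \<bar>real_of_int m - 1\<bar> * (C1 * (1 + \<bar>t\<bar>) ^ j) + C2 * (1 + \<bar>t\<bar>) ^ j + C3 * (1 + \<bar>t\<bar>) ^ j
        + 2 * \<bar>t\<bar> * (C4 * (1 + \<bar>t\<bar>) ^ j)"
      by (intro add_mono mult_left_mono C1 C2 C3 C4) auto
    also have "\<dots> = (\<bar>real_of_int m - 1\<bar> * C1 + C2 + C3 + 2 * C4 * \<bar>t\<bar>) * (1 + \<bar>t\<bar>) ^ j"
      by (simp add: algebra_simps)
    also have "\<dots> \<le> (?C * (1 + \<bar>t\<bar>)) * (1 + \<bar>t\<bar>) ^ j"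
    proof (intro mult_right_mono)
      have "C1 \<ge> 0" "C2 \<ge> 0" "C3 \<ge> 0" "C4 \<ge> 0"
        using order_trans[OF _ C1[of 0 0]] order_trans[OF _ C2[of 0 0]] order_trans[OF _ C3[of 0 0]] order_trans[OF _ C4[of 0 0]]
        by (auto simp: zero_le_mult_iff)
      then show "\<bar>real_of_int m - 1\<bar> * C1 + C2 + C3 + 2 * C4 * \<bar>t\<bar> \<le> ?C * (1 + \<bar>t\<bar>)"
        by (simp add: algebra_simps add_nonneg_nonneg)
    qed simp
    finally show ?thesis by (simp add: mult_ac)
  qed
  then show ?case by blast
qed

text \<open>At \<open>x = 0\<close> the recurrence, solved for \<open>t * wave m 0 t\<close>, has
  constant coefficients. Each power of \<open>t\<close> lowers the index by at most
  \<open>3\<close>, which is harmless because the weight absorbs negative powers of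
  \<open>k\<close>; the stationary point of the phase thus contributes nothing.\<close>

lemma wave_bound_t: "\<exists>C. \<forall>t. \<bar>t\<bar> ^ j * norm (wave m 0 t) \<le> C"
proof (induction j arbitrary: m)
  case 0
  show ?case using norm_wave_le[of m] by auto
next
  case (Suc j)
  obtain C1 where C1: "\<And>t. \<bar>t\<bar> ^ j * norm (wave (m - 2) 0 t) \<le> C1" using Suc by blast
  obtain C2 where C2: "\<And>t. \<bar>t\<bar> ^ j * norm (wave (m - 1) 0 t) \<le> C2" using Suc by blast
  obtain C3 where C3: "\<And>t. \<bar>t\<bar> ^ j * norm (wave (m - 3) 0 t) \<le> C3" using Suc by blast
  let ?C = "\<bar>real_of_int m - 2\<bar> * C1 + C2 + C3"
  have "\<bar>t\<bar> ^ Suc j * norm (wave m 0 t) \<le> ?C" for t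
  proof -
    have "2 * \<i> * t * wave m 0 t = (of_int m - 2) * wave (m - 2) 0 t - wave (m - 1) 0 t + wave (m - 3) 0 t"
      using wave_recurrence[of "m - 2" 0 t] by (simp add: algebra_simps)
    then have "norm (2 * \<i> * t * wave m 0 t) = norm ((of_int m - 2) * wave (m - 2) 0 t - wave (m - 1) 0 t + wave (m - 3) 0 t)"
      by simp
    also have "\<dots> \<le> norm ((of_int m - 2) * wave (m - 2) 0 t) + norm (wave (m - 1) 0 t) + norm (wave (m - 3) 0 t)"
      by (rule norm_add_diff_le)
    also have "norm ((of_int m - 2) * wave (m - 2) 0 t) = \<bar>real_of_int m - 2\<bar> * norm (wave (m - 2) 0 t)"
      using norm_of_int_diff_mult[of m 2] by simp
    finally have "2 * (\<bar>t\<bar> * norm (wave m 0 t)) \<le> \<bar>real_of_int m - 2\<bar> * norm (wave (m - 2) 0 t) + norm (wave (m - 1) 0 t) + norm (wave (m - 3) 0 t)"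
      by (simp add: norm_mult)
    moreover have "0 \<le> \<bar>t\<bar> * norm (wave m 0 t)" by simp
    ultimately have "\<bar>t\<bar> * norm (wave m 0 t) \<le> \<bar>real_of_int m - 2\<bar> * norm (wave (m - 2) 0 t) + norm (wave (m - 1) 0 t) + norm (wave (m - 3) 0 t)"
      by linarith
    then have "\<bar>t\<bar> ^ j * (\<bar>t\<bar> * norm (wave m 0 t)) \<le> \<bar>t\<bar> ^ j * (\<bar>real_of_int m - 2\<bar> * norm (wave (m - 2) 0 t) + norm (wave (m - 1) 0 t) + norm (wave (m - 3) 0 t))"
      by (rule mult_left_mono) simp
    also have "\<dots> = \<bar>real_of_int m - 2\<bar> * (\<bar>t\<bar> ^ j * norm (wave (m - 2) 0 t)) + \<bar>t\<bar> ^ j * norm (wave (m - 1) 0 t) + \<bar>t\<bar> ^ j * norm (wave (m - 3) 0 t)"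
      by (simp add: algebra_simps)
    also have "\<dots> \<le> ?C"
      by (intro add_mono mult_left_mono C1 C2 C3) auto
    finally show ?thesis by (simp add: mult_ac)
  qed
  then show ?case by blast
qed

section \<open>The outgoing mode\<close>

text \<open>The bounds with \<open>j\<close> and with \<open>j + 2\<close> powers of
  \<open>x\<close> are added, which leaves an integrable factor.\<close>

lemma wave_decay:
  "\<exists>C\<ge>0. \<forall>x t. \<bar>x\<bar> ^ j * norm (wave m x t) \<le> C * (1 + \<bar>t\<bar>) ^ (j + 2) * inverse (1 + x\<^sup>2)"
proof -
  obtain C1 where C1: "\<And>x t. \<bar>x\<bar> ^ j * norm (wave m x t) \<le> C1 * (1 + \<bar>t\<bar>) ^ j"
    using wave_bound_x by blast
  obtain C2 where C2: "\<And>x t. \<bar>x\<bar> ^ (j + 2) * norm (wave m x t) \<le> C2 * (1 + \<bar>t\<bar>) ^ (j + 2)"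
    using wave_bound_x by blast
  have pos: "C1 \<ge> 0" "C2 \<ge> 0"
    using order_trans[OF _ C1[of 0 0]] order_trans[OF _ C2[of 0 0]] by auto
  show ?thesis
  proof (intro exI[of _ "C1 + C2"] conjI allI)
    show "C1 + C2 \<ge> 0" using pos by simp
    fix x t :: real
    have "(1 + x\<^sup>2) * (\<bar>x\<bar> ^ j * norm (wave m x t)) = \<bar>x\<bar> ^ j * norm (wave m x t) + \<bar>x\<bar> ^ (j + 2) * norm (wave m x t)"
      by (simp add: power_add power2_eq_square algebra_simps flip: abs_mult)
    also have "\<dots> \<le> C1 * (1 + \<bar>t\<bar>) ^ j + C2 * (1 + \<bar>t\<bar>) ^ (j + 2)"
      by (intro add_mono C1 C2)
    also have "\<dots> \<le> C1 * (1 + \<bar>t\<bar>) ^ (j + 2) + C2 * (1 + \<bar>t\<bar>) ^ (j + 2)"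
      using pos by (intro add_mono mult_left_mono power_increasing) auto
    finally have "(1 + x\<^sup>2) * (\<bar>x\<bar> ^ j * norm (wave m x t)) \<le> (C1 + C2) * (1 + \<bar>t\<bar>) ^ (j + 2)"
      by (simp add: algebra_simps)
    moreover have "1 + x\<^sup>2 > 0" by (simp add: add_pos_nonneg)
    ultimately show "\<bar>x\<bar> ^ j * norm (wave m x t) \<le> (C1 + C2) * (1 + \<bar>t\<bar>) ^ (j + 2) * inverse (1 + x\<^sup>2)"
      unfolding divide_inverse[symmetric] by (subst pos_le_divide_eq) (simp_all add: mult.commute)
  qed
qed

text \<open>Both \<open>x\<close> and \<open>y\<close> are at most \<open>x + y\<close>: the first
  inequality pays for the power of \<open>x\<close>, the second leaves a majorant that is integrable
  in \<open>y\<close> and independent of \<open>x\<close>.\<close>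

lemma wave_shift_decay:
  "\<exists>C\<ge>0. \<forall>x\<ge>0. \<forall>y\<ge>0. \<forall>t.
      x ^ j * norm (wave m (x + y) t) \<le> C * (1 + \<bar>t\<bar>) ^ (j + 2) * inverse (1 + y\<^sup>2)"
proof -
  obtain C where C: "C \<ge> 0"
    "\<And>x t. \<bar>x\<bar> ^ j * norm (wave m x t) \<le> C * (1 + \<bar>t\<bar>) ^ (j + 2) * inverse (1 + x\<^sup>2)"
    using wave_decay[of j "m"] by blast
  show ?thesis
  proof (intro exI[of _ C] conjI allI impI)
    show "C \<ge> 0" by fact
    fix x y t :: real assume xy: "x \<ge> 0" "y \<ge> 0"
    have "x ^ j * norm (wave m (x + y) t) \<le> \<bar>x + y\<bar> ^ j * norm (wave m (x + y) t)"
      using xy by (intro mult_right_mono power_mono) auto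
    also have "\<dots> \<le> C * (1 + \<bar>t\<bar>) ^ (j + 2) * inverse (1 + (x + y)\<^sup>2)"
      by (rule C)
    also have "\<dots> \<le> C * (1 + \<bar>t\<bar>) ^ (j + 2) * inverse (1 + y\<^sup>2)"
      using xy C(1) by (intro mult_left_mono le_imp_inverse_le add_mono power_mono)
        (auto intro: add_pos_nonneg)
    finally show "x ^ j * norm (wave m (x + y) t) \<le> C * (1 + \<bar>t\<bar>) ^ (j + 2) * inverse (1 + y\<^sup>2)" .
  qed
qed

lemma wave_shift_decay0:
  "\<exists>C\<ge>0. \<forall>x\<ge>0. \<forall>y\<ge>0. \<forall>t. norm (wave m (x + y) t) \<le> C * (1 + \<bar>t\<bar>)\<^sup>2 * inverse (1 + y\<^sup>2)"
  using wave_shift_decay[of 0 m] by (simp add: power2_eq_square)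

text \<open>Integrating the translates against \<open>cis (- y)\<close> inverts \<open>\<partial>\<^sub>x - i\<close> on functions decaying at infinity,
  so \<open>\<partial>\<^sub>x outgoing = i outgoing\<close> up to rapidly decaying terms. This makes the boundary trace of \<open>outgoing 1\<close>
  asymptotic to a multiple of \<open>cis (- t)\<close>.\<close>

definition outgoing :: "int \<Rightarrow> real \<Rightarrow> real \<Rightarrow> complex" where
  "outgoing m x t = (\<integral>y. indicator {0..} y *\<^sub>R (cis (- y) * wave m (x + y) t) \<partial>lborel)"

lemma wave_continuous_compose [continuous_intros]:
  assumes "continuous_on A f" "continuous_on A g"
  shows "continuous_on A (\<lambda>p. wave m (f p) (g p))"
  using continuous_on_compose2[OF wave_continuous[of UNIV m] continuous_on_Pair[OF assms]] by simp

lemma outgoing_integrand_measurable: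
  "(\<lambda>y. indicator {0..} y *\<^sub>R (cis (- y) * wave m (x + y) t)) \<in> borel_measurable lborel"
proof -
  have [measurable]: "(\<lambda>y. cis (- y) * wave m (x + y) t) \<in> borel_measurable borel"
    by (intro borel_measurable_continuous_onI continuous_intros)
  show ?thesis by measurable
qed

lemma integrable_const_inverse_1_plus_square: "integrable lborel (\<lambda>y::real. K * inverse (1 + y\<^sup>2) :: real)"
  by (intro integrable_mult_right integrable_inverse_1_plus_square_lborel)

lemma outgoing_integrable:
  assumes "x \<ge> 0"
  shows "integrable lborel (\<lambda>y. indicator {0..} y *\<^sub>R (cis (- y) * wave m (x + y) t))"
proof -
  obtain C where C: "C \<ge> 0"
    "\<And>x y t. x \<ge> 0 \<Longrightarrow> y \<ge> 0 \<Longrightarrow>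
      norm (wave m (x + y) t) \<le> C * (1 + \<bar>t\<bar>) \<^sup>2 * inverse (1 + y\<^sup>2)"
    using wave_shift_decay0[of "m"] by blast
  show ?thesis
  proof (rule Bochner_Integration.integrable_bound[OF integrable_const_inverse_1_plus_square[of "C * (1 + \<bar>t\<bar>)\<^sup>2"]])
    show "AE y in lborel. norm (indicator {0..} y *\<^sub>R (cis (- y) * wave m (x + y) t))
        \<le> norm (C * (1 + \<bar>t\<bar>)\<^sup>2 * inverse (1 + y\<^sup>2))"
    proof (rule AE_I2)
      fix y :: real
      show "norm (indicator {0..} y *\<^sub>R (cis (- y) * wave m (x + y) t))
        \<le> norm (C * (1 + \<bar>t\<bar>)\<^sup>2 * inverse (1 + y\<^sup>2))"
        using C(2)[OF assms, of y t]
        by (cases "y \<ge> 0") (auto simp: norm_mult intro: order_trans[OF _ abs_ge_self])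
    qed
  qed (rule outgoing_integrand_measurable)
qed

lemma outgoing_bound_x: "\<exists>C. \<forall>x\<ge>0. \<forall>t. x ^ j * norm (outgoing m x t) \<le> C * (1 + \<bar>t\<bar>) ^ (j + 2)"
proof -
  obtain C where C: "C \<ge> 0"
    "\<And>x y t. x \<ge> 0 \<Longrightarrow> y \<ge> 0 \<Longrightarrow>
      x ^ j * norm (wave m (x + y) t) \<le> C * (1 + \<bar>t\<bar>) ^ (j + 2) * inverse (1 + y\<^sup>2)"
    using wave_shift_decay[of j "m"] by blast
  have "x ^ j * norm (outgoing m x t) \<le> C * (\<integral>y. inverse (1 + y\<^sup>2) \<partial>lborel) * (1 + \<bar>t\<bar>) ^ (j + 2)"
    if "x \<ge> 0" for x t
  proof -
    have "x ^ j * norm (outgoing m x t) = norm (x ^ j *\<^sub>R outgoing m x t)"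
      using that by simp
    also have "x ^ j *\<^sub>R outgoing m x t = (\<integral>y. x ^ j *\<^sub>R (indicator {0..} y *\<^sub>R (cis (- y) * wave m (x + y) t)) \<partial>lborel)"
      unfolding outgoing_def by (rule integral_scaleR_right[symmetric])
    also have "norm \<dots> \<le> (\<integral>y. C * (1 + \<bar>t\<bar>) ^ (j + 2) * inverse (1 + y\<^sup>2) \<partial>lborel)"
    proof (rule Bochner_Integration.integral_norm_bound_integral)
      show "integrable lborel (\<lambda>y. x ^ j *\<^sub>R (indicator {0..} y *\<^sub>R (cis (- y) * wave m (x + y) t)))"
        using outgoing_integrable[OF that] by (rule integrable_scaleR_right)
      fix y :: real
      show "norm (x ^ j *\<^sub>R (indicator {0..} y *\<^sub>R (cis (- y) * wave m (x + y) t)))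
          \<le> C * (1 + \<bar>t\<bar>) ^ (j + 2) * inverse (1 + y\<^sup>2)"
        using C(2)[OF that, of y t] C(1) that
        by (cases "y \<ge> 0") (auto simp: norm_mult add_nonneg_nonneg)
    qed (rule integrable_const_inverse_1_plus_square)
    also have "\<dots> = C * (\<integral>y. inverse (1 + y\<^sup>2) \<partial>lborel) * (1 + \<bar>t\<bar>) ^ (j + 2)"
      by (subst integral_mult_right_zero) (simp only: mult_ac)
    finally show ?thesis .
  qed
  then show ?thesis by blast
qed

lemma outgoing_has_vector_derivative_x:
  assumes "x \<ge> 0"
  shows "((\<lambda>x. outgoing m x t) has_vector_derivative \<i> * outgoing (m + 1) x t) (at x within {0..})"
proof -
  obtain C where C: "C \<ge> 0"
    "\<And>x y t. x \<ge> 0 \<Longrightarrow> y \<ge> 0 \<Longrightarrow>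
      norm (wave (m + 1) (x + y) t) \<le> C * (1 + \<bar>t\<bar>) \<^sup>2 * inverse (1 + y\<^sup>2)"
    using wave_shift_decay0[of "m + 1"] by blast
  let ?f = "\<lambda>m x y. indicator {0..} y *\<^sub>R (cis (- y) * wave m (x + y) t)"
  have "((\<lambda>x. \<integral>y. ?f m x y \<partial>lborel) has_vector_derivative (\<integral>y. \<i> * ?f (m + 1) x y \<partial>lborel)) (at x within {0..})"
  proof (rule has_vector_derivative_lebesgue_integral[where r = 1 and
        B = "\<lambda>y. C * (1 + \<bar>t\<bar>)\<^sup>2 * inverse (1 + y\<^sup>2)" and f' = "\<lambda>x y. \<i> * ?f (m + 1) x y"])
    fix q y :: real assume "q \<in> {0..}"
    have "((\<lambda>q. wave m (q + y) t) has_vector_derivative 1 *\<^sub>R (\<i> * wave (m + 1) (q + y) t)) (at q within {0..})"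
      by (rule vector_diff_chain_within[where f = "\<lambda>q. q + y" and g = "\<lambda>x. wave m x t", unfolded o_def])
        (auto intro!: wave_has_vector_derivative_x derivative_eq_intros)
    then have "((\<lambda>q. ?f m q y) has_vector_derivative indicator {0..} y *\<^sub>R (cis (- y) * (1 *\<^sub>R (\<i> * wave (m + 1) (q + y) t)))) (at q within {0..})"
      by (intro bounded_linear.has_vector_derivative[OF bounded_linear_scaleR_right] has_vector_derivative_mult_right)
    then show "((\<lambda>q. ?f m q y) has_vector_derivative \<i> * ?f (m + 1) q y) (at q within {0..})"
      by (simp add: mult_ac)
    show "norm (\<i> * ?f (m + 1) q y) \<le> C * (1 + \<bar>t\<bar>)\<^sup>2 * inverse (1 + y\<^sup>2)"
      using C(2)[of q y t] C(1) \<open>q \<in> {0..}\<close>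
      by (cases "y \<ge> 0") (auto simp: norm_mult add_nonneg_nonneg)
  next
    show "(\<lambda>y. \<i> * ?f (m + 1) x y) \<in> borel_measurable lborel"
      using outgoing_integrand_measurable by measurable
  qed (use assms outgoing_integrable integrable_const_inverse_1_plus_square in auto)
  then show ?thesis by (simp only: outgoing_def integral_mult_right_zero)
qed

lemma outgoing_has_vector_derivative_t:
  assumes "x \<ge> 0"
  shows "((\<lambda>t. outgoing m x t) has_vector_derivative - \<i> * outgoing (m + 2) x t) (at t within S)"
proof -
  obtain C where C: "C \<ge> 0"
    "\<And>x y t. x \<ge> 0 \<Longrightarrow> y \<ge> 0 \<Longrightarrow>
      norm (wave (m + 2) (x + y) t) \<le> C * (1 + \<bar>t\<bar>) \<^sup>2 * inverse (1 + y\<^sup>2)"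
    using wave_shift_decay0[of "m + 2"] by blast
  let ?f = "\<lambda>m t y. indicator {0..} y *\<^sub>R (cis (- y) * wave m (x + y) t)"
  have "((\<lambda>t. \<integral>y. ?f m t y \<partial>lborel) has_vector_derivative (\<integral>y. - \<i> * ?f (m + 2) t y \<partial>lborel)) (at t within UNIV)"
  proof (rule has_vector_derivative_lebesgue_integral[where r = 1 and
        B = "\<lambda>y. C * (2 + \<bar>t\<bar>)\<^sup>2 * inverse (1 + y\<^sup>2)" and f' = "\<lambda>t y. - \<i> * ?f (m + 2) t y"])
    fix q y :: real
    have "((\<lambda>q. ?f m q y) has_vector_derivative indicator {0..} y *\<^sub>R (cis (- y) * (- \<i> * wave (m + 2) (x + y) q))) (at q within UNIV)"
      by (intro bounded_linear.has_vector_derivative[OF bounded_linear_scaleR_right] has_vector_derivative_mult_right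
          wave_has_vector_derivative_t)
    then show "((\<lambda>q. ?f m q y) has_vector_derivative - \<i> * ?f (m + 2) q y) (at q within UNIV)"
      by (simp add: mult_ac)
    \<comment> \<open>Domination is needed only for times at distance less than \<open>1\<close>
      from \<open>t\<close>, which explains \<open>2 + \<bar>t\<bar>\<close> in the
      majorant.\<close>
    assume "dist q t < 1"
    then have "(1 + \<bar>q\<bar>)\<^sup>2 \<le> (2 + \<bar>t\<bar>)\<^sup>2"
      by (intro power_mono) (auto simp: dist_real_def)
    then have "C * (1 + \<bar>q\<bar>)\<^sup>2 * inverse (1 + y\<^sup>2) \<le> C * (2 + \<bar>t\<bar>)\<^sup>2 * inverse (1 + y\<^sup>2)"
      using C(1) by (intro mult_right_mono mult_left_mono) (auto simp: add_nonneg_nonneg)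
    then show "norm (- \<i> * ?f (m + 2) q y) \<le> C * (2 + \<bar>t\<bar>)\<^sup>2 * inverse (1 + y\<^sup>2)"
      using C(2)[of x y q] C(1) assms
      by (cases "y \<ge> 0") (auto simp: norm_mult add_nonneg_nonneg)
  next
    show "(\<lambda>y. - \<i> * ?f (m + 2) t y) \<in> borel_measurable lborel"
      using outgoing_integrand_measurable by measurable
  qed (use assms outgoing_integrable integrable_const_inverse_1_plus_square in auto)
  then have "((\<lambda>t. outgoing m x t) has_vector_derivative - \<i> * outgoing (m + 2) x t) (at t within UNIV)"
    by (simp only: outgoing_def integral_mult_right_zero)
  then show ?thesis by (rule has_vector_derivative_within_subset) simp
qed

lemma outgoing_continuous: "continuous_on ({0..} \<times> UNIV) (\<lambda>(x, t). outgoing m x t)"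
proof -
  obtain C where C: "C \<ge> 0"
    "\<And>x y t. x \<ge> 0 \<Longrightarrow> y \<ge> 0 \<Longrightarrow>
      norm (wave m (x + y) t) \<le> C * (1 + \<bar>t\<bar>) \<^sup>2 * inverse (1 + y\<^sup>2)"
    using wave_shift_decay0[of "m"] by blast
  let ?f = "\<lambda>p y. indicator {0..} y *\<^sub>R (cis (- y) * wave m (fst p + y) (snd p))"
  have "continuous_on ({0..} \<times> UNIV) (\<lambda>p. \<integral>y. ?f p y \<partial>lborel)"
    unfolding continuous_on_def
  proof
    fix p :: "real \<times> real" assume "p \<in> {0..} \<times> UNIV"
    show "((\<lambda>p. \<integral>y. ?f p y \<partial>lborel) \<longlongrightarrow> (\<integral>y. ?f p y \<partial>lborel)) (at p within {0..} \<times> UNIV)"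
    proof (rule tendsto_lebesgue_integral_at_within[where r = 1 and
          B = "\<lambda>y. C * (2 + \<bar>snd p\<bar>)\<^sup>2 * inverse (1 + y\<^sup>2)" and f = ?f])
      show "((\<lambda>q. ?f q y) \<longlongrightarrow> ?f p y) (at p within {0..} \<times> UNIV)" for y
      proof -
        have "continuous_on UNIV (\<lambda>q. ?f q y)"
          by (intro continuous_intros)
        then show ?thesis
          unfolding continuous_on_def by (meson UNIV_I tendsto_within_subset subset_UNIV)
      qed
      fix q :: "real \<times> real" and y :: real
      assume q: "q \<in> {0..} \<times> UNIV - {p}" "dist q p < 1"
      have "dist (snd q) (snd p) < 1"
        using q dist_snd_le[of q p] by linarith
      then have "(1 + \<bar>snd q\<bar>)\<^sup>2 \<le> (2 + \<bar>snd p\<bar>)\<^sup>2"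
        by (intro power_mono) (auto simp: dist_real_def)
      then have "C * (1 + \<bar>snd q\<bar>)\<^sup>2 * inverse (1 + y\<^sup>2) \<le> C * (2 + \<bar>snd p\<bar>)\<^sup>2 * inverse (1 + y\<^sup>2)"
        using C(1) by (intro mult_right_mono mult_left_mono) (auto simp: add_nonneg_nonneg)
      then show "norm (?f q y) \<le> C * (2 + \<bar>snd p\<bar>)\<^sup>2 * inverse (1 + y\<^sup>2)"
        using C(2)[of "fst q" y "snd q"] C(1) q
        by (cases "y \<ge> 0") (auto simp: norm_mult add_nonneg_nonneg mem_Times_iff)
    qed (use outgoing_integrand_measurable integrable_const_inverse_1_plus_square in auto)
  qed
  then show ?thesis by (simp add: outgoing_def case_prod_unfold)
qed

text \<open>Integrate the derivative of \<open>cis (- y) * wave m (x + y) t\<close> over the half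
  line of \<open>y\<close>. Since the space derivative of \<open>outgoing m\<close> is
  \<open>\<i> * outgoing (m + 1)\<close>, the statement is the equation
  \<open>(d/dx - \<i>) outgoing m = - wave m\<close>.\<close>

lemma outgoing_relation:
  assumes "x \<ge> 0"
  shows "outgoing (m + 1) x t = outgoing m x t + \<i> * wave m x t"
proof -
  let ?F = "\<lambda>y. cis (- y) * wave m (x + y) t"
  let ?f = "\<lambda>y. \<i> * (cis (- y) * wave (m + 1) (x + y) t) - \<i> * (cis (- y) * wave m (x + y) t)"
  have deriv: "(?F has_vector_derivative ?f y) (at y)" for y
  proof -
    have 1: "((\<lambda>y. wave m (x + y) t) has_vector_derivative 1 *\<^sub>R (\<i> * wave (m + 1) (x + y) t)) (at y)"
      by (rule vector_diff_chain_within[where f = "\<lambda>y. x + y" and g = "\<lambda>x. wave m x t", unfolded o_def])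
        (auto intro!: wave_has_vector_derivative_x derivative_eq_intros)
    have 2: "((\<lambda>y. cis (- y)) has_vector_derivative \<i> * of_real (- 1) * cis (- y)) (at y)"
      by (rule has_vector_derivative_cis) (auto intro!: derivative_eq_intros)
    from has_vector_derivative_mult[OF 2 1] show ?thesis
      by (simp add: algebra_simps)
  qed
  let ?g = "\<lambda>y. indicator {0..} y *\<^sub>R ?f y"
  have int: "integrable lborel (\<lambda>y. \<i> * (indicator {0..} y *\<^sub>R (cis (- y) * wave (m + 1) (x + y) t)) -
      \<i> * (indicator {0..} y *\<^sub>R (cis (- y) * wave m (x + y) t)))"
    by (intro Bochner_Integration.integrable_diff integrable_mult_right outgoing_integrable assms)
  moreover have eqg: "(\<lambda>y. \<i> * (indicator {0..} y *\<^sub>R (cis (- y) * wave (m + 1) (x + y) t)) -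
      \<i> * (indicator {0..} y *\<^sub>R (cis (- y) * wave m (x + y) t))) = ?g"
    by (simp add: scaleR_diff_right fun_eq_iff)
  ultimately have intg: "integrable lborel ?g" by simp
  have "(LBINT y=0..\<infinity>. ?f y) = 0 - wave m x t"
  proof (rule interval_integral_FTC_integrable[where F = ?F])
    show "isCont ?f y" for y
    proof -
      have "continuous_on UNIV ?f" by (intro continuous_intros)
      then show ?thesis using continuous_on_eq_continuous_at[OF open_UNIV] by blast
    qed
    show "set_integrable lborel (einterval 0 \<infinity>) ?f"
    proof -
      have "set_integrable lborel {0..} ?f"
        using intg by (simp add: set_integrable_def)
      then show ?thesis
        by (rule set_integrable_subset) (auto simp: einterval_def)
    qed
    show "((?F \<circ> real_of_ereal) \<longlongrightarrow> wave m x t) (at_right 0)"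
    proof -
      have "isCont ?F 0"
        using deriv by (rule has_vector_derivative_continuous)
      then have "(?F \<longlongrightarrow> wave m x t) (at 0)"
        by (simp add: isCont_def)
      then have "(?F \<longlongrightarrow> wave m x t) (at_right 0)"
        by (rule tendsto_within_subset) simp
      then show ?thesis by (simp add: zero_ereal_def ereal_tendsto_simps)
    qed
    show "((?F \<circ> real_of_ereal) \<longlongrightarrow> 0) (at_left \<infinity>)"
    proof -
      obtain C where C: "C \<ge> 0"
        "\<And>x y t. x \<ge> 0 \<Longrightarrow> y \<ge> 0 \<Longrightarrow>
          norm (wave m (x + y) t) \<le> C * (1 + \<bar>t\<bar>) \<^sup>2 * inverse (1 + y\<^sup>2)"
        using wave_shift_decay0[of "m"] by blast
      have "((\<lambda>y::real. C * (1 + \<bar>t\<bar>) \<^sup>2 * inverse (1 + y\<^sup>2)) \<longlongrightarrow> 0) at_top"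
        by (intro tendsto_mult_right_zero tendsto_inverse_0_at_top
            filterlim_tendsto_add_at_top[OF tendsto_const] filterlim_pow_at_top filterlim_ident; simp)
      then have "(?F \<longlongrightarrow> 0) at_top"
        by (rule Lim_null_comparison[rotated])
          (use C(2)[OF assms] in \<open>auto simp: norm_mult eventually_at_top_linorder intro!: exI[of _ 0]\<close>)
      then show ?thesis by (simp add: ereal_tendsto_simps)
    qed
  qed (use deriv in auto)
  moreover have [measurable]: "?f \<in> borel_measurable borel"
    by (intro borel_measurable_continuous_onI continuous_intros)
  have "(LBINT y=0..\<infinity>. ?f y) = (LBINT y:{0..}. ?f y)"
    by (simp add: interval_lebesgue_integral_def zero_ereal_def set_lebesgue_integral_def)
      (intro integral_cong_AE AE_I[where N = "{0}"], auto simp: indicator_def)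
  moreover have "(LBINT y:{0..}. ?f y) = \<i> * outgoing (m + 1) x t - \<i> * outgoing m x t"
    unfolding set_lebesgue_integral_def outgoing_def eqg[symmetric]
    by (subst Bochner_Integration.integral_diff)
      (intro integrable_mult_right outgoing_integrable assms, intro integrable_mult_right outgoing_integrable assms,
       simp only: integral_mult_right_zero)
  ultimately have "\<i> * outgoing (m + 1) x t - \<i> * outgoing m x t = - wave m x t" by simp
  then have "- \<i> * (\<i> * outgoing (m + 1) x t - \<i> * outgoing m x t) = - \<i> * (- wave m x t)" by simp
  then show ?thesis by (simp add: algebra_simps)
qed

section \<open>The boundary trace of the outgoing mode\<close>

definition outgoing_rate :: "real \<Rightarrow> complex" where
  "outgoing_rate t = wave 1 0 t + wave 2 0 t"

lemma outgoing_rate_bound: "\<exists>C\<ge>0. \<forall>t. \<bar>t\<bar> ^ j * norm (outgoing_rate t) \<le> C * inverse (1 + t\<^sup>2)"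
proof -
  obtain A where A: "\<And>t. \<bar>t\<bar> ^ j * norm (wave 1 0 t) \<le> A" using wave_bound_t by blast
  obtain B where B: "\<And>t. \<bar>t\<bar> ^ j * norm (wave 2 0 t) \<le> B" using wave_bound_t by blast
  obtain A' where A': "\<And>t. \<bar>t\<bar> ^ (j + 2) * norm (wave 1 0 t) \<le> A'" using wave_bound_t by blast
  obtain B' where B': "\<And>t. \<bar>t\<bar> ^ (j + 2) * norm (wave 2 0 t) \<le> B'" using wave_bound_t by blast
  have "\<bar>t\<bar> ^ j * norm (outgoing_rate t) \<le> (A + B + A' + B') * inverse (1 + t\<^sup>2)" for t
  proof -
    have "(1 + t\<^sup>2) * (\<bar>t\<bar> ^ j * norm (outgoing_rate t)) \<le> (1 + t\<^sup>2) * (\<bar>t\<bar> ^ j * (norm (wave 1 0 t) + norm (wave 2 0 t)))"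
      unfolding outgoing_rate_def by (intro mult_left_mono norm_triangle_ineq) auto
    also have "\<dots> = \<bar>t\<bar> ^ j * norm (wave 1 0 t) + \<bar>t\<bar> ^ j * norm (wave 2 0 t)
        + \<bar>t\<bar> ^ (j + 2) * norm (wave 1 0 t) + \<bar>t\<bar> ^ (j + 2) * norm (wave 2 0 t)"
      by (simp add: power_add power2_eq_square algebra_simps flip: abs_mult)
    also have "\<dots> \<le> A + B + A' + B'"
      by (intro add_mono A B A' B')
    finally have "(1 + t\<^sup>2) * (\<bar>t\<bar> ^ j * norm (outgoing_rate t)) \<le> A + B + A' + B'" .
    moreover have "1 + t\<^sup>2 > 0" by (simp add: add_pos_nonneg)
    ultimately show ?thesis
      unfolding divide_inverse[symmetric] by (subst pos_le_divide_eq) (simp_all add: mult.commute)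
  qed
  moreover have "A + B + A' + B' \<ge> 0"
    using order_trans[OF _ A[of 0]] order_trans[OF _ B[of 0]] order_trans[OF _ A'[of 0]] order_trans[OF _ B'[of 0]]
    by (simp add: add_nonneg_nonneg)
  ultimately show ?thesis by blast
qed

lemma outgoing_rate_continuous: "continuous_on S outgoing_rate"
  unfolding outgoing_rate_def by (intro continuous_intros)

lemma outgoing_rate_measurable [measurable]: "outgoing_rate \<in> borel_measurable borel"
  by (intro borel_measurable_continuous_onI outgoing_rate_continuous)

lemma outgoing_rate_integrable: "integrable lborel (\<lambda>y. indicator {0..} y *\<^sub>R (cis y * outgoing_rate y))"
proof -
  obtain C where C: "C \<ge> 0" "\<And>t. norm (outgoing_rate t) \<le> C * inverse (1 + t\<^sup>2)"
    using outgoing_rate_bound[of 0] by auto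
  show ?thesis
  proof (rule Bochner_Integration.integrable_bound[OF integrable_const_inverse_1_plus_square[of C]])
    show "AE y in lborel. norm (indicator {0..} y *\<^sub>R (cis y * outgoing_rate y)) \<le> norm (C * inverse (1 + y\<^sup>2))"
      using C by (auto simp: norm_mult indicator_def add_nonneg_nonneg intro!: AE_I2 order_trans[OF C(2)])
  qed simp
qed

text \<open>The limit of \<open>cis t * outgoing 1 0 t\<close> at infinity, written as the value at
  \<open>0\<close> plus the integral of the derivative.\<close>

definition outgoing_limit :: complex where
  "outgoing_limit = outgoing 1 0 0 + (\<integral>y. indicator {0..} y *\<^sub>R (cis y * outgoing_rate y) \<partial>lborel)"

text \<open>Two uses of \<open>outgoing_relation\<close> reduce \<open>outgoing 3\<close> to
  \<open>outgoing 1\<close> plus two waves; the rotating factor cancels \<open>outgoing 1\<close>,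
  and the waves decay rapidly at \<open>x = 0\<close>. This is the origin of
  \<open>outgoing_rate\<close>.\<close>

lemma cis_outgoing_has_vector_derivative:
  "((\<lambda>t. cis t * outgoing 1 0 t) has_vector_derivative cis t * outgoing_rate t) (at t within S)"
proof -
  have 1: "((\<lambda>t. cis t) has_vector_derivative \<i> * of_real 1 * cis t) (at t within S)"
    by (rule has_vector_derivative_cis) (auto intro!: derivative_eq_intros)
  have 2: "((\<lambda>t. outgoing 1 0 t) has_vector_derivative - \<i> * outgoing 3 0 t) (at t within S)"
    using outgoing_has_vector_derivative_t[of 0 1] by simp
  have "outgoing 3 0 t = outgoing 1 0 t + \<i> * wave 1 0 t + \<i> * wave 2 0 t"
    using outgoing_relation[of 0 1 t] outgoing_relation[of 0 2 t] by simp
  then have "cis t * (- \<i> * outgoing 3 0 t) + \<i> * of_real 1 * cis t * outgoing 1 0 t = cis t * outgoing_rate t"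
    by (simp add: outgoing_rate_def algebra_simps)
  with has_vector_derivative_mult[OF 1 2] show ?thesis by simp
qed

text \<open>The error is the integral of the derivative over the times after \<open>t\<close>, where
  \<open>t ^ j \<le> y ^ j\<close>.\<close>

lemma outgoing_asymptotics: "\<exists>C. \<forall>t\<ge>0. t ^ j * norm (cis t * outgoing 1 0 t - outgoing_limit) \<le> C"
proof -
  obtain C where C: "C \<ge> 0" "\<And>t. \<bar>t\<bar> ^ j * norm (outgoing_rate t) \<le> C * inverse (1 + t\<^sup>2)"
    using outgoing_rate_bound[of j] by auto
  let ?g = "\<lambda>A y. indicator A y *\<^sub>R (cis y * outgoing_rate y)"
  have "t ^ j * norm (cis t * outgoing 1 0 t - outgoing_limit) \<le> (\<integral>y. C * inverse (1 + y\<^sup>2) \<partial>lborel)" if t: "t \<ge> 0" for t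
  proof -
    have "(\<integral>y. ?g {0..t} y \<partial>lborel) = cis t * outgoing 1 0 t - cis 0 * outgoing 1 0 0"
      using t by (intro integral_FTC_atLeastAtMost cis_outgoing_has_vector_derivative continuous_intros outgoing_rate_continuous)
    moreover have "(\<integral>y. ?g {0..} y \<partial>lborel) = (\<integral>y. ?g {0..t} y \<partial>lborel) + (\<integral>y. ?g {t<..} y \<partial>lborel)"
    proof -
      have "integrable lborel (?g A)" if "A \<subseteq> {0..}" and [measurable]: "A \<in> sets borel" for A
        by (rule Bochner_Integration.integrable_bound[OF outgoing_rate_integrable]) (use that in \<open>auto simp: indicator_def\<close>)
      moreover have "{t<..} \<subseteq> {0..}" using t by force
      ultimately
      have "integrable lborel (?g {0..t})" "integrable lborel (?g {t<..})" by simp_all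
      then have "(\<integral>y. ?g {0..t} y \<partial>lborel) + (\<integral>y. ?g {t<..} y \<partial>lborel) = (\<integral>y. ?g {0..t} y + ?g {t<..} y \<partial>lborel)"
        by (rule Bochner_Integration.integral_add[symmetric])
      also have "\<dots> = (\<integral>y. ?g {0..} y \<partial>lborel)"
        using t by (intro Bochner_Integration.integral_cong) (auto simp: indicator_def)
      finally show ?thesis by simp
    qed
    ultimately have "cis t * outgoing 1 0 t - outgoing_limit = - (\<integral>y. ?g {t<..} y \<partial>lborel)"
      by (simp add: outgoing_limit_def)
    then have "t ^ j * norm (cis t * outgoing 1 0 t - outgoing_limit) = norm (t ^ j *\<^sub>R (\<integral>y. ?g {t<..} y \<partial>lborel))"
      using t by simp
    also have "t ^ j *\<^sub>R (\<integral>y. ?g {t<..} y \<partial>lborel) = (\<integral>y. t ^ j *\<^sub>R ?g {t<..} y \<partial>lborel)"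
      by (rule integral_scaleR_right[symmetric])
    also have "norm \<dots> \<le> (\<integral>y. C * inverse (1 + y\<^sup>2) \<partial>lborel)"
    proof (rule Bochner_Integration.integral_norm_bound_integral)
      show "integrable lborel (\<lambda>y. t ^ j *\<^sub>R ?g {t<..} y)"
        by (intro integrable_scaleR_right Bochner_Integration.integrable_bound[OF outgoing_rate_integrable])
          (use t in \<open>auto simp: indicator_def\<close>)
      fix y :: real
      show "norm (t ^ j *\<^sub>R ?g {t<..} y) \<le> C * inverse (1 + y\<^sup>2)"
      proof (cases "t < y")
        case True
        have "norm (t ^ j *\<^sub>R ?g {t<..} y) = t ^ j * norm (outgoing_rate y)"
          using t True by (simp add: norm_mult)
        also have "\<dots> \<le> \<bar>y\<bar> ^ j * norm (outgoing_rate y)"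
          using t True by (intro mult_right_mono power_mono) auto
        also have "\<dots> \<le> C * inverse (1 + y\<^sup>2)" by (rule C)
        finally show ?thesis .
      qed (use C(1) in \<open>simp add: add_nonneg_nonneg\<close>)
    qed (rule integrable_const_inverse_1_plus_square)
    finally show ?thesis .
  qed
  then show ?thesis by blast
qed

section \<open>Nonvanishing of the boundary amplitude\<close>

lemma exp_neg_le:
  assumes "\<delta> > 0" "y \<ge> (0::real)"
  shows "exp (- \<delta> * y) \<le> (1 + 2 / \<delta>\<^sup>2) * inverse (1 + y\<^sup>2)"
proof -
  have e: "exp (\<delta> * y) \<ge> 1 + \<delta> * y + (\<delta> * y)\<^sup>2 / 2"
    using assms by (intro exp_lower_Taylor_quadratic) simp
  have "1 + y\<^sup>2 \<le> (1 + 2 / \<delta>\<^sup>2) * (1 + (\<delta> * y)\<^sup>2 / 2)"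
    using assms by (simp add: power_mult_distrib field_simps)
  also have "\<dots> \<le> (1 + 2 / \<delta>\<^sup>2) * exp (\<delta> * y)"
    using e assms by (intro mult_left_mono) (auto intro: order_trans[rotated])
  finally have "(1 + y\<^sup>2) / exp (\<delta> * y) \<le> 1 + 2 / \<delta>\<^sup>2"
    by (simp add: pos_divide_le_eq)
  moreover have "1 + y\<^sup>2 > 0" by (simp add: add_pos_nonneg)
  moreover have "exp (- \<delta> * y) = 1 / exp (\<delta> * y)"
    by (simp add: exp_minus inverse_eq_divide)
  ultimately show ?thesis
    unfolding divide_inverse[symmetric] by (subst pos_le_divide_eq) simp_all
qed

text \<open>The Laplace transform of the cosine, by an explicit primitive; as a function of
  \<open>\<theta>\<close> it is a Poisson kernel up to a constant factor.\<close>

lemma integral_exp_cos: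
  fixes \<delta> \<theta> :: real
  assumes "\<delta> > 0"
  shows "integrable lborel (\<lambda>y. indicator {0..} y * (exp (- \<delta> * y) * cos (\<theta> * y)))" (is ?int)
    and "(\<integral>y. indicator {0..} y * (exp (- \<delta> * y) * cos (\<theta> * y)) \<partial>lborel) = \<delta> / (\<delta>\<^sup>2 + \<theta>\<^sup>2)" (is ?eq)
proof -
  have [measurable]: "(\<lambda>y. exp (- \<delta> * y) * cos (\<theta> * y)) \<in> borel_measurable borel"
    by measurable
  have bound: "norm (exp (- \<delta> * y) * cos (\<theta> * y)) \<le> (1 + 2 / \<delta>\<^sup>2) * inverse (1 + y\<^sup>2)" if "y \<ge> 0" for y
  proof -
    have "norm (exp (- \<delta> * y) * cos (\<theta> * y)) \<le> exp (- \<delta> * y) * 1"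
      unfolding norm_mult by (intro mult_mono) auto
    then show ?thesis using exp_neg_le[OF assms that] by simp
  qed
  show ?int
  proof (rule Bochner_Integration.integrable_bound[OF integrable_const_inverse_1_plus_square[of "1 + 2 / \<delta>\<^sup>2"]])
    show "AE y in lborel. norm (indicator {0..} y * (exp (- \<delta> * y) * cos (\<theta> * y))) \<le> norm ((1 + 2 / \<delta>\<^sup>2) * inverse (1 + y\<^sup>2))"
    proof (rule AE_I2)
      fix y :: real
      show "norm (indicator {0..} y * (exp (- \<delta> * y) * cos (\<theta> * y))) \<le> norm ((1 + 2 / \<delta>\<^sup>2) * inverse (1 + y\<^sup>2))"
        using bound[of y] by (cases "y \<ge> 0") (auto intro: order_trans[OF _ abs_ge_self])
    qed
  qed simp
  let ?F = "\<lambda>y. exp (- \<delta> * y) * (\<theta> * sin (\<theta> * y) - \<delta> * cos (\<theta> * y)) / (\<delta>\<^sup>2 + \<theta>\<^sup>2)"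
  let ?f = "\<lambda>y. exp (- \<delta> * y) * cos (\<theta> * y)"
  have nz: "\<delta>\<^sup>2 + \<theta>\<^sup>2 > 0" using assms by (simp add: add_pos_nonneg)
  have "(LBINT y=0..\<infinity>. ?f y) = 0 - (- \<delta> / (\<delta>\<^sup>2 + \<theta>\<^sup>2))"
  proof (rule interval_integral_FTC_integrable[where F = ?F])
    fix y
    let ?N = "\<lambda>y. exp (- \<delta> * y) * (\<theta> * sin (\<theta> * y) - \<delta> * cos (\<theta> * y))"
    have "(?N has_real_derivative ?f y * (\<delta>\<^sup>2 + \<theta>\<^sup>2)) (at y)"
      by (auto intro!: derivative_eq_intros simp: algebra_simps power2_eq_square)
    from DERIV_cdivide[OF this, of "\<delta>\<^sup>2 + \<theta>\<^sup>2"]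
    have "(?F has_real_derivative ?f y) (at y)"
      using assms by simp
    then show "(?F has_vector_derivative ?f y) (at y)"
      by (simp add: has_real_derivative_iff_has_vector_derivative)
  next
    show "set_integrable lborel (einterval 0 \<infinity>) ?f"
    proof -
      have "set_integrable lborel {0..} ?f"
        using \<open>?int\<close> by (simp add: set_integrable_def)
      then show ?thesis
        by (rule set_integrable_subset) (auto simp: einterval_def)
    qed
    have "isCont ?F 0" using nz by (intro continuous_intros) auto
    then have "(?F \<longlongrightarrow> - \<delta> / (\<delta>\<^sup>2 + \<theta>\<^sup>2)) (at 0)" by (simp add: isCont_def)
    then have "(?F \<longlongrightarrow> - \<delta> / (\<delta>\<^sup>2 + \<theta>\<^sup>2)) (at_right 0)" by (rule tendsto_within_subset) simp
    then show "((?F \<circ> real_of_ereal) \<longlongrightarrow> - \<delta> / (\<delta>\<^sup>2 + \<theta>\<^sup>2)) (at_right 0)"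
      by (simp add: zero_ereal_def ereal_tendsto_simps)
    have "(?F \<longlongrightarrow> 0) at_top"
    proof (rule Lim_null_comparison)
      have "filterlim (\<lambda>y. \<delta> * y) at_top at_top"
        using assms by (rule filterlim_tendsto_pos_mult_at_top[OF tendsto_const _ filterlim_ident])
      then have "((\<lambda>y. exp (- (\<delta> * y))) \<longlongrightarrow> 0) at_top"
        by (rule filterlim_compose[OF exp_at_bot filterlim_compose[OF filterlim_uminus_at_bot_at_top]])
      then show "((\<lambda>y. exp (- (\<delta> * y)) * ((\<bar>\<theta>\<bar> + \<delta>) / (\<delta>\<^sup>2 + \<theta>\<^sup>2))) \<longlongrightarrow> 0) at_top"
        by (rule tendsto_mult_left_zero)
      show "\<forall>\<^sub>F y in at_top. norm (?F y) \<le> exp (- (\<delta> * y)) * ((\<bar>\<theta>\<bar> + \<delta>) / (\<delta>\<^sup>2 + \<theta>\<^sup>2))"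
      proof (intro always_eventually allI)
        fix y
        have "\<bar>\<theta> * sin (\<theta> * y) - \<delta> * cos (\<theta> * y)\<bar> \<le> \<bar>\<theta> * sin (\<theta> * y)\<bar> + \<bar>\<delta> * cos (\<theta> * y)\<bar>"
          by (rule abs_triangle_ineq4)
        also have "\<dots> \<le> \<bar>\<theta>\<bar> * 1 + \<delta> * 1"
          unfolding abs_mult using assms by (intro add_mono mult_mono) auto
        finally show "norm (?F y) \<le> exp (- (\<delta> * y)) * ((\<bar>\<theta>\<bar> + \<delta>) / (\<delta>\<^sup>2 + \<theta>\<^sup>2))"
          using nz by (simp add: abs_mult divide_right_mono)
      qed
    qed
    then show "((?F \<circ> real_of_ereal) \<longlongrightarrow> 0) (at_left \<infinity>)"
      by (simp add: ereal_tendsto_simps)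
    show "isCont ?f y" for y by (intro continuous_intros)
  qed simp
  moreover have "(LBINT y=0..\<infinity>. ?f y) = (\<integral>y. indicator {0..} y * ?f y \<partial>lborel)"
    by (simp add: interval_lebesgue_integral_def zero_ereal_def set_lebesgue_integral_def)
      (intro integral_cong_AE AE_I[where N = "{0}"], auto simp: indicator_def)
  ultimately show ?eq by simp
qed

text \<open>Abel summation: the factor \<open>exp (- \<delta> y)\<close> turns the oscillatory integral in \<open>y\<close> into a Poisson kernel.\<close>

lemma Re_integral_ge_Abel:
  fixes w :: "real \<Rightarrow> real" and \<theta> :: "real \<Rightarrow> real" and g :: "real \<Rightarrow> complex"
  assumes w: "integrable lborel w" "\<And>s. w s \<ge> 0"
    and [measurable]: "\<theta> \<in> borel_measurable borel"
    and g: "\<And>y. g y = (\<integral>s. w s *\<^sub>R cis (\<theta> s * y) \<partial>lborel)"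
    and int: "integrable lborel (\<lambda>y. indicator {0..} y *\<^sub>R g y)"
    and \<kappa>: "\<And>\<delta>. 0 < \<delta> \<Longrightarrow> \<delta> < 1 \<Longrightarrow> \<kappa> \<le> (\<integral>s. w s * (\<delta> / (\<delta>\<^sup>2 + (\<theta> s)\<^sup>2)) \<partial>lborel)"
  shows "Re (\<integral>y. indicator {0..} y *\<^sub>R g y \<partial>lborel) \<ge> \<kappa>"
proof -
  have [measurable]: "w \<in> borel_measurable borel" using w by auto
  have intw: "integrable lborel (\<lambda>s. w s *\<^sub>R cis (\<theta> s * y))" for y
    by (rule Bochner_Integration.integrable_bound[OF w(1)]) (use w(2) in auto)
  have Re_g: "Re (g y) = (\<integral>s. w s * cos (\<theta> s * y) \<partial>lborel)" for y
    unfolding g by (subst integral_Re[symmetric, OF intw]) simp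
  let ?h = "\<lambda>\<delta> y. indicator {0..} y * (exp (- \<delta> * y) * Re (g y)) :: real"
  have Re_int: "integrable lborel (\<lambda>y. indicator {0..} y * Re (g y))"
    using integrable_Re[OF int] by simp
  \<comment> \<open>By Fubini the damped integral over \<open>y\<close> may be computed first, for
    each fixed \<open>s\<close>.\<close>
  have fub: "(\<integral>y. ?h \<delta> y \<partial>lborel) = (\<integral>s. w s * (\<delta> / (\<delta>\<^sup>2 + (\<theta> s)\<^sup>2)) \<partial>lborel)" if "\<delta> > 0" for \<delta>
  proof -
    let ?k = "\<lambda>y s. indicator {0..} y * (exp (- \<delta> * y) * (w s * cos (\<theta> s * y))) :: real"
    have ex: "integrable lborel (\<lambda>y. indicator {0..} y * exp (- \<delta> * y))"
      using integral_exp_cos(1)[OF that, of 0] by simp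
    have "integrable (lborel \<Otimes>\<^sub>M lborel) (\<lambda>(y, s). (indicator {0..} y * exp (- \<delta> * y)) * w s)"
      by (intro lborel_pair.Fubini_integrable) (use ex w in \<open>auto simp: abs_mult intro!: integrable_mult_left integrable_mult_right integrable_abs\<close>)
    then have "integrable (lborel \<Otimes>\<^sub>M lborel) (\<lambda>(y, s). ?k y s)"
    proof (rule Bochner_Integration.integrable_bound)
      show "AE p in lborel \<Otimes>\<^sub>M lborel. norm (case p of (y, s) \<Rightarrow> ?k y s)
          \<le> norm (case p of (y, s) \<Rightarrow> (indicator {0..} y * exp (- \<delta> * y)) * w s)"
        using w(2) by (auto intro!: AE_I2 simp: abs_mult mult_left_le split: prod.splits)
          (simp add: indicator_def mult_left_le)
    qed measurable
    then have "(\<integral>s. (\<integral>y. ?k y s \<partial>lborel) \<partial>lborel) = (\<integral>y. (\<integral>s. ?k y s \<partial>lborel) \<partial>lborel)"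
      by (rule lborel_pair.Fubini_integral)
    moreover have B: "(\<integral>s. ?k y s \<partial>lborel) = ?h \<delta> y" for y
      by (simp add: Re_g)
    moreover have C: "(\<integral>y. ?k y s \<partial>lborel) = w s * (\<delta> / (\<delta>\<^sup>2 + (\<theta> s)\<^sup>2))" for s
    proof -
      have "(\<integral>y. ?k y s \<partial>lborel) = (\<integral>y. w s * (indicator {0..} y * (exp (- \<delta> * y) * cos (\<theta> s * y))) \<partial>lborel)"
        by (simp add: mult_ac)
      also have "\<dots> = w s * (\<delta> / (\<delta>\<^sup>2 + (\<theta> s)\<^sup>2))"
        by (subst integral_mult_right_zero) (simp only: integral_exp_cos(2)[OF that])
      finally show ?thesis .
    qed
    ultimately show ?thesis by (simp only: B C)
  qed
  \<comment> \<open>The parameters \<open>inverse (real (n + 2))\<close> lie strictly between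
    \<open>0\<close> and \<open>1\<close>, as the hypothesis on \<open>\<kappa>\<close>
    requires.\<close>
  have "(\<lambda>n. \<integral>y. ?h (inverse (real (n + 2))) y \<partial>lborel) \<longlonglongrightarrow> (\<integral>y. indicator {0..} y * Re (g y) \<partial>lborel)"
  proof (rule integral_dominated_convergence[where w = "\<lambda>y. \<bar>indicator {0..} y * Re (g y)\<bar>"])
    have [measurable]: "(\<lambda>y. indicator {0..} y * Re (g y)) \<in> borel_measurable borel" using Re_int by auto
    then show "(\<lambda>y. indicator {0..} y * Re (g y)) \<in> borel_measurable lborel" by simp
    have "(\<lambda>y. exp (- inverse (real (n + 2)) * y) * (indicator {0..} y * Re (g y))) \<in> borel_measurable lborel" for n
      by measurable
    then show "?h (inverse (real (n + 2))) \<in> borel_measurable lborel" for n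
      by (simp add: mult_ac)
    show "integrable lborel (\<lambda>y. \<bar>indicator {0..} y * Re (g y)\<bar>)"
      using Re_int by (rule integrable_abs)
    show "AE y in lborel. (\<lambda>n. ?h (inverse (real (n + 2))) y) \<longlonglongrightarrow> indicator {0..} y * Re (g y)"
    proof (rule AE_I2)
      fix y :: real
      have "(\<lambda>n. inverse (real (n + 2))) \<longlonglongrightarrow> 0"
        using LIMSEQ_ignore_initial_segment[OF lim_inverse_n, of 2] by simp
      then have "(\<lambda>n. ?h (inverse (real (n + 2))) y) \<longlonglongrightarrow> indicator {0..} y * (exp (- 0 * y) * Re (g y))"
        by (intro tendsto_intros)
      then show "(\<lambda>n. ?h (inverse (real (n + 2))) y) \<longlonglongrightarrow> indicator {0..} y * Re (g y)" by simp
    qed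
    show "AE y in lborel. norm (?h (inverse (real (n + 2))) y) \<le> \<bar>indicator {0..} y * Re (g y)\<bar>" for n
      by (intro AE_I2) (auto simp: indicator_def abs_mult mult_left_le_one_le)
  qed
  moreover have "\<kappa> \<le> (\<integral>y. ?h (inverse (real (n + 2))) y \<partial>lborel)" for n
    using \<kappa>[of "inverse (real (n + 2))"] fub[of "inverse (real (n + 2))"] by (simp add: inverse_less_1_iff)
  ultimately have "\<kappa> \<le> (\<integral>y. indicator {0..} y * Re (g y) \<partial>lborel)"
    by (intro LIMSEQ_le_const) auto
  also have "\<dots> = Re (\<integral>y. indicator {0..} y *\<^sub>R g y \<partial>lborel)"
    by (subst integral_Re[symmetric, OF int]) simp
  finally show ?thesis .
qed

text \<open>For small \<open>\<delta>\<close> the kernel concentrates at \<open>s = 0\<close>, the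
  resonant wave number \<open>1\<close>. On \<open>{0..\<delta> / 2}\<close> one has
  \<open>exp s - 1 \<le> \<delta>\<close>, so the kernel is at least
  \<open>1 / (2 * \<delta>)\<close>, and the weight is at least \<open>exp (- 3)\<close>; the length
  \<open>\<delta> / 2\<close> of the interval gives the factor \<open>1 / 4\<close>.\<close>

lemma Poisson_integral_lower_bound:
  assumes "0 < \<delta>" "\<delta> < 1"
  shows "exp (- 3) / 4 \<le> (\<integral>s. weight 1 s * (\<delta> / (\<delta>\<^sup>2 + (exp s - 1)\<^sup>2)) \<partial>lborel)"
proof -
  let ?f = "\<lambda>s. weight 1 s * (\<delta> / (\<delta>\<^sup>2 + (exp s - 1)\<^sup>2))"
  have "exp (- 3) / (2 * \<delta>) * (\<delta> / 2) = (\<integral>s. indicator {0..\<delta> / 2} s * (exp (- 3) / (2 * \<delta>)) \<partial>lborel)"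
    using assms by simp
  also have "\<dots> \<le> (\<integral>s. ?f s \<partial>lborel)"
  proof (rule integral_mono)
    show "integrable lborel (\<lambda>s. indicator {0..\<delta> / 2} s * (exp (- 3) / (2 * \<delta>)) :: real)"
      using assms by (intro integrable_mult_left integrable_real_indicator) auto
    show "integrable lborel ?f"
    proof (rule Bochner_Integration.integrable_bound[OF integrable_mult_left[OF weight_integrable[of 1], of "1 / \<delta>"]])
      show "AE s in lborel. norm (?f s) \<le> norm (weight 1 s * (1 / \<delta>))"
      proof (rule AE_I2)
        fix s :: real
        have "\<delta> * \<delta> \<le> \<delta>\<^sup>2 + (exp s - 1)\<^sup>2" by (simp add: power2_eq_square)
        moreover have "\<delta>\<^sup>2 + (exp s - 1)\<^sup>2 > 0" using assms by (intro add_pos_nonneg) auto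
        ultimately have "\<delta> / (\<delta>\<^sup>2 + (exp s - 1)\<^sup>2) \<le> 1 / \<delta>"
          using assms by (simp add: field_simps)
        moreover have "\<delta> / (\<delta>\<^sup>2 + (exp s - 1)\<^sup>2) \<ge> 0" using assms by simp
        ultimately show "norm (?f s) \<le> norm (weight 1 s * (1 / \<delta>))"
          unfolding norm_mult by (intro mult_left_mono) (use assms in auto)
      qed
    qed measurable
    fix s :: real
    show "indicator {0..\<delta> / 2} s * (exp (- 3) / (2 * \<delta>)) \<le> ?f s"
    proof (cases "s \<in> {0..\<delta> / 2}")
      case True
      then have s: "0 \<le> s" "s \<le> \<delta> / 2" "s \<le> 1 / 2" using assms by auto
      have "exp s \<le> 1 + s + s\<^sup>2" using s by (intro exp_bound) auto
      also have "s\<^sup>2 \<le> s * 1" unfolding power2_eq_square using s by (intro mult_left_mono) auto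
      finally have e: "exp s \<le> 1 + 2 * s" by simp
      have "exp s \<ge> 1" using s by simp
      then have "(exp s - 1)\<^sup>2 \<le> \<delta>\<^sup>2" using e s by (intro power_mono) auto
      then have "\<delta> / (2 * \<delta>\<^sup>2) \<le> \<delta> / (\<delta>\<^sup>2 + (exp s - 1)\<^sup>2)"
        using assms by (intro divide_left_mono mult_pos_pos add_pos_nonneg) auto
      then have "1 / (2 * \<delta>) \<le> \<delta> / (\<delta>\<^sup>2 + (exp s - 1)\<^sup>2)"
        using assms by (simp add: power2_eq_square)
      moreover have "exp (- 3) \<le> weight 1 s"
      proof -
        have "exp (- s) \<le> 1" using s by simp
        then have "- 3 \<le> of_int 1 * s - exp s - exp (- s)" using e s unfolding of_int_1 by linarith
        then show ?thesis by (simp only: weight_def exp_le_cancel_iff)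
      qed
      ultimately have "exp (- 3) * (1 / (2 * \<delta>)) \<le> ?f s"
        using assms by (intro mult_mono) (auto simp: less_imp_le[OF weight_pos])
      then show ?thesis using True by simp
    next
      case False
      then show ?thesis using assms by (simp add: less_imp_le[OF weight_pos])
    qed
  qed
  finally show ?thesis using assms by simp
qed

text \<open>Both summands of \<open>outgoing_limit\<close> are half-line integrals of superpositions
  with positive weights, so by Abel summation their real parts are limits of Poisson integrals and
  cannot cancel. The first is bounded below through the resonance at wave number \<open>1\<close>;
  for the second, nonnegativity is enough.\<close>

lemma outgoing_limit_nonzero: "outgoing_limit \<noteq> 0"
proof -
  have 1: "outgoing 1 0 0 = (\<integral>y. indicator {0..} y *\<^sub>R (cis (- y) * wave 1 y 0) \<partial>lborel)"
    by (simp add: outgoing_def)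
  have "Re (outgoing 1 0 0) \<ge> exp (- 3) / 4"
    unfolding 1
  proof (rule Re_integral_ge_Abel[where w = "weight 1" and \<theta> = "\<lambda>s. exp s - 1"])
    fix y
    have "cis (- y) * wave 1 y 0 = (\<integral>s. cis (- y) * (weight 1 s *\<^sub>R plane_wave y 0 s) \<partial>lborel)"
      unfolding wave_def by (rule integral_mult_right_zero[symmetric])
    also have "\<dots> = (\<integral>s. weight 1 s *\<^sub>R cis ((exp s - 1) * y) \<partial>lborel)"
    proof (intro Bochner_Integration.integral_cong refl)
      fix s :: real
      have "- y + (exp s * y - exp (2 * s) * 0) = (exp s - 1) * y" by (simp add: algebra_simps)
      then show "cis (- y) * (weight 1 s *\<^sub>R plane_wave y 0 s) = weight 1 s *\<^sub>R cis ((exp s - 1) * y)"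
        by (simp only: plane_wave_def mult_scaleR_right cis_mult)
    qed
    finally show "cis (- y) * wave 1 y 0 = (\<integral>s. weight 1 s *\<^sub>R cis ((exp s - 1) * y) \<partial>lborel)" .
  qed (use weight_integrable Poisson_integral_lower_bound outgoing_integrable[of 0 1 0] in \<open>auto simp: less_imp_le[OF weight_pos]\<close>)
  moreover have "Re (\<integral>y. indicator {0..} y *\<^sub>R (cis y * outgoing_rate y) \<partial>lborel) \<ge> 0"
  proof (rule Re_integral_ge_Abel[where w = "\<lambda>s. weight 1 s + weight 2 s" and \<theta> = "\<lambda>s. 1 - exp (2 * s)"])
    fix y
    have "cis y * outgoing_rate y = (\<integral>s. cis y * (weight 1 s *\<^sub>R plane_wave 0 y s + weight 2 s *\<^sub>R plane_wave 0 y s) \<partial>lborel)"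
      unfolding outgoing_rate_def wave_def
      by (subst integral_mult_right_zero, subst Bochner_Integration.integral_add) (auto intro: wave_integrable)
    also have "\<dots> = (\<integral>s. (weight 1 s + weight 2 s) *\<^sub>R cis ((1 - exp (2 * s)) * y) \<partial>lborel)"
    proof (intro Bochner_Integration.integral_cong refl)
      fix s :: real
      have "y + (exp s * 0 - exp (2 * s) * y) = (1 - exp (2 * s)) * y" by (simp add: algebra_simps)
      then show "cis y * (weight 1 s *\<^sub>R plane_wave 0 y s + weight 2 s *\<^sub>R plane_wave 0 y s) = (weight 1 s + weight 2 s) *\<^sub>R cis ((1 - exp (2 * s)) * y)"
        by (simp only: plane_wave_def mult_scaleR_right cis_mult scaleR_add_left[symmetric])
    qed
    finally show "cis y * outgoing_rate y = (\<integral>s. (weight 1 s + weight 2 s) *\<^sub>R cis ((1 - exp (2 * s)) * y) \<partial>lborel)" .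
    fix \<delta> :: real assume "0 < \<delta>"
    then show "0 \<le> (\<integral>s. (weight 1 s + weight 2 s) * (\<delta> / (\<delta>\<^sup>2 + (1 - exp (2 * s))\<^sup>2)) \<partial>lborel)"
      by (intro integral_nonneg_AE AE_I2 mult_nonneg_nonneg add_nonneg_nonneg divide_nonneg_nonneg)
        (auto simp: less_imp_le[OF weight_pos])
  qed (use weight_integrable outgoing_rate_integrable in \<open>auto simp: less_imp_le[OF weight_pos] add_nonneg_nonneg\<close>)
  ultimately have "Re outgoing_limit \<ge> exp (- 3) / 4" by (simp add: outgoing_limit_def)
  then have "Re outgoing_limit > 0" by (rule less_le_trans[rotated]) simp
  then show ?thesis by auto
qed

section \<open>Families of functions closed under differentiation\<close>

text \<open>Smoothness and decay of all derivatives are proved by exhibiting a set of functions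
  stable under both partial derivatives, in place of formulas for iterated derivatives.\<close>

definition closed_family :: "(real \<Rightarrow> real \<Rightarrow> complex) set \<Rightarrow> bool" where
  "closed_family \<Phi> \<longleftrightarrow> (\<forall>f\<in>\<Phi>. continuous_on ({0..} \<times> {0..}) (\<lambda>(x, t). f x t) \<and>
     (\<exists>g\<in>\<Phi>. \<forall>x\<ge>0. \<forall>t\<ge>0. ((\<lambda>y. f y t) has_vector_derivative g x t) (at x within {0..})) \<and>
     (\<exists>g\<in>\<Phi>. \<forall>x\<ge>0. \<forall>t\<ge>0. ((\<lambda>s. f x s) has_vector_derivative g x t) (at t within {0..})))"

lemma closed_familyD:
  assumes "closed_family \<Phi>" "f \<in> \<Phi>"
  shows "continuous_on ({0..} \<times> {0..}) (\<lambda>(x, t). f x t)"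
    and "\<exists>g\<in>\<Phi>. \<forall>x\<ge>0. \<forall>t\<ge>0. ((\<lambda>y. f y t) has_vector_derivative g x t) (at x within {0..})"
    and "\<exists>g\<in>\<Phi>. \<forall>x\<ge>0. \<forall>t\<ge>0. ((\<lambda>s. f x s) has_vector_derivative g x t) (at t within {0..})"
  using assms unfolding closed_family_def by blast+

lemma hderiv_eq:
  assumes "(f has_vector_derivative D) (at x within {0..})" "x \<ge> 0"
  shows "hderiv f x = D"
  unfolding hderiv_def
proof (rule vector_derivative_within[OF _ assms(1)])
  have "x islimpt {x..x + 1}" by (simp add: islimpt_Icc)
  moreover have "{x..x + 1} \<subseteq> {0..}" using assms(2) by auto
  ultimately have "x islimpt {0..}" by (rule islimpt_subset)
  then show "at x within {0..} \<noteq> bot" by (simp add: trivial_limit_within)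
qed

lemma hderiv_cong:
  assumes "\<And>x. x \<ge> 0 \<Longrightarrow> f x = g x" "x \<ge> 0"
  shows "hderiv f x = hderiv g x"
proof -
  have "(f has_vector_derivative D) (at x within {0..}) \<longleftrightarrow> (g has_vector_derivative D) (at x within {0..})" for D
    using assms has_vector_derivative_transform[of x "{0..}" f g D]
      has_vector_derivative_transform[of x "{0..}" g f D] by auto
  then show ?thesis by (simp add: hderiv_def vector_derivative_def)
qed

lemma differentiable_halfline_cong:
  fixes f :: "real \<Rightarrow> complex"
  assumes "(g has_vector_derivative D) (at x within {0..})" "\<And>x. x \<ge> 0 \<Longrightarrow> f x = g x" "x \<ge> 0"
  shows "f differentiable (at x within {0..})"
proof -
  have "(f has_vector_derivative D) (at x within {0..})"
    using assms has_vector_derivative_transform[of x "{0..}" f g D] by auto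
  then show ?thesis by (auto intro: differentiableI_vector)
qed

text \<open>Equality is claimed on the quarter plane only, since the values of the total functions
  at negative arguments carry no meaning; one-sided derivatives do not see them.\<close>

lemma iterated_partials_closed_family:
  assumes "closed_family \<Phi>" "v \<in> iterated_partials f" "f \<in> \<Phi>"
  shows "\<exists>g\<in>\<Phi>. \<forall>x\<ge>0. \<forall>t\<ge>0. v x t = g x t"
  using assms(2)
proof induction
  case self
  then show ?case using assms by auto
next
  case (x v)
  then obtain g where g: "g \<in> \<Phi>" "\<forall>x\<ge>0. \<forall>t\<ge>0. v x t = g x t" by blast
  then obtain h where h: "h \<in> \<Phi>" "\<forall>x\<ge>0. \<forall>t\<ge>0. ((\<lambda>y. g y t) has_vector_derivative h x t) (at x within {0..})"
    using closed_familyD(2)[OF assms(1) g(1)] by blast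
  have "partial_x v x t = h x t" if "x \<ge> 0" "t \<ge> 0" for x t
  proof -
    have "partial_x v x t = hderiv (\<lambda>y. g y t) x"
      unfolding partial_x_def using g that by (intro hderiv_cong) auto
    also have "\<dots> = h x t" using h that by (intro hderiv_eq) auto
    finally show ?thesis .
  qed
  with h show ?case by blast
next
  case (t v)
  then obtain g where g: "g \<in> \<Phi>" "\<forall>x\<ge>0. \<forall>t\<ge>0. v x t = g x t" by blast
  then obtain h where h: "h \<in> \<Phi>" "\<forall>x\<ge>0. \<forall>t\<ge>0. ((\<lambda>s. g x s) has_vector_derivative h x t) (at t within {0..})"
    using closed_familyD(3)[OF assms(1) g(1)] by blast
  have "partial_t v x t = h x t" if "x \<ge> 0" "t \<ge> 0" for x t
  proof -
    have "partial_t v x t = hderiv (\<lambda>s. g x s) t"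
      unfolding partial_t_def using g that by (intro hderiv_cong) auto
    also have "\<dots> = h x t" using h that by (intro hderiv_eq) auto
    finally show ?thesis .
  qed
  with h show ?case by blast
qed

lemma closed_family_smooth_quarter_plane:
  assumes "closed_family \<Phi>" "f \<in> \<Phi>"
  shows "smooth_quarter_plane f"
  unfolding smooth_quarter_plane_def
proof (intro ballI conjI allI impI)
  fix v assume "v \<in> iterated_partials f"
  then obtain g where g: "g \<in> \<Phi>" "\<forall>x\<ge>0. \<forall>t\<ge>0. v x t = g x t"
    using iterated_partials_closed_family[OF assms(1) _ assms(2)] by blast
  have "continuous_on ({0..} \<times> {0..}) (\<lambda>(x, t). g x t)"
    using g(1) assms(1) unfolding closed_family_def by blast
  then show "continuous_on ({0..} \<times> {0..}) (\<lambda>(x, t). v x t)"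
    by (rule continuous_on_eq) (use g(2) in auto)
  fix x t :: real assume xt: "x \<ge> 0" "t \<ge> 0"
  obtain h where "\<forall>x\<ge>0. \<forall>t\<ge>0. ((\<lambda>y. g y t) has_vector_derivative h x t) (at x within {0..})"
    using g(1) assms(1) unfolding closed_family_def by blast
  then show "(\<lambda>y. v y t) differentiable (at x within {0..})"
    using g(2) xt by (intro differentiable_halfline_cong[where g = "\<lambda>y. g y t"]) auto
  obtain k where "\<forall>x\<ge>0. \<forall>t\<ge>0. ((\<lambda>s. g x s) has_vector_derivative k x t) (at t within {0..})"
    using g(1) assms(1) unfolding closed_family_def by blast
  then show "(\<lambda>s. v x s) differentiable (at t within {0..})"
    using g(2) xt by (intro differentiable_halfline_cong[where g = "\<lambda>s. g x s"]) auto
qed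

lemma closed_family_hderiv_x:
  assumes "closed_family \<Phi>" "f \<in> \<Phi>" "t \<ge> 0"
  shows "\<exists>g\<in>\<Phi>. \<forall>x\<ge>0. (hderiv ^^ m) (\<lambda>x. f x t) x = g x t"
proof (induction m)
  case 0
  then show ?case using assms by auto
next
  case (Suc m)
  then obtain g where g: "g \<in> \<Phi>" "\<forall>x\<ge>0. (hderiv ^^ m) (\<lambda>x. f x t) x = g x t" by blast
  then obtain h where h: "h \<in> \<Phi>" "\<forall>x\<ge>0. \<forall>t\<ge>0. ((\<lambda>y. g y t) has_vector_derivative h x t) (at x within {0..})"
    using closed_familyD(2)[OF assms(1) g(1)] by blast
  have "(hderiv ^^ Suc m) (\<lambda>x. f x t) x = h x t" if "x \<ge> 0" for x
  proof -
    have "(hderiv ^^ Suc m) (\<lambda>x. f x t) x = hderiv (\<lambda>y. g y t) x"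
      using g that by (auto intro: hderiv_cong)
    also have "\<dots> = h x t" using h that assms(3) by (intro hderiv_eq) auto
    finally show ?thesis .
  qed
  with h show ?case by blast
qed

lemma closed_family_hderiv_t:
  assumes "closed_family \<Phi>" "f \<in> \<Phi>" "x \<ge> 0"
  shows "\<exists>g\<in>\<Phi>. \<forall>t\<ge>0. (hderiv ^^ m) (\<lambda>t. f x t) t = g x t"
proof (induction m)
  case 0
  then show ?case using assms by auto
next
  case (Suc m)
  then obtain g where g: "g \<in> \<Phi>" "\<forall>t\<ge>0. (hderiv ^^ m) (\<lambda>t. f x t) t = g x t" by blast
  then obtain h where h: "h \<in> \<Phi>" "\<forall>x\<ge>0. \<forall>t\<ge>0. ((\<lambda>s. g x s) has_vector_derivative h x t) (at t within {0..})"
    using closed_familyD(3)[OF assms(1) g(1)] by blast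
  have "(hderiv ^^ Suc m) (\<lambda>t. f x t) t = h x t" if "t \<ge> 0" for t
  proof -
    have "(hderiv ^^ Suc m) (\<lambda>t. f x t) t = hderiv (\<lambda>s. g x s) t"
      using g that by (auto intro: hderiv_cong)
    also have "\<dots> = h x t" using h that assms(3) by (intro hderiv_eq) auto
    finally show ?thesis .
  qed
  with h show ?case by blast
qed

lemma closed_family_smooth_x:
  assumes "closed_family \<Phi>" "f \<in> \<Phi>" "t \<ge> 0"
  shows "smooth_halfline (\<lambda>x. f x t)"
  unfolding smooth_halfline_def
proof (intro allI impI)
  fix m x assume "(x::real) \<ge> 0"
  obtain g where g: "g \<in> \<Phi>" "\<forall>x\<ge>0. (hderiv ^^ m) (\<lambda>x. f x t) x = g x t"
    using closed_family_hderiv_x[OF assms] by blast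
  then obtain h where "\<forall>x\<ge>0. \<forall>t\<ge>0. ((\<lambda>y. g y t) has_vector_derivative h x t) (at x within {0..})"
    using closed_familyD(2)[OF assms(1) g(1)] by blast
  then show "(hderiv ^^ m) (\<lambda>x. f x t) differentiable (at x within {0..})"
    using g \<open>x \<ge> 0\<close> assms(3) by (intro differentiable_halfline_cong[where g = "\<lambda>y. g y t"]) auto
qed

lemma closed_family_smooth_t:
  assumes "closed_family \<Phi>" "f \<in> \<Phi>" "x \<ge> 0"
  shows "smooth_halfline (\<lambda>t. f x t)"
  unfolding smooth_halfline_def
proof (intro allI impI)
  fix m t assume "(t::real) \<ge> 0"
  obtain g where g: "g \<in> \<Phi>" "\<forall>t\<ge>0. (hderiv ^^ m) (\<lambda>t. f x t) t = g x t"
    using closed_family_hderiv_t[OF assms] by blast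
  then obtain h where "\<forall>x\<ge>0. \<forall>t\<ge>0. ((\<lambda>s. g x s) has_vector_derivative h x t) (at t within {0..})"
    using closed_familyD(3)[OF assms(1) g(1)] by blast
  then show "(hderiv ^^ m) (\<lambda>t. f x t) differentiable (at t within {0..})"
    using g \<open>t \<ge> 0\<close> assms(3) by (intro differentiable_halfline_cong[where g = "\<lambda>s. g x s"]) auto
qed

text \<open>Powers of \<open>x\<close> and \<open>t\<close> are weighed against growth of order
  \<open>p\<close> in time. Schwartz functions of \<open>x\<close> need every \<open>i\<close> with
  some \<open>p\<close>, as no uniformity in time is required; Schwartz functions of
  \<open>t\<close> need every \<open>j\<close> with \<open>p = 0\<close>.\<close>

definition decays :: "nat \<Rightarrow> nat \<Rightarrow> nat \<Rightarrow> (real \<Rightarrow> real \<Rightarrow> complex) \<Rightarrow> bool" where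
  "decays i j p f \<longleftrightarrow> (\<exists>C. \<forall>x\<ge>0. \<forall>t\<ge>0. x ^ i * t ^ j * norm (f x t) \<le> C * (1 + t) ^ p)"

lemma closed_family_schwartz_x:
  assumes "closed_family \<Phi>" "f \<in> \<Phi>" "t \<ge> 0"
    and "\<And>g i. g \<in> \<Phi> \<Longrightarrow> \<exists>p. decays i 0 p g"
  shows "(\<lambda>x. f x t) \<in> schwartz_halfline"
  unfolding schwartz_halfline_def
proof (intro CollectI conjI allI)
  show "smooth_halfline (\<lambda>x. f x t)" using assms closed_family_smooth_x by blast
  fix n m
  obtain g where g: "g \<in> \<Phi>" "\<forall>x\<ge>0. (hderiv ^^ m) (\<lambda>x. f x t) x = g x t"
    using closed_family_hderiv_x[OF assms(1-3)] by blast
  obtain p C where C: "\<forall>x\<ge>0. \<forall>t\<ge>0. x ^ n * t ^ 0 * norm (g x t) \<le> C * (1 + t) ^ p"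
    using assms(4)[OF g(1), of n] unfolding decays_def by blast
  show "bounded ((\<lambda>x. of_real (x ^ n) * (hderiv ^^ m) (\<lambda>x. f x t) x) ` {0..})"
    unfolding bounded_iff using C g(2) assms(3)
    by (intro exI[of _ "C * (1 + t) ^ p"]) (auto simp: norm_mult norm_power)
qed

lemma closed_family_schwartz_t:
  assumes "closed_family \<Phi>" "f \<in> \<Phi>"
    and "\<And>g j. g \<in> \<Phi> \<Longrightarrow> decays 0 j 0 g"
  shows "(\<lambda>t. f 0 t) \<in> schwartz_halfline"
  unfolding schwartz_halfline_def
proof (intro CollectI conjI allI)
  show "smooth_halfline (\<lambda>t. f 0 t)" using assms closed_family_smooth_t by auto
  fix n m
  obtain g where g: "g \<in> \<Phi>" "\<forall>t\<ge>0. (hderiv ^^ m) (\<lambda>t. f 0 t) t = g 0 t"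
    using closed_family_hderiv_t[OF assms(1-2), of 0] by auto
  obtain C where C: "\<forall>x\<ge>0. \<forall>t\<ge>0. x ^ 0 * t ^ n * norm (g x t) \<le> C * (1 + t) ^ 0"
    using assms(3)[OF g(1), of n] unfolding decays_def by blast
  show "bounded ((\<lambda>t. of_real (t ^ n) * (hderiv ^^ m) (\<lambda>t. f 0 t) t) ` {0..})"
    unfolding bounded_iff using C g(2)
    by (intro exI[of _ C]) (auto simp: norm_mult norm_power)
qed

section \<open>Finite linear combinations of generators\<close>

inductive_set lspan :: "(real \<Rightarrow> real \<Rightarrow> complex) set \<Rightarrow> (real \<Rightarrow> real \<Rightarrow> complex) set"
  for G where
  base: "f \<in> G \<Longrightarrow> f \<in> lspan G"
| add: "f \<in> lspan G \<Longrightarrow> g \<in> lspan G \<Longrightarrow> (\<lambda>x t. f x t + g x t) \<in> lspan G"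
| scale: "f \<in> lspan G \<Longrightarrow> (\<lambda>x t. c * f x t) \<in> lspan G"

text \<open>It is enough to differentiate generators, with results in the span; linearity does the
  rest. The span is needed because differentiating one profile may produce several.\<close>

definition generates :: "(real \<Rightarrow> real \<Rightarrow> complex) set \<Rightarrow> bool" where
  "generates G \<longleftrightarrow> (\<forall>f\<in>G. continuous_on ({0..} \<times> {0..}) (\<lambda>(x, t). f x t) \<and>
     (\<exists>g\<in>lspan G. \<forall>x\<ge>0. \<forall>t\<ge>0. ((\<lambda>y. f y t) has_vector_derivative g x t) (at x within {0..})) \<and>
     (\<exists>g\<in>lspan G. \<forall>x\<ge>0. \<forall>t\<ge>0. ((\<lambda>s. f x s) has_vector_derivative g x t) (at t within {0..})))"

lemma closed_family_lspan:
  assumes "generates G"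
  shows "closed_family (lspan G)"
  unfolding closed_family_def
proof
  fix f assume "f \<in> lspan G"
  then show "continuous_on ({0..} \<times> {0..}) (\<lambda>(x, t). f x t) \<and>
     (\<exists>g\<in>lspan G. \<forall>x\<ge>0. \<forall>t\<ge>0. ((\<lambda>y. f y t) has_vector_derivative g x t) (at x within {0..})) \<and>
     (\<exists>g\<in>lspan G. \<forall>x\<ge>0. \<forall>t\<ge>0. ((\<lambda>s. f x s) has_vector_derivative g x t) (at t within {0..}))"
  proof induction
    case (base f)
    then show ?case using assms unfolding generates_def by (elim ballE[of _ _ f]) auto
  next
    case (add f g)
    from add.IH obtain f1 f2 g1 g2 where
      1: "f1 \<in> lspan G" "\<forall>x\<ge>0. \<forall>t\<ge>0. ((\<lambda>y. f y t) has_vector_derivative f1 x t) (at x within {0..})" and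
      2: "f2 \<in> lspan G" "\<forall>x\<ge>0. \<forall>t\<ge>0. ((\<lambda>s. f x s) has_vector_derivative f2 x t) (at t within {0..})" and
      3: "g1 \<in> lspan G" "\<forall>x\<ge>0. \<forall>t\<ge>0. ((\<lambda>y. g y t) has_vector_derivative g1 x t) (at x within {0..})" and
      4: "g2 \<in> lspan G" "\<forall>x\<ge>0. \<forall>t\<ge>0. ((\<lambda>s. g x s) has_vector_derivative g2 x t) (at t within {0..})"
      by (elim conjE bexE) blast
    show ?case
    proof (intro conjI)
      show "continuous_on ({0..} \<times> {0..}) (\<lambda>(x, t). f x t + g x t)"
        using add by (auto simp: case_prod_unfold intro: continuous_on_add)
      show "\<exists>h\<in>lspan G. \<forall>x\<ge>0. \<forall>t\<ge>0. ((\<lambda>y. f y t + g y t) has_vector_derivative h x t) (at x within {0..})"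
        using 1 3 by (intro bexI[OF _ lspan.add[OF 1(1) 3(1)]]) (auto intro: has_vector_derivative_add)
      show "\<exists>h\<in>lspan G. \<forall>x\<ge>0. \<forall>t\<ge>0. ((\<lambda>s. f x s + g x s) has_vector_derivative h x t) (at t within {0..})"
        using 2 4 by (intro bexI[OF _ lspan.add[OF 2(1) 4(1)]]) (auto intro: has_vector_derivative_add)
    qed
  next
    case (scale f c)
    from scale.IH obtain f1 f2 where
      1: "f1 \<in> lspan G" "\<forall>x\<ge>0. \<forall>t\<ge>0. ((\<lambda>y. f y t) has_vector_derivative f1 x t) (at x within {0..})" and
      2: "f2 \<in> lspan G" "\<forall>x\<ge>0. \<forall>t\<ge>0. ((\<lambda>s. f x s) has_vector_derivative f2 x t) (at t within {0..})"
      by (elim conjE bexE) blast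
    show ?case
    proof (intro conjI)
      show "continuous_on ({0..} \<times> {0..}) (\<lambda>(x, t). c * f x t)"
        using scale by (auto simp: case_prod_unfold intro: continuous_on_mult_left)
      show "\<exists>h\<in>lspan G. \<forall>x\<ge>0. \<forall>t\<ge>0. ((\<lambda>y. c * f y t) has_vector_derivative h x t) (at x within {0..})"
        using 1 by (intro bexI[OF _ lspan.scale[OF 1(1), of c]]) (auto intro: has_vector_derivative_mult_right)
      show "\<exists>h\<in>lspan G. \<forall>x\<ge>0. \<forall>t\<ge>0. ((\<lambda>s. c * f x s) has_vector_derivative h x t) (at t within {0..})"
        using 2 by (intro bexI[OF _ lspan.scale[OF 2(1), of c]]) (auto intro: has_vector_derivative_mult_right)
    qed
  qed
qed

lemma decays_nonneg:
  assumes "decays i j p f"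
  obtains C where "C \<ge> 0" "\<forall>x\<ge>0. \<forall>t\<ge>0. x ^ i * t ^ j * norm (f x t) \<le> C * (1 + t) ^ p"
proof -
  obtain C where C: "\<forall>x\<ge>0. \<forall>t\<ge>0. x ^ i * t ^ j * norm (f x t) \<le> C * (1 + t) ^ p"
    using assms unfolding decays_def by blast
  have "0 \<le> (0::real) ^ i * 0 ^ j * norm (f 0 0)" by simp
  also have "\<dots> \<le> C * (1 + 0) ^ p" using C by (meson order_refl)
  finally have "C \<ge> 0" by simp
  with C show ?thesis using that by blast
qed

lemma decays_mono:
  assumes "decays i j p f" "p \<le> q"
  shows "decays i j q f"
proof -
  obtain C where C: "C \<ge> 0" "\<forall>x\<ge>0. \<forall>t\<ge>0. x ^ i * t ^ j * norm (f x t) \<le> C * (1 + t) ^ p"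
    using decays_nonneg[OF assms(1)] by blast
  have "C * (1 + t) ^ p \<le> C * (1 + t) ^ q" if "t \<ge> 0" for t
    using C(1) that assms(2) by (intro mult_left_mono power_increasing) auto
  with C show ?thesis unfolding decays_def by (meson order_trans)
qed

lemma decays_add:
  assumes "decays i j p f" "decays i j p g"
  shows "decays i j p (\<lambda>x t. f x t + g x t)"
proof -
  obtain C where C: "\<forall>x\<ge>0. \<forall>t\<ge>0. x ^ i * t ^ j * norm (f x t) \<le> C * (1 + t) ^ p"
    using assms(1) unfolding decays_def by blast
  obtain D where D: "\<forall>x\<ge>0. \<forall>t\<ge>0. x ^ i * t ^ j * norm (g x t) \<le> D * (1 + t) ^ p"
    using assms(2) unfolding decays_def by blast
  have "x ^ i * t ^ j * norm (f x t + g x t) \<le> (C + D) * (1 + t) ^ p" if "x \<ge> 0" "t \<ge> 0" for x t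
  proof -
    have "x ^ i * t ^ j * norm (f x t + g x t) \<le> x ^ i * t ^ j * (norm (f x t) + norm (g x t))"
      using that by (intro mult_left_mono norm_triangle_ineq) auto
    also have "\<dots> \<le> C * (1 + t) ^ p + D * (1 + t) ^ p"
      using C D that unfolding distrib_left by (intro add_mono) auto
    finally show ?thesis by (simp add: distrib_right)
  qed
  then show ?thesis unfolding decays_def by blast
qed

lemma decays_scale:
  assumes "decays i j p f"
  shows "decays i j p (\<lambda>x t. c * f x t)"
proof -
  obtain C where C: "\<forall>x\<ge>0. \<forall>t\<ge>0. x ^ i * t ^ j * norm (f x t) \<le> C * (1 + t) ^ p"
    using assms(1) unfolding decays_def by blast
  have "x ^ i * t ^ j * norm (c * f x t) \<le> (norm c * C) * (1 + t) ^ p" if "x \<ge> 0" "t \<ge> 0" for x t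
  proof -
    have "norm c * (x ^ i * t ^ j * norm (f x t)) \<le> norm c * (C * (1 + t) ^ p)"
      using C that by (intro mult_left_mono) auto
    then show ?thesis by (simp add: norm_mult mult_ac)
  qed
  then show ?thesis unfolding decays_def by blast
qed

lemma decays_lspan:
  assumes "f \<in> lspan G" "\<And>g. g \<in> G \<Longrightarrow> decays i j p g"
  shows "decays i j p f"
  using assms(1) by induction (auto intro: assms decays_add decays_scale)

lemma ex_decays_lspan:
  assumes "f \<in> lspan G" "\<And>g. g \<in> G \<Longrightarrow> \<exists>p. decays i j p g"
  shows "\<exists>p. decays i j p f"
  using assms(1)
proof induction
  case (add f g)
  then obtain p q where "decays i j p f" "decays i j q g" by blast
  then have "decays i j (max p q) f" "decays i j (max p q) g" by (auto intro: decays_mono)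
  then show ?case by (blast intro: decays_add)
qed (use assms in \<open>auto intro: decays_scale\<close>)

section \<open>Sums of rescaled modes\<close>

text \<open>Indexed from \<open>0\<close>: mode \<open>n\<close> has frequency
  \<open>\<omega> * (real n + 1)\<close>, the square of its wave number. Frequency zero is thereby
  excluded, and the wave numbers stay away from \<open>0\<close>.\<close>

definition wavenumber :: "real \<Rightarrow> nat \<Rightarrow> real" where
  "wavenumber \<omega> n = sqrt (\<omega> * (real n + 1))"

text \<open>Decay beyond all powers, in a summable form that serves directly as a majorant and is
  stable under multiplication by wave numbers.\<close>

definition rapid :: "(nat \<Rightarrow> complex) \<Rightarrow> bool" where
  "rapid b \<longleftrightarrow> (\<forall>k. summable (\<lambda>n. norm (b n) * (real n + 1) ^ k))"

text \<open>The Schroedinger equation is invariant under the scaling \<open>x\<close> to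
  \<open>l * x\<close> and \<open>t\<close> to \<open>l\<^sup>2 * t\<close>, so a single profile
  yields all frequencies.\<close>

definition mode_sum :: "real \<Rightarrow> (nat \<Rightarrow> complex) \<Rightarrow> (real \<Rightarrow> real \<Rightarrow> complex) \<Rightarrow> real \<Rightarrow> real \<Rightarrow> complex" where
  "mode_sum \<omega> b f x t = (\<Sum>n. b n * f (wavenumber \<omega> n * x) ((wavenumber \<omega> n)\<^sup>2 * t))"

lemma wavenumber_pos: "\<omega> > 0 \<Longrightarrow> wavenumber \<omega> n > 0"
  by (simp add: wavenumber_def add_nonneg_pos)

lemma wavenumber_sq: "\<omega> > 0 \<Longrightarrow> (wavenumber \<omega> n)\<^sup>2 = \<omega> * (real n + 1)"
  by (simp add: wavenumber_def)

lemma wavenumber_ge: "\<omega> > 0 \<Longrightarrow> wavenumber \<omega> n \<ge> sqrt \<omega>"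
  by (simp add: wavenumber_def)

lemma wavenumber_le:
  assumes "\<omega> > 0"
  shows "wavenumber \<omega> n \<le> (1 + \<omega>) * (real n + 1)"
proof (rule power2_le_imp_le)
  have "(wavenumber \<omega> n)\<^sup>2 = \<omega> * (real n + 1)" using assms by (rule wavenumber_sq)
  also have "\<dots> \<le> (1 + \<omega>) * (real n + 1)" using assms by (intro mult_right_mono) auto
  also have "\<dots> \<le> ((1 + \<omega>) * (real n + 1))\<^sup>2"
  proof -
    have "1 * 1 \<le> (1 + \<omega>) * (real n + 1)" using assms by (intro mult_mono) auto
    then show ?thesis by (simp add: power2_eq_square mult_left_le[of 1] mult_le_cancel_left1 del: mult_1)
  qed
  finally show "(wavenumber \<omega> n)\<^sup>2 \<le> ((1 + \<omega>) * (real n + 1))\<^sup>2" .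
qed (use assms in simp)

lemma rapid_summable: "rapid b \<Longrightarrow> summable (\<lambda>n. norm (b n) * (real n + 1) ^ k)"
  by (simp add: rapid_def)

lemma rapid_wavenumber:
  assumes "rapid b" "\<omega> > 0"
  shows "rapid (\<lambda>n. b n * of_real (wavenumber \<omega> n))"
  unfolding rapid_def
proof
  fix k
  show "summable (\<lambda>n. norm (b n * of_real (wavenumber \<omega> n)) * (real n + 1) ^ k)"
  proof (rule summable_comparison_test')
    show "summable (\<lambda>n. (1 + \<omega>) * (norm (b n) * (real n + 1) ^ Suc k))"
      by (intro summable_mult rapid_summable assms)
    fix n :: nat
    have "norm (b n * of_real (wavenumber \<omega> n)) * (real n + 1) ^ k = norm (b n) * (real n + 1) ^ k * wavenumber \<omega> n"
      using wavenumber_pos[OF assms(2), of n] by (simp add: norm_mult)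
    also have "\<dots> \<le> norm (b n) * (real n + 1) ^ k * ((1 + \<omega>) * (real n + 1))"
      by (intro mult_left_mono wavenumber_le assms) auto
    finally show "norm (norm (b n * of_real (wavenumber \<omega> n)) * (real n + 1) ^ k) \<le> (1 + \<omega>) * (norm (b n) * (real n + 1) ^ Suc k)"
      by (simp add: mult_ac)
  qed
qed

lemma rapid_scale:
  assumes "rapid b"
  shows "rapid (\<lambda>n. c * b n)"
  using summable_mult[OF rapid_summable[OF assms], of "norm c"] unfolding rapid_def
  by (simp add: norm_mult mult_ac)

text \<open>Decay survives the scaling because the wave numbers are at least
  \<open>sqrt \<omega>\<close>, which bounds the powers of \<open>1 / l\<close>; growth in the
  scaled time costs a power of \<open>real n + 1\<close>, which rapid coefficients absorb.\<close>

lemma mode_term_bound: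
  fixes b :: "nat \<Rightarrow> complex" and f :: "real \<Rightarrow> real \<Rightarrow> complex"
  assumes "\<omega> > 0" "x \<ge> 0" "t \<ge> 0" "C \<ge> 0"
    and C: "\<forall>x\<ge>0. \<forall>t\<ge>0. x ^ i * t ^ j * norm (f x t) \<le> C * (1 + t) ^ p"
  shows "x ^ i * t ^ j * norm (b n * f (wavenumber \<omega> n * x) ((wavenumber \<omega> n)\<^sup>2 * t))
    \<le> (norm (b n) * (real n + 1) ^ p) * (C * (1 / sqrt \<omega>) ^ (i + 2 * j) * (1 + \<omega>) ^ p * (1 + t) ^ p)"
proof -
  define l where "l = wavenumber \<omega> n"
  have l: "l > 0" using wavenumber_pos[OF assms(1)] by (simp add: l_def)
  have linv: "1 / l \<le> 1 / sqrt \<omega>"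
    using wavenumber_ge[OF assms(1), of n] assms(1) l by (auto simp: l_def intro: frac_le)
  have 1: "1 + l\<^sup>2 * t \<le> (1 + \<omega>) * (real n + 1) * (1 + t)"
  proof -
    have "1 + l\<^sup>2 * t = 1 + \<omega> * (real n + 1) * t" using wavenumber_sq[OF assms(1), of n] by (simp add: l_def)
    also have "\<dots> \<le> (1 + \<omega>) * (real n + 1) * (1 + t)"
      using assms by (simp add: algebra_simps)
    finally show ?thesis .
  qed
  have xt: "x ^ i * t ^ j = ((l * x) ^ i * (l\<^sup>2 * t) ^ j) * (1 / l) ^ (i + 2 * j)"
    using l by (simp add: power_mult_distrib power_add power_mult power_divide)
  have "x ^ i * t ^ j * norm (f (l * x) (l\<^sup>2 * t))
      = (1 / l) ^ (i + 2 * j) * ((l * x) ^ i * (l\<^sup>2 * t) ^ j * norm (f (l * x) (l\<^sup>2 * t)))"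
    unfolding xt by simp
  also have "\<dots> \<le> (1 / sqrt \<omega>) ^ (i + 2 * j) * (C * (1 + l\<^sup>2 * t) ^ p)"
    using assms l linv by (intro mult_mono power_mono C[rule_format]) auto
  also have "\<dots> \<le> (1 / sqrt \<omega>) ^ (i + 2 * j) * (C * ((1 + \<omega>) * (real n + 1) * (1 + t)) ^ p)"
    using assms 1 by (intro mult_left_mono power_mono) auto
  finally have "x ^ i * t ^ j * norm (f (l * x) (l\<^sup>2 * t))
      \<le> (1 / sqrt \<omega>) ^ (i + 2 * j) * (C * ((1 + \<omega>) * (real n + 1) * (1 + t)) ^ p)" .
  then have "norm (b n) * (x ^ i * t ^ j * norm (f (l * x) (l\<^sup>2 * t)))
      \<le> norm (b n) * ((1 / sqrt \<omega>) ^ (i + 2 * j) * (C * ((1 + \<omega>) * (real n + 1) * (1 + t)) ^ p))"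
    by (rule mult_left_mono) simp
  moreover have "x ^ i * t ^ j * norm (b n * f (l * x) (l\<^sup>2 * t)) = norm (b n) * (x ^ i * t ^ j * norm (f (l * x) (l\<^sup>2 * t)))"
    by (subst norm_mult) (simp only: mult_ac)
  moreover have "norm (b n) * ((1 / sqrt \<omega>) ^ (i + 2 * j) * (C * ((1 + \<omega>) * (real n + 1) * (1 + t)) ^ p))
      = (norm (b n) * (real n + 1) ^ p) * (C * (1 / sqrt \<omega>) ^ (i + 2 * j) * (1 + \<omega>) ^ p * (1 + t) ^ p)"
    by (simp only: power_mult_distrib mult_ac)
  ultimately show ?thesis unfolding l_def by linarith
qed

lemma mode_sum_summable_norm:
  assumes "\<omega> > 0" "rapid b" "decays 0 0 p f" "x \<ge> 0" "t \<ge> 0"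
  shows "summable (\<lambda>n. norm (b n * f (wavenumber \<omega> n * x) ((wavenumber \<omega> n)\<^sup>2 * t)))"
proof -
  obtain C where C: "C \<ge> 0" "\<forall>x\<ge>0. \<forall>t\<ge>0. x ^ 0 * t ^ 0 * norm (f x t) \<le> C * (1 + t) ^ p"
    using decays_nonneg[OF assms(3)] by blast
  show ?thesis
  proof (rule summable_comparison_test')
    show "summable (\<lambda>n. norm (b n) * (real n + 1) ^ p * (C * (1 / sqrt \<omega>) ^ (0 + 2 * 0) * (1 + \<omega>) ^ p * (1 + t) ^ p))"
      by (intro summable_mult2 rapid_summable assms)
    show "norm (norm (b n * f (wavenumber \<omega> n * x) ((wavenumber \<omega> n)\<^sup>2 * t)))
        \<le> norm (b n) * (real n + 1) ^ p * (C * (1 / sqrt \<omega>) ^ (0 + 2 * 0) * (1 + \<omega>) ^ p * (1 + t) ^ p)" for n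
      using mode_term_bound[OF assms(1,4,5) C, of b n] by simp
  qed
qed

lemmas mode_sum_summable = summable_norm_cancel[OF mode_sum_summable_norm]

text \<open>Over the counting measure a series is an integral, so the lemmas on limits and
  derivatives under the integral sign apply to mode sums.\<close>

lemma mode_sum_integral:
  assumes "\<omega> > 0" "rapid b" "decays 0 0 p f" "x \<ge> 0" "t \<ge> 0"
  shows "integrable (count_space UNIV) (\<lambda>n. b n * f (wavenumber \<omega> n * x) ((wavenumber \<omega> n)\<^sup>2 * t))"
    and "mode_sum \<omega> b f x t = (\<integral>n. b n * f (wavenumber \<omega> n * x) ((wavenumber \<omega> n)\<^sup>2 * t) \<partial>count_space UNIV)"
proof -
  show *: "integrable (count_space UNIV) (\<lambda>n. b n * f (wavenumber \<omega> n * x) ((wavenumber \<omega> n)\<^sup>2 * t))"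
    unfolding integrable_count_space_nat_iff by (rule mode_sum_summable_norm[OF assms])
  show "mode_sum \<omega> b f x t = (\<integral>n. b n * f (wavenumber \<omega> n * x) ((wavenumber \<omega> n)\<^sup>2 * t) \<partial>count_space UNIV)"
    unfolding mode_sum_def by (rule integral_count_space_nat[OF *, symmetric])
qed

lemma mode_sum_decays:
  assumes "\<omega> > 0" "rapid b" "decays i j p f" "decays 0 0 q f"
  shows "decays i j p (mode_sum \<omega> b f)"
proof -
  obtain C where C: "C \<ge> 0" "\<forall>x\<ge>0. \<forall>t\<ge>0. x ^ i * t ^ j * norm (f x t) \<le> C * (1 + t) ^ p"
    using decays_nonneg[OF assms(3)] by blast
  let ?K = "C * (1 / sqrt \<omega>) ^ (i + 2 * j) * (1 + \<omega>) ^ p"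
  have "x ^ i * t ^ j * norm (mode_sum \<omega> b f x t) \<le> (\<Sum>n. norm (b n) * (real n + 1) ^ p) * ?K * (1 + t) ^ p"
    if "x \<ge> 0" "t \<ge> 0" for x t
  proof -
    have s: "summable (\<lambda>n. norm (b n * f (wavenumber \<omega> n * x) ((wavenumber \<omega> n)\<^sup>2 * t)))"
      by (rule mode_sum_summable_norm[OF assms(1,2,4) that])
    have "x ^ i * t ^ j * norm (mode_sum \<omega> b f x t) \<le> x ^ i * t ^ j * (\<Sum>n. norm (b n * f (wavenumber \<omega> n * x) ((wavenumber \<omega> n)\<^sup>2 * t)))"
      unfolding mode_sum_def using that by (intro mult_left_mono summable_norm s) auto
    also have "\<dots> = (\<Sum>n. x ^ i * t ^ j * norm (b n * f (wavenumber \<omega> n * x) ((wavenumber \<omega> n)\<^sup>2 * t)))"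
      by (rule suminf_mult[OF s, symmetric])
    also have "\<dots> \<le> (\<Sum>n. norm (b n) * (real n + 1) ^ p * (?K * (1 + t) ^ p))"
      using mode_term_bound[OF assms(1) that C]
      by (intro suminf_le summable_mult summable_mult2 s rapid_summable assms) auto
    also have "\<dots> = (\<Sum>n. norm (b n) * (real n + 1) ^ p) * (?K * (1 + t) ^ p)"
      by (rule suminf_mult2[symmetric, OF rapid_summable[OF assms(2)]])
    finally show ?thesis by (simp only: mult.assoc)
  qed
  then show ?thesis unfolding decays_def by blast
qed

lemma mode_sum_has_vector_derivative_x:
  assumes "\<omega> > 0" "rapid b" "decays 0 0 p f" "decays 0 0 q g" "x \<ge> 0" "t \<ge> 0"
    and deriv: "\<forall>x\<ge>0. \<forall>t\<ge>0. ((\<lambda>y. f y t) has_vector_derivative g x t) (at x within {0..})"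
  shows "((\<lambda>y. mode_sum \<omega> b f y t) has_vector_derivative mode_sum \<omega> (\<lambda>n. b n * wavenumber \<omega> n) g x t) (at x within {0..})"
proof -
  obtain C where C: "C \<ge> 0" "\<forall>x\<ge>0. \<forall>t\<ge>0. x ^ 0 * t ^ 0 * norm (g x t) \<le> C * (1 + t) ^ q"
    using decays_nonneg[OF assms(4)] by blast
  let ?b = "\<lambda>n. b n * of_real (wavenumber \<omega> n)"
  let ?K = "C * (1 / sqrt \<omega>) ^ (0 + 2 * 0) * (1 + \<omega>) ^ q * (1 + t) ^ q"
  have rb: "rapid ?b" by (rule rapid_wavenumber[OF assms(2,1)])
  have "((\<lambda>y. \<integral>n. b n * f (wavenumber \<omega> n * y) ((wavenumber \<omega> n)\<^sup>2 * t) \<partial>count_space UNIV) has_vector_derivative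
      (\<integral>n. ?b n * g (wavenumber \<omega> n * x) ((wavenumber \<omega> n)\<^sup>2 * t) \<partial>count_space UNIV)) (at x within {0..})"
  proof (rule has_vector_derivative_lebesgue_integral[where r = 1 and B = "\<lambda>n. norm (?b n) * (real n + 1) ^ q * ?K"
        and f = "\<lambda>y n. b n * f (wavenumber \<omega> n * y) ((wavenumber \<omega> n)\<^sup>2 * t)" and f' = "\<lambda>y n. ?b n * g (wavenumber \<omega> n * y) ((wavenumber \<omega> n)\<^sup>2 * t)"])
    show "integrable (count_space UNIV) (\<lambda>n. norm (?b n) * (real n + 1) ^ q * ?K)"
      unfolding integrable_count_space_nat_iff using summable_mult2[OF rapid_summable[OF rb], of q ?K] C(1) assms
      by (simp add: abs_mult norm_mult power_abs)
    show "integrable (count_space UNIV) (\<lambda>n. b n * f (wavenumber \<omega> n * y) ((wavenumber \<omega> n)\<^sup>2 * t))" if "y \<in> {0..}" for y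
      using mode_sum_integral(1)[OF assms(1-3), of y t] that assms by simp
    show "((\<lambda>y. b n * f (wavenumber \<omega> n * y) ((wavenumber \<omega> n)\<^sup>2 * t)) has_vector_derivative ?b n * g (wavenumber \<omega> n * y) ((wavenumber \<omega> n)\<^sup>2 * t)) (at y within {0..})"
      if "y \<in> {0..}" for y n
    proof -
      have l: "wavenumber \<omega> n > 0" by (rule wavenumber_pos[OF assms(1)])
      have "((\<lambda>y. f y ((wavenumber \<omega> n)\<^sup>2 * t)) has_vector_derivative g (wavenumber \<omega> n * y) ((wavenumber \<omega> n)\<^sup>2 * t)) (at (wavenumber \<omega> n * y) within {0..})"
        using deriv l that assms by simp
      then have "((\<lambda>y. f y ((wavenumber \<omega> n)\<^sup>2 * t)) has_vector_derivative g (wavenumber \<omega> n * y) ((wavenumber \<omega> n)\<^sup>2 * t)) (at (wavenumber \<omega> n * y) within (\<lambda>y. wavenumber \<omega> n * y) ` {0..})"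
        by (rule has_vector_derivative_within_subset) (use l in auto)
      moreover have "((\<lambda>y. wavenumber \<omega> n * y) has_vector_derivative wavenumber \<omega> n) (at y within {0..})"
        by (auto intro!: derivative_eq_intros)
      ultimately have "((\<lambda>y. f (wavenumber \<omega> n * y) ((wavenumber \<omega> n)\<^sup>2 * t)) has_vector_derivative wavenumber \<omega> n *\<^sub>R g (wavenumber \<omega> n * y) ((wavenumber \<omega> n)\<^sup>2 * t)) (at y within {0..})"
        using vector_diff_chain_within[of "\<lambda>y. wavenumber \<omega> n * y" "wavenumber \<omega> n" y "{0..}" "\<lambda>y. f y ((wavenumber \<omega> n)\<^sup>2 * t)"]
        by (simp add: o_def)
      from has_vector_derivative_mult_right[OF this, of "b n"] show ?thesis
        by (simp add: scaleR_conv_of_real mult_ac)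
    qed
    show "norm (?b n * g (wavenumber \<omega> n * y) ((wavenumber \<omega> n)\<^sup>2 * t)) \<le> norm (?b n) * (real n + 1) ^ q * ?K" if "y \<in> {0..}" for y n
      using mode_term_bound[OF assms(1) _ assms(6) C, of y ?b n] that by simp
  qed (use assms in auto)
  then have "((\<lambda>y. \<integral>n. b n * f (wavenumber \<omega> n * y) ((wavenumber \<omega> n)\<^sup>2 * t) \<partial>count_space UNIV) has_vector_derivative
      mode_sum \<omega> ?b g x t) (at x within {0..})"
    using mode_sum_integral(2)[OF assms(1) rb assms(4-6)] by simp
  then show ?thesis
    by (rule has_vector_derivative_transform[rotated 2]) (use mode_sum_integral(2)[OF assms(1-3)] assms in auto)
qed

lemma mode_sum_has_vector_derivative_t:
  assumes "\<omega> > 0" "rapid b" "decays 0 0 p f" "decays 0 0 q g" "x \<ge> 0" "t \<ge> 0"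
    and deriv: "\<forall>x\<ge>0. \<forall>t\<ge>0. ((\<lambda>s. f x s) has_vector_derivative g x t) (at t within {0..})"
  shows "((\<lambda>s. mode_sum \<omega> b f x s) has_vector_derivative mode_sum \<omega> (\<lambda>n. b n * wavenumber \<omega> n * wavenumber \<omega> n) g x t) (at t within {0..})"
proof -
  obtain C where C: "C \<ge> 0" "\<forall>x\<ge>0. \<forall>t\<ge>0. x ^ 0 * t ^ 0 * norm (g x t) \<le> C * (1 + t) ^ q"
    using decays_nonneg[OF assms(4)] by blast
  let ?b = "\<lambda>n. b n * of_real (wavenumber \<omega> n) * of_real (wavenumber \<omega> n)"
  let ?K = "\<lambda>t. C * (1 / sqrt \<omega>) ^ (0 + 2 * 0) * (1 + \<omega>) ^ q * (1 + t) ^ q"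
  have rb: "rapid ?b" by (intro rapid_wavenumber assms)
  have "((\<lambda>s. \<integral>n. b n * f (wavenumber \<omega> n * x) ((wavenumber \<omega> n)\<^sup>2 * s) \<partial>count_space UNIV) has_vector_derivative
      (\<integral>n. ?b n * g (wavenumber \<omega> n * x) ((wavenumber \<omega> n)\<^sup>2 * t) \<partial>count_space UNIV)) (at t within {0..})"
  proof (rule has_vector_derivative_lebesgue_integral[where r = 1 and B = "\<lambda>n. norm (?b n) * (real n + 1) ^ q * ?K (t + 1)"
        and f = "\<lambda>s n. b n * f (wavenumber \<omega> n * x) ((wavenumber \<omega> n)\<^sup>2 * s)" and f' = "\<lambda>s n. ?b n * g (wavenumber \<omega> n * x) ((wavenumber \<omega> n)\<^sup>2 * s)"])
    show "integrable (count_space UNIV) (\<lambda>n. norm (?b n) * (real n + 1) ^ q * ?K (t + 1))"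
      unfolding integrable_count_space_nat_iff using summable_mult2[OF rapid_summable[OF rb], of q "?K (t + 1)"] C(1) assms
      by (simp add: abs_mult norm_mult power_abs)
    show "integrable (count_space UNIV) (\<lambda>n. b n * f (wavenumber \<omega> n * x) ((wavenumber \<omega> n)\<^sup>2 * s))" if "s \<in> {0..}" for s
      using mode_sum_integral(1)[OF assms(1-3), of x s] that assms by simp
    show "((\<lambda>s. b n * f (wavenumber \<omega> n * x) ((wavenumber \<omega> n)\<^sup>2 * s)) has_vector_derivative ?b n * g (wavenumber \<omega> n * x) ((wavenumber \<omega> n)\<^sup>2 * s)) (at s within {0..})"
      if "s \<in> {0..}" for s n
    proof -
      have l: "wavenumber \<omega> n > 0" by (rule wavenumber_pos[OF assms(1)])
      let ?l = "(wavenumber \<omega> n)\<^sup>2"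
      have "((\<lambda>s. f (wavenumber \<omega> n * x) s) has_vector_derivative g (wavenumber \<omega> n * x) (?l * s)) (at (?l * s) within {0..})"
        using deriv l that assms by simp
      then have "((\<lambda>s. f (wavenumber \<omega> n * x) s) has_vector_derivative g (wavenumber \<omega> n * x) (?l * s)) (at (?l * s) within (\<lambda>s. ?l * s) ` {0..})"
        by (rule has_vector_derivative_within_subset) auto
      moreover have "((\<lambda>s. ?l * s) has_vector_derivative ?l) (at s within {0..})"
        by (auto intro!: derivative_eq_intros)
      ultimately have "((\<lambda>s. f (wavenumber \<omega> n * x) (?l * s)) has_vector_derivative ?l *\<^sub>R g (wavenumber \<omega> n * x) (?l * s)) (at s within {0..})"
        using vector_diff_chain_within[of "\<lambda>s. ?l * s" ?l s "{0..}" "\<lambda>s. f (wavenumber \<omega> n * x) s"]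
        by (simp add: o_def)
      from has_vector_derivative_mult_right[OF this, of "b n"] show ?thesis
        by (simp add: scaleR_conv_of_real power2_eq_square mult_ac)
    qed
    show "norm (?b n * g (wavenumber \<omega> n * x) ((wavenumber \<omega> n)\<^sup>2 * s)) \<le> norm (?b n) * (real n + 1) ^ q * ?K (t + 1)"
      if "s \<in> {0..}" "dist s t < 1" for s n
    proof -
      have "?K s \<le> ?K (t + 1)"
        using that C(1) assms by (intro mult_left_mono power_mono) (auto simp: dist_real_def)
      then have "norm (?b n) * (real n + 1) ^ q * ?K s \<le> norm (?b n) * (real n + 1) ^ q * ?K (t + 1)"
        by (rule mult_left_mono) simp
      then show ?thesis
        using mode_term_bound[OF assms(1) assms(5) _ C, of s ?b n] that by simp
    qed
  qed (use assms in auto)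
  then have "((\<lambda>s. \<integral>n. b n * f (wavenumber \<omega> n * x) ((wavenumber \<omega> n)\<^sup>2 * s) \<partial>count_space UNIV) has_vector_derivative
      mode_sum \<omega> ?b g x t) (at t within {0..})"
    using mode_sum_integral(2)[OF assms(1) rb assms(4-6)] by simp
  then show ?thesis
    by (rule has_vector_derivative_transform[rotated 2]) (use mode_sum_integral(2)[OF assms(1-3)] assms in auto)
qed

lemma mode_sum_continuous:
  assumes "\<omega> > 0" "rapid b" "decays 0 0 p f"
    and cont: "continuous_on ({0..} \<times> {0..}) (\<lambda>(x, t). f x t)"
  shows "continuous_on ({0..} \<times> {0..}) (\<lambda>(x, t). mode_sum \<omega> b f x t)"
proof -
  obtain C where C: "C \<ge> 0" "\<forall>x\<ge>0. \<forall>t\<ge>0. x ^ 0 * t ^ 0 * norm (f x t) \<le> C * (1 + t) ^ p"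
    using decays_nonneg[OF assms(3)] by blast
  let ?K = "\<lambda>t. C * (1 / sqrt \<omega>) ^ (0 + 2 * 0) * (1 + \<omega>) ^ p * (1 + t) ^ p"
  let ?f = "\<lambda>z n. b n * f (wavenumber \<omega> n * fst z) ((wavenumber \<omega> n)\<^sup>2 * snd z)"
  have "continuous_on ({0..} \<times> {0..}) (\<lambda>z. \<integral>n. ?f z n \<partial>count_space UNIV)"
    unfolding continuous_on_def
  proof
    fix z :: "real \<times> real" assume z: "z \<in> {0..} \<times> {0..}"
    show "((\<lambda>z. \<integral>n. ?f z n \<partial>count_space UNIV) \<longlongrightarrow> (\<integral>n. ?f z n \<partial>count_space UNIV)) (at z within {0..} \<times> {0..})"
    proof (rule tendsto_lebesgue_integral_at_within[where r = 1 and f = ?f and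
          B = "\<lambda>n. norm (b n) * (real n + 1) ^ p * ?K (snd z + 1)"])
      show "integrable (count_space UNIV) (\<lambda>n. norm (b n) * (real n + 1) ^ p * ?K (snd z + 1))"
        unfolding integrable_count_space_nat_iff using summable_mult2[OF rapid_summable[OF assms(2)], of p "?K (snd z + 1)"] C(1) assms z
        by (simp add: abs_mult norm_mult power_abs mem_Times_iff)
      show "((\<lambda>w. ?f w n) \<longlongrightarrow> ?f z n) (at z within {0..} \<times> {0..})" for n
      proof -
        have "continuous_on ({0..} \<times> {0..}) (\<lambda>w. case (wavenumber \<omega> n * fst w, (wavenumber \<omega> n)\<^sup>2 * snd w) of (x, t) \<Rightarrow> f x t)"
          by (rule continuous_on_compose2[OF cont])
            (use wavenumber_pos[OF assms(1), of n] in \<open>auto intro!: continuous_intros\<close>)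
        then have "continuous_on ({0..} \<times> {0..}) (\<lambda>w. ?f w n)"
          by (auto intro: continuous_on_mult_left)
        with z show ?thesis unfolding continuous_on_def by blast
      qed
      show "norm (?f w n) \<le> norm (b n) * (real n + 1) ^ p * ?K (snd z + 1)"
        if w: "w \<in> {0..} \<times> {0..} - {z}" "dist w z < 1" for w n
      proof -
        have "dist (snd w) (snd z) < 1" using w dist_snd_le[of w z] by linarith
        then have "?K (snd w) \<le> ?K (snd z + 1)"
          using w C(1) assms by (intro mult_left_mono power_mono) (auto simp: dist_real_def)
        then have "norm (b n) * (real n + 1) ^ p * ?K (snd w) \<le> norm (b n) * (real n + 1) ^ p * ?K (snd z + 1)"
          by (rule mult_left_mono) simp
        then show ?thesis
          using mode_term_bound[OF assms(1) _ _ C, of "fst w" "snd w" b n] w by (simp add: mem_Times_iff)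
      qed
    qed auto
  qed
  then show ?thesis
    by (rule continuous_on_eq) (use mode_sum_integral(2)[OF assms(1-3)] in auto)
qed

lemma mode_sum_cmult:
  assumes "\<omega> > 0" "rapid b" "decays 0 0 p f" "x \<ge> 0" "t \<ge> 0"
  shows "mode_sum \<omega> b (\<lambda>x t. c * f x t) x t = c * mode_sum \<omega> b f x t"
  unfolding mode_sum_def mult.left_commute[of _ c]
  by (rule suminf_mult[OF mode_sum_summable[OF assms]])

lemma mode_sum_add:
  assumes "\<omega> > 0" "rapid b" "decays 0 0 p f" "decays 0 0 q g" "x \<ge> 0" "t \<ge> 0"
  shows "mode_sum \<omega> b (\<lambda>x t. f x t + g x t) x t = mode_sum \<omega> b f x t + mode_sum \<omega> b g x t"
  unfolding mode_sum_def distrib_left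
  using suminf_add[OF mode_sum_summable[OF assms(1-3,5,6)] mode_sum_summable[OF assms(1,2,4-6)]] by simp

lemma mode_sum_lspan:
  assumes "\<omega> > 0" "f \<in> lspan G" "rapid b" "\<And>g. g \<in> G \<Longrightarrow> \<exists>p. decays 0 0 p g"
  shows "\<exists>h\<in>lspan {mode_sum \<omega> b g | b g. rapid b \<and> g \<in> G}. \<forall>x\<ge>0. \<forall>t\<ge>0. mode_sum \<omega> b f x t = h x t"
  using assms(2)
proof induction
  case (base f)
  then show ?case using assms(3) by (blast intro: lspan.base)
next
  case (add f g)
  from add.IH(1) obtain h where
    h: "h \<in> lspan {mode_sum \<omega> b g | b g. rapid b \<and> g \<in> G}" "\<forall>x\<ge>0. \<forall>t\<ge>0. mode_sum \<omega> b f x t = h x t"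
    by (elim bexE)
  from add.IH(2) obtain k where
    k: "k \<in> lspan {mode_sum \<omega> b g | b g. rapid b \<and> g \<in> G}" "\<forall>x\<ge>0. \<forall>t\<ge>0. mode_sum \<omega> b g x t = k x t"
    by (elim bexE)
  obtain p q where pq: "decays 0 0 p f" "decays 0 0 q g"
    using ex_decays_lspan[OF add.hyps(1) assms(4)] ex_decays_lspan[OF add.hyps(2) assms(4)] by blast
  show ?case
  proof (intro bexI[OF _ lspan.add[OF h(1) k(1)]] allI impI)
    fix x t :: real assume xt: "x \<ge> 0" "t \<ge> 0"
    have "mode_sum \<omega> b (\<lambda>x t. f x t + g x t) x t = mode_sum \<omega> b f x t + mode_sum \<omega> b g x t"
      by (rule mode_sum_add[OF assms(1,3) pq xt])
    with h k xt show "mode_sum \<omega> b (\<lambda>x t. f x t + g x t) x t = h x t + k x t" by simp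
  qed
next
  case (scale f c)
  from scale.IH obtain h where
    h: "h \<in> lspan {mode_sum \<omega> b g | b g. rapid b \<and> g \<in> G}" "\<forall>x\<ge>0. \<forall>t\<ge>0. mode_sum \<omega> b f x t = h x t"
    by (elim bexE)
  obtain p where p: "decays 0 0 p f"
    using ex_decays_lspan[OF scale.hyps(1) assms(4)] by blast
  show ?case
  proof (intro bexI[OF _ lspan.scale[OF h(1), of c]] allI impI)
    fix x t :: real assume xt: "x \<ge> 0" "t \<ge> 0"
    have "mode_sum \<omega> b (\<lambda>x t. c * f x t) x t = c * mode_sum \<omega> b f x t"
      by (rule mode_sum_cmult[OF assms(1,3) p xt])
    with h xt show "mode_sum \<omega> b (\<lambda>x t. c * f x t) x t = c * h x t" by simp
  qed
qed

text \<open>Differentiation in \<open>x\<close> or \<open>t\<close> multiplies the coefficients by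
  one or two wave numbers, which keeps them rapid, and replaces the profile by a combination of
  profiles; \<open>mode_sum_lspan\<close> moves that combination outside the sum.\<close>

lemma generates_mode_sums:
  assumes "\<omega> > 0" "generates G" "\<And>g. g \<in> G \<Longrightarrow> \<exists>p. decays 0 0 p g"
  shows "generates {mode_sum \<omega> b g | b g. rapid b \<and> g \<in> G}" (is "generates ?M")
  unfolding generates_def
proof
  fix F assume "F \<in> ?M"
  then obtain b f where F: "F = mode_sum \<omega> b f" "rapid b" "f \<in> G" by blast
  obtain p where p: "decays 0 0 p f" using assms(3)[OF F(3)] by blast
  have f: "continuous_on ({0..} \<times> {0..}) (\<lambda>(x, t). f x t)"
    "\<exists>g\<in>lspan G. \<forall>x\<ge>0. \<forall>t\<ge>0. ((\<lambda>y. f y t) has_vector_derivative g x t) (at x within {0..})"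
    "\<exists>g\<in>lspan G. \<forall>x\<ge>0. \<forall>t\<ge>0. ((\<lambda>s. f x s) has_vector_derivative g x t) (at t within {0..})"
    using closed_familyD[OF closed_family_lspan[OF assms(2)] lspan.base[OF F(3)]] by blast+
  from f(2) obtain g where g: "g \<in> lspan G"
    "\<forall>x\<ge>0. \<forall>t\<ge>0. ((\<lambda>y. f y t) has_vector_derivative g x t) (at x within {0..})" by blast
  from f(3) obtain k where k: "k \<in> lspan G"
    "\<forall>x\<ge>0. \<forall>t\<ge>0. ((\<lambda>s. f x s) has_vector_derivative k x t) (at t within {0..})" by blast
  obtain q where q: "decays 0 0 q g" using ex_decays_lspan[OF g(1) assms(3)] by blast
  obtain r where r: "decays 0 0 r k" using ex_decays_lspan[OF k(1) assms(3)] by blast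
  obtain h where h: "h \<in> lspan ?M" "\<forall>x\<ge>0. \<forall>t\<ge>0. mode_sum \<omega> (\<lambda>n. b n * wavenumber \<omega> n) g x t = h x t"
    using mode_sum_lspan[OF assms(1) g(1) rapid_wavenumber[OF F(2) assms(1)] assms(3)] by blast
  obtain l where l: "l \<in> lspan ?M" "\<forall>x\<ge>0. \<forall>t\<ge>0. mode_sum \<omega> (\<lambda>n. b n * wavenumber \<omega> n * wavenumber \<omega> n) k x t = l x t"
    using mode_sum_lspan[OF assms(1) k(1) rapid_wavenumber[OF rapid_wavenumber[OF F(2) assms(1)] assms(1)] assms(3)] by blast
  show "continuous_on ({0..} \<times> {0..}) (\<lambda>(x, t). F x t) \<and>
     (\<exists>g\<in>lspan ?M. \<forall>x\<ge>0. \<forall>t\<ge>0. ((\<lambda>y. F y t) has_vector_derivative g x t) (at x within {0..})) \<and>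
     (\<exists>g\<in>lspan ?M. \<forall>x\<ge>0. \<forall>t\<ge>0. ((\<lambda>s. F x s) has_vector_derivative g x t) (at t within {0..}))"
    unfolding F(1)
  proof (intro conjI)
    show "continuous_on ({0..} \<times> {0..}) (\<lambda>(x, t). mode_sum \<omega> b f x t)"
      by (rule mode_sum_continuous[OF assms(1) F(2) p f(1)])
    show "\<exists>g\<in>lspan ?M. \<forall>x\<ge>0. \<forall>t\<ge>0. ((\<lambda>y. mode_sum \<omega> b f y t) has_vector_derivative g x t) (at x within {0..})"
      using mode_sum_has_vector_derivative_x[OF assms(1) F(2) p q _ _ g(2)] h(2)
      by (intro bexI[OF _ h(1)]) auto
    show "\<exists>g\<in>lspan ?M. \<forall>x\<ge>0. \<forall>t\<ge>0. ((\<lambda>s. mode_sum \<omega> b f x s) has_vector_derivative g x t) (at t within {0..})"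
      using mode_sum_has_vector_derivative_t[OF assms(1) F(2) p r _ _ k(2)] l(2)
      by (intro bexI[OF _ l(1)]) auto
  qed
qed

section \<open>Fourier coefficients of smooth periodic functions\<close>

lemma smooth_halfline_hderiv: "smooth_halfline f \<Longrightarrow> smooth_halfline ((hderiv ^^ m) f)"
proof -
  assume f: "smooth_halfline f"
  have "(hderiv ^^ k) ((hderiv ^^ m) f) = (hderiv ^^ (k + m)) f" for k
    by (simp add: funpow_add)
  with f show ?thesis unfolding smooth_halfline_def by simp
qed

lemma smooth_halfline_has_vector_derivative:
  assumes "smooth_halfline f" "x \<ge> 0"
  shows "(f has_vector_derivative hderiv f x) (at x within {0..})"
proof (rule hderiv_works)
  have "((hderiv ^^ 0) f) differentiable (at x within {0..})"
    using assms unfolding smooth_halfline_def by blast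
  then show "f differentiable (at x within {0..})" by simp
qed

text \<open>At \<open>t = 0\<close> the derivative is one-sided, while at \<open>T\<close> it is
  two-sided; restricting the latter to the shifted half line makes the two comparable.\<close>

lemma has_period_hderiv:
  assumes "has_period f T" "smooth_halfline f"
  shows "has_period (hderiv f) T"
  unfolding has_period_def
proof (intro conjI allI impI)
  show T: "T > 0" using assms(1) by (simp add: has_period_def)
  fix t :: real assume t: "t \<ge> 0"
  let ?D = "hderiv f (t + T)"
  have "(f has_vector_derivative ?D) (at (t + T) within {0..})"
    using smooth_halfline_has_vector_derivative[OF assms(2)] t T by simp
  then have "(f has_vector_derivative ?D) (at (t + T) within (\<lambda>s. s + T) ` {0..})"
    by (rule has_vector_derivative_within_subset) (use T in auto)
  moreover have "((\<lambda>s. s + T) has_vector_derivative 1) (at t within {0..})"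
    by (auto intro!: derivative_eq_intros)
  ultimately have "((\<lambda>s. f (s + T)) has_vector_derivative ?D) (at t within {0..})"
    using vector_diff_chain_within[of "\<lambda>s. s + T" 1 t "{0..}" f ?D] by (simp add: o_def)
  then have "(f has_vector_derivative ?D) (at t within {0..})"
    by (rule has_vector_derivative_transform[rotated 2])
      (use assms(1) t in \<open>auto simp: has_period_def\<close>)
  then show "hderiv f (t + T) = hderiv f t" using hderiv_eq t by metis
qed

lemma has_period_iterated_hderiv:
  assumes "has_period f T" "smooth_halfline f"
  shows "has_period ((hderiv ^^ m) f) T"
  by (induction m) (auto intro: assms has_period_hderiv smooth_halfline_hderiv)

lemma exp_has_vector_derivative:
  "((\<lambda>t. exp (\<i> * of_real (k * t))) has_vector_derivative \<i> * of_real k * exp (\<i> * of_real (k * t))) (at t within S)"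
proof -
  have "((\<lambda>z. exp (\<i> * (of_real k * z))) has_field_derivative \<i> * of_real k * exp (\<i> * (of_real k * of_real t))) (at (of_real t))"
    by (auto intro!: derivative_eq_intros)
  from has_vector_derivative_real_field[OF this] show ?thesis by simp
qed

lemma exp_of_int_2pi: "exp (- \<i> * of_real (of_int n * (2 * pi / T) * T)) = 1" if "T > 0"
proof -
  have "- \<i> * of_real (of_int n * (2 * pi / T) * T) = of_int (2 * (- n)) * (of_real pi * \<i>)"
    using that by (simp add: algebra_simps)
  then show ?thesis by (subst exp_eq_1) (auto intro: exI[of _ "- n"])
qed

text \<open>Integration by parts; the boundary terms cancel because \<open>f\<close> and the
  exponential each take equal values at \<open>0\<close> and \<open>T\<close>.\<close>

lemma fourier_coeff_hderiv:
  assumes "smooth_halfline f" "has_period f T"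
  shows "fourier_coeff T (hderiv f) n = \<i> * of_real (of_int n * (2 * pi / T)) * fourier_coeff T f n"
proof -
  have T: "T > 0" "f T = f 0" using assms(2) by (auto simp: has_period_def dest!: spec[of _ 0])
  define k where "k = of_int n * (2 * pi / T)"
  define e where "e t = exp (- \<i> * of_real (k * t))" for t :: real
  have e': "(e has_vector_derivative - \<i> * of_real k * e t) (at t within S)" for t S
    using exp_has_vector_derivative[of "- k" t S] by (simp add: e_def[abs_def])
  have ce: "continuous_on S e" for S unfolding e_def by (intro continuous_intros)
  have cf: "continuous_on {0..T} f" "continuous_on {0..T} (hderiv f)"
    using smooth_halfline_continuous[OF assms(1)] smooth_halfline_continuous[OF smooth_halfline_hderiv[OF assms(1), of 1]]
    by (auto intro: continuous_on_subset)
  have "((\<lambda>t. f t * (- \<i> * of_real k * e t) + hderiv f t * e t) has_integral (f T * e T - f 0 * e 0)) {0..T}"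
  proof (rule fundamental_theorem_of_calculus)
    fix t assume t: "t \<in> {0..T}"
    have "(f has_vector_derivative hderiv f t) (at t within {0..T})"
      by (rule has_vector_derivative_within_subset[OF smooth_halfline_has_vector_derivative[OF assms(1)]]) (use t in auto)
    from has_vector_derivative_mult[OF this e'] show
      "((\<lambda>t. f t * e t) has_vector_derivative f t * (- \<i> * of_real k * e t) + hderiv f t * e t) (at t within {0..T})" .
  qed (use T in simp)
  moreover have "e T = 1" "e 0 = 1" using exp_of_int_2pi[OF T(1), of n] by (auto simp: e_def k_def)
  ultimately have "integral {0..T} (\<lambda>t. f t * (- \<i> * of_real k * e t) + hderiv f t * e t) = 0"
    using T by (auto dest: integral_unique)
  also have "(\<lambda>t. f t * (- \<i> * of_real k * e t) + hderiv f t * e t) = (\<lambda>t. (- \<i> * of_real k) * (f t * e t) + hderiv f t * e t)"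
    by (simp add: fun_eq_iff mult_ac)
  also have "integral {0..T} \<dots> = integral {0..T} (\<lambda>t. (- \<i> * of_real k) * (f t * e t)) + integral {0..T} (\<lambda>t. hderiv f t * e t)"
    by (intro integral_add integrable_continuous_real continuous_intros cf ce)
  also have "integral {0..T} (\<lambda>t. (- \<i> * of_real k) * (f t * e t)) = (- \<i> * of_real k) * integral {0..T} (\<lambda>t. f t * e t)"
    by (rule integral_mult_right)
  finally have "integral {0..T} (\<lambda>t. hderiv f t * e t) = \<i> * of_real k * integral {0..T} (\<lambda>t. f t * e t)"
    by (simp add: algebra_simps eq_neg_iff_add_eq_0)
  then show ?thesis by (simp add: fourier_coeff_def e_def k_def)
qed

lemma fourier_coeff_iterated_hderiv:
  assumes "smooth_halfline f" "has_period f T"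
  shows "fourier_coeff T ((hderiv ^^ m) f) n = (\<i> * of_real (of_int n * (2 * pi / T))) ^ m * fourier_coeff T f n"
proof (induction m)
  case (Suc m)
  then show ?case
    using fourier_coeff_hderiv[OF smooth_halfline_hderiv[OF assms(1)] has_period_iterated_hderiv[OF assms(2,1)], of m n]
    by simp
qed simp

lemma fourier_coeff_bound:
  assumes "continuous_on {0..} f" "T > 0"
  shows "\<exists>K. \<forall>n. norm (fourier_coeff T f n) \<le> K"
proof -
  have "compact (f ` {0..T})"
    by (intro compact_continuous_image continuous_on_subset[OF assms(1)]) auto
  then obtain K where K: "\<forall>t\<in>{0..T}. norm (f t) \<le> K"
    using compact_imp_bounded[of "f ` {0..T}"] unfolding bounded_iff by auto
  have "norm (fourier_coeff T f n) \<le> K" for n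
  proof -
    have "norm (integral {0..T} (\<lambda>t. f t * exp (- \<i> * of_real (of_int n * (2 * pi / T) * t)))) \<le> K * (T - 0)"
    proof (rule integral_bound)
      show "continuous_on {0..T} (\<lambda>t. f t * exp (- \<i> * of_real (of_int n * (2 * pi / T) * t)))"
        by (intro continuous_intros continuous_on_subset[OF assms(1)]) auto
      show "norm (f t * exp (- \<i> * of_real (of_int n * (2 * pi / T) * t))) \<le> K" if "t \<in> {0..T}" for t
        using K that by (simp add: norm_mult)
    qed (use assms in simp)
    then show ?thesis using assms(2) by (simp add: fourier_coeff_def norm_mult norm_divide field_simps)
  qed
  then show ?thesis by blast
qed

text \<open>\<open>\<sigma>\<close> is \<open>1\<close> or \<open>- 1\<close> and selects the
  positive or the negative frequencies. Smoothness enters through arbitrarily many integrations by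
  parts.\<close>

lemma rapid_fourier_coeff:
  fixes \<sigma> :: int
  assumes "smooth_halfline f" "has_period f T" "\<bar>\<sigma>\<bar> = 1"
  shows "rapid (\<lambda>n. fourier_coeff T f (\<sigma> * (int n + 1)))"
  unfolding rapid_def
proof
  fix k
  let ?w = "2 * pi / T"
  have T: "T > 0" and w: "?w > 0" using assms(2) by (auto simp: has_period_def)
  \<comment> \<open>Two derivatives beyond \<open>k\<close> leave the summable factor
    \<open>1 / (real n + 1)\<^sup>2\<close>.\<close>
  obtain K where K: "\<forall>n. norm (fourier_coeff T ((hderiv ^^ (k + 2)) f) n) \<le> K"
    using fourier_coeff_bound[OF smooth_halfline_continuous[OF smooth_halfline_hderiv[OF assms(1)]] T] by blast
  show "summable (\<lambda>n. norm (fourier_coeff T f (\<sigma> * (int n + 1))) * (real n + 1) ^ k)"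
  proof (rule summable_comparison_test')
    show "summable (\<lambda>n. (K / ?w ^ (k + 2)) * (1 / (real n + 1)\<^sup>2))"
      using inverse_squares_sums by (intro summable_mult) (simp add: sums_iff add.commute)
    fix n :: nat
    let ?a = "norm (fourier_coeff T f (\<sigma> * (int n + 1)))"
    have "\<bar>of_int \<sigma>\<bar> = (1::real)" using assms(3) by (metis of_int_1 of_int_abs)
    then have "norm (\<i> * of_real (of_int (\<sigma> * (int n + 1)) * ?w)) = (real n + 1) * ?w"
      using w T unfolding norm_mult norm_of_real of_int_mult abs_mult by simp
    then have "norm (fourier_coeff T ((hderiv ^^ (k + 2)) f) (\<sigma> * (int n + 1))) = ((real n + 1) * ?w) ^ (k + 2) * ?a"
      unfolding fourier_coeff_iterated_hderiv[OF assms(1,2)] norm_mult[of "_ ^ _"] norm_power by simp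
    then have "((real n + 1) * ?w) ^ (k + 2) * ?a \<le> K" using K by metis
    then have "(?a * (real n + 1) ^ k) * (real n + 1)\<^sup>2 * ?w ^ (k + 2) \<le> K"
      by (simp only: power_mult_distrib power_add mult_ac)
    then have "?a * (real n + 1) ^ k \<le> K / ?w ^ (k + 2) / (real n + 1)\<^sup>2"
      using w by (simp only: pos_le_divide_eq zero_less_power)
    then show "norm (?a * (real n + 1) ^ k) \<le> (K / ?w ^ (k + 2)) * (1 / (real n + 1)\<^sup>2)"
      by simp
  qed
qed

lemma integral_suminf:
  fixes F :: "nat \<Rightarrow> real \<Rightarrow> complex"
  assumes "\<And>n. continuous_on {a..b} (F n)" "\<And>n t. t \<in> {a..b} \<Longrightarrow> norm (F n t) \<le> M n" "summable M"
  shows "(\<lambda>n. integral {a..b} (F n)) sums integral {a..b} (\<lambda>t. \<Sum>n. F n t)"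
proof -
  have "uniform_limit {a..b} (\<lambda>N t. \<Sum>n<N. F n t) (\<lambda>t. \<Sum>n. F n t) sequentially"
    using assms by (intro Weierstrass_m_test) auto
  then obtain I J where I: "\<And>N. ((\<lambda>t. \<Sum>n<N. F n t) has_integral I N) {a..b}"
    and J: "((\<lambda>t. \<Sum>n. F n t) has_integral J) {a..b}" and lim: "I \<longlonglongrightarrow> J"
    by (rule uniform_limit_integral) (auto intro!: continuous_intros assms)
  have "I N = (\<Sum>n<N. integral {a..b} (F n))" for N
    using I[of N] by (subst integral_sum[symmetric])
      (auto intro!: integrable_continuous_real assms dest: integral_unique)
  then have "I = (\<lambda>N. \<Sum>n<N. integral {a..b} (F n))" by blast
  with lim J show ?thesis unfolding sums_def by (simp add: integral_unique)
qed

lemma fourier_orthogonality: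
  assumes "T > 0"
  shows "integral {0..T} (\<lambda>t. exp (\<i> * of_real (of_int m * (2 * pi / T) * t)) * exp (- \<i> * of_real (of_int n * (2 * pi / T) * t)))
    = (if m = n then of_real T else 0)"
proof (cases "m = n")
  case True
  then show ?thesis using assms by (simp flip: exp_add add: scaleR_conv_of_real)
next
  case False
  define k where "k = of_int (m - n) * (2 * pi / T)"
  have k: "k \<noteq> 0" using False assms by (simp add: k_def)
  have "((\<lambda>t. exp (\<i> * of_real (k * t))) has_integral
      (exp (\<i> * of_real (k * T)) / (\<i> * of_real k) - exp (\<i> * of_real (k * 0)) / (\<i> * of_real k))) {0..T}"
  proof (rule fundamental_theorem_of_calculus)
    fix t
    have "((\<lambda>t. exp (\<i> * of_real (k * t)) / (\<i> * of_real k)) has_vector_derivative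
        \<i> * of_real k * exp (\<i> * of_real (k * t)) / (\<i> * of_real k)) (at t within {0..T})"
      by (intro has_vector_derivative_divide exp_has_vector_derivative)
    then show "((\<lambda>t. exp (\<i> * of_real (k * t)) / (\<i> * of_real k)) has_vector_derivative exp (\<i> * of_real (k * t))) (at t within {0..T})"
      using k by simp
  qed (use assms in simp)
  moreover have "exp (\<i> * of_real (k * T)) = 1"
    using exp_of_int_2pi[OF assms, of "n - m"] by (simp add: k_def algebra_simps)
  ultimately have "integral {0..T} (\<lambda>t. exp (\<i> * of_real (k * t))) = 0"
    by (simp add: integral_unique)
  moreover have "exp (\<i> * of_real (of_int m * (2 * pi / T) * t)) * exp (- \<i> * of_real (of_int n * (2 * pi / T) * t))
    = exp (\<i> * of_real (k * t))" for t
    unfolding exp_add[symmetric] k_def by (simp add: algebra_simps diff_divide_distrib)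
  ultimately show ?thesis using False by simp
qed

text \<open>The half sums are indexed from \<open>0\<close>, hence the shift by \<open>1\<close> on
  either side of the frequency zero.\<close>

lemma has_sum_int:
  fixes f :: "int \<Rightarrow> complex"
  assumes "((\<lambda>n. f (int n + 1)) has_sum A) UNIV" "((\<lambda>n. f (- int n - 1)) has_sum B) UNIV"
  shows "(f has_sum (f 0 + (A + B))) UNIV"
proof -
  have "(f has_sum A) (range (\<lambda>n. int n + 1))"
    using assms(1) by (subst has_sum_reindex) (auto simp: inj_on_def o_def)
  moreover have "(f has_sum B) (range (\<lambda>n. - int n - 1))"
    using assms(2) by (subst has_sum_reindex) (auto simp: inj_on_def o_def)
  ultimately have "(f has_sum (A + B)) (range (\<lambda>n. int n + 1) \<union> range (\<lambda>n. - int n - 1))"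
    by (rule has_sum_Un_disjoint) auto
  then have "(f has_sum (f 0 + (A + B))) (insert 0 (range (\<lambda>n. int n + 1) \<union> range (\<lambda>n. - int n - 1)))"
    by (intro has_sum_insert) auto
  also have "insert 0 (range (\<lambda>n. int n + 1) \<union> range (\<lambda>n. - int n - 1)) = (UNIV :: int set)"
  proof -
    have "z = 0 \<or> (\<exists>n. z = int n + 1) \<or> (\<exists>n. z = - int n - 1)" for z
    proof (cases z rule: int_cases3)
      case (pos n)
      then show ?thesis by (intro disjI2 disjI1 exI[of _ "n - 1"]) auto
    next
      case (neg n)
      then show ?thesis by (intro disjI2 exI[of _ "n - 1"]) auto
    qed simp
    then show ?thesis by blast
  qed
  finally show ?thesis .
qed

section \<open>Existence\<close>

text \<open>The plane wave at the imaginary wave number \<open>\<i>\<close>, which oscillates in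
  time with frequency \<open>1\<close>.\<close>

definition evanescent :: "real \<Rightarrow> real \<Rightarrow> complex" where
  "evanescent x t = cis t * of_real (exp (- x))"

text \<open>The boundary error of the normalized outgoing mode. The argument \<open>x\<close> is a
  dummy that lets \<open>mode_sum\<close> apply.\<close>

definition defect :: "real \<Rightarrow> real \<Rightarrow> complex" where
  "defect x t = (1 / outgoing_limit) * outgoing 1 0 t - cis (- t)"

lemma cis_has_vector_derivative:
  "((\<lambda>t. cis (k * t)) has_vector_derivative \<i> * of_real k * cis (k * t)) (at t within S)"
  using exp_has_vector_derivative[of k t S] by (simp add: cis_conv_exp)

lemma evanescent_has_vector_derivative_t: "((\<lambda>s. evanescent x s) has_vector_derivative \<i> * evanescent x t) (at t within S)"
  using has_vector_derivative_mult_left[OF cis_has_vector_derivative[of 1 t S], of "of_real (exp (- x))"]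
  by (simp add: evanescent_def mult_ac)

lemma evanescent_has_vector_derivative_x: "((\<lambda>y. evanescent y t) has_vector_derivative - 1 * evanescent x t) (at x within S)"
proof -
  have "((\<lambda>y. exp (- y)) has_real_derivative - exp (- x)) (at x within S)"
    by (auto intro!: derivative_eq_intros)
  from has_vector_derivative_mult_right[OF has_vector_derivative_of_real[OF this], of "cis t"]
  show ?thesis by (simp add: evanescent_def)
qed

lemma power_mult_exp_neg_le: "x ^ i * exp (- x) \<le> fact i" if "x \<ge> 0" for x :: real
proof -
  have "x ^ i /\<^sub>R fact i \<le> exp x"
    unfolding exp_def using sum_le_suminf[OF summable_exp_generic, of "{i}" x] that by simp
  then show ?thesis by (simp add: exp_minus field_simps)
qed

lemma evanescent_decays: "decays i 0 0 evanescent"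
  unfolding decays_def
  using power_mult_exp_neg_le by (intro exI[of _ "fact i"]) (simp add: evanescent_def norm_mult)

lemma outgoing_decays: "decays i 0 (i + 2) (outgoing m)"
proof -
  obtain C where C: "\<forall>x\<ge>0. \<forall>t. x ^ i * norm (outgoing m x t) \<le> C * (1 + \<bar>t\<bar>) ^ (i + 2)"
    using outgoing_bound_x by blast
  have "x ^ i * t ^ 0 * norm (outgoing m x t) \<le> C * (1 + t) ^ (i + 2)" if "x \<ge> 0" "t \<ge> 0" for x t
    using C[rule_format, OF that(1), of t] that(2) by simp
  then show ?thesis unfolding decays_def by blast
qed

lemma generates_profiles: "generates (insert evanescent (range outgoing))"
  unfolding generates_def
proof
  fix f assume "f \<in> insert evanescent (range outgoing)"
  then consider "f = evanescent" | m where "f = outgoing m" by blast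
  then show "continuous_on ({0..} \<times> {0..}) (\<lambda>(x, t). f x t) \<and>
     (\<exists>g\<in>lspan (insert evanescent (range outgoing)). \<forall>x\<ge>0. \<forall>t\<ge>0. ((\<lambda>y. f y t) has_vector_derivative g x t) (at x within {0..})) \<and>
     (\<exists>g\<in>lspan (insert evanescent (range outgoing)). \<forall>x\<ge>0. \<forall>t\<ge>0. ((\<lambda>s. f x s) has_vector_derivative g x t) (at t within {0..}))"
  proof cases
    case 1
    have e: "evanescent \<in> lspan (insert evanescent (range outgoing))" by (simp add: lspan.base)
    show ?thesis unfolding 1
    proof (intro conjI)
      show "continuous_on ({0..} \<times> {0..}) (\<lambda>(x, t). evanescent x t)"
        unfolding evanescent_def case_prod_unfold cis_conv_exp by (intro continuous_intros)
      show "\<exists>g\<in>lspan (insert evanescent (range outgoing)). \<forall>x\<ge>0. \<forall>t\<ge>0. ((\<lambda>y. evanescent y t) has_vector_derivative g x t) (at x within {0..})"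
        by (intro bexI[OF _ lspan.scale[OF e, of "- 1"]]) (use evanescent_has_vector_derivative_x in blast)
      show "\<exists>g\<in>lspan (insert evanescent (range outgoing)). \<forall>x\<ge>0. \<forall>t\<ge>0. ((\<lambda>s. evanescent x s) has_vector_derivative g x t) (at t within {0..})"
        by (intro bexI[OF _ lspan.scale[OF e, of \<i>]]) (use evanescent_has_vector_derivative_t in blast)
    qed
  next
    case 2
    have v: "outgoing k \<in> lspan (insert evanescent (range outgoing))" for k by (simp add: lspan.base)
    show ?thesis unfolding 2
    proof (intro conjI)
      show "continuous_on ({0..} \<times> {0..}) (\<lambda>(x, t). outgoing m x t)"
        by (rule continuous_on_subset[OF outgoing_continuous]) auto
      show "\<exists>g\<in>lspan (insert evanescent (range outgoing)). \<forall>x\<ge>0. \<forall>t\<ge>0. ((\<lambda>y. outgoing m y t) has_vector_derivative g x t) (at x within {0..})"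
        by (intro bexI[OF _ lspan.scale[OF v[of "m + 1"], of \<i>]]) (use outgoing_has_vector_derivative_x in blast)
      show "\<exists>g\<in>lspan (insert evanescent (range outgoing)). \<forall>x\<ge>0. \<forall>t\<ge>0. ((\<lambda>s. outgoing m x s) has_vector_derivative g x t) (at t within {0..})"
        by (intro bexI[OF _ lspan.scale[OF v[of "m + 2"], of "- \<i>"]]) (use outgoing_has_vector_derivative_t in blast)
    qed
  qed
qed

text \<open>\<open>evanescent\<close> carries the positive and \<open>outgoing 1\<close> the
  negative frequencies. Two space derivatives or one time derivative produce the same factor, the
  square of the wave number, so the equation for the profiles gives it for the sums.\<close>

lemma
  fixes \<kappa> :: complex
  assumes \<omega>: "\<omega> > 0" and b: "rapid b" and c: "rapid c"
  defines "u \<equiv> \<lambda>x t. mode_sum \<omega> b evanescent x t + \<kappa> * mode_sum \<omega> c (outgoing 1) x t"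
  shows schroedinger_solution_mode_sum: "schroedinger_solution u"
    and partial_x_mode_sum: "\<And>x t. x \<ge> 0 \<Longrightarrow> t \<ge> 0 \<Longrightarrow> partial_x u x t =
      - 1 * mode_sum \<omega> (\<lambda>n. b n * wavenumber \<omega> n) evanescent x t + \<kappa> * (\<i> * mode_sum \<omega> (\<lambda>n. c n * wavenumber \<omega> n) (outgoing 2) x t)"
proof -
  let ?G = "insert evanescent (range outgoing)"
  let ?M = "{mode_sum \<omega> b g | b g. rapid b \<and> g \<in> ?G}"
  let ?b = "\<lambda>n. b n * of_real (wavenumber \<omega> n)" and ?c = "\<lambda>n. c n * of_real (wavenumber \<omega> n)"
  let ?b2 = "\<lambda>n. b n * of_real (wavenumber \<omega> n) * of_real (wavenumber \<omega> n)" and ?c2 = "\<lambda>n. c n * of_real (wavenumber \<omega> n) * of_real (wavenumber \<omega> n)"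
  note r = rapid_wavenumber[OF b \<omega>] rapid_wavenumber[OF c \<omega>]
  note r2 = rapid_wavenumber[OF r(1) \<omega>] rapid_wavenumber[OF r(2) \<omega>]
  have dec: "\<exists>p. decays i 0 p g" if "g \<in> ?G" for g i
    using that evanescent_decays outgoing_decays by blast
  have dec': "\<exists>p. decays i 0 p g" if "g \<in> lspan ?M" for g i
  proof (rule ex_decays_lspan[OF that])
    fix f assume "f \<in> ?M"
    then obtain b g where f: "f = mode_sum \<omega> b g" "rapid b" "g \<in> ?G" by blast
    from dec[OF f(3), of i] dec[OF f(3), of 0] show "\<exists>p. decays i 0 p f"
      unfolding f(1) using mode_sum_decays[OF \<omega> f(2)] by blast
  qed
  have closed: "closed_family (lspan ?M)"
    by (intro closed_family_lspan generates_mode_sums \<omega> generates_profiles dec)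
  have u: "u \<in> lspan ?M"
    unfolding u_def by (intro lspan.add lspan.scale; rule lspan.base; use b c in blast)
  have e0: "decays 0 0 0 (\<lambda>x t. k * evanescent x t)" "decays 0 0 0 evanescent" for k
    by (intro decays_scale evanescent_decays) (rule evanescent_decays)
  have V0: "decays 0 0 2 (\<lambda>x t. k * outgoing m x t)" "decays 0 0 2 (outgoing m)" for k m
    using decays_scale[OF outgoing_decays[of 0 m], of k] outgoing_decays[of 0 m] by (simp_all add: numeral_2_eq_2)
  have ex: "((\<lambda>y. mode_sum \<omega> b evanescent y t) has_vector_derivative - 1 * mode_sum \<omega> (\<lambda>n. b n * wavenumber \<omega> n) evanescent x t) (at x within {0..})"
    if "x \<ge> 0" "t \<ge> 0" "rapid b" for x t b
    using mode_sum_has_vector_derivative_x[OF \<omega> that(3) e0(2) e0(1) that(1,2), of "- 1"] evanescent_has_vector_derivative_x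
    unfolding mode_sum_cmult[OF \<omega> rapid_wavenumber[OF that(3) \<omega>] e0(2) that(1,2)] by blast
  have Vx: "((\<lambda>y. mode_sum \<omega> c (outgoing m) y t) has_vector_derivative \<i> * mode_sum \<omega> (\<lambda>n. c n * wavenumber \<omega> n) (outgoing (m + 1)) x t) (at x within {0..})"
    if "x \<ge> 0" "t \<ge> 0" "rapid c" for x t c m
    using mode_sum_has_vector_derivative_x[OF \<omega> that(3) V0(2) V0(1) that(1,2), of m \<i> "m + 1"] outgoing_has_vector_derivative_x
    unfolding mode_sum_cmult[OF \<omega> rapid_wavenumber[OF that(3) \<omega>] V0(2) that(1,2)] by blast
  have et: "((\<lambda>s. mode_sum \<omega> b evanescent x s) has_vector_derivative \<i> * mode_sum \<omega> ?b2 evanescent x t) (at t within {0..})"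
    if "x \<ge> 0" "t \<ge> 0" for x t
    using mode_sum_has_vector_derivative_t[OF \<omega> b e0(2) e0(1) that, of \<i>] evanescent_has_vector_derivative_t
    unfolding mode_sum_cmult[OF \<omega> r2(1) e0(2) that] by blast
  have Vt: "((\<lambda>s. mode_sum \<omega> c (outgoing 1) x s) has_vector_derivative - \<i> * mode_sum \<omega> ?c2 (outgoing 3) x t) (at t within {0..})"
    if "x \<ge> 0" "t \<ge> 0" for x t
    using mode_sum_has_vector_derivative_t[OF \<omega> c V0(2) V0(1) that, of 1 "- \<i>" 3] outgoing_has_vector_derivative_t[of _ 1]
    unfolding mode_sum_cmult[OF \<omega> r2(2) V0(2) that] by simp
  show px: "partial_x u x t = - 1 * mode_sum \<omega> ?b evanescent x t + \<kappa> * (\<i> * mode_sum \<omega> ?c (outgoing 2) x t)"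
    if "x \<ge> 0" "t \<ge> 0" for x t
    unfolding partial_x_def u_def
    using has_vector_derivative_add[OF ex[OF that b] has_vector_derivative_mult_right[OF Vx[OF that c, of 1], of \<kappa>]] that(1)
    by (intro hderiv_eq) simp_all
  have pxx: "partial_x (partial_x u) x t = - 1 * (- 1 * mode_sum \<omega> ?b2 evanescent x t) + \<kappa> * (\<i> * (\<i> * mode_sum \<omega> ?c2 (outgoing 3) x t))"
    if "x \<ge> 0" "t \<ge> 0" for x t
  proof -
    have "partial_x (partial_x u) x t = hderiv (\<lambda>x. - 1 * mode_sum \<omega> ?b evanescent x t + \<kappa> * (\<i> * mode_sum \<omega> ?c (outgoing 2) x t)) x"
      unfolding partial_x_def[of "partial_x u"] using that by (intro hderiv_cong px)
    also have "\<dots> = - 1 * (- 1 * mode_sum \<omega> ?b2 evanescent x t) + \<kappa> * (\<i> * (\<i> * mode_sum \<omega> ?c2 (outgoing (2 + 1)) x t))"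
      by (intro hderiv_eq has_vector_derivative_add has_vector_derivative_mult_right ex Vx r that)
    finally show ?thesis by simp
  qed
  have pt: "partial_t u x t = \<i> * mode_sum \<omega> ?b2 evanescent x t + \<kappa> * (- \<i> * mode_sum \<omega> ?c2 (outgoing 3) x t)"
    if "x \<ge> 0" "t \<ge> 0" for x t
    unfolding partial_t_def u_def
    by (intro hderiv_eq has_vector_derivative_add has_vector_derivative_mult_right et Vt that)
  show "schroedinger_solution u"
    unfolding schroedinger_solution_def
  proof (intro conjI allI impI)
    show "smooth_quarter_plane u" by (rule closed_family_smooth_quarter_plane[OF closed u])
    show "(\<lambda>x. u x t) \<in> schwartz_halfline" if "t \<ge> 0" for t
      by (rule closed_family_schwartz_x[OF closed u that dec'])
    show "\<i> * partial_t u x t + partial_x (partial_x u) x t = 0" if "x > 0" "t > 0" for x t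
      using that by (simp add: pt pxx algebra_simps)
  qed
qed

section \<open>Periodic boundary data as mode sums\<close>

lemma smooth_halfline_cong:
  assumes "smooth_halfline f" "\<And>x. x \<ge> 0 \<Longrightarrow> f x = g x"
  shows "smooth_halfline g" and "\<And>m x. x \<ge> 0 \<Longrightarrow> (hderiv ^^ m) f x = (hderiv ^^ m) g x"
proof -
  show eq: "(hderiv ^^ m) f x = (hderiv ^^ m) g x" if "x \<ge> 0" for m x
    using that
  proof (induction m arbitrary: x)
    case (Suc m)
    then show ?case by (auto intro: hderiv_cong)
  qed (use assms in simp)
  show "smooth_halfline g"
    unfolding smooth_halfline_def
  proof (intro allI impI)
    fix m and x :: real assume x: "x \<ge> 0"
    show "(hderiv ^^ m) g differentiable (at x within {0..})"
      by (rule differentiable_halfline_cong[OF smooth_halfline_has_vector_derivative[OF smooth_halfline_hderiv[OF assms(1)] x]])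
        (use eq x in auto)
  qed
qed

lemma schwartz_halfline_cong:
  assumes "f \<in> schwartz_halfline" "\<And>x. x \<ge> 0 \<Longrightarrow> f x = g x"
  shows "g \<in> schwartz_halfline"
proof -
  have f: "smooth_halfline f" using assms(1) by (simp add: schwartz_halfline_def)
  have "(\<lambda>x. of_real (x ^ n) * (hderiv ^^ m) f x) ` {0..} = (\<lambda>x. of_real (x ^ n) * (hderiv ^^ m) g x) ` {0..}" for n m
    using smooth_halfline_cong(2)[OF f assms(2)] by (intro image_cong) auto
  with assms(1) show ?thesis
    using smooth_halfline_cong(1)[OF f assms(2)] unfolding schwartz_halfline_def by simp
qed

text \<open>Two mode sums with profiles that do not depend on \<open>x\<close>, so that smoothness
  and summability come from the lemmas on mode sums. The index \<open>0\<close> is left out, which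
  fits coefficients with \<open>c 0 = 0\<close>.\<close>

definition fourier_series :: "real \<Rightarrow> (int \<Rightarrow> complex) \<Rightarrow> real \<Rightarrow> complex" where
  "fourier_series \<omega> c t = mode_sum \<omega> (\<lambda>n. c (int n + 1)) (\<lambda>x t. cis t) 0 t + mode_sum \<omega> (\<lambda>n. c (- int n - 1)) (\<lambda>x t. cis (- t)) 0 t"

lemma cis_decays: "decays 0 0 0 (\<lambda>x t. cis t)" "decays 0 0 0 (\<lambda>x t. cis (- t))"
  unfolding decays_def by (auto intro: exI[of _ 1])

lemma cis_wavenumber:
  assumes "\<omega> > 0"
  shows "cis ((wavenumber \<omega> n)\<^sup>2 * t) = exp (\<i> * of_real (of_int (int n + 1) * \<omega> * t))"
    and "cis (- ((wavenumber \<omega> n)\<^sup>2 * t)) = exp (\<i> * of_real (of_int (- int n - 1) * \<omega> * t))"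
proof -
  have "\<omega> * (real n + 1) * t = of_int (int n + 1) * \<omega> * t" "- (\<omega> * (real n + 1) * t) = of_int (- int n - 1) * \<omega> * t"
    by (simp_all add: algebra_simps)
  then show "cis ((wavenumber \<omega> n)\<^sup>2 * t) = exp (\<i> * of_real (of_int (int n + 1) * \<omega> * t))"
    "cis (- ((wavenumber \<omega> n)\<^sup>2 * t)) = exp (\<i> * of_real (of_int (- int n - 1) * \<omega> * t))"
    unfolding wavenumber_sq[OF assms] cis_conv_exp by (simp_all only:)
qed

lemma
  assumes \<omega>: "\<omega> > 0" and c: "rapid (\<lambda>n. c (int n + 1))" "rapid (\<lambda>n. c (- int n - 1))" and "c 0 = 0"
  shows fourier_series_has_sum: "\<And>t. t \<ge> 0 \<Longrightarrow> ((\<lambda>n::int. c n * exp (\<i> * of_real (of_int n * \<omega> * t))) has_sum fourier_series \<omega> c t) UNIV"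
    and fourier_series_smooth: "smooth_halfline (fourier_series \<omega> c)"
    and fourier_series_period: "has_period (fourier_series \<omega> c) (2 * pi / \<omega>)"
    and fourier_series_coeff: "fourier_coeff (2 * pi / \<omega>) (fourier_series \<omega> c) n = c n"
proof -
  note ss = mode_sum_summable_norm[OF \<omega> c(1) cis_decays(1), of 0] mode_sum_summable_norm[OF \<omega> c(2) cis_decays(2), of 0]
  show "((\<lambda>n::int. c n * exp (\<i> * of_real (of_int n * \<omega> * t))) has_sum fourier_series \<omega> c t) UNIV" if "t \<ge> 0" for t
  proof -
    have "((\<lambda>n::int. c n * exp (\<i> * of_real (of_int n * \<omega> * t))) has_sum
        (c 0 * exp (\<i> * of_real (of_int 0 * \<omega> * t)) + fourier_series \<omega> c t)) UNIV"
      unfolding fourier_series_def mode_sum_def cis_wavenumber[OF \<omega>]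
    proof (rule has_sum_int)
      show "((\<lambda>n. c (int n + 1) * exp (\<i> * of_real (of_int (int n + 1) * \<omega> * t))) has_sum
          (\<Sum>n. c (int n + 1) * exp (\<i> * of_real (of_int (int n + 1) * \<omega> * t)))) UNIV"
        using ss(1)[of t] that summable_sums[OF summable_norm_cancel[OF ss(1), of t]] unfolding cis_wavenumber[OF \<omega>]
        by (intro norm_summable_imp_has_sum) simp_all
      show "((\<lambda>n. c (- int n - 1) * exp (\<i> * of_real (of_int (- int n - 1) * \<omega> * t))) has_sum
          (\<Sum>n. c (- int n - 1) * exp (\<i> * of_real (of_int (- int n - 1) * \<omega> * t)))) UNIV"
        using ss(2)[of t] that summable_sums[OF summable_norm_cancel[OF ss(2), of t]] unfolding cis_wavenumber[OF \<omega>]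
        by (intro norm_summable_imp_has_sum) simp_all
    qed
    then show ?thesis using \<open>c 0 = 0\<close> by simp
  qed
  show "smooth_halfline (fourier_series \<omega> c)"
  proof -
    let ?G = "{\<lambda>x t. cis t, \<lambda>x t. cis (- t)} :: (real \<Rightarrow> real \<Rightarrow> complex) set"
    let ?M = "{mode_sum \<omega> b g | b g. rapid b \<and> g \<in> ?G}"
    have p: "(\<lambda>x t. cis t) \<in> lspan ?G" "(\<lambda>x t. cis (- t)) \<in> lspan ?G" by (auto intro: lspan.base)
    have d: "((\<lambda>s. cis s) has_vector_derivative \<i> * cis t) (at t within {0..})"
      "((\<lambda>s. cis (- s)) has_vector_derivative - \<i> * cis (- t)) (at t within {0..})" for t
      using cis_has_vector_derivative[of 1 t "{0..}"] cis_has_vector_derivative[of "- 1" t "{0..}"] by simp_all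
    have "generates ?G"
      unfolding generates_def
    proof
      fix f assume "f \<in> ?G"
      then have f: "f = (\<lambda>x t. cis t) \<or> f = (\<lambda>x t. cis (- t))" by simp
      then have "f \<in> lspan ?G" using p by auto
      from lspan.scale[OF this, of 0] have z: "(\<lambda>x t. 0) \<in> lspan ?G" by simp
      show "continuous_on ({0..} \<times> {0..}) (\<lambda>(x, t). f x t) \<and>
         (\<exists>g\<in>lspan ?G. \<forall>x\<ge>0. \<forall>t\<ge>0. ((\<lambda>y. f y t) has_vector_derivative g x t) (at x within {0..})) \<and>
         (\<exists>g\<in>lspan ?G. \<forall>x\<ge>0. \<forall>t\<ge>0. ((\<lambda>s. f x s) has_vector_derivative g x t) (at t within {0..}))"
      proof (intro conjI)
        show "continuous_on ({0..} \<times> {0..}) (\<lambda>(x, t). f x t)"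
          using f by (auto simp: case_prod_unfold cis_conv_exp intro!: continuous_intros)
        show "\<exists>g\<in>lspan ?G. \<forall>x\<ge>0. \<forall>t\<ge>0. ((\<lambda>y. f y t) has_vector_derivative g x t) (at x within {0..})"
          by (intro bexI[OF _ z]) (use f in auto)
        show "\<exists>g\<in>lspan ?G. \<forall>x\<ge>0. \<forall>t\<ge>0. ((\<lambda>s. f x s) has_vector_derivative g x t) (at t within {0..})"
          using f
        proof
          assume "f = (\<lambda>x t. cis t)"
          then show ?thesis using d by (intro bexI[OF _ lspan.scale[OF p(1), of \<i>]]) auto
        next
          assume "f = (\<lambda>x t. cis (- t))"
          then show ?thesis using d by (intro bexI[OF _ lspan.scale[OF p(2), of "- \<i>"]]) auto
        qed
      qed
    qed
    then have "closed_family (lspan ?M)"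
      by (intro closed_family_lspan generates_mode_sums \<omega>) (use cis_decays in blast)+
    moreover have "(\<lambda>x t. mode_sum \<omega> (\<lambda>n. c (int n + 1)) (\<lambda>x t. cis t) x t + mode_sum \<omega> (\<lambda>n. c (- int n - 1)) (\<lambda>x t. cis (- t)) x t) \<in> lspan ?M"
      by (intro lspan.add; rule lspan.base; use c in blast)
    ultimately have "smooth_halfline (\<lambda>t. mode_sum \<omega> (\<lambda>n. c (int n + 1)) (\<lambda>x t. cis t) 0 t + mode_sum \<omega> (\<lambda>n. c (- int n - 1)) (\<lambda>x t. cis (- t)) 0 t)"
      by (rule closed_family_smooth_t) simp
    then show ?thesis by (simp add: fourier_series_def[abs_def])
  qed
  have per: "exp (\<i> * of_real (of_int k * \<omega> * (t + 2 * pi / \<omega>))) = exp (\<i> * of_real (of_int k * \<omega> * t))" for k :: int and t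
  proof -
    have "\<i> * of_real (of_int k * \<omega> * (t + 2 * pi / \<omega>)) = \<i> * of_real (of_int k * \<omega> * t) + of_real (of_int (2 * k) * pi) * \<i>"
      using \<omega> by (simp add: algebra_simps)
    then show ?thesis unfolding exp_eq by (rule exI)
  qed
  show "has_period (fourier_series \<omega> c) (2 * pi / \<omega>)"
    unfolding has_period_def fourier_series_def mode_sum_def cis_wavenumber[OF \<omega>] per using \<omega> by simp
  show "fourier_coeff (2 * pi / \<omega>) (fourier_series \<omega> c) n = c n"
  proof -
    define T where "T = 2 * pi / \<omega>"
    have T: "T > 0" "2 * pi / T = \<omega>" using \<omega> by (auto simp: T_def)
    define e where "e k t = exp (\<i> * of_real (of_int k * \<omega> * t))" for k :: int and t :: real
    define e' where "e' t = exp (- \<i> * of_real (of_int n * \<omega> * t))" for t :: real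
    \<comment> \<open>Positive and negative frequencies are paired into one series over the natural
      numbers, which is integrated term by term against the exponential of index
      \<open>n\<close>.\<close>
    let ?F = "\<lambda>k t. c (int k + 1) * (e (int k + 1) t * e' t) + c (- int k - 1) * (e (- int k - 1) t * e' t)"
    have ce: "continuous_on S (e k)" "continuous_on S e'" for S k
      unfolding e_def e'_def by (intro continuous_intros)+
    have "(\<lambda>k. integral {0..T} (?F k)) sums integral {0..T} (\<lambda>t. \<Sum>k. ?F k t)"
    proof (rule integral_suminf)
      show "continuous_on {0..T} (?F k)" for k by (intro continuous_intros ce)
      show "norm (?F k t) \<le> norm (c (int k + 1)) + norm (c (- int k - 1))" for k t
        by (rule order_trans[OF norm_triangle_ineq]) (simp add: norm_mult e_def e'_def)
      show "summable (\<lambda>k. norm (c (int k + 1)) + norm (c (- int k - 1)))"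
        using rapid_summable[OF c(1), of 0] rapid_summable[OF c(2), of 0] by (intro summable_add) simp_all
    qed
    also have "integral {0..T} (\<lambda>t. \<Sum>k. ?F k t) = integral {0..T} (\<lambda>t. fourier_series \<omega> c t * e' t)"
    proof (rule integral_cong)
      fix t assume t: "t \<in> {0..T}"
      have 1: "summable (\<lambda>k. c (int k + 1) * e (int k + 1) t)" "summable (\<lambda>k. c (- int k - 1) * e (- int k - 1) t)"
        using summable_norm_cancel[OF ss(1), of t] summable_norm_cancel[OF ss(2), of t] t
        unfolding cis_wavenumber[OF \<omega>] e_def by simp_all
      have "fourier_series \<omega> c t = (\<Sum>k. c (int k + 1) * e (int k + 1) t + c (- int k - 1) * e (- int k - 1) t)"
        unfolding fourier_series_def mode_sum_def cis_wavenumber[OF \<omega>] e_def[symmetric] by (rule suminf_add[OF 1])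
      then show "(\<Sum>k. ?F k t) = fourier_series \<omega> c t * e' t"
        using suminf_mult2[OF summable_add[OF 1], of "e' t"] by (simp add: algebra_simps)
    qed
    finally have 2: "(\<lambda>k. integral {0..T} (?F k)) sums integral {0..T} (\<lambda>t. fourier_series \<omega> c t * e' t)" .
    have 3: "integral {0..T} (\<lambda>t. e k t * e' t) = (if k = n then of_real T else 0)" for k
      using fourier_orthogonality[OF T(1), of k n] unfolding T(2) e_def e'_def .
    have 4: "integral {0..T} (?F k) = (if int k + 1 = n then c n * of_real T else 0) + (if - int k - 1 = n then c n * of_real T else 0)" for k
    proof -
      have "integral {0..T} (?F k) = integral {0..T} (\<lambda>t. c (int k + 1) * (e (int k + 1) t * e' t)) + integral {0..T} (\<lambda>t. c (- int k - 1) * (e (- int k - 1) t * e' t))"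
        by (intro integral_add integrable_continuous_real continuous_intros ce)
      then show ?thesis by (simp add: 3)
    qed
    have "(\<lambda>k. integral {0..T} (?F k)) sums (c n * of_real T)"
    proof (cases n rule: int_cases3)
      case zero
      then show ?thesis using \<open>c 0 = 0\<close> unfolding 4 by simp
    next
      case (pos m)
      have "(\<lambda>k. if k = m - 1 then c n * of_real T else 0) sums (c n * of_real T)"
        using sums_single[of "m - 1" "\<lambda>_. c n * of_real T"] by simp
      also have "(\<lambda>k. if k = m - 1 then c n * of_real T else 0) = (\<lambda>k. integral {0..T} (?F k))"
        unfolding 4 using pos by (auto simp: fun_eq_iff)
      finally show ?thesis .
    next
      case (neg m)
      have "(\<lambda>k. if k = m - 1 then c n * of_real T else 0) sums (c n * of_real T)"
        using sums_single[of "m - 1" "\<lambda>_. c n * of_real T"] by simp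
      also have "(\<lambda>k. if k = m - 1 then c n * of_real T else 0) = (\<lambda>k. integral {0..T} (?F k))"
        unfolding 4 using neg by (auto simp: fun_eq_iff)
      finally show ?thesis .
    qed
    with 2 have "integral {0..T} (\<lambda>t. fourier_series \<omega> c t * e' t) = c n * of_real T"
      by (rule sums_unique2)
    then show ?thesis using T unfolding fourier_coeff_def T_def[symmetric] e'_def T(2) by simp
  qed
qed

section \<open>Boundary errors of the constructed solution\<close>

lemma outgoing_continuous_t: "continuous_on S (\<lambda>t. outgoing m 0 t)"
  unfolding continuous_on_eq_continuous_within
  using has_vector_derivative_continuous[OF outgoing_has_vector_derivative_t[of 0 m]] by blast

lemma defect_has_vector_derivative_t:
  "((\<lambda>s. defect x s) has_vector_derivative (- \<i>) * defect x t + (1 / outgoing_limit) * (wave 1 0 t + wave 2 0 t)) (at t within S)"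
proof -
  have "((\<lambda>s. (1 / outgoing_limit) * outgoing 1 0 s - cis (- 1 * s)) has_vector_derivative
      (1 / outgoing_limit) * (- \<i> * outgoing (1 + 2) 0 t) - \<i> * of_real (- 1) * cis (- 1 * t)) (at t within S)"
    by (intro has_vector_derivative_diff has_vector_derivative_mult_right outgoing_has_vector_derivative_t cis_has_vector_derivative) simp
  moreover have "outgoing (1 + 2) 0 t = outgoing 1 0 t + \<i> * (wave 1 0 t + wave 2 0 t)"
    using outgoing_relation[of 0 1 t] outgoing_relation[of 0 2 t] by (simp add: algebra_simps)
  ultimately show ?thesis by (simp add: defect_def algebra_simps diff_divide_distrib add_divide_distrib)
qed

text \<open>Up to the unimodular factor \<open>cis (- t)\<close> this is
  \<open>outgoing_asymptotics\<close> divided by \<open>outgoing_limit\<close>, whose nonvanishing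
  enters here.\<close>

lemma defect_decays: "decays 0 j 0 defect"
proof -
  obtain C where C: "\<forall>t\<ge>0. t ^ j * norm (cis t * outgoing 1 0 t - outgoing_limit) \<le> C"
    using outgoing_asymptotics by blast
  have "x ^ 0 * t ^ j * norm (defect x t) \<le> (C / norm outgoing_limit) * (1 + t) ^ 0" if "t \<ge> 0" for x t
  proof -
    have "defect x t = cis (- t) * (cis t * outgoing 1 0 t - outgoing_limit) / outgoing_limit"
      using outgoing_limit_nonzero by (simp add: defect_def right_diff_distrib diff_divide_distrib cis_mult flip: mult.assoc)
    then have "norm (defect x t) = norm (cis t * outgoing 1 0 t - outgoing_limit) / norm outgoing_limit"
      by (simp add: norm_mult norm_divide)
    with C that show ?thesis by (simp add: divide_right_mono)
  qed
  then show ?thesis unfolding decays_def by blast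
qed

lemma wave_decays: "decays 0 j 0 (\<lambda>x t. wave m 0 t)"
proof -
  obtain C where "\<forall>t. \<bar>t\<bar> ^ j * norm (wave m 0 t) \<le> C" using wave_bound_t by blast
  then have "x ^ 0 * t ^ j * norm (wave m 0 t) \<le> C * (1 + t) ^ 0" if "t \<ge> 0" for x t :: real
    using that by (metis abs_of_nonneg mult.left_neutral mult.right_neutral power_0)
  then show ?thesis unfolding decays_def by blast
qed

text \<open>Rapidly decaying functions of time whose span is closed under the time derivative:
  differentiating \<open>defect\<close> gives \<open>defect\<close> and two boundary waves, and
  differentiating a boundary wave raises its index by \<open>2\<close>.\<close>

definition boundary_profiles :: "(real \<Rightarrow> real \<Rightarrow> complex) set" where
  "boundary_profiles = insert defect (range (\<lambda>m x t. wave m 0 t))"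

lemma boundary_profiles_decay: "f \<in> boundary_profiles \<Longrightarrow> decays 0 j 0 f"
  using defect_decays wave_decays unfolding boundary_profiles_def by blast

lemma boundary_profile_lspan:
  "defect \<in> lspan boundary_profiles" "(\<lambda>x t. wave m 0 t) \<in> lspan boundary_profiles"
  by (rule lspan.base; unfold boundary_profiles_def; blast)+

lemma generates_boundary_profiles: "generates boundary_profiles"
  unfolding generates_def
proof
  fix f assume "f \<in> boundary_profiles"
  then have f: "f = defect \<or> (\<exists>m. f = (\<lambda>x t. wave m 0 t))" unfolding boundary_profiles_def by blast
  have z: "(\<lambda>x t. 0) \<in> lspan boundary_profiles"
    using lspan.scale[OF boundary_profile_lspan(1), of 0] by simp
  show "continuous_on ({0..} \<times> {0..}) (\<lambda>(x, t). f x t) \<and>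
     (\<exists>g\<in>lspan boundary_profiles. \<forall>x\<ge>0. \<forall>t\<ge>0. ((\<lambda>y. f y t) has_vector_derivative g x t) (at x within {0..})) \<and>
     (\<exists>g\<in>lspan boundary_profiles. \<forall>x\<ge>0. \<forall>t\<ge>0. ((\<lambda>s. f x s) has_vector_derivative g x t) (at t within {0..}))"
    using f
  proof (elim disjE exE)
    assume f: "f = defect"
    have "(\<lambda>x t. (- \<i>) * defect x t + (1 / outgoing_limit) * (wave 1 0 t + wave 2 0 t)) \<in> lspan boundary_profiles"
      by (intro lspan.add lspan.scale boundary_profile_lspan)
    note d = bexI[OF _ this]
    show ?thesis
      unfolding f
    proof (intro conjI)
      show "continuous_on ({0..} \<times> {0..}) (\<lambda>(x, t). defect x t)"
        unfolding defect_def case_prod_unfold cis_conv_exp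
        by (intro continuous_intros continuous_on_compose2[OF outgoing_continuous_t[of UNIV]]) auto
      show "\<exists>g\<in>lspan boundary_profiles. \<forall>x\<ge>0. \<forall>t\<ge>0. ((\<lambda>y. defect y t) has_vector_derivative g x t) (at x within {0..})"
        by (intro bexI[OF _ z]) (auto simp: defect_def)
      show "\<exists>g\<in>lspan boundary_profiles. \<forall>x\<ge>0. \<forall>t\<ge>0. ((\<lambda>s. defect x s) has_vector_derivative g x t) (at t within {0..})"
        by (rule d) (use defect_has_vector_derivative_t in blast)
    qed
  next
    fix m assume f: "f = (\<lambda>x t. wave m 0 t)"
    show ?thesis
      unfolding f
    proof (intro conjI)
      show "continuous_on ({0..} \<times> {0..}) (\<lambda>(x::real, t). wave m 0 t)"
        unfolding case_prod_unfold by (intro continuous_intros)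
      show "\<exists>g\<in>lspan boundary_profiles. \<forall>x\<ge>0. \<forall>t\<ge>0. ((\<lambda>y. wave m 0 t) has_vector_derivative g x t) (at x within {0..})"
        by (intro bexI[OF _ z]) auto
      show "\<exists>g\<in>lspan boundary_profiles. \<forall>x\<ge>0. \<forall>t\<ge>0. ((\<lambda>s. wave m 0 s) has_vector_derivative g x t) (at t within {0..})"
        by (intro bexI[OF _ lspan.scale[OF boundary_profile_lspan(2)[of "m + 2"], of "- \<i>"]])
          (use wave_has_vector_derivative_t in blast)
    qed
  qed
qed

lemma mode_sum_boundary_schwartz:
  assumes "\<omega> > 0" "rapid b" "f \<in> boundary_profiles"
  shows "(\<lambda>t. mode_sum \<omega> b f 0 t) \<in> schwartz_halfline"
proof -
  let ?M = "{mode_sum \<omega> b g | b g. rapid b \<and> g \<in> boundary_profiles}"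
  have "closed_family (lspan ?M)"
    by (intro closed_family_lspan generates_mode_sums assms generates_boundary_profiles)
      (use boundary_profiles_decay in blast)
  then show ?thesis
  proof (rule closed_family_schwartz_t)
    show "mode_sum \<omega> b f \<in> lspan ?M" by (rule lspan.base) (use assms in blast)
    fix g j assume "g \<in> lspan ?M"
    then show "decays 0 j 0 g"
    proof (rule decays_lspan)
      fix f assume "f \<in> ?M"
      then show "decays 0 j 0 f"
        using mode_sum_decays[OF assms(1) _ boundary_profiles_decay boundary_profiles_decay] by blast
    qed
  qed
qed

lemma decays_bigo:
  assumes "decays 0 2 0 f" "\<And>t. t \<ge> 0 \<Longrightarrow> g t = f 0 t"
  shows "g \<in> O[at_top](\<lambda>t. of_real (t powr (- 3 / 2)))"
proof -
  obtain C where C: "C \<ge> 0" "\<forall>x\<ge>0. \<forall>t\<ge>0. x ^ 0 * t ^ 2 * norm (f x t) \<le> C * (1 + t) ^ 0"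
    using decays_nonneg[OF assms(1)] by blast
  show ?thesis
  proof (rule bigoI)
    show "eventually (\<lambda>t. norm (g t) \<le> C * norm (of_real (t powr (- 3 / 2)) :: complex)) at_top"
      using eventually_ge_at_top[of 1]
    proof eventually_elim
      case (elim t)
      have "t\<^sup>2 * norm (g t) \<le> C" using C(2) elim assms(2)[of t] by simp
      then have "norm (g t) \<le> C * t powr (- 2)"
        using elim by (simp add: powr_minus powr_numeral field_simps)
      also have "\<dots> \<le> C * t powr (- 3 / 2)"
        using elim C(1) by (intro mult_left_mono powr_mono) auto
      finally show ?case by simp
    qed
  qed
qed

lemma neumann_coeff_pos:
  assumes "\<omega> > 0"
  shows "neumann_coeff \<omega> a (int n + 1) = - 1 * (a (int n + 1) * wavenumber \<omega> n)"
  using assms by (simp add: neumann_coeff_def wavenumber_def mult_ac)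

lemma neumann_coeff_neg:
  assumes "\<omega> > 0"
  shows "neumann_coeff \<omega> a (- int n - 1) = \<i> * (a (- int n - 1) * wavenumber \<omega> n)"
  using assms by (simp add: neumann_coeff_def wavenumber_def mult_ac add.commute)

lemma rapid_neumann_coeff:
  assumes "\<omega> > 0" "rapid (\<lambda>n. a (int n + 1))" "rapid (\<lambda>n. a (- int n - 1))"
  shows "rapid (\<lambda>n. neumann_coeff \<omega> a (int n + 1))" "rapid (\<lambda>n. neumann_coeff \<omega> a (- int n - 1))"
  unfolding neumann_coeff_pos[OF assms(1)] neumann_coeff_neg[OF assms(1)]
  by (intro rapid_scale rapid_wavenumber assms)+

text \<open>Both boundary errors are combinations of mode sums of boundary profiles, so the Neumann
  condition holds with room to spare.\<close>

lemma asymptotically_admissible_fourier_series: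
  assumes \<omega>: "\<omega> > 0" and a: "rapid (\<lambda>n. a (int n + 1))" "rapid (\<lambda>n. a (- int n - 1))" "a 0 = 0"
    and g0: "smooth_halfline g0" "\<And>t. t \<ge> 0 \<Longrightarrow> g0 t = fourier_series \<omega> a t"
  shows "asymptotically_admissible g0 (fourier_series \<omega> (neumann_coeff \<omega> a))"
proof -
  define b where "b n = a (int n + 1)" for n
  define c where "c n = a (- int n - 1)" for n
  define \<kappa> where "\<kappa> = 1 / outgoing_limit"
  define u where "u x t = mode_sum \<omega> b evanescent x t + \<kappa> * mode_sum \<omega> c (outgoing 1) x t" for x t
  have b: "rapid b" and c: "rapid c" using a by (simp_all add: b_def[abs_def] c_def[abs_def])
  let ?b = "\<lambda>n. b n * of_real (wavenumber \<omega> n)" and ?c = "\<lambda>n. c n * of_real (wavenumber \<omega> n)"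
  note r = rapid_wavenumber[OF b \<omega>] rapid_wavenumber[OF c \<omega>]
  have u_eq: "u = (\<lambda>x t. mode_sum \<omega> b evanescent x t + \<kappa> * mode_sum \<omega> c (outgoing 1) x t)" by (simp add: u_def fun_eq_iff)
  have V0: "decays 0 0 2 (outgoing m)" for m using outgoing_decays[of 0 m] by (simp add: numeral_2_eq_2)
  have evanescent0: "mode_sum \<omega> b evanescent 0 t = mode_sum \<omega> b (\<lambda>x t. cis t) 0 t" for b t
    by (simp add: mode_sum_def evanescent_def)
  \<comment> \<open>The evanescent waves have exactly the prescribed trace; only the negative
    frequencies leave an error.\<close>
  have 1: "u 0 t - g0 t = mode_sum \<omega> c defect 0 t" if t: "t \<ge> 0" for t
  proof -
    have "mode_sum \<omega> c (\<lambda>x t. \<kappa> * outgoing 1 x t + (- 1) * cis (- t)) 0 t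
      = mode_sum \<omega> c (\<lambda>x t. \<kappa> * outgoing 1 x t) 0 t + mode_sum \<omega> c (\<lambda>x t. (- 1) * cis (- t)) 0 t"
      by (rule mode_sum_add[OF \<omega> c decays_scale[OF V0] decays_scale[OF cis_decays(2)] order_refl t])
    also have "\<dots> = \<kappa> * mode_sum \<omega> c (outgoing 1) 0 t + (- 1) * mode_sum \<omega> c (\<lambda>x t. cis (- t)) 0 t"
      by (simp only: mode_sum_cmult[OF \<omega> c V0 order_refl t] mode_sum_cmult[OF \<omega> c cis_decays(2) order_refl t])
    also have "mode_sum \<omega> c (\<lambda>x t. \<kappa> * outgoing 1 x t + (- 1) * cis (- t)) 0 t = mode_sum \<omega> c defect 0 t"
      by (simp add: mode_sum_def defect_def \<kappa>_def)
    finally show ?thesis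
      using g0(2)[OF t] by (simp add: u_def evanescent0 fourier_series_def b_def[abs_def] c_def[abs_def])
  qed
  \<comment> \<open>At the boundary \<open>\<i> * outgoing 2\<close> equals
    \<open>\<i> * outgoing 1 - wave 1\<close> by \<open>outgoing_relation\<close>; hence the factor
    \<open>\<i>\<close> for negative frequencies, with a decaying remainder.\<close>
  have 2: "partial_x u 0 t - fourier_series \<omega> (neumann_coeff \<omega> a) t
      = \<i> * mode_sum \<omega> ?c defect 0 t + (- \<kappa>) * mode_sum \<omega> ?c (\<lambda>x t. wave 1 0 t) 0 t" if t: "t \<ge> 0" for t
  proof -
    have J0: "decays 0 0 0 (\<lambda>x t. wave 1 0 t)" by (rule wave_decays)
    have "\<kappa> * (\<i> * mode_sum \<omega> ?c (outgoing 2) 0 t) = mode_sum \<omega> ?c (\<lambda>x t. (\<kappa> * \<i>) * outgoing 2 x t) 0 t"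
      by (subst mode_sum_cmult[OF \<omega> r(2) V0 order_refl t]) (rule mult.assoc[symmetric])
    also have "\<dots> = mode_sum \<omega> ?c (\<lambda>x t. (\<i> * defect x t + (- \<kappa>) * wave 1 0 t) + \<i> * cis (- t)) 0 t"
      using outgoing_relation[of 0 1] by (simp add: mode_sum_def defect_def \<kappa>_def algebra_simps diff_divide_distrib)
    also have "\<dots> = mode_sum \<omega> ?c (\<lambda>x t. \<i> * defect x t + (- \<kappa>) * wave 1 0 t) 0 t + mode_sum \<omega> ?c (\<lambda>x t. \<i> * cis (- t)) 0 t"
      by (rule mode_sum_add[OF \<omega> r(2) decays_add[OF decays_scale[OF defect_decays] decays_scale[OF wave_decays]] decays_scale[OF cis_decays(2)] order_refl t])
    also have "mode_sum \<omega> ?c (\<lambda>x t. \<i> * defect x t + (- \<kappa>) * wave 1 0 t) 0 t = mode_sum \<omega> ?c (\<lambda>x t. \<i> * defect x t) 0 t + mode_sum \<omega> ?c (\<lambda>x t. (- \<kappa>) * wave 1 0 t) 0 t"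
      by (rule mode_sum_add[OF \<omega> r(2) decays_scale[OF defect_decays] decays_scale[OF wave_decays] order_refl t])
    also have "mode_sum \<omega> ?c (\<lambda>x t. \<i> * defect x t) 0 t = \<i> * mode_sum \<omega> ?c defect 0 t"
      by (rule mode_sum_cmult[OF \<omega> r(2) defect_decays order_refl t])
    also have "mode_sum \<omega> ?c (\<lambda>x t. (- \<kappa>) * wave 1 0 t) 0 t = (- \<kappa>) * mode_sum \<omega> ?c (\<lambda>x t. wave 1 0 t) 0 t"
      by (rule mode_sum_cmult[OF \<omega> r(2) wave_decays order_refl t])
    finally have 3: "\<kappa> * (\<i> * mode_sum \<omega> ?c (outgoing 2) 0 t) = \<i> * mode_sum \<omega> ?c defect 0 t + (- \<kappa>) * mode_sum \<omega> ?c (\<lambda>x t. wave 1 0 t) 0 t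
      + mode_sum \<omega> ?c (\<lambda>x t. \<i> * cis (- t)) 0 t" .
    have "fourier_series \<omega> (neumann_coeff \<omega> a) t = mode_sum \<omega> ?b (\<lambda>x t. - 1 * cis t) 0 t + mode_sum \<omega> ?c (\<lambda>x t. \<i> * cis (- t)) 0 t"
      by (simp add: fourier_series_def neumann_coeff_pos[OF \<omega>] neumann_coeff_neg[OF \<omega>] b_def c_def mode_sum_def mult_ac)
    also have "mode_sum \<omega> ?b (\<lambda>x t. - 1 * cis t) 0 t = - 1 * mode_sum \<omega> ?b evanescent 0 t"
      unfolding evanescent0 by (rule mode_sum_cmult[OF \<omega> r(1) cis_decays(1) order_refl t])
    finally show ?thesis
      using 3 partial_x_mode_sum[OF \<omega> b c, of 0 t \<kappa>] t unfolding u_eq by simp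
  qed
  show ?thesis
    unfolding asymptotically_admissible_def
  proof (intro conjI exI[of _ u])
    show "smooth_halfline (fourier_series \<omega> (neumann_coeff \<omega> a))"
      by (rule fourier_series_smooth[OF \<omega> rapid_neumann_coeff[OF \<omega> a(1,2)]]) (simp add: neumann_coeff_def)
    show "schroedinger_solution u" unfolding u_eq by (rule schroedinger_solution_mode_sum[OF \<omega> b c])
    show "(\<lambda>t. u 0 t - g0 t) \<in> schwartz_halfline"
      by (rule schwartz_halfline_cong[OF mode_sum_boundary_schwartz[OF \<omega> c, of defect]])
        (auto simp: 1 boundary_profiles_def)
    have "decays 0 2 0 (\<lambda>x t. \<i> * mode_sum \<omega> ?c defect x t + (- \<kappa>) * mode_sum \<omega> ?c (\<lambda>x t. wave 1 0 t) x t)"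
      by (intro decays_add decays_scale mode_sum_decays[OF \<omega> r(2) _ defect_decays] mode_sum_decays[OF \<omega> r(2) _ wave_decays]
          defect_decays wave_decays)
    then show "(\<lambda>t. partial_x u 0 t - fourier_series \<omega> (neumann_coeff \<omega> a) t) \<in> O[at_top](\<lambda>t. of_real (t powr (-3/2)))"
      by (rule decays_bigo) (rule 2)
  qed (rule g0(1))
qed

theorem proposition2p5:
  fixes g0 :: "real \<Rightarrow> complex" and a :: "int \<Rightarrow> complex" and \<omega> \<tau> :: real
  assumes "\<omega> > 0" and "\<tau> = 2 * pi / \<omega>"
    and "smooth_halfline g0" and "has_period g0 \<tau>"
    and "\<forall>n. a n = fourier_coeff \<tau> g0 n"
    and "\<forall>t>0. ((\<lambda>n::int. a n * exp (\<i> * of_real (of_int n * \<omega> * t))) has_sum g0 t) UNIV"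
    and "a 0 = 0"
  shows "\<exists>g1 :: real \<Rightarrow> complex.
      ((\<exists>T. has_period g1 T) \<and> asymptotically_admissible g0 g1) \<and>
      (\<forall>h. (\<exists>T. has_period h T) \<and> asymptotically_admissible g0 h \<longrightarrow> (\<forall>t\<ge>0. h t = g1 t)) \<and>
      has_period g1 \<tau> \<and>
      (\<forall>n. fourier_coeff \<tau> g1 n = neumann_coeff \<omega> a n) \<and>
      (\<forall>t>0. ((\<lambda>n::int. neumann_coeff \<omega> a n * exp (\<i> * of_real (of_int n * \<omega> * t))) has_sum g1 t) UNIV)"
proof -
  have a: "rapid (\<lambda>n. a (int n + 1))" "rapid (\<lambda>n. a (- int n - 1))"
    using rapid_fourier_coeff[OF assms(3,4), of 1] rapid_fourier_coeff[OF assms(3,4), of "- 1"] assms(5)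
    by (simp_all add: minus_diff_commute)
  have pos: "g0 t = fourier_series \<omega> a t" if "t > 0" for t
    using has_sum_unique[OF assms(6)[rule_format, OF that] fourier_series_has_sum[OF assms(1) a assms(7)]] that by simp
  \<comment> \<open>The series is given for \<open>t > 0\<close> only; the value at \<open>0\<close>
    is recovered by moving one period to the right.\<close>
  have g0: "g0 t = fourier_series \<omega> a t" if "t \<ge> 0" for t
  proof -
    have "g0 t = g0 (t + \<tau>)" using assms(4) that by (simp add: has_period_def)
    also have "\<dots> = fourier_series \<omega> a (t + \<tau>)" using assms(4) that by (intro pos) (simp add: has_period_def)
    also have "\<dots> = fourier_series \<omega> a t"
      using fourier_series_period[OF assms(1) a assms(7)] that assms(2) by (simp add: has_period_def)
    finally show ?thesis .
  qed
  let ?g1 = "fourier_series \<omega> (neumann_coeff \<omega> a)"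
  have z: "neumann_coeff \<omega> a 0 = 0" by (simp add: neumann_coeff_def)
  note c = assms(1) rapid_neumann_coeff[OF assms(1) a] z
  have adm: "asymptotically_admissible g0 ?g1"
    by (rule asymptotically_admissible_fourier_series[OF assms(1) a assms(7,3) g0])
  have per: "has_period ?g1 \<tau>" using fourier_series_period[OF c] assms(2) by simp
  show ?thesis
  proof (intro exI[of _ ?g1] conjI allI impI)
    show "\<exists>T. has_period ?g1 T" using per by blast
    show "h t = ?g1 t" if "(\<exists>T. has_period h T) \<and> asymptotically_admissible g0 h" "t \<ge> 0" for h t
      using neumann_data_unique[OF _ _ adm per] that by blast
    show "fourier_coeff \<tau> ?g1 n = neumann_coeff \<omega> a n" for n
      using fourier_series_coeff[OF c] assms(2) by simp
    show "((\<lambda>n::int. neumann_coeff \<omega> a n * exp (\<i> * of_real (of_int n * \<omega> * t))) has_sum ?g1 t) UNIV" if "t > 0" for t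
      using fourier_series_has_sum[OF c] that by simp
  qed (use adm per in auto)
qed

end
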